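(* For $(\xi,\eta;\lambda,\nu)\in(\mathbb Z/2\mathbb Z)^5\times\mathbb C^5$ one has $$\mathrm{Diff}_{G_3'}(I(\xi,\lambda),J(\eta,\nu))=\begin{cases}\mathbb C\,\mathbb D_3^{(1)}(\lambda,\nu)&\text{if }(\xi,\eta;\lambda,\nu)\in\mathrm{Supp}_{3,a}(\mathbb D),\\ \mathbb C\,\mathbb D_3^{(2)}(\lambda,\nu)&\text{if }(\xi,\eta;\lambda,\nu)\in\mathrm{Supp}_{3,b}(\mathbb D),\\ \mathbb C\,\mathbb D_3^{(1)}(\lambda,\nu)\oplus\mathbb C\,\mathbb D_3^{(2)}(\lambda,\nu)&\text{if }(\xi,\eta;\lambda,\nu)\in\mathrm{Supp}_{3,c}(\mathbb D),\\ \{0\}&\text{otherwise,}\end{cases}$$ where the operators have the following two (equal) expressions, in symmetrized and in ordered form: $$\mathbb D_3^{(1)}(\lambda,\nu)=\mathrm{Rest}_3\circ\big(T^{\mathrm{sym}}_{(\nu_1-\lambda_1,\lambda_3-\nu_2)}\,p^{(\nu_1-\lambda_1,\lambda_3-\nu_2)}_{\nu_1+\nu_2-2\lambda_2,\ \nu_1-\nu_2-2}\big)(D_1,D_2,D_3)$$ $$=\mathrm{Rest}_3\circ T^{\mathrm{ord}}_{(\nu_1-\lambda_1,\lambda_3-\nu_2)}\,{}_3F_1\!\left[\begin{matrix}\lambda_1-\nu_1,\ \nu_2-\lambda_3,\ \nu_2-\lambda_2+1\\ \nu_2-\nu_1+2\end{matrix};D_1,D_2,D_3\right],$$ $$\mathbb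 D_3^{(2)}(\lambda,\nu)=\mathrm{Rest}_3\circ D_3^{\nu_1-\nu_2-1}\big(T^{\mathrm{sym}}_{(\nu_2-\lambda_1+1,\lambda_3-\nu_1+1)}\,p^{(\nu_2-\lambda_1+1,\lambda_3-\nu_1+1)}_{\nu_1+\nu_2-2\lambda_2,\ \nu_2-\nu_1}\big)(D_1,D_2,D_3)$$ $$=\mathrm{Rest}_3\circ D_3^{\nu_1-\nu_2-1}\,T^{\mathrm{ord}}_{(\nu_2-\lambda_1+1,\lambda_3-\nu_1+1)}\,{}_3F_1\!\left[\begin{matrix}\lambda_1-\nu_2-1,\ \nu_1-\lambda_3-1,\ \nu_1-\lambda_2\\ \nu_1-\nu_2\end{matrix};D_1,D_2,D_3\right].$$
   Context: $\mathbb N=\{0,1,2,\dots\}$; $[a,b]=\emptyset$ if $b<a$. $G=GL(3,\mathbb R)$, $G'=GL(2,\mathbb R)$; $P=MAN_+\subset G$ is the group of invertible upper triangular matrices, $M=\{\mathrm{diag}(\pm1,\pm1,\pm1)\}$, $A$ = positive diagonal matrices, $N_+$ = upper unipotent. For $\xi\in(\mathbb Z/2\mathbb Z)^3,\lambda\in\mathbb C^3$, $I(\xi,\lambda)=\mathrm{Ind}_P^G(\mathbb C_\xi\boxtimes\mathbb C_\lambda)$ is the unnormalized principal series: smooth $f$ on $G$ with $f(gman)=\prod_j m_j^{-\xi_j}\prod_j a_j^{-\lambda_j}f(g)$, with left translation. $J(\eta,\nu)$ ($\eta\in(\mathbb Z/2\mathbb Z)^2,\nu\in\mathbb C^2$)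 is the analogous principal series of $G'$ induced from its upper triangular subgroup $P'$. Let $\iota_3\begin{pmatrix}a&b\\c&d\end{pmatrix}=\begin{pmatrix}a&0&b\\0&1&0\\c&0&d\end{pmatrix}$, $G_3'=\iota_3(G')$; regard $J(\eta,\nu)$ as a representation of $G_3'$. $\mathrm{Diff}_{G_3'}(I(\xi,\lambda),J(\eta,\nu))$ is the space of $G_3'$-intertwining differential operators $I(\xi,\lambda)\to J(\eta,\nu)$ with respect to the natural map $G_3'/\iota_3(P')\to G/P$. With $N_1^-=E_{21},N_2^-=E_{32},N_3^-=E_{31}$, use coordinates $(x_1,x_2,x_3)\mapsto\exp(x_1N_1^-+x_2N_2^-+x_3N_3^-)$ on the lower unipotent group $N_-$ and $x_3\mapsto\exp(x_3N_3^-)$ on $N_-\cap G_3'$; restricting to these cells, such operators are viewed as operators $C^\infty(\mathbb R^3)\to C^\infty(\mathbb R)$. $\mathrm{Rest}_3$ is restriction to $x_1=x_2=0$. $\Phi_3=\{(\lambda,\nu)\in\mathbb C^5:\nu_1-\lambda_1,\ \lambda_3-\nu_2\in\mathbb N\}$; $\Phi_{3,a}$: those in $\Phi_3$ with $\nu_1-\nu_2-1\notin[1,\min(\nu_1-\lambda_1,\lambda_3-\nu_2)]\cap\mathbb Z$; $\Phi_{3,b}$: those with $\nu_1-\nu_2-1\in[1,\min(\nu_1-\lambda_1,\lambda_3-\nu_2)]\cap\mathbb Z$ and $\lambda_2-\nu_2\notin[1,\nu_1-\nu_2-1]\cap\mathbb Z$; $\Phi_{3,c}$: those with $\nu_1-\nu_2-1\in[1,\min(\nu_1-\lambda_1,\lambda_3-\nu_2)]\cap\mathbb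 Z$ and $\lambda_2-\nu_2\in[1,\nu_1-\nu_2-1]\cap\mathbb Z$. For $\omega\in\{a,b,c\}$, $\mathrm{Supp}_{3,\omega}(\mathbb D)=\{(\xi,\eta;\lambda,\nu)\in(\mathbb Z/2\mathbb Z)^5\times\Phi_{3,\omega}:\xi_1+\eta_1\equiv\nu_1-\lambda_1,\ \xi_3+\eta_2\equiv\lambda_3-\nu_2\bmod2\}$. Operators: $D_1=\frac{\partial}{\partial x_1}+\frac{x_2}2\frac{\partial}{\partial x_3}$, $D_2=\frac{\partial}{\partial x_2}-\frac{x_1}2\frac{\partial}{\partial x_3}$, $D_3=\frac{\partial}{\partial x_3}$. For $\alpha=(\alpha_1,\alpha_2)\in\mathbb N^2$ and a polynomial $q(t)=\sum_{n=0}^{\min(\alpha)}c_nt^n$ (where $\min(\alpha)=\min(\alpha_1,\alpha_2)$), $(T^{\mathrm{sym}}_\alpha q)(D_1,D_2,D_3)=\sum_nc_n\,\mathrm{sym}_{\alpha_1+\alpha_2-n}(D_1^{\alpha_1-n}D_2^{\alpha_2-n}D_3^n)$ and $(T^{\mathrm{ord}}_\alpha q)(D_1,D_2,D_3)=\sum_nc_n\,D_1^{\alpha_1-n}D_2^{\alpha_2-n}D_3^n$, where $\mathrm{sym}_k(Y_1\cdots Y_k)=\frac1{k!}\sum_{\tau\in\mathfrak S_k}Y_{\tau(1)}\cdots Y_{\tau(k)}$. $T^{\mathrm{ord}}_\alpha\,{}_3F_1[\cdots;D_1,D_2,D_3]$ means $T^{\mathrm{ord}}_\alpha q$ with $q(t)={}_3F_1[\cdots;t]$.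 $(x)_n=x(x+1)\cdots(x+n-1)$. ${}_3F_1\left[\begin{matrix}-n,-m,c\\ d\end{matrix};t\right]=\sum_{k=0}^{\min(n,m)}\frac{(-n)_k(-m)_k(c)_k}{(d)_k\,k!}t^k$ for $n,m\in\mathbb N$, where terms with $(c)_k=0$ are read as $0$ even if $(d)_k=0$. Cayley continuants: $\mathrm{Cay}_n(x,y)$ are the polynomials with $(1+t)^{\frac{y+x}2}(1-t)^{\frac{y-x}2}=\sum_{n\ge0}\mathrm{Cay}_n(x,y)\frac{t^n}{n!}$ (equivalently, for $n\geq 2$, the $n\times n$ tridiagonal determinant with diagonal entries $x$, superdiagonal $1,2,\dots,n-1$, subdiagonal $y,y-1,\dots,y-n+2$). $p^{(\alpha_1,\alpha_2)}_{a,b}(t)=\sum_{n=0}^{\min(\alpha)}\frac{(-\alpha_1)_n(-\alpha_2)_n}{2^nn!\,(-b)_n}\mathrm{Cay}_n(a,b)\,t^n$. If $b\in\mathbb N$, $n>b$ and $m:=\frac{b-a}2\in\{0,1,\dots,b\}$ (so both $(-b)_n$ and $\mathrm{Cay}_n(a,b)$ vanish), the quotient $\mathrm{Cay}_n(a,b)/(-b)_n$ is read as $(-1)^n\sum_{k=0}^{m}\frac{(-n)_k(-m)_k}{(-b)_k\,k!}2^k$, consistently with the identity $\mathrm{Cay}_n(a,b)/(-b)_n=(-1)^n{}_2F_1[-n,\frac{a-b}2;-b;2]$. *)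

theory Defs
  imports
    "HOL-Analysis.Analysis"
    "HOL-Computational_Algebra.Polynomial"
    "HOL-Combinatorics.Permutations"
    "HOL-Library.Z2"
begin

primrec Ck_on :: "nat \<Rightarrow> 'a::real_normed_vector set \<Rightarrow> ('a \<Rightarrow> 'b::real_normed_vector) \<Rightarrow> bool" where
  "Ck_on 0 S f \<longleftrightarrow> continuous_on S f"
| "Ck_on (Suc k) S f \<longleftrightarrow>
     f differentiable_on S \<and> (\<forall>v. Ck_on k S (\<lambda>x. frechet_derivative f (at x) v))"

text \<open>Only used for open sets \<open>S\<close>.\<close>

definition smooth_on :: "'a::real_normed_vector set \<Rightarrow> ('a \<Rightarrow> 'b::real_normed_vector) \<Rightarrow> bool" where
  "smooth_on S f \<longleftrightarrow> (\<forall>k. Ck_on k S f)"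

primrec iter_deriv :: "'a::real_normed_vector list \<Rightarrow> ('a \<Rightarrow> complex) \<Rightarrow> 'a \<Rightarrow> complex" where
  "iter_deriv [] f = f"
| "iter_deriv (v # vs) f = (\<lambda>x. frechet_derivative (iter_deriv vs f) (at x) v)"

text \<open>
  \<open>T\<close>, acting on the functions in \<open>F\<close>, is a differential operator with respect to the map
  \<open>p\<close> from the open set \<open>Y\<close>: locally on \<open>Y\<close> it is a finite sum of smooth coefficients times
  partial derivatives of \<open>f\<close> evaluated at \<open>p y\<close>.
\<close>

definition diff_op_along ::
  "('b::euclidean_space \<Rightarrow> 'a::euclidean_space) \<Rightarrow> 'b set \<Rightarrow> ('a \<Rightarrow> complex) set
    \<Rightarrow> (('a \<Rightarrow> complex) \<Rightarrow> ('b \<Rightarrow> complex)) \<Rightarrow> bool" where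
  "diff_op_along p Y F T \<longleftrightarrow>
     (\<forall>y\<in>Y. \<exists>U k c. open U \<and> y \<in> U \<and> U \<subseteq> Y \<and>
        (\<forall>vs. set vs \<subseteq> Basis \<and> length vs \<le> k \<longrightarrow> smooth_on U (c vs)) \<and>
        (\<forall>f\<in>F. \<forall>z\<in>U. T f z =
           (\<Sum>vs\<in>{vs. set vs \<subseteq> Basis \<and> length vs \<le> k}. c vs z * iter_deriv vs f (p z))))"

definition linear_op_on :: "('a \<Rightarrow> complex) set \<Rightarrow> (('a \<Rightarrow> complex) \<Rightarrow> ('b \<Rightarrow> complex)) \<Rightarrow> bool" where
  "linear_op_on F T \<longleftrightarrow>
     (\<forall>f\<in>F. \<forall>g\<in>F. T (\<lambda>x. f x + g x) = (\<lambda>y. T f y + T g y)) \<and>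
     (\<forall>f\<in>F. \<forall>c. T (\<lambda>x. c * f x) = (\<lambda>y. c * T f y))"

definition GL :: "(real^'n^'n) set" where
  "GL = {g. invertible g}"

definition diag_mat :: "real^'n \<Rightarrow> real^'n^'n" where
  "diag_mat v = (\<chi> i j. if i = j then v $ i else 0)"

text \<open>
  Upper unipotent groups, spelled out entry by entry: in the numeral index type \<open>3\<close> one has
  \<open>3 = 0\<close>, so its order is not the order \<open>1, 2, 3\<close> of the matrix indices.
\<close>

definition unip3 :: "(real^3^3) set" where
  "unip3 = {vector [vector [1, a, b], vector [0, 1, c], vector [0, 0, 1]] | a b c. True}"

definition unip2 :: "(real^2^2) set" where
  "unip2 = {vector [vector [1, a], vector [0, 1]] | a. True}"

text \<open>
  Functions on the group are extended by \<open>0\<close> to all matrices, so that elements of the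
  representation space are determined by their values on \<open>GL\<close>.
\<close>

definition princ_series ::
  "(real^'n^'n) set \<Rightarrow> bit^'n \<Rightarrow> complex^'n \<Rightarrow> (real^'n^'n \<Rightarrow> complex) set" where
  "princ_series N \<xi> lam =
     {f. smooth_on GL f \<and> (\<forall>g. g \<notin> GL \<longrightarrow> f g = 0) \<and>
         (\<forall>g m a n. g \<in> GL \<and> (\<forall>j. m $ j \<in> {1, -1}) \<and> (\<forall>j. a $ j > 0) \<and> n \<in> N \<longrightarrow>
            f (g ** diag_mat m ** diag_mat a ** n) =
              (\<Prod>j\<in>UNIV. complex_of_real (m $ j) powi (- of_bool (\<xi> $ j = 1))) *
              (\<Prod>j\<in>UNIV. complex_of_real (a $ j) powr (- (lam $ j))) * f g)}"

definition I_ser :: "bit^3 \<Rightarrow> complex^3 \<Rightarrow> (real^3^3 \<Rightarrow> complex) set" where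
  "I_ser \<xi> lam = princ_series unip3 \<xi> lam"

definition J_ser :: "bit^2 \<Rightarrow> complex^2 \<Rightarrow> (real^2^2 \<Rightarrow> complex) set" where
  "J_ser \<eta> \<nu> = princ_series unip2 \<eta> \<nu>"

definition ltrans :: "real^'n^'n \<Rightarrow> (real^'n^'n \<Rightarrow> complex) \<Rightarrow> (real^'n^'n \<Rightarrow> complex)" where
  "ltrans h f = (\<lambda>g. f (matrix_inv h ** g))"

definition iota3 :: "real^2^2 \<Rightarrow> real^3^3" where
  "iota3 h = vector [vector [h$1$1, 0, h$1$2], vector [0, 1, 0], vector [h$2$1, 0, h$2$2]]"

text \<open>
  Intertwining differential operators from \<open>I \<xi> lam\<close> to \<open>J \<eta> \<nu>\<close>, as maps on the equivariant
  functions. Local trivialisations of the line bundles turn differential operators between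
  sections with respect to the map \<open>G'/P' \<rightarrow> G/P\<close> induced by \<open>iota3\<close> into differential operators
  on equivariant functions with respect to \<open>iota3\<close> itself, and conversely.
  The value \<open>0\<close> outside of \<open>I_ser \<xi> lam\<close> makes \<open>T\<close> determined by its action on that space.
\<close>

definition Diff_G3 ::
  "bit^3 \<Rightarrow> complex^3 \<Rightarrow> bit^2 \<Rightarrow> complex^2
    \<Rightarrow> ((real^3^3 \<Rightarrow> complex) \<Rightarrow> (real^2^2 \<Rightarrow> complex)) set" where
  "Diff_G3 \<xi> lam \<eta> \<nu> =
     {T. (\<forall>f. f \<notin> I_ser \<xi> lam \<longrightarrow> T f = (\<lambda>_. 0)) \<and>
         (\<forall>f\<in>I_ser \<xi> lam. T f \<in> J_ser \<eta> \<nu>) \<and>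
         linear_op_on (I_ser \<xi> lam) T \<and>
         (\<forall>h\<in>GL. \<forall>f\<in>I_ser \<xi> lam. T (ltrans (iota3 h) f) = ltrans h (T f)) \<and>
         diff_op_along iota3 GL (I_ser \<xi> lam) T}"

text \<open>Multiplication on \<^typ>\<open>real^'n^'n\<close> is entrywise, hence the library's \<open>exp\<close> cannot be used.\<close>

definition mat_exp :: "real^'n^'n \<Rightarrow> real^'n^'n" where
  "mat_exp X = (\<Sum>k. (1 / fact k) *\<^sub>R (((\<lambda>Y. X ** Y) ^^ k) (mat 1)))"

definition unit_mat :: "'n \<Rightarrow> 'n \<Rightarrow> real^'n^'n" where
  "unit_mat i j = (\<chi> k l. if k = i \<and> l = j then 1 else 0)"

definition cell3 :: "real^3 \<Rightarrow> real^3^3" where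
  "cell3 x = mat_exp (x$1 *\<^sub>R unit_mat 2 1 + x$2 *\<^sub>R unit_mat 3 2 + x$3 *\<^sub>R unit_mat 3 1)"

text \<open>\<open>iota3\<close> maps this to \<open>mat_exp (t *\<^sub>R unit_mat 3 1)\<close>.\<close>

definition cell2 :: "real \<Rightarrow> real^2^2" where
  "cell2 t = mat_exp (t *\<^sub>R unit_mat 2 1)"

definition Cinf :: "('a::real_normed_vector \<Rightarrow> complex) set" where
  "Cinf = {f. smooth_on UNIV f}"

definition axis3 :: "real \<Rightarrow> real^3" where
  "axis3 t = vector [0, 0, t]"

type_synonym cell_operator = "(real^3 \<Rightarrow> complex) \<Rightarrow> (real \<Rightarrow> complex)"

text \<open>
  Differential operators \<open>C\<^sup>\<infinity>(\<real>\<^sup>3) \<rightarrow> C\<^sup>\<infinity>(\<real>)\<close> with respect to \<open>axis3\<close>, again with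
  value \<open>0\<close> outside of \<open>C\<^sup>\<infinity>(\<real>\<^sup>3)\<close>.
\<close>

definition cell_diff_ops :: "cell_operator set" where
  "cell_diff_ops =
     {D. (\<forall>\<phi>. \<phi> \<notin> Cinf \<longrightarrow> D \<phi> = (\<lambda>_. 0)) \<and> (\<forall>\<phi>\<in>Cinf. D \<phi> \<in> Cinf) \<and>
         linear_op_on Cinf D \<and> diff_op_along axis3 UNIV Cinf D}"

text \<open>
  The operator \<open>T\<close> viewed on the cells. A differential operator on \<open>C\<^sup>\<infinity>(\<real>\<^sup>3)\<close> is determined
  by its values on the restrictions of equivariant functions, as these include all compactly
  supported smooth functions.
\<close>

definition cell_op ::
  "bit^3 \<Rightarrow> complex^3 \<Rightarrow> ((real^3^3 \<Rightarrow> complex) \<Rightarrow> (real^2^2 \<Rightarrow> complex)) \<Rightarrow> cell_operator" where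
  "cell_op \<xi> lam T =
     (THE D. D \<in> cell_diff_ops \<and>
        (\<forall>f\<in>I_ser \<xi> lam. \<forall>t. T f (cell2 t) = D (\<lambda>x. f (cell3 x)) t))"

text \<open>The natural number equal to \<open>z\<close>, for \<open>z \<in> \<nat>\<close>.\<close>

definition cnat :: "complex \<Rightarrow> nat" where
  "cnat z = nat \<lfloor>Re z\<rfloor>"

definition Phi3 :: "((complex^3) \<times> (complex^2)) set" where
  "Phi3 = {(lam, \<nu>). \<nu>$1 - lam$1 \<in> \<nat> \<and> lam$3 - \<nu>$2 \<in> \<nat>}"

definition resonant :: "complex^3 \<Rightarrow> complex^2 \<Rightarrow> bool" where
  "resonant lam \<nu> \<longleftrightarrow>
     \<nu>$1 - \<nu>$2 - 1 \<in> of_nat ` {1..min (cnat (\<nu>$1 - lam$1)) (cnat (lam$3 - \<nu>$2))}"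

definition Phi3a :: "((complex^3) \<times> (complex^2)) set" where
  "Phi3a = {(lam, \<nu>) \<in> Phi3. \<not> resonant lam \<nu>}"

definition Phi3b :: "((complex^3) \<times> (complex^2)) set" where
  "Phi3b = {(lam, \<nu>) \<in> Phi3. resonant lam \<nu> \<and> lam$2 - \<nu>$2 \<notin> of_nat ` {1..cnat (\<nu>$1 - \<nu>$2 - 1)}}"

definition Phi3c :: "((complex^3) \<times> (complex^2)) set" where
  "Phi3c = {(lam, \<nu>) \<in> Phi3. resonant lam \<nu> \<and> lam$2 - \<nu>$2 \<in> of_nat ` {1..cnat (\<nu>$1 - \<nu>$2 - 1)}}"

definition Supp3 ::
  "((complex^3) \<times> (complex^2)) set \<Rightarrow> ((bit^3) \<times> (bit^2) \<times> (complex^3) \<times> (complex^2)) set" where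
  "Supp3 \<Phi> = {(\<xi>, \<eta>, lam, \<nu>). (lam, \<nu>) \<in> \<Phi> \<and>
     \<xi>$1 + \<eta>$1 = of_nat (cnat (\<nu>$1 - lam$1)) \<and> \<xi>$3 + \<eta>$2 = of_nat (cnat (lam$3 - \<nu>$2))}"

definition Cay :: "nat \<Rightarrow> complex \<Rightarrow> complex \<Rightarrow> complex" where
  "Cay n x y = fact n * fps_nth
     (fps_binomial ((y + x) / 2) * fps_compose (fps_binomial ((y - x) / 2)) (- fps_X)) n"

text \<open>The quotient \<open>Cay n a b / pochhammer (- b) n\<close>, with its reading in the case \<open>0 / 0\<close>.\<close>

definition Cay_quot :: "nat \<Rightarrow> complex \<Rightarrow> complex \<Rightarrow> complex" where
  "Cay_quot n a b =
     (if b \<in> \<nat> \<and> n > cnat b \<and> (b - a) / 2 \<in> of_nat ` {0..cnat b}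
      then (-1) ^ n * (\<Sum>k=0..cnat ((b - a) / 2).
             pochhammer (- of_nat n) k * pochhammer (- ((b - a) / 2)) k
               / (pochhammer (- b) k * fact k) * 2 ^ k)
      else Cay n a b / pochhammer (- b) n)"

definition p_poly :: "nat \<times> nat \<Rightarrow> complex \<Rightarrow> complex \<Rightarrow> complex poly" where
  "p_poly \<alpha> a b = (\<Sum>n=0..min (fst \<alpha>) (snd \<alpha>).
     monom (pochhammer (- of_nat (fst \<alpha>)) n * pochhammer (- of_nat (snd \<alpha>)) n
              / (2 ^ n * fact n) * Cay_quot n a b) n)"

text \<open>
  The polynomial \<open>\<^sub>3F\<^sub>1[-n, -m, c; d; t]\<close>. As \<open>x / 0 = 0\<close>, terms with \<open>pochhammer c k = 0\<close> vanish
  even if \<open>pochhammer d k = 0\<close>.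
\<close>

definition F31 :: "nat \<Rightarrow> nat \<Rightarrow> complex \<Rightarrow> complex \<Rightarrow> complex poly" where
  "F31 n m c d = (\<Sum>k=0..min n m.
     monom (pochhammer (- of_nat n) k * pochhammer (- of_nat m) k * pochhammer c k
              / (pochhammer d k * fact k)) k)"

type_synonym operator3 = "(real^3 \<Rightarrow> complex) \<Rightarrow> (real^3 \<Rightarrow> complex)"

definition pd :: "3 \<Rightarrow> operator3" where
  "pd i \<phi> = (\<lambda>x. frechet_derivative \<phi> (at x) (axis i 1))"

definition D1 :: operator3 where
  "D1 \<phi> = (\<lambda>x. pd 1 \<phi> x + of_real (x$2 / 2) * pd 3 \<phi> x)"

definition D2 :: operator3 where
  "D2 \<phi> = (\<lambda>x. pd 2 \<phi> x - of_real (x$1 / 2) * pd 3 \<phi> x)"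

definition D3 :: operator3 where
  "D3 \<phi> = pd 3 \<phi>"

definition sym_prod :: "operator3 list \<Rightarrow> operator3" where
  "sym_prod Ys \<phi> = (\<lambda>x. 1 / fact (length Ys) *
     (\<Sum>\<tau> | \<tau> permutes {..<length Ys}.
        foldr (\<circ>) (map (\<lambda>i. Ys ! \<tau> i) [0..<length Ys]) id \<phi> x))"

definition T_sym :: "nat \<times> nat \<Rightarrow> complex poly \<Rightarrow> operator3" where
  "T_sym \<alpha> q \<phi> = (\<lambda>x. \<Sum>n=0..min (fst \<alpha>) (snd \<alpha>). coeff q n *
     sym_prod (replicate (fst \<alpha> - n) D1 @ replicate (snd \<alpha> - n) D2 @ replicate n D3) \<phi> x)"

definition T_ord :: "nat \<times> nat \<Rightarrow> complex poly \<Rightarrow> operator3" where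
  "T_ord \<alpha> q \<phi> = (\<lambda>x. \<Sum>n=0..min (fst \<alpha>) (snd \<alpha>). coeff q n *
     ((D1 ^^ (fst \<alpha> - n)) \<circ> (D2 ^^ (snd \<alpha> - n)) \<circ> (D3 ^^ n)) \<phi> x)"

definition Rest3 :: "operator3 \<Rightarrow> cell_operator" where
  "Rest3 D \<phi> = (\<lambda>t. if \<phi> \<in> Cinf then D \<phi> (axis3 t) else 0)"

definition DD1_sym :: "complex^3 \<Rightarrow> complex^2 \<Rightarrow> cell_operator" where
  "DD1_sym lam \<nu> =
     (let \<alpha> = (cnat (\<nu>$1 - lam$1), cnat (lam$3 - \<nu>$2))
      in Rest3 (T_sym \<alpha> (p_poly \<alpha> (\<nu>$1 + \<nu>$2 - 2 * lam$2) (\<nu>$1 - \<nu>$2 - 2))))"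

definition DD1_ord :: "complex^3 \<Rightarrow> complex^2 \<Rightarrow> cell_operator" where
  "DD1_ord lam \<nu> =
     (let \<alpha> = (cnat (\<nu>$1 - lam$1), cnat (lam$3 - \<nu>$2))
      in Rest3 (T_ord \<alpha> (F31 (fst \<alpha>) (snd \<alpha>) (\<nu>$2 - lam$2 + 1) (\<nu>$2 - \<nu>$1 + 2))))"

definition DD2_sym :: "complex^3 \<Rightarrow> complex^2 \<Rightarrow> cell_operator" where
  "DD2_sym lam \<nu> =
     (let \<alpha> = (cnat (\<nu>$2 - lam$1 + 1), cnat (lam$3 - \<nu>$1 + 1))
      in Rest3 ((D3 ^^ cnat (\<nu>$1 - \<nu>$2 - 1)) \<circ>
           T_sym \<alpha> (p_poly \<alpha> (\<nu>$1 + \<nu>$2 - 2 * lam$2) (\<nu>$2 - \<nu>$1))))"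

definition DD2_ord :: "complex^3 \<Rightarrow> complex^2 \<Rightarrow> cell_operator" where
  "DD2_ord lam \<nu> =
     (let \<alpha> = (cnat (\<nu>$2 - lam$1 + 1), cnat (lam$3 - \<nu>$1 + 1))
      in Rest3 ((D3 ^^ cnat (\<nu>$1 - \<nu>$2 - 1)) \<circ>
           T_ord \<alpha> (F31 (fst \<alpha>) (snd \<alpha>) (\<nu>$1 - lam$2) (\<nu>$1 - \<nu>$2))))"

definition zero_op :: cell_operator where
  "zero_op = (\<lambda>_ _. 0)"

definition cline :: "cell_operator \<Rightarrow> cell_operator set" where
  "cline D = {\<lambda>\<phi> t. c * D \<phi> t | c. True}"

definition op_set_plus :: "cell_operator set \<Rightarrow> cell_operator set \<Rightarrow> cell_operator set" where
  "op_set_plus A B = {\<lambda>\<phi> t. D \<phi> t + E \<phi> t | D E. D \<in> A \<and> E \<in> B}"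

end

theory Submission
  imports Defs "HOL-Combinatorics.Multiset_Permutations"
begin

text \<open>
  An intertwining operator \<open>T\<close> is determined by the functional \<open>f \<mapsto> T f 1\<close>, which depends only on a jet
  of \<open>f\<close> at the identity. As \<open>f\<close> is equivariant, this is a jet at \<open>0\<close> of its restriction to the lower
  unipotent group, and all such jets occur. Equivariance under the diagonal group leaves the derivatives
  \<open>\<Sum>\<^sub>n b\<^sub>n \<partial>\<^sub>1\<^bsup>\<alpha>\<^sub>1-n\<^esup> \<partial>\<^sub>2\<^bsup>\<alpha>\<^sub>2-n\<^esup> \<partial>\<^sub>3\<^bsup>n\<^esup>\<close> with \<open>\<alpha> = (\<nu>\<^sub>1 - \<lambda>\<^sub>1, \<lambda>\<^sub>3 - \<nu>\<^sub>2)\<close>, and invariance under the upper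
  unipotent subgroup becomes, with \<open>c = \<nu>\<^sub>2 - \<lambda>\<^sub>2 + 1\<close> and \<open>d = \<nu>\<^sub>2 - \<nu>\<^sub>1 + 2\<close>, the recursion
  \<open>(k + 1) (d + k) b\<^sub>k\<^sub>+\<^sub>1 = (\<alpha>\<^sub>1 - k) (\<alpha>\<^sub>2 - k) (c + k) b\<^sub>k\<close>.
  It has a one-dimensional solution space unless \<open>d + k = 0\<close> and \<open>c + j = 0\<close> for some \<open>j \<le> k < min \<alpha>\<^sub>1 \<alpha>\<^sub>2\<close>,
  where it has dimension two. The symmetrised form follows by normal ordering and binomial inversion.
\<close>

section \<open>Smooth functions\<close>

text \<open>A functional at the identity with the right behaviour under the upper triangular group
  of \<open>G'\<close> spreads to an operator by left translation, so the lower unipotent direction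
  imposes no condition and the classification becomes linear algebra on jets. The obstacle is to
  have enough test functions. No bump functions are used: polynomials in affine coordinates of the
  cell are homogenised to global equivariant functions, at the price of a nowhere vanishing smooth
  weight. Test functions thus realise a given monomial only modulo functions with vanishing jet, and
  the calculus of \<open>flat\<close> carries this error through products, compositions and
  differential operators. Two charts of the lower unipotent group are in play. In matrix entries
  (\<open>uch\<close>) the group is an affine subspace of the matrices, so jets restrict and
  translate without correction terms. The theorem speaks of exponential coordinates; they differ by
  a quadratic shear, which turns normally ordered words in \<open>D1\<close>, \<open>D2\<close>,
  \<open>D3\<close> into plain partial derivatives along the axis.\<close>

lemma frechet_derivative_eq: "(f has_derivative D) (at x) \<Longrightarrow> frechet_derivative f (at x) = D"
  using frechet_derivative_at by metis

lemma frechet_derivative_cong_open: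
  assumes "open S" "x \<in> S" "\<And>y. y \<in> S \<Longrightarrow> f y = g y"
  shows "frechet_derivative f (at x) = frechet_derivative g (at x)"
proof -
  have "(f has_derivative D) (at x) \<longleftrightarrow> (g has_derivative D) (at x)" for D
    using assms has_derivative_transform_within_open[of f D x UNIV S g]
      has_derivative_transform_within_open[of g D x UNIV S f] by auto
  then show ?thesis unfolding frechet_derivative_def by simp
qed

lemma has_derivative_frechet:
  assumes "open S" "x \<in> S" "f differentiable_on S"
  shows "(f has_derivative frechet_derivative f (at x)) (at x)"
  using assms differentiable_on_eq_differentiable_at frechet_derivative_works by blast

lemma Ck_on_cong:
  assumes "open S" "\<And>x. x \<in> S \<Longrightarrow> f x = g x" "Ck_on k S f"
  shows "Ck_on k S g"
  using assms(2,3)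
proof (induction k arbitrary: f g)
  case 0
  then show ?case by (metis Ck_on.simps(1) continuous_on_cong)
next
  case (Suc k)
  have "g differentiable_on S"
    using Suc.prems by (metis Ck_on.simps(2) differentiable_on_def differentiable_transform_within zero_less_one)
  moreover have "Ck_on k S (\<lambda>x. frechet_derivative g (at x) v)" for v
  proof (rule Suc.IH)
    show "Ck_on k S (\<lambda>x. frechet_derivative f (at x) v)" using Suc.prems by simp
    show "frechet_derivative f (at x) v = frechet_derivative g (at x) v" if "x \<in> S" for x
      using frechet_derivative_cong_open[OF assms(1) that, of f g] Suc.prems by simp
  qed
  ultimately show ?case by simp
qed

lemma Ck_on_Suc_imp: "Ck_on (Suc k) S f \<Longrightarrow> Ck_on k S f"
proof (induction k arbitrary: f)
  case 0
  then show ?case by (simp add: differentiable_imp_continuous_on)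
next
  case (Suc k)
  then show ?case by (metis Ck_on.simps(2))
qed

lemma smooth_on_cong: "open S \<Longrightarrow> (\<And>x. x \<in> S \<Longrightarrow> f x = g x) \<Longrightarrow> smooth_on S f \<Longrightarrow> smooth_on S g"
  unfolding smooth_on_def using Ck_on_cong by metis

lemma smooth_on_iff:
  "smooth_on S f \<longleftrightarrow> f differentiable_on S \<and> (\<forall>v. smooth_on S (\<lambda>x. frechet_derivative f (at x) v))"
proof -
  have "(\<forall>k. Ck_on k S f) \<longleftrightarrow> (\<forall>k. Ck_on (Suc k) S f)"
    using Ck_on_Suc_imp by blast
  then show ?thesis unfolding smooth_on_def by auto
qed

lemma smooth_on_differentiable: "smooth_on S f \<Longrightarrow> f differentiable_on S"
  using smooth_on_iff by blast

lemma smooth_on_continuous: "smooth_on S f \<Longrightarrow> continuous_on S f"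
  using smooth_on_differentiable differentiable_imp_continuous_on by blast

lemma smooth_on_deriv: "smooth_on S f \<Longrightarrow> smooth_on S (\<lambda>x. frechet_derivative f (at x) v)"
  using smooth_on_iff by blast

lemma smooth_on_has_derivative:
  "open S \<Longrightarrow> smooth_on S f \<Longrightarrow> x \<in> S \<Longrightarrow> (f has_derivative frechet_derivative f (at x)) (at x)"
  using has_derivative_frechet smooth_on_differentiable by blast

text \<open>Smoothness is a greatest fixed point of differentiation, so a class closed under it is
  enough. Meant for families such as c * t powr s, whose derivatives stay in the family.\<close>

lemma smooth_on_coinduct:
  assumes "open S" "X f"
    and step: "\<And>f. X f \<Longrightarrow> \<exists>D. (\<forall>x\<in>S. (f has_derivative D x) (at x)) \<and> (\<forall>v. \<exists>g. X g \<and> (\<forall>x\<in>S. g x = D x v))"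
  shows "smooth_on S f"
proof -
  have "Ck_on k S f" if "X f" for k f
    using that
  proof (induction k arbitrary: f)
    case (0 f)
    from step[OF 0] have "f differentiable_on S"
      using differentiable_at_imp_differentiable_on differentiable_def by blast
    then show ?case by (simp add: differentiable_imp_continuous_on)
  next
    case (Suc k f)
    from step[OF Suc.prems] obtain D where D: "\<And>x. x \<in> S \<Longrightarrow> (f has_derivative D x) (at x)"
      and g: "\<And>v. \<exists>g. X g \<and> (\<forall>x\<in>S. g x = D x v)" by blast
    have "f differentiable_on S"
      using D differentiable_at_imp_differentiable_on differentiable_def by blast
    moreover have "Ck_on k S (\<lambda>x. frechet_derivative f (at x) v)" for v
    proof -
      obtain g where "X g" and g: "\<And>x. x \<in> S \<Longrightarrow> g x = D x v" using g by blast
      show ?thesis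
        by (rule Ck_on_cong[OF assms(1) _ Suc.IH[OF \<open>X g\<close>]]) (simp add: g frechet_derivative_eq[OF D])
    qed
    ultimately show ?case by simp
  qed
  then show ?thesis using assms(2) unfolding smooth_on_def by blast
qed

lemma Ck_on_const [simp]: "Ck_on k S (\<lambda>x. c)"
  by (induction k arbitrary: c) simp_all

lemma smooth_on_const [simp]: "smooth_on S (\<lambda>x. c)"
  by (simp add: smooth_on_def)

lemma smooth_on_linear:
  assumes "open S" "bounded_linear A" shows "smooth_on S A"
proof -
  have "(A has_derivative A) (at x)" for x
    using assms(2) by (rule bounded_linear_imp_has_derivative)
  then have "A differentiable_on S" and "frechet_derivative A (at x) = A" for x
    by (auto intro: differentiable_at_imp_differentiable_on differentiableI frechet_derivative_eq)
  then show ?thesis by (subst smooth_on_iff) (simp add: assms(1))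
qed

lemma Ck_on_add:
  assumes "open S" "Ck_on k S f" "Ck_on k S g"
  shows "Ck_on k S (\<lambda>x. f x + g x)"
  using assms(2,3)
proof (induction k arbitrary: f g)
  case 0
  then show ?case by (simp add: continuous_on_add)
next
  case (Suc k)
  then have df: "f differentiable_on S" and dg: "g differentiable_on S" by simp_all
  have *: "frechet_derivative f (at x) v + frechet_derivative g (at x) v = frechet_derivative (\<lambda>x. f x + g x) (at x) v"
    if "x \<in> S" for x v
    using frechet_derivative_eq[OF has_derivative_add[OF has_derivative_frechet[OF assms(1) that df] has_derivative_frechet[OF assms(1) that dg]]]
    by simp
  have "Ck_on k S (\<lambda>x. frechet_derivative (\<lambda>x. f x + g x) (at x) v)" for v
    by (rule Ck_on_cong[OF assms(1) *]) (use Suc in auto)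
  then show ?case using df dg by (simp add: differentiable_on_add)
qed

lemma smooth_on_add:
  "open S \<Longrightarrow> smooth_on S f \<Longrightarrow> smooth_on S g \<Longrightarrow> smooth_on S (\<lambda>x. f x + g x)"
  unfolding smooth_on_def using Ck_on_add by blast

lemma Ck_on_sum:
  assumes "open S" "\<And>i. i \<in> I \<Longrightarrow> Ck_on k S (f i)" shows "Ck_on k S (\<lambda>x. \<Sum>i\<in>I. f i x)"
  using assms(2)
proof (induction I rule: infinite_finite_induct)
  case (insert i I)
  then have "Ck_on k S (\<lambda>x. f i x + (\<Sum>i\<in>I. f i x))"
    by (intro Ck_on_add[OF assms(1)]) auto
  then show ?case using insert by simp
qed simp_all

lemma smooth_on_sum:
  "open S \<Longrightarrow> (\<And>i. i \<in> I \<Longrightarrow> smooth_on S (f i)) \<Longrightarrow> smooth_on S (\<lambda>x. \<Sum>i\<in>I. f i x)"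
  unfolding smooth_on_def by (intro allI Ck_on_sum) auto

text \<open>Assuming smoothness of all orders instead of \<open>Ck_on k\<close> keeps the induction
  simple: both terms of the product rule again pair two smooth functions.\<close>

lemma Ck_on_bilinear:
  assumes "bounded_bilinear B" "open S" "smooth_on S f" "smooth_on S g"
  shows "Ck_on k S (\<lambda>x. B (f x) (g x))"
  using assms(3,4)
proof (induction k arbitrary: f g)
  case 0
  then show ?case
    using bounded_bilinear.continuous_on[OF assms(1) smooth_on_continuous smooth_on_continuous] by simp
next
  case (Suc k)
  have D: "((\<lambda>x. B (f x) (g x)) has_derivative
      (\<lambda>v. B (f x) (frechet_derivative g (at x) v) + B (frechet_derivative f (at x) v) (g x))) (at x)"
    if "x \<in> S" for x
    by (rule bounded_bilinear.FDERIV[OF assms(1) smooth_on_has_derivative[OF assms(2) Suc.prems(1) that]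
          smooth_on_has_derivative[OF assms(2) Suc.prems(2) that]])
  have "Ck_on k S (\<lambda>x. frechet_derivative (\<lambda>x. B (f x) (g x)) (at x) v)" for v
  proof (rule Ck_on_cong[OF assms(2)])
    show "B (f x) (frechet_derivative g (at x) v) + B (frechet_derivative f (at x) v) (g x)
        = frechet_derivative (\<lambda>x. B (f x) (g x)) (at x) v" if "x \<in> S" for x
      using frechet_derivative_eq[OF D[OF that]] by simp
    show "Ck_on k S (\<lambda>x. B (f x) (frechet_derivative g (at x) v) + B (frechet_derivative f (at x) v) (g x))"
      by (rule Ck_on_add[OF assms(2) Suc.IH[OF Suc.prems(1) smooth_on_deriv[OF Suc.prems(2)]]
            Suc.IH[OF smooth_on_deriv[OF Suc.prems(1)] Suc.prems(2)]])
  qed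
  moreover have "(\<lambda>x. B (f x) (g x)) differentiable_on S"
    using D differentiable_at_imp_differentiable_on differentiable_def by blast
  ultimately show ?case by simp
qed

lemma smooth_on_bilinear:
  assumes "bounded_bilinear B" "open S" "smooth_on S f" "smooth_on S g"
  shows "smooth_on S (\<lambda>x. B (f x) (g x))"
  using Ck_on_bilinear[OF assms] by (simp add: smooth_on_def)

lemmas smooth_on_mult = smooth_on_bilinear[OF bounded_bilinear_mult]
lemmas smooth_on_scaleR = smooth_on_bilinear[OF bounded_bilinear_scaleR]

text \<open>Over a basis the chain rule has factors of two kinds only: scalars depending on x and
  derivatives of \<open>f\<close> in constant directions. In this shape the inductions for
  smoothness and flatness of composites close.\<close>

lemma frechet_derivative_compose_sum:
  fixes g :: "'a::real_normed_vector \<Rightarrow> 'b::euclidean_space" and f :: "'b \<Rightarrow> 'c::real_normed_vector"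
  assumes "(g has_derivative Dg) (at x)" "(f has_derivative Df) (at (g x))"
  shows "frechet_derivative (\<lambda>x. f (g x)) (at x) v = (\<Sum>b\<in>Basis. (Dg v \<bullet> b) *\<^sub>R Df b)"
proof -
  have "frechet_derivative (\<lambda>x. f (g x)) (at x) v = Df (Dg v)"
    by (rule fun_cong[OF frechet_derivative_eq[OF has_derivative_compose[OF assms]]])
  also have "\<dots> = Df (\<Sum>b\<in>Basis. (Dg v \<bullet> b) *\<^sub>R b)" by (simp add: euclidean_representation)
  also have "\<dots> = (\<Sum>b\<in>Basis. (Dg v \<bullet> b) *\<^sub>R Df b)"
    using has_derivative_linear[OF assms(2)] by (simp add: linear_sum linear_scale)
  finally show ?thesis .
qed

lemma smooth_on_compose:
  fixes g :: "'a::real_normed_vector \<Rightarrow> 'b::euclidean_space" and f :: "'b \<Rightarrow> 'c::real_normed_vector"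
  assumes "open S" "open T" "smooth_on S g" "smooth_on T f" "\<And>x. x \<in> S \<Longrightarrow> g x \<in> T"
  shows "smooth_on S (\<lambda>x. f (g x))"
proof -
  \<comment> \<open>The scalar weight \<open>h\<close> strengthens the claim: differentiating a
    weighted composite gives a sum of weighted composites, with \<open>f\<close> or one of its
    derivatives inside.\<close>
  have "Ck_on k S (\<lambda>x. h x *\<^sub>R f (g x))" if "smooth_on T f" "smooth_on S h" for k f and h :: "'a \<Rightarrow> real"
    using that
  proof (induction k arbitrary: f h)
    case 0
    have "continuous_on S (\<lambda>x. f (g x))"
      by (rule continuous_on_compose2[of T f S g]) (use 0 assms smooth_on_continuous in auto)
    then show ?case using 0 smooth_on_continuous by (auto intro!: continuous_on_scaleR)
  next
    case (Suc k)
    have g': "(g has_derivative frechet_derivative g (at x)) (at x)"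
      and f': "(f has_derivative frechet_derivative f (at (g x))) (at (g x))"
      and h': "(h has_derivative frechet_derivative h (at x)) (at x)" if "x \<in> S" for x
      using smooth_on_has_derivative[OF assms(1) assms(3) that] smooth_on_has_derivative[OF assms(2) Suc.prems(1) assms(5)[OF that]]
        smooth_on_has_derivative[OF assms(1) Suc.prems(2) that] by -
    have fg': "((\<lambda>x. f (g x)) has_derivative (\<lambda>v. \<Sum>b\<in>Basis. (frechet_derivative g (at x) v \<bullet> b) *\<^sub>R frechet_derivative f (at (g x)) b)) (at x)"
      if "x \<in> S" for x
    proof -
      have "frechet_derivative f (at (g x)) (frechet_derivative g (at x) v)
          = (\<Sum>b\<in>Basis. (frechet_derivative g (at x) v \<bullet> b) *\<^sub>R frechet_derivative f (at (g x)) b)" for v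
        using frechet_derivative_compose_sum[OF g'[OF that] f'[OF that], of v]
          fun_cong[OF frechet_derivative_eq[OF has_derivative_compose[OF g'[OF that] f'[OF that]]], of v] by simp
      then show ?thesis using has_derivative_compose[OF g'[OF that] f'[OF that]] by simp
    qed
    have D: "((\<lambda>x. h x *\<^sub>R f (g x)) has_derivative
        (\<lambda>v. h x *\<^sub>R (\<Sum>b\<in>Basis. (frechet_derivative g (at x) v \<bullet> b) *\<^sub>R frechet_derivative f (at (g x)) b)
            + frechet_derivative h (at x) v *\<^sub>R f (g x))) (at x)" if "x \<in> S" for x
      using has_derivative_scaleR[OF h'[OF that] fg'[OF that]] by simp
    have "Ck_on k S (\<lambda>x. frechet_derivative (\<lambda>x. h x *\<^sub>R f (g x)) (at x) v)" for v
    proof (rule Ck_on_cong[OF assms(1)])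
      show "(\<Sum>b\<in>Basis. (h x * (frechet_derivative g (at x) v \<bullet> b)) *\<^sub>R frechet_derivative f (at (g x)) b)
          + frechet_derivative h (at x) v *\<^sub>R f (g x)
          = frechet_derivative (\<lambda>x. h x *\<^sub>R f (g x)) (at x) v" if "x \<in> S" for x
        using frechet_derivative_eq[OF D[OF that]] by (simp add: scaleR_sum_right)
      have sm: "smooth_on S (\<lambda>x. h x * (frechet_derivative g (at x) v \<bullet> b))" for b
        by (rule smooth_on_mult[OF assms(1) Suc.prems(2)
              smooth_on_bilinear[OF bounded_bilinear_inner assms(1) smooth_on_deriv[OF assms(3)] smooth_on_const]])
      show "Ck_on k S (\<lambda>x. (\<Sum>b\<in>Basis. (h x * (frechet_derivative g (at x) v \<bullet> b)) *\<^sub>R frechet_derivative f (at (g x)) b)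
          + frechet_derivative h (at x) v *\<^sub>R f (g x))"
        by (rule Ck_on_add[OF assms(1) Ck_on_sum[OF assms(1) Suc.IH[OF smooth_on_deriv[OF Suc.prems(1)] sm]]
              Suc.IH[OF Suc.prems(1) smooth_on_deriv[OF Suc.prems(2)]]])
    qed
    moreover have "(\<lambda>x. h x *\<^sub>R f (g x)) differentiable_on S"
      using D differentiable_at_imp_differentiable_on differentiable_def by blast
    ultimately show ?case by simp
  qed
  from this[OF assms(4) smooth_on_const[of _ 1]] show ?thesis
    by (simp add: smooth_on_def)
qed

lemma smooth_on_compose_linear:
  assumes "open S" "bounded_linear A" "smooth_on S (g :: _ \<Rightarrow> 'b::euclidean_space)"
  shows "smooth_on S (\<lambda>x. A (g x))"
  using smooth_on_compose[OF assms(1) open_UNIV assms(3) smooth_on_linear[OF open_UNIV assms(2)]] by simp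

section \<open>Iterated derivatives and jets\<close>

lemma iter_deriv_append: "iter_deriv (xs @ ys) f = iter_deriv xs (iter_deriv ys f)"
  by (induction xs) simp_all

lemma smooth_on_iter_deriv: "smooth_on S f \<Longrightarrow> smooth_on S (iter_deriv vs f)"
  by (induction vs) (simp_all add: smooth_on_deriv)

lemma iter_deriv_cong:
  assumes "open S" "\<And>y. y \<in> S \<Longrightarrow> f y = g y" "x \<in> S"
  shows "iter_deriv vs f x = iter_deriv vs g x"
  using assms(3)
proof (induction vs arbitrary: x)
  case Nil
  then show ?case using assms(2) by simp
next
  case (Cons v vs)
  then show ?case using frechet_derivative_cong_open[OF assms(1) Cons.prems Cons.IH] by simp
qed

lemma iter_deriv_add:
  assumes "open S" "smooth_on S f" "smooth_on S g" "x \<in> S"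
  shows "iter_deriv vs (\<lambda>y. f y + g y) x = iter_deriv vs f x + iter_deriv vs g x"
  using assms(4)
proof (induction vs arbitrary: x)
  case (Cons v vs)
  have "iter_deriv (v # vs) (\<lambda>y. f y + g y) x
      = frechet_derivative (\<lambda>y. iter_deriv vs f y + iter_deriv vs g y) (at x) v"
    using frechet_derivative_cong_open[OF assms(1) Cons.prems Cons.IH] by simp
  also have "\<dots> = frechet_derivative (iter_deriv vs f) (at x) v + frechet_derivative (iter_deriv vs g) (at x) v"
    by (rule fun_cong[OF frechet_derivative_eq[OF has_derivative_add]];
        rule smooth_on_has_derivative[OF assms(1) smooth_on_iter_deriv Cons.prems]; fact)
  finally show ?case by simp
qed simp

lemma iter_deriv_cmult:
  assumes "open S" "smooth_on S f" "x \<in> S"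
  shows "iter_deriv vs (\<lambda>y. c * f y) x = c * iter_deriv vs f x"
  using assms(3)
proof (induction vs arbitrary: x)
  case (Cons v vs)
  have "iter_deriv (v # vs) (\<lambda>y. c * f y) x = frechet_derivative (\<lambda>y. c * iter_deriv vs f y) (at x) v"
    using frechet_derivative_cong_open[OF assms(1) Cons.prems Cons.IH] by simp
  also have "\<dots> = c * frechet_derivative (iter_deriv vs f) (at x) v"
    by (rule fun_cong[OF frechet_derivative_eq[OF has_derivative_mult_right]];
        rule smooth_on_has_derivative[OF assms(1) smooth_on_iter_deriv Cons.prems]; fact)
  finally show ?case by simp
qed simp

lemma iter_deriv_zero [simp]: "iter_deriv vs (\<lambda>y. 0) = (\<lambda>x. 0)"
  by (induction vs) simp_all

lemma iter_deriv_sum: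
  assumes "open S" "\<And>i. i \<in> I \<Longrightarrow> smooth_on S (f i)" "x \<in> S"
  shows "iter_deriv vs (\<lambda>y. \<Sum>i\<in>I. f i y) x = (\<Sum>i\<in>I. iter_deriv vs (f i) x)"
  using assms(2)
proof (induction I rule: infinite_finite_induct)
  case (insert i I)
  have "iter_deriv vs (\<lambda>y. f i y + (\<Sum>i\<in>I. f i y)) x = iter_deriv vs (f i) x + iter_deriv vs (\<lambda>y. \<Sum>i\<in>I. f i y) x"
    using insert by (intro iter_deriv_add[OF assms(1) _ _ assms(3)] smooth_on_sum[OF assms(1)]) auto
  then show ?case using insert by simp
qed simp_all

text \<open>The inner map has constant derivative, so no higher chain rule terms appear: every
  direction is just pushed through \<open>A\<close>.\<close>

lemma iter_deriv_affine:
  assumes "bounded_linear A" "open T" "smooth_on T f" "A x + c \<in> T"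
  shows "iter_deriv vs (\<lambda>y. f (A y + c)) x = iter_deriv (map A vs) f (A x + c)"
  using assms(4)
proof (induction vs arbitrary: x)
  case (Cons v vs)
  let ?S = "(\<lambda>y. A y + c) -` T"
  have D: "((\<lambda>y. A y + c) has_derivative A) (at y)" for y
    using has_derivative_add_const[OF bounded_linear_imp_has_derivative[OF assms(1)]] .
  have "continuous_on UNIV (\<lambda>y. A y + c)"
    using assms(1) by (intro continuous_intros linear_continuous_on) simp
  then have S: "open ?S" using assms(2) by (simp add: continuous_open_vimage continuous_on_open_vimage)
  have "iter_deriv (v # vs) (\<lambda>y. f (A y + c)) x = frechet_derivative (\<lambda>y. iter_deriv (map A vs) f (A y + c)) (at x) v"
    using frechet_derivative_cong_open[OF S _ Cons.IH] Cons.prems by simp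
  also have "\<dots> = frechet_derivative (iter_deriv (map A vs) f) (at (A x + c)) (A v)"
    by (rule fun_cong[OF frechet_derivative_eq[OF has_derivative_compose[OF D
       smooth_on_has_derivative[OF assms(2) smooth_on_iter_deriv[OF assms(3)] Cons.prems]]]])
  finally show ?case by simp
qed simp

lemma smooth_on_affine:
  assumes "bounded_linear A" "open S"
  shows "smooth_on S (\<lambda>y. A y + c)"
  using smooth_on_add[OF assms(2) smooth_on_linear[OF assms(2,1)] smooth_on_const] .

lemma iter_deriv_scale:
  assumes "open S" "smooth_on S f" "x \<in> S"
  shows "iter_deriv (map (\<lambda>v. c v *\<^sub>R v) vs) f x = of_real (prod_list (map c vs)) * iter_deriv vs f x"
  using assms(3)
proof (induction vs arbitrary: x)
  case (Cons v vs)
  let ?k = "of_real (prod_list (map c vs)) :: complex"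
  have D: "(iter_deriv vs f has_derivative frechet_derivative (iter_deriv vs f) (at x)) (at x)"
    by (rule smooth_on_has_derivative[OF assms(1) smooth_on_iter_deriv[OF assms(2)] Cons.prems])
  have "iter_deriv (map (\<lambda>v. c v *\<^sub>R v) (v # vs)) f x
      = frechet_derivative (\<lambda>y. ?k * iter_deriv vs f y) (at x) (c v *\<^sub>R v)"
    using frechet_derivative_cong_open[OF assms(1) Cons.prems Cons.IH] by simp
  also have "\<dots> = ?k * frechet_derivative (iter_deriv vs f) (at x) (c v *\<^sub>R v)"
    by (rule fun_cong[OF frechet_derivative_eq[OF has_derivative_mult_right[OF D]]])
  also have "frechet_derivative (iter_deriv vs f) (at x) (c v *\<^sub>R v)
      = c v *\<^sub>R frechet_derivative (iter_deriv vs f) (at x) v"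
    using has_derivative_linear[OF D] by (simp add: linear_scale)
  finally show ?case by (simp add: scaleR_conv_of_real)
qed simp

section \<open>Symmetry of mixed derivatives\<close>

lemma mean_value_bound:
  fixes h :: "real \<Rightarrow> 'a::real_normed_vector"
  assumes "0 \<le> s" "\<And>t. 0 \<le> t \<Longrightarrow> t \<le> s \<Longrightarrow> (h has_vector_derivative h' t) (at t)"
    and B: "\<And>t. 0 \<le> t \<Longrightarrow> t \<le> s \<Longrightarrow> norm (h' t) \<le> B"
  shows "norm (h s - h 0) \<le> B * s"
proof -
  have "norm (h s - h 0) \<le> B * norm (s - 0)"
  proof (rule differentiable_bound[where S = "{0..s}" and f' = "\<lambda>t r. r *\<^sub>R h' t"])
    show "(h has_derivative (\<lambda>r. r *\<^sub>R h' t)) (at t within {0..s})" if "t \<in> {0..s}" for t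
      using assms(2)[of t] that by (simp add: has_vector_derivative_def has_derivative_at_withinI)
    show "onorm (\<lambda>r. r *\<^sub>R h' t) \<le> B" if "t \<in> {0..s}" for t
      using B[of t] that by (simp add: onorm_scaleR_left onorm_id bounded_linear_ident)
  qed (use assms(1) in auto)
  then show ?thesis using assms(1) by simp
qed

lemma line_derivative:
  assumes "open S" "f differentiable_on S" "p + t *\<^sub>R v \<in> S"
  shows "((\<lambda>t. f (p + t *\<^sub>R v)) has_vector_derivative frechet_derivative f (at (p + t *\<^sub>R v)) v) (at t)"
proof -
  have g: "((\<lambda>t. p + t *\<^sub>R v) has_derivative (\<lambda>r. r *\<^sub>R v)) (at t)"
    by (auto intro!: derivative_eq_intros)
  have f: "(f has_derivative frechet_derivative f (at (p + t *\<^sub>R v))) (at (p + t *\<^sub>R v))"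
    by (rule has_derivative_frechet[OF assms(1,3,2)])
  show ?thesis
    unfolding has_vector_derivative_def
    using has_derivative_compose[OF g f] has_derivative_linear[OF f] by (simp add: linear_scale)
qed

text \<open>Two nested mean value estimates: along w for the derivative of \<open>f\<close> in
  direction v, then along v for \<open>f\<close> itself. They compare the second difference with s *
  s times the mixed derivative.\<close>

lemma second_difference_bound:
  fixes f :: "'a::real_normed_vector \<Rightarrow> 'b::real_normed_vector"
  assumes "open S" "smooth_on S f" "0 \<le> s" "s * (norm v + norm w) < d"
    and d: "\<And>y. norm (y - x) < d \<Longrightarrow> y \<in> S \<and>
        norm (frechet_derivative (\<lambda>y. frechet_derivative f (at y) v) (at y) w - A) \<le> e"
  shows "norm (f (x + s *\<^sub>R v + s *\<^sub>R w) - f (x + s *\<^sub>R v) - f (x + s *\<^sub>R w) + f x - (s * s) *\<^sub>R A) \<le> e * s * s"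
proof -
  let ?g = "\<lambda>y. frechet_derivative f (at y) v"
  have near: "norm (x + r *\<^sub>R v + q *\<^sub>R w - x) < d" if "0 \<le> r" "r \<le> s" "0 \<le> q" "q \<le> s" for r q
  proof -
    have "norm (x + r *\<^sub>R v + q *\<^sub>R w - x) \<le> r * norm v + q * norm w"
      using norm_triangle_ineq[of "r *\<^sub>R v" "q *\<^sub>R w"] that by simp
    also have "\<dots> \<le> s * norm v + s * norm w"
      using that by (intro add_mono mult_right_mono) auto
    finally show ?thesis using assms(4) by (simp add: algebra_simps)
  qed
  have inner: "norm ((?g (x + r *\<^sub>R v + s *\<^sub>R w) - s *\<^sub>R A) - (?g (x + r *\<^sub>R v + 0 *\<^sub>R w) - 0 *\<^sub>R A)) \<le> e * s"
    if r: "0 \<le> r" "r \<le> s" for r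
  proof (rule mean_value_bound[where h = "\<lambda>q. ?g (x + r *\<^sub>R v + q *\<^sub>R w) - q *\<^sub>R A"
        and h' = "\<lambda>q. frechet_derivative ?g (at (x + r *\<^sub>R v + q *\<^sub>R w)) w - A", OF assms(3)])
    fix q :: real assume q: "0 \<le> q" "q \<le> s"
    show "norm (frechet_derivative ?g (at (x + r *\<^sub>R v + q *\<^sub>R w)) w - A) \<le> e"
      using d near[OF r q] by blast
    have "((\<lambda>q. ?g (x + r *\<^sub>R v + q *\<^sub>R w)) has_vector_derivative
        frechet_derivative ?g (at (x + r *\<^sub>R v + q *\<^sub>R w)) w) (at q)"
      using d near[OF r q] smooth_on_differentiable[OF smooth_on_deriv[OF assms(2)]]
      by (intro line_derivative[OF assms(1)]) auto
    moreover have "((\<lambda>q. q *\<^sub>R A) has_vector_derivative A) (at q)"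
      by (auto intro!: derivative_eq_intros simp: has_vector_derivative_def)
    ultimately show "((\<lambda>q. ?g (x + r *\<^sub>R v + q *\<^sub>R w) - q *\<^sub>R A) has_vector_derivative
        frechet_derivative ?g (at (x + r *\<^sub>R v + q *\<^sub>R w)) w - A) (at q)"
      by (rule has_vector_derivative_diff)
  qed
  have "norm ((f (x + s *\<^sub>R w + s *\<^sub>R v) - f (x + s *\<^sub>R v) - s *\<^sub>R s *\<^sub>R A)
      - (f (x + s *\<^sub>R w + 0 *\<^sub>R v) - f (x + 0 *\<^sub>R v) - 0 *\<^sub>R s *\<^sub>R A)) \<le> (e * s) * s"
  proof (rule mean_value_bound[where h = "\<lambda>r. f (x + s *\<^sub>R w + r *\<^sub>R v) - f (x + r *\<^sub>R v) - r *\<^sub>R s *\<^sub>R A"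
        and h' = "\<lambda>r. ?g (x + s *\<^sub>R w + r *\<^sub>R v) - ?g (x + r *\<^sub>R v) - s *\<^sub>R A", OF assms(3)])
    fix r :: real assume r: "0 \<le> r" "r \<le> s"
    show "norm (?g (x + s *\<^sub>R w + r *\<^sub>R v) - ?g (x + r *\<^sub>R v) - s *\<^sub>R A) \<le> e * s"
      using inner[OF r] by (simp add: algebra_simps)
    have 1: "x + s *\<^sub>R w + r *\<^sub>R v \<in> S" "x + r *\<^sub>R v \<in> S"
      using d near[OF r assms(3) order_refl] d near[OF r order_refl assms(3)] by (auto simp: algebra_simps)
    have "((\<lambda>r. r *\<^sub>R s *\<^sub>R A) has_vector_derivative s *\<^sub>R A) (at r)"
      by (auto intro!: derivative_eq_intros simp: has_vector_derivative_def)
    then show "((\<lambda>r. f (x + s *\<^sub>R w + r *\<^sub>R v) - f (x + r *\<^sub>R v) - r *\<^sub>R s *\<^sub>R A) has_vector_derivative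
        ?g (x + s *\<^sub>R w + r *\<^sub>R v) - ?g (x + r *\<^sub>R v) - s *\<^sub>R A) (at r)"
      using 1 smooth_on_differentiable[OF assms(2)]
      by (intro has_vector_derivative_diff line_derivative[OF assms(1)]) auto
  qed
  then show ?thesis by (simp add: algebra_simps)
qed

text \<open>The second difference is symmetric in v and w, so after division by s * s it is close to
  both mixed derivatives.\<close>

lemma deriv_swap:
  fixes f :: "'a::real_normed_vector \<Rightarrow> 'b::real_normed_vector"
  assumes "open S" "smooth_on S f" "x \<in> S"
  shows "frechet_derivative (\<lambda>y. frechet_derivative f (at y) v) (at x) w
       = frechet_derivative (\<lambda>y. frechet_derivative f (at y) w) (at x) v"
proof -
  let ?G = "\<lambda>v w y. frechet_derivative (\<lambda>y. frechet_derivative f (at y) v) (at y) w"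
  let ?A = "?G v w x" and ?B = "?G w v x"
  have ev: "\<exists>d>0. \<forall>y. norm (y - x) < d \<longrightarrow> y \<in> S \<and> norm (?G v w y - ?G v w x) \<le> e" if "e > 0" for e v w
  proof -
    have "continuous_on S (?G v w)"
      by (intro smooth_on_continuous smooth_on_deriv assms)
    then have "isCont (?G v w) x" using assms continuous_on_eq_continuous_at by blast
    then have "\<exists>d>0. \<forall>y. dist y x < d \<longrightarrow> dist (?G v w y) (?G v w x) < e"
      using that unfolding continuous_at_eps_delta by simp
    then obtain d1 where d1: "d1 > 0" "\<forall>y. dist y x < d1 \<longrightarrow> dist (?G v w y) (?G v w x) < e"
      by (elim exE conjE)
    obtain d2 where d2: "d2 > 0" "\<And>y. dist y x < d2 \<Longrightarrow> y \<in> S"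
      using assms(1,3) unfolding open_dist by blast
    show ?thesis using d1 d2 by (intro exI[of _ "min d1 d2"]) (auto simp: dist_norm less_imp_le)
  qed
  have bound: "norm (?A - ?B) \<le> 2 * e" if e: "e > 0" for e
  proof -
    obtain d1 where d1: "d1 > 0" "\<And>y. norm (y - x) < d1 \<Longrightarrow> y \<in> S \<and> norm (?G v w y - ?A) \<le> e"
      using ev[OF e, of v w] by blast
    obtain d2 where d2: "d2 > 0" "\<And>y. norm (y - x) < d2 \<Longrightarrow> y \<in> S \<and> norm (?G w v y - ?B) \<le> e"
      using ev[OF e, of w v] by blast
    \<comment> \<open>Small enough for both neighbourhoods; the summand 1 keeps the denominator
      positive when v = w = 0.\<close>
    define s where "s = min d1 d2 / (2 * (norm v + norm w + 1))"
    have N: "norm v + norm w + 1 > 0" using norm_ge_zero[of v] norm_ge_zero[of w] by linarith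
    have s: "s > 0" unfolding s_def using d1 d2 N by (auto intro!: divide_pos_pos)
    have "s * (norm v + norm w) \<le> s * (norm v + norm w + 1)" using s by simp
    also have "\<dots> = min d1 d2 / 2" unfolding s_def using N by (simp add: field_simps)
    also have "\<dots> < min d1 d2" using d1 d2 by auto
    finally have sd: "s * (norm v + norm w) < d1" "s * (norm w + norm v) < d2" by (auto simp: algebra_simps)
    let ?D = "f (x + s *\<^sub>R v + s *\<^sub>R w) - f (x + s *\<^sub>R v) - f (x + s *\<^sub>R w) + f x"
    have 1: "norm (?D - (s * s) *\<^sub>R ?A) \<le> e * s * s"
      by (rule second_difference_bound[OF assms(1,2) less_imp_le[OF s] sd(1) d1(2)])
    have 2: "norm (?D - (s * s) *\<^sub>R ?B) \<le> e * s * s"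
      using second_difference_bound[OF assms(1,2) less_imp_le[OF s] sd(2) d2(2)] by (simp add: algebra_simps)
    have "(s * s) *\<^sub>R (?A - ?B) = (?D - (s * s) *\<^sub>R ?B) - (?D - (s * s) *\<^sub>R ?A)"
      by (simp add: algebra_simps)
    then have "norm ((s * s) *\<^sub>R (?A - ?B)) \<le> e * s * s + e * s * s"
      using norm_triangle_ineq4[of "?D - (s * s) *\<^sub>R ?B" "?D - (s * s) *\<^sub>R ?A"] 1 2 by (simp only:)
    then have "(s * s) * norm (?A - ?B) \<le> (s * s) * (2 * e)"
      unfolding norm_scaleR using s by (simp add: mult_ac)
    then show ?thesis using s by (simp add: mult_le_cancel_left_pos)
  qed
  have "norm (?A - ?B) \<le> 0 + e" if "e > 0" for e
    using bound[of "e / 2"] that by simp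
  then have "norm (?A - ?B) \<le> 0" by (rule field_le_epsilon)
  then show ?thesis by simp
qed

lemma iter_deriv_move:
  assumes "open S" "smooth_on S f" "x \<in> S"
  shows "iter_deriv (us @ v # ws) f x = iter_deriv (v # us @ ws) f x"
  using assms(3)
proof (induction us arbitrary: x)
  case (Cons u us)
  have "iter_deriv ((u # us) @ v # ws) f x = frechet_derivative (iter_deriv (v # us @ ws) f) (at x) u"
    using frechet_derivative_cong_open[OF assms(1) Cons.prems Cons.IH] by simp
  also have "\<dots> = iter_deriv (v # (u # us) @ ws) f x"
    using deriv_swap[OF assms(1) smooth_on_iter_deriv[OF assms(2)] Cons.prems] by simp
  finally show ?case .
qed simp

lemma iter_deriv_perm:
  assumes "open S" "smooth_on S f" "x \<in> S" "mset us = mset vs"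
  shows "iter_deriv us f x = iter_deriv vs f x"
  using assms(3,4)
proof (induction us arbitrary: x vs)
  case (Cons u us)
  then obtain as bs where vs: "vs = as @ u # bs"
    by (metis list.set_intros(1) set_mset_mset split_list)
  then have "mset us = mset (as @ bs)" using Cons.prems by simp
  then have "iter_deriv us f y = iter_deriv (as @ bs) f y" if "y \<in> S" for y using Cons.IH that by blast
  then have "iter_deriv (u # us) f x = iter_deriv (u # as @ bs) f x"
    using frechet_derivative_cong_open[OF assms(1) Cons.prems(1), of "iter_deriv us f" "iter_deriv (as @ bs) f"] by simp
  then show ?case using iter_deriv_move[OF assms(1,2) Cons.prems(1)] vs by simp
qed simp

section \<open>Functions with vanishing jet\<close>

definition flat :: "nat \<Rightarrow> 'a::real_normed_vector \<Rightarrow> ('a \<Rightarrow> complex) \<Rightarrow> bool" where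
  "flat k x f \<longleftrightarrow> (\<forall>vs. length vs \<le> k \<longrightarrow> iter_deriv vs f x = 0)"

lemma flat_0 [simp]: "flat 0 x f \<longleftrightarrow> f x = 0"
  by (simp add: flat_def)

text \<open>The head of the list is the derivative taken last. Splitting off the last entry instead,
  the derivative taken first, trades order k + 1 of \<open>f\<close> for order k of the derivatives
  of \<open>f\<close>; induction on k relies on this.\<close>

lemma flat_Suc: "flat (Suc k) x f \<longleftrightarrow> f x = 0 \<and> (\<forall>v. flat k x (\<lambda>y. frechet_derivative f (at y) v))"
proof -
  have *: "iter_deriv (vs @ [v]) f = iter_deriv vs (\<lambda>y. frechet_derivative f (at y) v)" for vs v
    by (simp add: iter_deriv_append)
  show ?thesis
  proof
    assume L: "flat (Suc k) x f"
    show "f x = 0 \<and> (\<forall>v. flat k x (\<lambda>y. frechet_derivative f (at y) v))"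
      unfolding flat_def
    proof (intro conjI allI impI)
      show "f x = 0" using L[unfolded flat_def, rule_format, of "[]"] by simp
      show "iter_deriv vs (\<lambda>y. frechet_derivative f (at y) v) x = 0" if "length vs \<le> k" for v vs
        using L[unfolded flat_def, rule_format, of "vs @ [v]"] that by (simp only: *) simp
    qed
  next
    assume R: "f x = 0 \<and> (\<forall>v. flat k x (\<lambda>y. frechet_derivative f (at y) v))"
    show "flat (Suc k) x f"
      unfolding flat_def
    proof (intro allI impI)
      fix vs :: "'a list" assume "length vs \<le> Suc k"
      then show "iter_deriv vs f x = 0"
        using R * by (cases vs rule: rev_cases) (auto simp: flat_def simp del: iter_deriv.simps(2))
    qed
  qed
qed

lemma flat_imp_zero: "flat k x f \<Longrightarrow> f x = 0"
  unfolding flat_def by (metis iter_deriv.simps(1) le0 list.size(3))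

lemma flat_mono: "flat k x f \<Longrightarrow> j \<le> k \<Longrightarrow> flat j x f"
  unfolding flat_def by auto

lemma flat_cong: "open S \<Longrightarrow> x \<in> S \<Longrightarrow> (\<And>y. y \<in> S \<Longrightarrow> f y = g y) \<Longrightarrow> flat k x f \<Longrightarrow> flat k x g"
  unfolding flat_def using iter_deriv_cong[of S f g x] by metis

lemma flat_add:
  "open S \<Longrightarrow> x \<in> S \<Longrightarrow> smooth_on S f \<Longrightarrow> smooth_on S g \<Longrightarrow> flat k x f \<Longrightarrow> flat k x g \<Longrightarrow> flat k x (\<lambda>y. f y + g y)"
  unfolding flat_def by (simp add: iter_deriv_add)

lemma flat_sum:
  "open S \<Longrightarrow> x \<in> S \<Longrightarrow> (\<And>i. i \<in> I \<Longrightarrow> smooth_on S (f i)) \<Longrightarrow> (\<And>i. i \<in> I \<Longrightarrow> flat k x (f i)) \<Longrightarrow>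
    flat k x (\<lambda>y. \<Sum>i\<in>I. f i y)"
  unfolding flat_def by (simp add: iter_deriv_sum)

text \<open>Both summands of the product rule are flat to one order less, so the flat functions form
  an ideal.\<close>

lemma flat_mult:
  assumes "open S" "x \<in> S" "smooth_on S f" "smooth_on S g" "flat k x f"
  shows "flat k x (\<lambda>y. g y * f y)"
  using assms(3-5)
proof (induction k arbitrary: f g)
  case (Suc k)
  have "flat k x (\<lambda>y. frechet_derivative (\<lambda>y. g y * f y) (at y) v)" for v
  proof (rule flat_cong[OF assms(1,2)])
    show "g y * frechet_derivative f (at y) v + frechet_derivative g (at y) v * f y
        = frechet_derivative (\<lambda>y. g y * f y) (at y) v" if "y \<in> S" for y
      using frechet_derivative_eq[OF has_derivative_mult[OF smooth_on_has_derivative[OF assms(1) Suc.prems(2) that]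
         smooth_on_has_derivative[OF assms(1) Suc.prems(1) that]]] by simp
    show "flat k x (\<lambda>y. g y * frechet_derivative f (at y) v + frechet_derivative g (at y) v * f y)"
      using Suc.prems(3) flat_mono[OF Suc.prems(3), of k]
      by (intro flat_add[OF assms(1,2)] Suc.IH smooth_on_mult[OF assms(1)] smooth_on_deriv Suc.prems)
        (auto simp: flat_Suc)
  qed
  then show ?case using Suc.prems(3) flat_imp_zero by (auto simp: flat_Suc)
qed simp

text \<open>Derivatives of the composite are sums of smooth scalars times composites that are flat
  to one order less. This makes vanishing of jets independent of coordinates.\<close>

lemma flat_compose:
  fixes g :: "'a::real_normed_vector \<Rightarrow> 'b::euclidean_space"
  assumes "open S" "open T" "x \<in> S" "smooth_on S g" "\<And>y. y \<in> S \<Longrightarrow> g y \<in> T"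
    and "smooth_on T f" "flat k (g x) f"
  shows "flat k x (\<lambda>y. f (g y))"
  using assms(6,7)
proof (induction k arbitrary: f)
  case (Suc k)
  have "flat k x (\<lambda>y. frechet_derivative (\<lambda>y. f (g y)) (at y) v)" for v
  proof (rule flat_cong[OF assms(1,3)])
    show "(\<Sum>b\<in>Basis. complex_of_real (frechet_derivative g (at y) v \<bullet> b) * frechet_derivative f (at (g y)) b)
        = frechet_derivative (\<lambda>y. f (g y)) (at y) v" if "y \<in> S" for y
      using frechet_derivative_compose_sum[OF smooth_on_has_derivative[OF assms(1,4) that]
          smooth_on_has_derivative[OF assms(2) Suc.prems(1) assms(5)[OF that]], of v]
      by (simp add: scaleR_conv_of_real)
    have s1: "smooth_on S (\<lambda>y. complex_of_real (frechet_derivative g (at y) v \<bullet> b))" for b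
      by (rule smooth_on_compose_linear[OF assms(1) bounded_linear_of_real
           smooth_on_bilinear[OF bounded_bilinear_inner assms(1) smooth_on_deriv[OF assms(4)] smooth_on_const]])
    have s2: "smooth_on S (\<lambda>y. frechet_derivative f (at (g y)) b)" for b
      by (rule smooth_on_compose[OF assms(1,2,4) smooth_on_deriv[OF Suc.prems(1)] assms(5)])
    have "flat k x (\<lambda>y. frechet_derivative f (at (g y)) b)" for b
      by (rule Suc.IH[OF smooth_on_deriv[OF Suc.prems(1)]]) (use Suc.prems(2) in \<open>simp add: flat_Suc\<close>)
    then show "flat k x (\<lambda>y. \<Sum>b\<in>Basis. complex_of_real (frechet_derivative g (at y) v \<bullet> b) * frechet_derivative f (at (g y)) b)"
      by (intro flat_sum[OF assms(1,3)] flat_mult[OF assms(1,3)] smooth_on_mult[OF assms(1)] s1 s2)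
  qed
  then show ?case using Suc.prems(2) flat_imp_zero by (auto simp: flat_Suc)
qed simp

section \<open>Differential operators along a map\<close>

lemma finite_basis_lists: "finite {vs. set vs \<subseteq> (Basis :: 'a::euclidean_space set) \<and> length vs \<le> k}"
  by (rule finite_lists_length_le[OF finite_Basis])

text \<open>Like \<open>diff_op_along\<close>, but with one set of coefficients on all of \<open>U\<close>.\<close>

definition diff_op_form ::
  "('b::euclidean_space \<Rightarrow> 'a::euclidean_space) \<Rightarrow> 'b set \<Rightarrow> ('a \<Rightarrow> complex) set
    \<Rightarrow> (('a \<Rightarrow> complex) \<Rightarrow> ('b \<Rightarrow> complex)) \<Rightarrow> bool" where
  "diff_op_form p U F T \<longleftrightarrow> (\<exists>k c.
        (\<forall>vs. set vs \<subseteq> Basis \<and> length vs \<le> k \<longrightarrow> smooth_on U (c vs)) \<and>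
        (\<forall>f\<in>F. \<forall>z\<in>U. T f z =
           (\<Sum>vs\<in>{vs. set vs \<subseteq> Basis \<and> length vs \<le> k}. c vs z * iter_deriv vs f (p z))))"

lemma diff_op_form_along: "open U \<Longrightarrow> diff_op_form p U F T \<Longrightarrow> diff_op_along p U F T"
  unfolding diff_op_form_def diff_op_along_def by blast

lemma diff_op_form_cong:
  "(\<And>f z. f \<in> F \<Longrightarrow> z \<in> U \<Longrightarrow> T f z = T' f z) \<Longrightarrow> diff_op_form p U F T \<Longrightarrow> diff_op_form p U F T'"
  unfolding diff_op_form_def by simp

lemma diff_op_form_subset: "diff_op_form p U F T \<Longrightarrow> G \<subseteq> F \<Longrightarrow> diff_op_form p U G T"
  unfolding diff_op_form_def by (meson subsetD)

lemma diff_op_form_iter: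
  assumes "set vs \<subseteq> Basis"
  shows "diff_op_form p U F (\<lambda>f z. iter_deriv vs f (p z))"
proof -
  have "(\<Sum>us\<in>{us. set us \<subseteq> Basis \<and> length us \<le> length vs}. (if us = vs then 1 else 0) * iter_deriv us f (p z))
      = iter_deriv vs f (p z)" for f z
    using assms by (simp add: if_distrib[of "\<lambda>a. a * _"] sum.delta[OF finite_basis_lists] cong: if_cong)
  then show ?thesis
    unfolding diff_op_form_def
    by (intro exI[of _ "length vs"] exI[of _ "\<lambda>us z. if us = vs then 1 else 0"]) simp
qed

lemma diff_op_form_zero: "diff_op_form p U F (\<lambda>f z. 0)"
  unfolding diff_op_form_def by (intro exI[of _ 0] exI[of _ "\<lambda>us z. 0"]) simp

lemma diff_op_form_mult:
  assumes "open U" "smooth_on U a" "diff_op_form p U F T"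
  shows "diff_op_form p U F (\<lambda>f z. a z * T f z)"
proof -
  obtain k c where c: "\<forall>vs. set vs \<subseteq> Basis \<and> length vs \<le> k \<longrightarrow> smooth_on U (c vs)"
    "\<forall>f\<in>F. \<forall>z\<in>U. T f z = (\<Sum>vs\<in>{vs. set vs \<subseteq> Basis \<and> length vs \<le> k}. c vs z * iter_deriv vs f (p z))"
    using assms(3) unfolding diff_op_form_def by blast
  show ?thesis
    unfolding diff_op_form_def
    by (intro exI[of _ k] exI[of _ "\<lambda>vs z. a z * c vs z"])
      (use c in \<open>auto simp: sum_distrib_left mult.assoc intro!: smooth_on_mult[OF assms(1,2)]\<close>)
qed

lemma diff_op_form_add:
  assumes "open U" "diff_op_form p U F T" "diff_op_form p U F T'"
  shows "diff_op_form p U F (\<lambda>f z. T f z + T' f z)"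
proof -
  have ext: "\<exists>k0. \<forall>k\<ge>k0. \<exists>c. (\<forall>vs. smooth_on U (c vs)) \<and> (\<forall>f\<in>F. \<forall>z\<in>U. T f z =
     (\<Sum>vs\<in>{vs. set vs \<subseteq> Basis \<and> length vs \<le> k}. c vs z * iter_deriv vs f (p z)))"
    if T: "diff_op_form p U F T" for T
  proof -
    obtain k0 c where c: "\<forall>vs. set vs \<subseteq> Basis \<and> length vs \<le> k0 \<longrightarrow> smooth_on U (c vs)"
      "\<forall>f\<in>F. \<forall>z\<in>U. T f z = (\<Sum>vs\<in>{vs. set vs \<subseteq> Basis \<and> length vs \<le> k0}. c vs z * iter_deriv vs f (p z))"
      using T unfolding diff_op_form_def by blast
    \<comment> \<open>Padding by zero beyond order \<open>k0\<close> lets two operators share one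
      order.\<close>
    define c' where "c' vs = (if set vs \<subseteq> Basis \<and> length vs \<le> k0 then c vs else (\<lambda>z. 0))" for vs
    have "T f z = (\<Sum>vs\<in>{vs. set vs \<subseteq> Basis \<and> length vs \<le> k}. c' vs z * iter_deriv vs f (p z))"
      if "k \<ge> k0" "f \<in> F" "z \<in> U" for k f z
    proof -
      have "T f z = (\<Sum>vs\<in>{vs. set vs \<subseteq> Basis \<and> length vs \<le> k0}. c' vs z * iter_deriv vs f (p z))"
        using c(2) that by (auto simp: c'_def intro!: sum.cong)
      also have "\<dots> = (\<Sum>vs\<in>{vs. set vs \<subseteq> Basis \<and> length vs \<le> k}. c' vs z * iter_deriv vs f (p z))"
        using that(1) by (intro sum.mono_neutral_left finite_basis_lists) (auto simp: c'_def)
      finally show ?thesis .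
    qed
    moreover have "smooth_on U (c' vs)" for vs using c(1) by (simp add: c'_def)
    ultimately show ?thesis by blast
  qed
  obtain k1 where k1: "\<And>k. k \<ge> k1 \<Longrightarrow> \<exists>c. (\<forall>vs. smooth_on U (c vs)) \<and> (\<forall>f\<in>F. \<forall>z\<in>U. T f z =
     (\<Sum>vs\<in>{vs. set vs \<subseteq> Basis \<and> length vs \<le> k}. c vs z * iter_deriv vs f (p z)))"
    using ext[OF assms(2)] by blast
  obtain k2 where k2: "\<And>k. k \<ge> k2 \<Longrightarrow> \<exists>c. (\<forall>vs. smooth_on U (c vs)) \<and> (\<forall>f\<in>F. \<forall>z\<in>U. T' f z =
     (\<Sum>vs\<in>{vs. set vs \<subseteq> Basis \<and> length vs \<le> k}. c vs z * iter_deriv vs f (p z)))"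
    using ext[OF assms(3)] by blast
  define k where "k = max k1 k2"
  obtain c where c: "\<forall>vs. smooth_on U (c vs)" "\<forall>f\<in>F. \<forall>z\<in>U. T f z =
     (\<Sum>vs\<in>{vs. set vs \<subseteq> Basis \<and> length vs \<le> k}. c vs z * iter_deriv vs f (p z))"
    using k1[of k] by (auto simp: k_def)
  obtain c' where c': "\<forall>vs. smooth_on U (c' vs)" "\<forall>f\<in>F. \<forall>z\<in>U. T' f z =
     (\<Sum>vs\<in>{vs. set vs \<subseteq> Basis \<and> length vs \<le> k}. c' vs z * iter_deriv vs f (p z))"
    using k2[of k] by (auto simp: k_def)
  show ?thesis
    unfolding diff_op_form_def
    by (intro exI[of _ k] exI[of _ "\<lambda>vs z. c vs z + c' vs z"])
      (use c c' in \<open>auto simp: sum.distrib distrib_right intro!: smooth_on_add[OF assms(1)]\<close>)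
qed

lemma diff_op_form_sum:
  assumes "open U" "\<And>i. i \<in> I \<Longrightarrow> diff_op_form p U F (T i)"
  shows "diff_op_form p U F (\<lambda>f z. \<Sum>i\<in>I. T i f z)"
  using assms(2)
proof (induction I rule: infinite_finite_induct)
  case (insert i I)
  have "diff_op_form p U F (\<lambda>f z. T i f z + (\<Sum>i\<in>I. T i f z))"
    using insert by (intro diff_op_form_add[OF assms(1)]) auto
  then show ?case using insert by simp
qed (simp_all add: diff_op_form_zero)

text \<open>The directions V z vary with the base point z but are held constant while
  differentiating. Expanding each in the basis moves the dependence on z into the coefficients. The
  induction is on the end of the list because the last entry is the derivative taken first.\<close>

lemma diff_op_form_iter_smooth:
  fixes p :: "'b::euclidean_space \<Rightarrow> 'a::euclidean_space"
  assumes "open U" "open S" "\<And>z. z \<in> U \<Longrightarrow> p z \<in> S" "\<And>V. V \<in> set Vs \<Longrightarrow> smooth_on U V"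
  shows "diff_op_form p U {f. smooth_on S f} (\<lambda>f z. iter_deriv (map (\<lambda>V. V z) Vs) f (p z))"
  using assms(4)
proof (induction Vs rule: rev_induct)
  case Nil
  then show ?case using diff_op_form_iter[of "[]"] by simp
next
  case (snoc V Vs)
  let ?F = "{f. smooth_on S f}"
  have ih: "diff_op_form p U ?F (\<lambda>f z. iter_deriv (map (\<lambda>V. V z) Vs) f (p z))"
    using snoc by simp
  obtain k c where c: "\<forall>vs. set vs \<subseteq> Basis \<and> length vs \<le> k \<longrightarrow> smooth_on U (c vs)"
    "\<forall>f\<in>?F. \<forall>z\<in>U. iter_deriv (map (\<lambda>V. V z) Vs) f (p z) =
      (\<Sum>vs\<in>{vs. set vs \<subseteq> Basis \<and> length vs \<le> k}. c vs z * iter_deriv vs f (p z))"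
    using ih unfolding diff_op_form_def by blast
  have "diff_op_form p U ?F (\<lambda>f z. \<Sum>b\<in>Basis. complex_of_real (V z \<bullet> b) *
      (\<Sum>vs\<in>{vs. set vs \<subseteq> Basis \<and> length vs \<le> k}. c vs z * iter_deriv (vs @ [b]) f (p z)))"
  proof (intro diff_op_form_sum[OF assms(1)] diff_op_form_mult[OF assms(1)] diff_op_form_iter)
    show "smooth_on U (\<lambda>z. complex_of_real (V z \<bullet> b))" for b
      by (rule smooth_on_compose_linear[OF assms(1) bounded_linear_of_real
           smooth_on_bilinear[OF bounded_bilinear_inner assms(1) _ smooth_on_const]]) (use snoc in simp)
  qed (use c(1) in auto)
  moreover have "(\<Sum>b\<in>Basis. complex_of_real (V z \<bullet> b) *
      (\<Sum>vs\<in>{vs. set vs \<subseteq> Basis \<and> length vs \<le> k}. c vs z * iter_deriv (vs @ [b]) f (p z)))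
      = iter_deriv (map (\<lambda>V. V z) (Vs @ [V])) f (p z)" if "f \<in> ?F" "z \<in> U" for f z
  proof -
    let ?d = "\<lambda>b x. frechet_derivative f (at x) b"
    have sm: "smooth_on S f" using that by simp
    have expand: "frechet_derivative f (at x) (V z) = (\<Sum>b\<in>Basis. complex_of_real (V z \<bullet> b) * ?d b x)" if "x \<in> S" for x
      using frechet_derivative_compose_sum[OF has_derivative_ident smooth_on_has_derivative[OF assms(2) sm that], of "V z"]
      by (simp add: scaleR_conv_of_real)
    have "iter_deriv (map (\<lambda>V. V z) (Vs @ [V])) f (p z) = iter_deriv (map (\<lambda>V. V z) Vs) (?d (V z)) (p z)"
      by (simp add: iter_deriv_append)
    also have "\<dots> = iter_deriv (map (\<lambda>V. V z) Vs) (\<lambda>x. \<Sum>b\<in>Basis. complex_of_real (V z \<bullet> b) * ?d b x) (p z)"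
      by (rule iter_deriv_cong[OF assms(2) expand assms(3)[OF that(2)]])
    also have "\<dots> = (\<Sum>b\<in>Basis. iter_deriv (map (\<lambda>V. V z) Vs) (\<lambda>x. complex_of_real (V z \<bullet> b) * ?d b x) (p z))"
      by (rule iter_deriv_sum[OF assms(2) smooth_on_mult[OF assms(2) smooth_on_const smooth_on_deriv[OF sm]] assms(3)[OF that(2)]])
    also have "\<dots> = (\<Sum>b\<in>Basis. complex_of_real (V z \<bullet> b) * iter_deriv (map (\<lambda>V. V z) Vs) (?d b) (p z))"
      by (simp only: iter_deriv_cmult[OF assms(2) smooth_on_deriv[OF sm] assms(3)[OF that(2)]])
    also have "\<dots> = (\<Sum>b\<in>Basis. complex_of_real (V z \<bullet> b) *
        (\<Sum>vs\<in>{vs. set vs \<subseteq> Basis \<and> length vs \<le> k}. c vs z * iter_deriv (vs @ [b]) f (p z)))"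
      using c(2) that smooth_on_deriv[OF sm] by (simp add: iter_deriv_append)
    finally show ?thesis by simp
  qed
  ultimately show ?case by (rule diff_op_form_cong[rotated])
qed

lemma smooth_on_diff_op_form:
  assumes "open U" "open S" "smooth_on U p" "\<And>z. z \<in> U \<Longrightarrow> p z \<in> S" "smooth_on S f"
    "diff_op_form p U {f. smooth_on S f} T"
  shows "smooth_on U (T f)"
proof -
  obtain k c where c: "\<forall>vs. set vs \<subseteq> Basis \<and> length vs \<le> k \<longrightarrow> smooth_on U (c vs)"
    "\<forall>f\<in>{f. smooth_on S f}. \<forall>z\<in>U. T f z = (\<Sum>vs\<in>{vs. set vs \<subseteq> Basis \<and> length vs \<le> k}. c vs z * iter_deriv vs f (p z))"
    using assms(6) unfolding diff_op_form_def by blast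
  show ?thesis
  proof (rule smooth_on_cong[OF assms(1)])
    show "(\<Sum>vs\<in>{vs. set vs \<subseteq> Basis \<and> length vs \<le> k}. c vs z * iter_deriv vs f (p z)) = T f z" if "z \<in> U" for z
      using c(2) assms(5) that by simp
    show "smooth_on U (\<lambda>z. \<Sum>vs\<in>{vs. set vs \<subseteq> Basis \<and> length vs \<le> k}. c vs z * iter_deriv vs f (p z))"
      using c(1) by (intro smooth_on_sum smooth_on_mult assms(1)
          smooth_on_compose[OF assms(1,2,3) smooth_on_iter_deriv[OF assms(5)] assms(4)]) auto
  qed
qed

lemma diff_op_form_deriv:
  assumes "v \<in> Basis" "diff_op_form (\<lambda>x. x) UNIV F T" "\<And>f. f \<in> F \<Longrightarrow> smooth_on UNIV f"
  shows "diff_op_form (\<lambda>x. x) UNIV F (\<lambda>f x. frechet_derivative (T f) (at x) v)"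
proof -
  obtain k c where c: "\<forall>vs. set vs \<subseteq> Basis \<and> length vs \<le> k \<longrightarrow> smooth_on UNIV (c vs)"
    "\<forall>f\<in>F. \<forall>z\<in>UNIV. T f z = (\<Sum>vs\<in>{vs. set vs \<subseteq> Basis \<and> length vs \<le> k}. c vs z * iter_deriv vs f z)"
    using assms(2) unfolding diff_op_form_def by blast
  let ?L = "{vs :: 'a list. set vs \<subseteq> Basis \<and> length vs \<le> k}"
  have "diff_op_form (\<lambda>x. x) UNIV F (\<lambda>f z. \<Sum>vs\<in>?L.
      c vs z * iter_deriv (v # vs) f z + frechet_derivative (c vs) (at z) v * iter_deriv vs f z)"
    using c(1) assms(1)
    by (intro diff_op_form_sum diff_op_form_add diff_op_form_mult diff_op_form_iter smooth_on_deriv open_UNIV) auto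
  then show ?thesis
  proof (rule diff_op_form_cong[rotated])
    fix f :: "'a \<Rightarrow> complex" and z assume f: "f \<in> F"
    have "T f = (\<lambda>z. \<Sum>vs\<in>?L. c vs z * iter_deriv vs f z)" using c(2) f by auto
    then have "(T f has_derivative (\<lambda>v. \<Sum>vs\<in>?L. c vs z * frechet_derivative (iter_deriv vs f) (at z) v
        + frechet_derivative (c vs) (at z) v * iter_deriv vs f z)) (at z)"
      using c(1) by (auto intro!: has_derivative_sum has_derivative_mult
          smooth_on_has_derivative[OF open_UNIV] smooth_on_iter_deriv assms(3)[OF f])
    then show "(\<Sum>vs\<in>?L. c vs z * iter_deriv (v # vs) f z + frechet_derivative (c vs) (at z) v * iter_deriv vs f z)
        = frechet_derivative (T f) (at z) v"
      by (simp add: frechet_derivative_eq)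
  qed
qed

lemma diff_op_form_restrict:
  assumes "diff_op_form (\<lambda>x. x) UNIV F T" "open U" "smooth_on U q"
  shows "diff_op_form q U F (\<lambda>f z. T f (q z))"
proof -
  obtain k c where c: "\<forall>vs. set vs \<subseteq> Basis \<and> length vs \<le> k \<longrightarrow> smooth_on UNIV (c vs)"
    "\<forall>f\<in>F. \<forall>z\<in>UNIV. T f z = (\<Sum>vs\<in>{vs. set vs \<subseteq> Basis \<and> length vs \<le> k}. c vs z * iter_deriv vs f z)"
    using assms(1) unfolding diff_op_form_def by blast
  show ?thesis
    unfolding diff_op_form_def
    by (intro exI[of _ k] exI[of _ "\<lambda>vs z. c vs (q z)"])
      (use c in \<open>auto intro!: smooth_on_compose[OF assms(2) open_UNIV assms(3)]\<close>)
qed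

section \<open>Smoothness of powers, quotients and vectors\<close>

lemma smooth_on_powr:
  assumes "open S" "smooth_on S q" "\<And>x. x \<in> S \<Longrightarrow> q x > 0"
  shows "smooth_on S (\<lambda>x. complex_of_real (q x) powr s)"
proof (rule smooth_on_compose[OF assms(1) open_greaterThan[of 0] assms(2)])
  show "smooth_on {0<..} (\<lambda>t. complex_of_real t powr s)"
  proof (rule smooth_on_coinduct[where X = "\<lambda>f. \<exists>c s. f = (\<lambda>t. c * complex_of_real t powr s)"])
    fix f assume "\<exists>c s. f = (\<lambda>t. c * complex_of_real t powr s)"
    then obtain c s where f: "f = (\<lambda>t. c * complex_of_real t powr s)" by blast
    have D: "(f has_derivative (\<lambda>v. c * (s * complex_of_real t powr (s - 1) * of_real v))) (at t)" if "t > 0" for t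
    proof -
      have "((\<lambda>z. z powr s) has_derivative (\<lambda>h. s * complex_of_real t powr (s - 1) * h)) (at (complex_of_real t))"
        using has_field_derivative_powr[of "complex_of_real t" s] that
        by (simp add: has_field_derivative_def complex_nonpos_Reals_iff)
      from has_derivative_mult_right[OF has_derivative_compose[OF bounded_linear_imp_has_derivative[OF bounded_linear_of_real] this]]
      show ?thesis by (simp add: f)
    qed
    show "\<exists>D. (\<forall>t\<in>{0<..}. (f has_derivative D t) (at t)) \<and>
       (\<forall>v. \<exists>g. (\<exists>c s. g = (\<lambda>t. c * complex_of_real t powr s)) \<and> (\<forall>t\<in>{0<..}. g t = D t v))"
    proof (intro exI[of _ "\<lambda>t v. c * (s * complex_of_real t powr (s - 1) * of_real v)"] conjI ballI allI)
      show "\<exists>g. (\<exists>c s. g = (\<lambda>t. c * complex_of_real t powr s)) \<and>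
          (\<forall>t\<in>{0<..}. g t = c * (s * complex_of_real t powr (s - 1) * of_real v))" for v
        by (intro exI[of _ "\<lambda>t. (c * s * of_real v) * complex_of_real t powr (s - 1)"]) auto
    qed (use D in auto)
  qed (rule open_greaterThan, rule exI[of _ 1], rule exI[of _ s], simp)
qed (use assms in auto)

lemma smooth_on_inverse:
  assumes "open S" "smooth_on S q" "\<And>x. x \<in> S \<Longrightarrow> q x \<noteq> (0::real)"
  shows "smooth_on S (\<lambda>x. inverse (q x))"
proof (rule smooth_on_compose[OF assms(1) _ assms(2)])
  show "open (- {0::real})" by (rule open_Compl) simp
  show "smooth_on (- {0}) (\<lambda>t::real. inverse t)"
  proof (rule smooth_on_coinduct[where X = "\<lambda>f. \<exists>c n. f = (\<lambda>t. c * inverse t ^ n)"])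
    fix f :: "real \<Rightarrow> real" assume "\<exists>c n. f = (\<lambda>t. c * inverse t ^ n)"
    then obtain c n where f: "f = (\<lambda>t. c * inverse t ^ n)" by blast
    have D: "(f has_derivative (\<lambda>v. (- c * n * v) * inverse t ^ Suc n)) (at t)" if "t \<noteq> 0" for t
    proof -
      have "(f has_real_derivative c * (n * (- (inverse t ^ Suc (Suc 0)) * inverse t ^ (n - Suc 0)))) (at t)"
        unfolding f by (rule DERIV_cmult[OF DERIV_power[OF DERIV_inverse[OF that]]])
      moreover have "c * (n * (- (inverse t ^ Suc (Suc 0)) * inverse t ^ (n - Suc 0))) * v = (- c * n * v) * inverse t ^ Suc n" for v
        by (cases n) auto
      ultimately show ?thesis
        unfolding has_field_derivative_def by (elim has_derivative_eq_rhs, intro ext)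
    qed
    show "\<exists>D. (\<forall>t\<in>- {0}. (f has_derivative D t) (at t)) \<and>
       (\<forall>v. \<exists>g. (\<exists>c n. g = (\<lambda>t. c * inverse t ^ n)) \<and> (\<forall>t\<in>- {0}. g t = D t v))"
    proof (intro exI[of _ "\<lambda>t v. (- c * n * v) * inverse t ^ Suc n"] conjI ballI allI)
      show "\<exists>g. (\<exists>c n. g = (\<lambda>t. c * inverse t ^ n)) \<and>
          (\<forall>t\<in>- {0}. g t = (- c * n * v) * inverse t ^ Suc n)" for v
        by (intro exI[of _ "\<lambda>t. (- c * n * v) * inverse t ^ Suc n"] conjI ballI refl
            exI[of _ "- c * n * v"] exI[of _ "Suc n"])
    qed (use D in auto)
  qed (rule open_Compl, simp, rule exI[of _ 1], rule exI[of _ "1::nat"], simp)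
qed (use assms in auto)

lemma smooth_on_divide:
  "open S \<Longrightarrow> smooth_on S p \<Longrightarrow> smooth_on S q \<Longrightarrow> (\<And>x. x \<in> S \<Longrightarrow> q x \<noteq> (0::real)) \<Longrightarrow> smooth_on S (\<lambda>x. p x / q x)"
  unfolding divide_inverse by (intro smooth_on_mult smooth_on_inverse)

lemma smooth_on_power:
  fixes f :: "_ \<Rightarrow> 'b::real_normed_algebra_1"
  shows "open S \<Longrightarrow> smooth_on S f \<Longrightarrow> smooth_on S (\<lambda>x. f x ^ n)"
  by (induction n) (auto intro: smooth_on_mult)

lemma smooth_on_diff:
  fixes f :: "_ \<Rightarrow> 'b::euclidean_space"
  assumes "open S" "smooth_on S f" "smooth_on S g" shows "smooth_on S (\<lambda>x. f x - g x)"
  using smooth_on_add[OF assms(1,2) smooth_on_compose_linear[OF assms(1) bounded_linear_minus[OF bounded_linear_ident] assms(3)]]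
  by simp

lemma smooth_on_of_real: "open S \<Longrightarrow> smooth_on S f \<Longrightarrow> smooth_on S (\<lambda>x. complex_of_real (f x))"
  by (rule smooth_on_compose_linear[OF _ bounded_linear_of_real])

lemma smooth_on_ident: "open S \<Longrightarrow> smooth_on S (\<lambda>x. x)"
  by (rule smooth_on_linear[OF _ bounded_linear_ident])

lemma smooth_on_vec_nth:
  fixes f :: "_ \<Rightarrow> 'b::euclidean_space ^ 'n"
  shows "open S \<Longrightarrow> smooth_on S f \<Longrightarrow> smooth_on S (\<lambda>x. f x $ i)"
  by (rule smooth_on_compose_linear[OF _ bounded_linear_vec_nth])

lemma bounded_linear_axis: "bounded_linear (axis i :: 'b::euclidean_space \<Rightarrow> 'b ^ 'n)"
  unfolding linear_conv_bounded_linear[symmetric]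
  by (rule linearI) (simp_all add: axis_def vec_eq_iff)

lemma smooth_on_axis:
  fixes f :: "_ \<Rightarrow> 'b::euclidean_space"
  shows "open S \<Longrightarrow> smooth_on S f \<Longrightarrow> smooth_on S (\<lambda>x. axis i (f x))"
  by (rule smooth_on_compose_linear[OF _ bounded_linear_axis])

lemma vector_3_axis: "(vector [a, b, c] :: 'b::real_vector ^ 3) = axis 1 a + axis 2 b + axis 3 c"
  by (simp add: vec_eq_iff forall_3 axis_def)

lemma vector_2_axis: "(vector [a, b] :: 'b::real_vector ^ 2) = axis 1 a + axis 2 b"
  by (simp add: vec_eq_iff forall_2 axis_def)

lemma smooth_on_vector_3:
  fixes a b c :: "_ \<Rightarrow> 'b::euclidean_space"
  shows "open S \<Longrightarrow> smooth_on S a \<Longrightarrow> smooth_on S b \<Longrightarrow> smooth_on S c \<Longrightarrow>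
    smooth_on S (\<lambda>x. vector [a x, b x, c x] :: 'b ^ 3)"
  unfolding vector_3_axis by (intro smooth_on_add smooth_on_axis)

lemma smooth_on_vector_2:
  fixes a b :: "_ \<Rightarrow> 'b::euclidean_space"
  shows "open S \<Longrightarrow> smooth_on S a \<Longrightarrow> smooth_on S b \<Longrightarrow> smooth_on S (\<lambda>x. vector [a x, b x] :: 'b ^ 2)"
  unfolding vector_2_axis by (intro smooth_on_add smooth_on_axis)

lemmas smooth_intros = smooth_on_const smooth_on_add smooth_on_diff smooth_on_mult smooth_on_power
  smooth_on_of_real smooth_on_vec_nth smooth_on_vector_3 smooth_on_vector_2 smooth_on_ident

section \<open>Jets and left invariant operators in three variables\<close>

lemma Basis_real3: "(Basis :: (real^3) set) = {axis 1 1, axis 2 1, axis 3 1}"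
  by (auto simp: Basis_vec_def UNIV_3)

lemma axis3_distinct [simp]:
  "axis 1 (1::real) \<noteq> (axis 2 1 :: real^3)" "axis 1 (1::real) \<noteq> (axis 3 1 :: real^3)" "axis 2 (1::real) \<noteq> (axis 3 1 :: real^3)"
  by (simp_all add: axis_eq_axis)

lemma sum_Basis_real3: "(\<Sum>b\<in>(Basis :: (real^3) set). g b) = g (axis 1 1) + g (axis 2 1) + g (axis 3 1)"
  by (simp add: Basis_real3 add.assoc)

definition pdm :: "nat \<Rightarrow> nat \<Rightarrow> nat \<Rightarrow> (real^3 \<Rightarrow> complex) \<Rightarrow> real^3 \<Rightarrow> complex" where
  "pdm i j l \<psi> = iter_deriv (replicate i (axis 1 1) @ replicate j (axis 2 1) @ replicate l (axis 3 1)) \<psi>"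

definition monom3 :: "nat \<Rightarrow> nat \<Rightarrow> nat \<Rightarrow> real^3 \<Rightarrow> complex" where
  "monom3 i j l x = complex_of_real (x$1 ^ i * x$2 ^ j * x$3 ^ l)"

lemma smooth_on_monom3: "open S \<Longrightarrow> smooth_on S (monom3 i j l)"
  unfolding monom3_def[abs_def] by (intro smooth_intros)

lemma flat_basisI:
  fixes f :: "'a::euclidean_space \<Rightarrow> complex"
  assumes "open S" "smooth_on S f" "x \<in> S"
    and "\<And>vs. set vs \<subseteq> Basis \<Longrightarrow> length vs \<le> k \<Longrightarrow> iter_deriv vs f x = 0"
  shows "flat k x f"
  using assms(2,4)
proof (induction k arbitrary: f)
  case 0
  from "0.prems"(2)[of "[]"] show ?case by simp
next
  case (Suc k)
  have "flat k x (\<lambda>y. frechet_derivative f (at y) v)" for v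
  proof (rule flat_cong[OF assms(1,3)])
    show "(\<Sum>b\<in>Basis. complex_of_real (v \<bullet> b) * frechet_derivative f (at y) b) = frechet_derivative f (at y) v"
      if "y \<in> S" for y
      using frechet_derivative_compose_sum[OF has_derivative_ident smooth_on_has_derivative[OF assms(1) Suc.prems(1) that], of v]
      by (simp add: scaleR_conv_of_real)
    have "flat k x (\<lambda>y. frechet_derivative f (at y) b)" if "b \<in> Basis" for b
    proof (rule Suc.IH[OF smooth_on_deriv[OF Suc.prems(1)]])
      fix vs :: "'a list" assume "set vs \<subseteq> Basis" "length vs \<le> k"
      then show "iter_deriv vs (\<lambda>y. frechet_derivative f (at y) b) x = 0"
        using Suc.prems(2)[of "vs @ [b]"] that by (simp add: iter_deriv_append)
    qed
    then show "flat k x (\<lambda>y. \<Sum>b\<in>Basis. complex_of_real (v \<bullet> b) * frechet_derivative f (at y) b)"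
      by (intro flat_sum[OF assms(1,3)] flat_mult[OF assms(1,3)] smooth_on_mult[OF assms(1)]
          smooth_on_deriv Suc.prems(1) smooth_on_const)
  qed
  then show ?case using Suc.prems(2)[of "[]"] by (simp add: flat_Suc)
qed

text \<open>Mixed derivatives commute, so a list of basis vectors may be sorted and only the
  multiplicities i, j, l matter.\<close>

lemma flat_pdmI:
  assumes "smooth_on UNIV f" "\<And>i j l. i + j + l \<le> k \<Longrightarrow> pdm i j l f x = 0"
  shows "flat k x f"
proof (rule flat_basisI[OF open_UNIV assms(1) UNIV_I])
  fix vs :: "(real^3) list" assume vs: "set vs \<subseteq> Basis" "length vs \<le> k"
  have "\<exists>i j l. i + j + l = length vs \<and>
      mset vs = mset (replicate i (axis 1 1) @ replicate j (axis 2 1) @ replicate l (axis 3 1))"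
    using vs(1)
  proof (induction vs)
    case (Cons v vs)
    then obtain i j l where *: "i + j + l = length vs"
      "mset vs = mset (replicate i (axis 1 1) @ replicate j (axis 2 1) @ replicate l (axis 3 1))" by auto
    from Cons.prems consider "v = axis 1 1" | "v = axis 2 1" | "v = axis 3 1" by (auto simp: Basis_real3)
    then show ?case
    proof cases
      case 1
      then show ?thesis using * by (intro exI[of _ "Suc i"] exI[of _ j] exI[of _ l]) simp
    next
      case 2
      then show ?thesis using * by (intro exI[of _ i] exI[of _ "Suc j"] exI[of _ l]) simp
    next
      case 3
      then show ?thesis using * by (intro exI[of _ i] exI[of _ j] exI[of _ "Suc l"]) simp
    qed
  qed simp
  then obtain i j l where *: "i + j + l = length vs"
    "mset vs = mset (replicate i (axis 1 1) @ replicate j (axis 2 1) @ replicate l (axis 3 1))" by blast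
  then show "iter_deriv vs f x = 0"
    using iter_deriv_perm[OF open_UNIV assms(1) UNIV_I *(2)] assms(2)[of i j l] vs(2) by (simp add: pdm_def)
qed

lemma flat_imp_pdm: "flat k x f \<Longrightarrow> i + j + l \<le> k \<Longrightarrow> pdm i j l f x = 0"
  unfolding flat_def pdm_def by auto

lemma pdm_add: "smooth_on UNIV f \<Longrightarrow> smooth_on UNIV g \<Longrightarrow> pdm i j l (\<lambda>y. f y + g y) x = pdm i j l f x + pdm i j l g x"
  unfolding pdm_def by (rule iter_deriv_add[OF open_UNIV _ _ UNIV_I])

lemma pdm_cmult: "smooth_on UNIV f \<Longrightarrow> pdm i j l (\<lambda>y. c * f y) x = c * pdm i j l f x"
  unfolding pdm_def by (rule iter_deriv_cmult[OF open_UNIV _ UNIV_I])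

lemma pdm_sum: "(\<And>a. a \<in> A \<Longrightarrow> smooth_on UNIV (f a)) \<Longrightarrow> pdm i j l (\<lambda>y. \<Sum>a\<in>A. f a y) x = (\<Sum>a\<in>A. pdm i j l (f a) x)"
  unfolding pdm_def by (rule iter_deriv_sum[OF open_UNIV _ UNIV_I])

lemma pdm_diff:
  assumes "smooth_on UNIV f" "smooth_on UNIV g"
  shows "pdm i j l (\<lambda>y. f y - g y) x = pdm i j l f x - pdm i j l g x"
  using pdm_add[OF assms(1), of "\<lambda>y. - 1 * g y"] pdm_cmult[OF assms(2), of i j l "- 1" x]
    smooth_on_mult[OF open_UNIV smooth_on_const assms(2), of "- 1"] by simp

lemma iter_deriv_cmult_UNIV: "smooth_on UNIV f \<Longrightarrow> iter_deriv vs (\<lambda>y. c * f y) = (\<lambda>x. c * iter_deriv vs f x)"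
  using iter_deriv_cmult[OF open_UNIV _ UNIV_I] by blast

lemma has_derivative_monom3:
  "(monom3 i j l has_derivative (\<lambda>v. of_real (v$1) * (of_nat i * monom3 (i - 1) j l x)
     + of_real (v$2) * (of_nat j * monom3 i (j - 1) l x) + of_real (v$3) * (of_nat l * monom3 i j (l - 1) x))) (at x)"
proof -
  have nth: "((\<lambda>x. x $ m) has_derivative (\<lambda>v. v $ m)) (at x)" for m :: 3 and x :: "real^3"
    by (rule bounded_linear_imp_has_derivative[OF bounded_linear_vec_nth])
  note pw = has_derivative_power[OF nth]
  show ?thesis
    unfolding monom3_def[abs_def]
    by (rule has_derivative_eq_rhs[OF has_derivative_compose[OF has_derivative_mult[OF has_derivative_mult[OF pw pw] pw]
       bounded_linear_imp_has_derivative[OF bounded_linear_of_real]]])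
      (auto simp: algebra_simps)
qed

lemma frechet_derivative_monom3:
  "frechet_derivative (monom3 i j l) (at x) (axis 1 1) = of_nat i * monom3 (i - 1) j l x"
  "frechet_derivative (monom3 i j l) (at x) (axis 2 1) = of_nat j * monom3 i (j - 1) l x"
  "frechet_derivative (monom3 i j l) (at x) (axis 3 1) = of_nat l * monom3 i j (l - 1) x"
  by (simp_all add: frechet_derivative_eq[OF has_derivative_monom3] axis_def)

lemma frechet_derivative_cmult_monom3:
  "frechet_derivative (\<lambda>x. c * monom3 i j l x) (at x) v = c * frechet_derivative (monom3 i j l) (at x) v"
  unfolding frechet_derivative_eq[OF has_derivative_mult_right[OF has_derivative_monom3]]
    frechet_derivative_eq[OF has_derivative_monom3] ..

lemma iter_deriv_monom3:
  "iter_deriv (replicate n (axis 1 1)) (monom3 i j l) = (\<lambda>x. of_nat (\<Prod>m<n. i - m) * monom3 (i - n) j l x)"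
  "iter_deriv (replicate n (axis 2 1)) (monom3 i j l) = (\<lambda>x. of_nat (\<Prod>m<n. j - m) * monom3 i (j - n) l x)"
  "iter_deriv (replicate n (axis 3 1)) (monom3 i j l) = (\<lambda>x. of_nat (\<Prod>m<n. l - m) * monom3 i j (l - n) x)"
  by (induction n; simp add: frechet_derivative_cmult_monom3 frechet_derivative_monom3 mult.assoc del: of_nat_prod)+

lemma pdm_monom3:
  "pdm i' j' l' (monom3 i j l) 0 = (if i' = i \<and> j' = j \<and> l' = l then fact i * fact j * fact l else 0)"
proof -
  \<comment> \<open>For n < i the remaining power of 0 vanishes; for n > i the product contains the
    factor i - i.\<close>
  have ff: "of_nat (\<Prod>m<n. i - m) * of_nat (0 ^ (i - n)) = (if n = i then fact i else (0::complex))" for n i :: nat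
  proof (cases "n = i")
    case True
    have "(\<Prod>m<i. i - m) = fact i" by (simp add: fact_prod_rev atLeast0LessThan)
    then have "of_nat (\<Prod>m<i. i - m) = (fact i :: complex)" by (metis of_nat_fact)
    then show ?thesis using True by simp
  next
    case False
    then have "n < i \<or> i < n" by auto
    moreover have "(\<Prod>m<n. i - m) = 0" if "i < n" using that by auto
    ultimately show ?thesis using False by auto
  qed
  define P where "P n i = (of_nat (\<Prod>m<n. i - m) :: complex)" for n i :: nat
  note it = iter_deriv_monom3[folded P_def]
  have sm: "smooth_on UNIV (\<lambda>x. c * monom3 i j l x)" for c i j l
    by (intro smooth_on_mult smooth_on_const smooth_on_monom3 open_UNIV)
  have "pdm i' j' l' (monom3 i j l) 0 = P l' l * (P j' j * (P i' i * monom3 (i - i') (j - j') (l - l') 0))"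
    unfolding pdm_def iter_deriv_append it iter_deriv_cmult_UNIV[OF smooth_on_monom3[OF open_UNIV]] iter_deriv_cmult_UNIV[OF sm]
    by (rule refl)
  also have "\<dots> = (of_nat (\<Prod>m<i'. i - m) * of_nat (0 ^ (i - i'))) * (of_nat (\<Prod>m<j'. j - m) * of_nat (0 ^ (j - j')))
     * (of_nat (\<Prod>m<l'. l - m) * of_nat (0 ^ (l - l')))"
    by (simp add: monom3_def P_def mult_ac del: of_nat_prod)
  also have "\<dots> = (if i' = i \<and> j' = j \<and> l' = l then fact i * fact j * fact l else 0)"
    unfolding ff by auto
  finally show ?thesis .
qed

text \<open>A cube of exponents instead of a simplex: it contains every exponent of total degree at
  most k and, as a product, is easy to sum over. The terms of higher degree do not change the
  k-jet.\<close>

definition taylor3 :: "nat \<Rightarrow> (real^3 \<Rightarrow> complex) \<Rightarrow> real^3 \<Rightarrow> complex" where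
  "taylor3 k \<psi> x = (\<Sum>(i, j, l)\<in>{..k} \<times> {..k} \<times> {..k}. pdm i j l \<psi> 0 / (fact i * fact j * fact l) * monom3 i j l x)"

lemma smooth_on_taylor3: "smooth_on UNIV (taylor3 k \<psi>)"
  unfolding taylor3_def[abs_def] case_prod_beta
  by (intro smooth_on_sum smooth_on_mult smooth_on_const smooth_on_monom3 open_UNIV)

lemma pdm_monom3_sum:
  assumes "i \<le> k" "j \<le> k" "l \<le> k"
  shows "pdm i j l (\<lambda>x. \<Sum>(i, j, l)\<in>{..k} \<times> {..k} \<times> {..k}. c i j l * monom3 i j l x) 0 = c i j l * (fact i * fact j * fact l)"
proof -
  let ?T = "{..k} \<times> {..k} \<times> {..k}"
  have "pdm i j l (\<lambda>x. \<Sum>t\<in>?T. c (fst t) (fst (snd t)) (snd (snd t)) * monom3 (fst t) (fst (snd t)) (snd (snd t)) x) 0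
      = (\<Sum>t\<in>?T. pdm i j l (\<lambda>x. c (fst t) (fst (snd t)) (snd (snd t)) * monom3 (fst t) (fst (snd t)) (snd (snd t)) x) 0)"
    by (intro pdm_sum smooth_on_mult smooth_on_const smooth_on_monom3 open_UNIV)
  also have "\<dots> = (\<Sum>t\<in>?T. if t = (i, j, l) then c i j l * (fact i * fact j * fact l) else 0)"
    by (intro sum.cong refl) (auto simp: pdm_cmult smooth_on_monom3 pdm_monom3)
  also have "\<dots> = c i j l * (fact i * fact j * fact l)"
    using assms by simp
  finally show ?thesis by (simp add: case_prod_beta)
qed

lemma flat_taylor3:
  assumes "smooth_on UNIV \<psi>"
  shows "flat k 0 (\<lambda>x. \<psi> x - taylor3 k \<psi> x)"
proof (rule flat_pdmI)
  show "smooth_on UNIV (\<lambda>x. \<psi> x - taylor3 k \<psi> x)"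
    by (intro smooth_on_diff assms smooth_on_taylor3) simp
  fix i j l assume "i + j + l \<le> k"
  then have "pdm i j l (taylor3 k \<psi>) 0 = pdm i j l \<psi> 0"
    unfolding taylor3_def[abs_def]
    using pdm_monom3_sum[of i k j l "\<lambda>i j l. pdm i j l \<psi> 0 / (fact i * fact j * fact l)"] by simp
  then show "pdm i j l (\<lambda>x. \<psi> x - taylor3 k \<psi> x) 0 = 0"
    by (simp add: pdm_diff assms smooth_on_taylor3)
qed

lemma frechet_compose_real3:
  fixes g :: "'a::real_normed_vector \<Rightarrow> real^3" and f :: "real^3 \<Rightarrow> complex"
  assumes "(g has_derivative Dg) (at x)" "smooth_on UNIV f"
  shows "frechet_derivative (\<lambda>x. f (g x)) (at x) v
    = of_real (Dg v $ 1) * pd 1 f (g x) + of_real (Dg v $ 2) * pd 2 f (g x) + of_real (Dg v $ 3) * pd 3 f (g x)"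
  using frechet_derivative_compose_sum[OF assms(1) smooth_on_has_derivative[OF open_UNIV assms(2) UNIV_I], of v]
  by (simp add: sum_Basis_real3 pd_def inner_axis scaleR_conv_of_real)

section \<open>The left invariant fields in affine coordinates\<close>

lemma smooth_on_pd: "smooth_on UNIV f \<Longrightarrow> smooth_on UNIV (pd i f)"
  unfolding pd_def[abs_def] by (rule smooth_on_deriv)

lemma smooth_on_D:
  assumes "smooth_on UNIV f"
  shows "smooth_on UNIV (D1 f)" "smooth_on UNIV (D2 f)" "smooth_on UNIV (D3 f)"
proof -
  have half: "smooth_on UNIV (\<lambda>x::real^3. complex_of_real (x $ i / 2))" for i
    unfolding divide_inverse by (intro smooth_intros open_UNIV)
  show "smooth_on UNIV (D1 f)" "smooth_on UNIV (D2 f)" "smooth_on UNIV (D3 f)"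
    unfolding D1_def D2_def D3_def by (intro smooth_intros open_UNIV smooth_on_pd assms half)+
qed

lemma smooth_on_D_funpow:
  assumes "smooth_on UNIV f"
  shows "smooth_on UNIV ((D1 ^^ n) f)" "smooth_on UNIV ((D2 ^^ n) f)" "smooth_on UNIV ((D3 ^^ n) f)"
  by (induction n) (simp_all add: assms smooth_on_D)

text \<open>In the coordinates \<open>kap_inv x\<close> the fields \<open>D2\<close> and \<open>D3\<close> are partial derivatives, and \<open>D1\<close> is
  \<open>\<partial>\<^sub>1 + x\<^sub>2 \<partial>\<^sub>3\<close>, which agrees with \<open>\<partial>\<^sub>1\<close> on \<open>x\<^sub>2 = 0\<close>. Hence normal ordered monomials restrict to
  partial derivatives on the axis.\<close>

definition kap :: "real^3 \<Rightarrow> real^3" where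
  "kap x = vector [x$1, x$2, x$3 - x$1 * x$2 / 2]"

definition kap_inv :: "real^3 \<Rightarrow> real^3" where
  "kap_inv x = vector [x$1, x$2, x$3 + x$1 * x$2 / 2]"

lemma kap_simps [simp]: "kap x $ 1 = x $ 1" "kap x $ 2 = x $ 2" "kap x $ 3 = x $ 3 - x$1 * x$2 / 2"
  "kap_inv x $ 1 = x $ 1" "kap_inv x $ 2 = x $ 2" "kap_inv x $ 3 = x $ 3 + x$1 * x$2 / 2"
  by (simp_all add: kap_def kap_inv_def)

lemma kap_kap_inv [simp]: "kap (kap_inv x) = x" "kap_inv (kap x) = x"
  by (simp_all add: vec_eq_iff forall_3)

lemma kap_axis3 [simp]: "kap (axis3 t) = axis3 t" "kap_inv (axis3 t) = axis3 t"
  by (simp_all add: vec_eq_iff forall_3 axis3_def)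

lemma smooth_on_kap: "open S \<Longrightarrow> smooth_on S kap" "open S \<Longrightarrow> smooth_on S kap_inv"
  unfolding kap_def[abs_def] kap_inv_def[abs_def] divide_inverse by (intro smooth_intros; assumption)+

lemma has_derivative_kap:
  "(kap has_derivative (\<lambda>v. vector [v$1, v$2, v$3 - (v$1 * x$2 + x$1 * v$2) / 2])) (at x)"
proof -
  have nth: "((\<lambda>x. x $ m) has_derivative (\<lambda>v. v $ m)) (at x)" for m :: 3 and x :: "real^3"
    by (rule bounded_linear_imp_has_derivative[OF bounded_linear_vec_nth])
  note ax = has_derivative_compose[OF _ bounded_linear_imp_has_derivative[OF bounded_linear_axis]]
  have 3: "((\<lambda>x. x$3 - x$1 * x$2 / 2) has_derivative (\<lambda>v. v$3 - (v$1 * x$2 + x$1 * v$2) / 2)) (at x)" for x :: "real^3"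
    by (auto intro!: derivative_eq_intros nth simp: field_simps)
  show ?thesis
    unfolding kap_def[abs_def] vector_3_axis
    by (intro has_derivative_add ax nth 3)
qed

lemma D_kap:
  assumes "smooth_on UNIV \<phi>"
  shows "D1 \<phi> (kap x) = frechet_derivative (\<lambda>y. \<phi> (kap y)) (at x) (axis 1 1)
      + of_real (x$2) * frechet_derivative (\<lambda>y. \<phi> (kap y)) (at x) (axis 3 1)"
    "D2 \<phi> (kap x) = frechet_derivative (\<lambda>y. \<phi> (kap y)) (at x) (axis 2 1)"
    "D3 \<phi> (kap x) = frechet_derivative (\<lambda>y. \<phi> (kap y)) (at x) (axis 3 1)"
  unfolding frechet_compose_real3[OF has_derivative_kap assms]
  by (simp_all add: D1_def D2_def D3_def axis_def field_simps)

text \<open>A directional derivative sees only the line through the point. This allows a comparison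
  of functions that agree merely on the plane where the second coordinate is 0.\<close>

lemma frechet_derivative_eq_on_line:
  assumes "smooth_on UNIV f" "smooth_on UNIV g" "\<And>s. f (x + s *\<^sub>R v) = g (x + s *\<^sub>R v)"
  shows "frechet_derivative f (at x) v = frechet_derivative g (at x) v"
proof -
  have "((\<lambda>s. h (x + s *\<^sub>R v)) has_vector_derivative frechet_derivative h (at x) v) (at 0)" if "smooth_on UNIV h" for h :: "'a \<Rightarrow> 'b"
    using line_derivative[OF open_UNIV smooth_on_differentiable[OF that], of x 0 v] by simp
  from this[OF assms(1)] this[OF assms(2)] show ?thesis
    by (simp add: assms(3) vector_derivative_unique_at)
qed

lemma D_funpow_kap:
  assumes "smooth_on UNIV \<phi>"
  shows "(D2 ^^ n) \<phi> (kap x) = iter_deriv (replicate n (axis 2 1)) (\<lambda>y. \<phi> (kap y)) x"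
    "(D3 ^^ n) \<phi> (kap x) = iter_deriv (replicate n (axis 3 1)) (\<lambda>y. \<phi> (kap y)) x"
    "x $ 2 = 0 \<Longrightarrow> (D1 ^^ n) \<phi> (kap x) = iter_deriv (replicate n (axis 1 1)) (\<lambda>y. \<phi> (kap y)) x"
proof -
  have sk: "smooth_on UNIV (\<lambda>y. f (kap y))" if "smooth_on UNIV f" for f :: "real^3 \<Rightarrow> complex"
    by (rule smooth_on_compose[OF open_UNIV open_UNIV smooth_on_kap(1)[OF open_UNIV] that UNIV_I])
  show "(D2 ^^ n) \<phi> (kap x) = iter_deriv (replicate n (axis 2 1)) (\<lambda>y. \<phi> (kap y)) x"
    by (induction n arbitrary: x) (simp_all add: D_kap smooth_on_D_funpow assms)
  show "(D3 ^^ n) \<phi> (kap x) = iter_deriv (replicate n (axis 3 1)) (\<lambda>y. \<phi> (kap y)) x"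
    by (induction n arbitrary: x) (simp_all add: D_kap smooth_on_D_funpow assms)
  show "x $ 2 = 0 \<Longrightarrow> (D1 ^^ n) \<phi> (kap x) = iter_deriv (replicate n (axis 1 1)) (\<lambda>y. \<phi> (kap y)) x"
  proof (induction n arbitrary: x)
    case (Suc n)
    \<comment> \<open>The line in direction 1 stays in the plane where the second coordinate is 0,
      so the induction hypothesis holds along all of it; the second term of \<open>D_kap\<close>
      vanishes on this plane.\<close>
    have "frechet_derivative (\<lambda>y. (D1 ^^ n) \<phi> (kap y)) (at x) (axis 1 1)
        = frechet_derivative (iter_deriv (replicate n (axis 1 1)) (\<lambda>y. \<phi> (kap y))) (at x) (axis 1 1)"
      using Suc.prems
      by (intro frechet_derivative_eq_on_line sk smooth_on_D_funpow smooth_on_iter_deriv assms Suc.IH)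
        (simp add: axis_def)
    then show ?case using Suc.prems by (simp add: D_kap smooth_on_D_funpow assms)
  qed simp
qed

lemma D_ord_axis3:
  assumes "smooth_on UNIV \<phi>"
  shows "(D1 ^^ i) ((D2 ^^ j) ((D3 ^^ l) \<phi>)) (axis3 t) = pdm i j l (\<lambda>y. \<phi> (kap y)) (axis3 t)"
proof -
  have "(D1 ^^ i) ((D2 ^^ j) ((D3 ^^ l) \<phi>)) (kap (axis3 t))
      = iter_deriv (replicate i (axis 1 1)) (\<lambda>y. (D2 ^^ j) ((D3 ^^ l) \<phi>) (kap y)) (axis3 t)"
    by (rule D_funpow_kap) (simp_all add: smooth_on_D_funpow assms axis3_def)
  then show ?thesis
    by (simp add: D_funpow_kap smooth_on_D_funpow assms pdm_def iter_deriv_append)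
qed

section \<open>Cayley continuants\<close>

lemma fps_binomial_ODE: "(1 + fps_X) * fps_deriv (fps_binomial e) = fps_const e * fps_binomial (e :: complex)"
proof -
  have "fps_nth (1 + fps_X :: complex fps) 0 \<noteq> 0" by simp
  then have "(1 + fps_X :: complex fps) * inverse (1 + fps_X) = 1" by (simp add: inverse_mult_eq_1')
  then show ?thesis
    unfolding fps_binomial_deriv by (simp add: fps_divide_unit mult.assoc[symmetric] mult.commute[of _ "inverse _"])
qed

text \<open>\<open>cay_basis b k\<close> is \<open>(1 + t)\<^bsup>b\<^esup> (t / (1 + t))\<^bsup>k\<^esup>\<close>: the generating function of the Cayley continuants
  is \<open>(1 + t)\<^bsup>b\<^esup> (1 - 2 t / (1 + t))\<^bsup>-c\<^esup>\<close> with \<open>c = (a - b) / 2\<close>, and is expanded in powers of \<open>2 t / (1 + t)\<close>.\<close>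

definition cay_basis :: "complex \<Rightarrow> nat \<Rightarrow> complex fps" where
  "cay_basis b k = fps_X ^ k * fps_binomial (b - of_nat k)"

lemma cay_basis_nth: "fps_nth (cay_basis b k) n = (if n < k then 0 else (b - of_nat k) gchoose (n - k))"
  by (simp add: cay_basis_def fps_X_power_mult_nth)

lemma cay_basis_shift: "fps_X * cay_basis b k = (1 + fps_X) * cay_basis b (Suc k)"
proof -
  have "fps_binomial (b - of_nat k) = (1 + fps_X) * fps_binomial (b - of_nat (Suc k))"
    using fps_binomial_add_mult[of 1 "b - of_nat (Suc k)"] by (simp add: fps_binomial_1)
  then show ?thesis by (simp add: cay_basis_def mult_ac)
qed

text \<open>The first-order operator that annihilates the generating function is bidiagonal on this
  basis. At k = 0 the truncated index k - 1 is harmless because its coefficient is 0.\<close>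

lemma cay_basis_ODE:
  "(1 - fps_X\<^sup>2) * fps_deriv (cay_basis b k) - (fps_const (b + 2 * c) - fps_const b * fps_X) * cay_basis b k
     = of_nat k * cay_basis b (k - 1) - fps_const (2 * (c + of_nat k)) * cay_basis b k"
proof -
  let ?B = "fps_binomial (b - of_nat k)" and ?X = "fps_X :: complex fps"
  define e where "e = fps_const b - of_nat k"
  have e: "fps_const (b - of_nat k) = e"
    by (simp add: e_def fps_of_nat[symmetric] fps_const_sub[symmetric] del: fps_const_sub)
  have cns: "fps_const (b + 2 * c) = fps_const b + 2 * fps_const c"
     "fps_const (2 * (c + of_nat k)) = 2 * fps_const c + 2 * of_nat k"
    by (simp_all add: fps_of_nat[symmetric] fps_numeral_fps_const algebra_simps)
  have B: "(1 + ?X) * fps_deriv ?B = e * ?B" using fps_binomial_ODE[of "b - of_nat k"] e by simp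
  show ?thesis
  proof (cases k)
    case 0
    have "(1 - ?X\<^sup>2) * fps_deriv ?B = (1 - ?X) * ((1 + ?X) * fps_deriv ?B)" by (simp add: algebra_simps power2_eq_square)
    then have *: "(1 - ?X\<^sup>2) * fps_deriv ?B = (1 - ?X) * (e * ?B)" unfolding B .
    have cb: "cay_basis b k = ?B" using 0 by (simp add: cay_basis_def)
    show ?thesis unfolding cb cns * e_def using 0 by (simp add: algebra_simps)
  next
    case (Suc j)
    have sh: "?X * cay_basis b j = (1 + ?X) * cay_basis b k" using cay_basis_shift Suc by simp
    have "fps_deriv (?X ^ Suc j) = of_nat (Suc j) * ?X ^ j"
      by (induction j) (simp_all add: algebra_simps)
    then have d: "fps_deriv (cay_basis b k) = of_nat k * (?X ^ j * ?B) + ?X ^ k * fps_deriv ?B"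
      unfolding cay_basis_def Suc fps_deriv_mult by (simp only: mult_ac add_ac)
    have j: "(1 + ?X) * (?X ^ j * ?B) = cay_basis b j"
      using fps_binomial_add_mult[of 1 "b - of_nat k"] Suc by (simp add: cay_basis_def fps_binomial_1 algebra_simps)
    have "(1 - ?X\<^sup>2) * fps_deriv (cay_basis b k)
       = (1 - ?X) * (of_nat k * ((1 + ?X) * (?X ^ j * ?B)) + ?X ^ k * ((1 + ?X) * fps_deriv ?B))"
      unfolding d by (simp add: algebra_simps power2_eq_square)
    also have "\<dots> = (1 - ?X) * (of_nat k * cay_basis b j + e * cay_basis b k)"
      unfolding j B by (simp add: cay_basis_def algebra_simps)
    also have "\<dots> = of_nat k * (cay_basis b j - ?X * cay_basis b j) + (1 - ?X) * e * cay_basis b k"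
      by (simp add: algebra_simps)
    finally show ?thesis unfolding sh cns by (simp add: Suc e_def algebra_simps)
  qed
qed

text \<open>Logarithmic derivatives add: (b + c) / (1 + t) + c / (1 - t), multiplied by 1 - t^2, is
  b + 2 c - b t.\<close>

lemma cay_gf_ODE:
  defines "F \<equiv> \<lambda>b c. fps_binomial (b + c) * fps_compose (fps_binomial (- c)) (- fps_X)"
  shows "(1 - fps_X\<^sup>2) * fps_deriv (F b c) = (fps_const (b + 2 * c) - fps_const b * fps_X) * F b (c::complex)"
proof -
  let ?A = "fps_binomial (b + c)" and ?B = "fps_compose (fps_binomial (- c)) (- fps_X)" and ?X = "fps_X :: complex fps"
  have A: "(1 + ?X) * fps_deriv ?A = fps_const (b + c) * ?A" by (rule fps_binomial_ODE)
  have "fps_compose ((1 + ?X) * fps_deriv (fps_binomial (- c))) (- ?X) = fps_compose (fps_const (- c) * fps_binomial (- c)) (- ?X)"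
    by (simp only: fps_binomial_ODE)
  then have "(1 - ?X) * fps_compose (fps_deriv (fps_binomial (- c))) (- ?X) = - fps_const c * ?B"
    by (simp add: fps_compose_mult_distrib fps_compose_add_distrib fps_compose_uminus fps_const_neg[symmetric] del: fps_const_neg)
  moreover have "fps_deriv ?B = - fps_compose (fps_deriv (fps_binomial (- c))) (- ?X)"
    by (simp add: fps_compose_deriv)
  ultimately have B: "(1 - ?X) * fps_deriv ?B = fps_const c * ?B"
    by (simp add: fps_const_neg[symmetric] del: fps_const_neg)
  have "(1 - ?X\<^sup>2) * fps_deriv (?A * ?B) = (1 - ?X) * ((1 + ?X) * fps_deriv ?A) * ?B + (1 + ?X) * ?A * ((1 - ?X) * fps_deriv ?B)"
    by (simp add: algebra_simps power2_eq_square)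
  also have "\<dots> = (1 - ?X) * (fps_const (b + c) * ?A) * ?B + (1 + ?X) * ?A * (fps_const c * ?B)"
    unfolding A B ..
  also have "\<dots> = (fps_const (b + 2 * c) - fps_const b * ?X) * (?A * ?B)"
  proof -
    have "fps_const (b + c) = fps_const b + fps_const c" "fps_const (b + 2 * c) = fps_const b + 2 * fps_const c"
      by (simp_all add: fps_numeral_fps_const)
    then show ?thesis by (simp only:) (simp add: algebra_simps del: fps_const_add)
  qed
  finally show ?thesis unfolding F_def .
qed

text \<open>The partial sum G solves the differential equation of F up to a multiple of
  \<open>cay_basis b N\<close>, which has order N in t. Together with the constant term the equation
  determines the coefficients successively, so F and G agree up to degree N.\<close>

lemma cay_expansion:
  fixes b c :: complex
  shows "n \<le> N \<Longrightarrow> fps_nth (fps_binomial (b + c) * fps_compose (fps_binomial (- c)) (- fps_X)) n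
    = (\<Sum>k\<le>N. pochhammer c k * 2 ^ k / fact k * fps_nth (cay_basis b k) n)"
proof -
  define F where "F = fps_binomial (b + c) * fps_compose (fps_binomial (- c)) (- fps_X)"
  define u where "u k = pochhammer c k * 2 ^ k / fact k" for k
  define G where "G = (\<Sum>k\<le>N. fps_const (u k) * cay_basis b k)"
  let ?L = "\<lambda>Y. (1 - fps_X\<^sup>2) * fps_deriv Y - (fps_const (b + 2 * c) - fps_const b * fps_X) * Y"
  \<comment> \<open>Coefficient n of the equation gives coefficient n + 1 of Y from earlier ones and
    from the defect \<open>?L Y\<close>.\<close>
  have rec: "of_nat (Suc n) * fps_nth Y (Suc n) = (if n = 0 then 0 else of_nat (n - 1) * fps_nth Y (n - 1))
      + (b + 2 * c) * fps_nth Y n - (if n = 0 then 0 else b * fps_nth Y (n - 1)) + fps_nth (?L Y) n" for Y n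
    by (cases n) (simp_all add: algebra_simps power2_eq_square fps_X_mult_nth)
  have LF: "?L F = 0" using cay_gf_ODE unfolding F_def by simp
  have uSuc: "of_nat (Suc k) * u (Suc k) = 2 * (c + of_nat k) * u k" for k
    by (simp add: u_def pochhammer_rec' field_simps del: of_nat_Suc)
  have lin: "p * fps_deriv (Y + fps_const v * Z) - q * (Y + fps_const v * Z)
      = (p * fps_deriv Y - q * Y) + fps_const v * (p * fps_deriv Z - q * Z)" for p q Y Z :: "complex fps" and v
    by (simp add: algebra_simps)
  have ring: "- (x * y) * z + y * (x * z - k * h) = - (k * y) * h" for x y z k h :: "complex fps"
    by (simp add: algebra_simps)
  \<comment> \<open>Telescoping: \<open>u\<close> is chosen so that the diagonal contribution of k
    cancels the off-diagonal one of k + 1, and only the last diagonal term survives.\<close>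
  have LG: "?L (\<Sum>k\<le>M. fps_const (u k) * cay_basis b k) = - fps_const (2 * (c + of_nat M) * u M) * cay_basis b M" for M
  proof (induction M)
    case 0
    have "(\<Sum>k\<le>0. fps_const (u k) * cay_basis b k) = cay_basis b 0" by (simp add: u_def)
    then show ?case by (simp only: cay_basis_ODE) (simp add: u_def del: fps_const_neg)
  next
    case (Suc M)
    have "?L (\<Sum>k\<le>Suc M. fps_const (u k) * cay_basis b k)
        = ?L (\<Sum>k\<le>M. fps_const (u k) * cay_basis b k) + fps_const (u (Suc M)) * ?L (cay_basis b (Suc M))"
      unfolding sum.atMost_Suc by (rule lin)
    also have "\<dots> = - fps_const (2 * (c + of_nat M) * u M) * cay_basis b M
        + fps_const (u (Suc M)) * (of_nat (Suc M) * cay_basis b M - fps_const (2 * (c + of_nat (Suc M))) * cay_basis b (Suc M))"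
      unfolding Suc cay_basis_ODE by simp
    also have "fps_const (2 * (c + of_nat M) * u M) = of_nat (Suc M) * fps_const (u (Suc M))"
      unfolding uSuc[symmetric] by (simp add: fps_of_nat[symmetric] del: of_nat_Suc)
    also have "- (of_nat (Suc M) * fps_const (u (Suc M))) * cay_basis b M
        + fps_const (u (Suc M)) * (of_nat (Suc M) * cay_basis b M - fps_const (2 * (c + of_nat (Suc M))) * cay_basis b (Suc M))
        = - (fps_const (2 * (c + of_nat (Suc M))) * fps_const (u (Suc M))) * cay_basis b (Suc M)"
      by (rule ring)
    also have "fps_const (2 * (c + of_nat (Suc M))) * fps_const (u (Suc M)) = fps_const (2 * (c + of_nat (Suc M)) * u (Suc M))"
      by (rule fps_const_mult)
    finally show ?case .
  qed
  have LG0: "fps_nth (?L G) n = 0" if "n < N" for n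
    using that unfolding G_def LG by (simp add: cay_basis_nth)
  have eq: "n \<le> N \<Longrightarrow> fps_nth F n = fps_nth G n" for n
  proof (induction n rule: less_induct)
    case (less n)
    show ?case
    proof (cases n)
      case 0
      have "fps_nth G 0 = (\<Sum>k\<le>N. if k = 0 then 1 else 0)"
        unfolding G_def fps_sum_nth by (intro sum.cong) (auto simp: cay_basis_nth u_def)
      then show ?thesis using 0 by (simp add: F_def)
    next
      case (Suc m)
      have m: "fps_nth F m = fps_nth G m" "m \<noteq> 0 \<Longrightarrow> fps_nth F (m - 1) = fps_nth G (m - 1)" using less Suc by auto
      have "of_nat (Suc m) * fps_nth F (Suc m) = of_nat (Suc m) * fps_nth G (Suc m)"
        unfolding rec[of m F] rec[of m G] using LF LG0[of m] less.prems Suc m by auto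
      then show ?thesis using Suc by (simp del: of_nat_Suc)
    qed
  qed
  show "n \<le> N \<Longrightarrow> ?thesis"
    using eq[of n] by (simp add: F_def G_def fps_sum_nth u_def)
qed

text \<open>The hypergeometric identity freed of denominators, hence valid also where
  \<open>pochhammer (- b) n\<close> vanishes. Dividing by that symbol, split at k, recovers the
  terms of the 2F1.\<close>

lemma Cay_eq_sum:
  "Cay n a b = (\<Sum>k\<le>n. (- 1) ^ (n - k) * of_nat (n choose k) * 2 ^ k * pochhammer ((a - b) / 2) k * pochhammer (- b + of_nat k) (n - k))"
proof -
  define c where "c = (a - b) / 2"
  have ab: "(b + a) / 2 = b + c" "(b - a) / 2 = - c" by (simp_all add: c_def field_simps)
  have "Cay n a b = fact n * (\<Sum>k\<le>n. pochhammer c k * 2 ^ k / fact k * fps_nth (cay_basis b k) n)"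
    unfolding Cay_def ab cay_expansion[OF order_refl] ..
  also have "\<dots> = (\<Sum>k\<le>n. (- 1) ^ (n - k) * of_nat (n choose k) * 2 ^ k * pochhammer c k * pochhammer (- b + of_nat k) (n - k))"
    unfolding sum_distrib_left
  proof (intro sum.cong refl)
    fix k assume "k \<in> {..n}"
    then have k: "k \<le> n" by simp
    have "fps_nth (cay_basis b k) n = (- 1) ^ (n - k) * pochhammer (- b + of_nat k) (n - k) / fact (n - k)"
      using k by (simp add: cay_basis_nth gbinomial_pochhammer)
    moreover have "of_nat (n choose k) = (fact n / (fact k * fact (n - k)) :: complex)" using k by (rule binomial_fact)
    ultimately show "fact n * (pochhammer c k * 2 ^ k / fact k * fps_nth (cay_basis b k) n)
       = (- 1) ^ (n - k) * of_nat (n choose k) * 2 ^ k * pochhammer c k * pochhammer (- b + of_nat k) (n - k)"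
      by simp
  qed
  finally show ?thesis by (simp add: c_def)
qed

text \<open>Both alternatives present the quotient as a signed binomial transform, ready for
  inversion. In the reading of 0 / 0 the numerators vanish for k > m, and m is at most b, so no term
  with a vanishing denominator contributes.\<close>

lemma Cay_quot_eq:
  assumes "pochhammer (- b) n \<noteq> 0 \<or> b \<in> \<nat> \<and> cnat b < n \<and> (b - a) / 2 \<in> of_nat ` {0..cnat b}"
  shows "Cay_quot n a b = (- 1) ^ n * (\<Sum>k\<le>n. (- 1) ^ k * of_nat (n choose k) * (2 ^ k * pochhammer ((a - b) / 2) k / pochhammer (- b) k))"
proof (cases "b \<in> \<nat> \<and> n > cnat b \<and> (b - a) / 2 \<in> of_nat ` {0..cnat b}")
  case True
  then obtain m where m: "(b - a) / 2 = of_nat m" "m \<le> cnat b" by auto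
  have cm': "cnat (of_nat m) = m" by (simp add: cnat_def)
  have c: "(a - b) / 2 = - of_nat m" using m(1) by (simp add: field_simps)
  have "(\<Sum>k=0..m. pochhammer (- of_nat n) k * pochhammer (- of_nat m) k / (pochhammer (- b) k * fact k) * 2 ^ k)
      = (\<Sum>k\<le>n. (- 1) ^ k * of_nat (n choose k) * (2 ^ k * pochhammer (- of_nat m) k / pochhammer (- b) k))"
  proof (rule sum.mono_neutral_cong_left)
    show "{0..m} \<subseteq> {..n}" using True m by auto
    show "\<forall>k\<in>{..n} - {0..m}. (- 1) ^ k * of_nat (n choose k) * (2 ^ k * pochhammer (- of_nat m) k / pochhammer (- b) k) = 0"
      by (auto simp: pochhammer_of_nat_eq_0_iff)
    fix k
    have "of_nat (n choose k) = (- 1) ^ k * pochhammer (- of_nat n) k / (fact k :: complex)"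
      by (simp add: binomial_gbinomial gbinomial_pochhammer)
    then show "pochhammer (- of_nat n) k * pochhammer (- of_nat m) k / (pochhammer (- b) k * fact k) * 2 ^ k
        = (- 1) ^ k * of_nat (n choose k) * (2 ^ k * pochhammer (- of_nat m) k / pochhammer (- b) k)"
      by (simp add: power_mult_distrib[symmetric] mult_ac)
  qed simp
  then show ?thesis using True by (simp add: Cay_quot_def m(1) cm' c)
next
  case False
  then have nz: "pochhammer (- b) n \<noteq> 0" using assms by blast
  have "Cay n a b / pochhammer (- b) n
      = (\<Sum>k\<le>n. (- 1) ^ n * ((- 1) ^ k * of_nat (n choose k) * (2 ^ k * pochhammer ((a - b) / 2) k / pochhammer (- b) k)))"
    unfolding Cay_eq_sum sum_divide_distrib
  proof (intro sum.cong refl)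
    fix k assume "k \<in> {..n}"
    then have k: "k \<le> n" by simp
    have p: "pochhammer (- b) n = pochhammer (- b) k * pochhammer (- b + of_nat k) (n - k)"
      by (rule pochhammer_product[OF k])
    have "(- 1 :: complex) ^ n = (- 1) ^ (n - k) * (- 1) ^ k" using k by (simp add: power_add[symmetric])
    then have s: "(- 1 :: complex) ^ (n - k) = (- 1) ^ n * (- 1) ^ k"
      by (simp add: mult.assoc power_mult_distrib[symmetric])
    show "(- 1) ^ (n - k) * of_nat (n choose k) * 2 ^ k * pochhammer ((a - b) / 2) k * pochhammer (- b + of_nat k) (n - k) / pochhammer (- b) n
       = (- 1) ^ n * ((- 1) ^ k * of_nat (n choose k) * (2 ^ k * pochhammer ((a - b) / 2) k / pochhammer (- b) k))"
      using nz unfolding p s by simp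
  qed
  then show ?thesis using False unfolding Cay_quot_def by (simp only: if_False sum_distrib_left)
qed

text \<open>Signed binomial transforms are involutions. After exchanging the sums, the inner sum is
  a multiple of the alternating sum of the binomial coefficients of N - k, which is zero unless k =
  N.\<close>

lemma binomial_inversion:
  fixes u :: "nat \<Rightarrow> complex"
  shows "(\<Sum>n\<le>N. of_nat (N choose n) * ((- 1) ^ n * (\<Sum>k\<le>n. (- 1) ^ k * of_nat (n choose k) * u k))) = u N"
proof -
  have inner: "(\<Sum>n\<in>{k..N}. of_nat (N choose n) * (- 1) ^ n * of_nat (n choose k)) = (if k = N then (- 1) ^ N else (0::complex))"
    if k: "k \<le> N" for k
  proof -
    have "(\<Sum>n\<in>{k..N}. of_nat (N choose n) * (- 1) ^ n * of_nat (n choose k))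
        = (\<Sum>n\<in>{k..N}. of_nat (N choose k) * ((- 1) ^ n * of_nat ((N - k) choose (n - k))) :: complex)"
      using choose_mult[of k _ N] by (intro sum.cong refl) (simp add: of_nat_mult[symmetric] mult_ac del: of_nat_mult)
    also have "\<dots> = (\<Sum>i\<le>N - k. of_nat (N choose k) * ((- 1) ^ (k + i) * of_nat ((N - k) choose i)))"
      by (rule sum.reindex_bij_witness[of _ "\<lambda>i. k + i" "\<lambda>n. n - k"]) (use k in auto)
    also have "\<dots> = of_nat (N choose k) * (- 1) ^ k * (\<Sum>i\<le>N - k. (- 1) ^ i * of_nat ((N - k) choose i))"
      by (simp add: sum_distrib_left power_add mult_ac)
    also have "\<dots> = (if k = N then (- 1) ^ N else 0)"
      using choose_alternating_sum[of "N - k"] k by auto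
    finally show ?thesis .
  qed
  have "(\<Sum>n\<le>N. of_nat (N choose n) * ((- 1) ^ n * (\<Sum>k\<le>n. (- 1) ^ k * of_nat (n choose k) * u k)))
      = (\<Sum>n\<le>N. \<Sum>k\<le>n. of_nat (N choose n) * (- 1) ^ n * of_nat (n choose k) * ((- 1) ^ k * u k))"
    by (simp add: sum_distrib_left mult_ac)
  also have "\<dots> = (\<Sum>k\<le>N. \<Sum>n\<in>{k..N}. of_nat (N choose n) * (- 1) ^ n * of_nat (n choose k) * ((- 1) ^ k * u k))"
    unfolding sum.Sigma[OF finite_atMost ballI[OF finite_atMost]] sum.Sigma[OF finite_atMost ballI[OF finite_atLeastAtMost]]
    by (rule sum.reindex_bij_witness[of _ "\<lambda>(k, n). (n, k)" "\<lambda>(n, k). (k, n)"]) auto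
  also have "\<dots> = (\<Sum>k\<le>N. if k = N then (- 1) ^ N * ((- 1) ^ N * u N) else 0)"
    unfolding sum_distrib_right[symmetric] by (intro sum.cong refl) (auto simp: inner)
  also have "\<dots> = u N" by (simp add: power_mult_distrib[symmetric] mult.assoc[symmetric])
  finally show ?thesis .
qed

lemma coeff_F31: "coeff (F31 n m c d) k = (if k \<le> min n m then pochhammer (- of_nat n) k * pochhammer (- of_nat m) k * pochhammer c k
              / (pochhammer d k * fact k) else 0)"
  by (simp add: F31_def coeff_sum if_distrib[of "\<lambda>a. a * _"] cong: if_cong)

lemma coeff_p_poly: "coeff (p_poly \<alpha> a b) n = (if n \<le> min (fst \<alpha>) (snd \<alpha>) then
   pochhammer (- of_nat (fst \<alpha>)) n * pochhammer (- of_nat (snd \<alpha>)) n / (2 ^ n * fact n) * Cay_quot n a b else 0)"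
  by (simp add: p_poly_def coeff_sum)

text \<open>Reordering coefficients from symmetric to normal order in the Heisenberg algebra: the
  number of ways to match k of i letters \<open>D1\<close> with k of j letters \<open>D2\<close>,
  each matched pair being out of order in half of the arrangements.\<close>

definition sym_coeff :: "nat \<Rightarrow> nat \<Rightarrow> nat \<Rightarrow> complex" where
  "sym_coeff i j k = of_nat (i choose k) * of_nat (j choose k) * fact k / 2 ^ k"

lemma pochhammer_choose: "pochhammer (- of_nat m) k = (- 1) ^ k * fact k * (of_nat (m choose k) :: complex)"
proof -
  have "of_nat (m choose k) = (- 1) ^ k * pochhammer (- of_nat m) k / (fact k :: complex)"
    by (simp add: binomial_gbinomial gbinomial_pochhammer)
  then show ?thesis by (simp add: mult.assoc[symmetric] power_mult_distrib[symmetric])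
qed

text \<open>Normal ordering acts on the rescaled coefficients by the binomial matrix, so it undoes
  the transform in \<open>Cay_quot_eq\<close> and leaves the Pochhammer ratio of the 3F1.\<close>

lemma ord_coeff_eq:
  assumes N: "N \<le> min (fst \<alpha>) (snd \<alpha>)"
    and ok: "\<And>n. n \<le> N \<Longrightarrow> pochhammer (- b) n \<noteq> 0 \<or> b \<in> \<nat> \<and> cnat b < n \<and> (b - a) / 2 \<in> of_nat ` {0..cnat b}"
  shows "coeff (F31 (fst \<alpha>) (snd \<alpha>) ((a - b) / 2) (- b)) N
    = (\<Sum>n\<le>N. coeff (p_poly \<alpha> a b) n * sym_coeff (fst \<alpha> - n) (snd \<alpha> - n) (N - n))"
proof -
  define c where "c = (a - b) / 2"
  obtain A B where \<alpha>: "\<alpha> = (A, B)" by (cases \<alpha>)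
  \<comment> \<open>The reordering coefficients combine with the Pochhammer symbols of index n into
    those of index N; apart from the Cayley quotient only N choose n still depends on n.\<close>
  have t: "coeff (p_poly \<alpha> a b) n * sym_coeff (A - n) (B - n) (N - n)
     = pochhammer (- of_nat A) N * pochhammer (- of_nat B) N / (2 ^ N * fact N) * (of_nat (N choose n) * Cay_quot n a b)"
    if n: "n \<le> N" for n
  proof -
    have p: "pochhammer (- of_nat M) N = pochhammer (- of_nat M) n * ((- 1) ^ (N - n) * fact (N - n) * (of_nat ((M - n) choose (N - n)) :: complex))"
      if "N \<le> M" for M
    proof -
      have "- of_nat M + of_nat n = (- of_nat (M - n) :: complex)" using n that by (simp add: of_nat_diff)
      then show ?thesis using pochhammer_product[OF n, of "- of_nat M :: complex"] by (simp add: pochhammer_choose)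
    qed
    have sq: "(- 1 :: complex) ^ (N - n) * (- 1) ^ (N - n) = 1" by (simp add: power_mult_distrib[symmetric])
    have "(2::complex) ^ N = 2 ^ n * 2 ^ (N - n)" using n by (simp add: power_add[symmetric])
    moreover have "of_nat (N choose n) = (fact N / (fact n * fact (N - n)) :: complex)" using n by (rule binomial_fact)
    moreover have "n \<le> A" "n \<le> B" "N \<le> A" "N \<le> B" using n N \<alpha> by auto
    ultimately show ?thesis
      using sq by (simp add: coeff_p_poly \<alpha> p sym_coeff_def field_simps)
  qed
  have "(\<Sum>n\<le>N. coeff (p_poly \<alpha> a b) n * sym_coeff (fst \<alpha> - n) (snd \<alpha> - n) (N - n))
     = pochhammer (- of_nat A) N * pochhammer (- of_nat B) N / (2 ^ N * fact N) * (\<Sum>n\<le>N. of_nat (N choose n) * Cay_quot n a b)"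
    unfolding sum_distrib_left by (intro sum.cong refl) (use t \<alpha> in simp)
  also have "(\<Sum>n\<le>N. of_nat (N choose n) * Cay_quot n a b) = 2 ^ N * pochhammer c N / pochhammer (- b) N"
    using binomial_inversion[of N "\<lambda>k. 2 ^ k * pochhammer c k / pochhammer (- b) k"] Cay_quot_eq[OF ok] by (simp add: c_def)
  finally show ?thesis using N by (simp add: coeff_F31 \<alpha> c_def mult_ac)
qed

section \<open>Symmetrised and normal ordered monomials\<close>

lemma pd_eq_iter_deriv: "pd i f = iter_deriv [axis i 1] f"
  by (simp add: pd_def)

lemma pd_lincomb:
  assumes "\<And>a. a \<in> A \<Longrightarrow> smooth_on UNIV (f a)"
  shows "pd i (\<lambda>x. \<Sum>a\<in>A. c a * f a x) = (\<lambda>x. \<Sum>a\<in>A. c a * pd i (f a) x)"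
proof
  fix x
  have "pd i (\<lambda>x. \<Sum>a\<in>A. c a * f a x) x = (\<Sum>a\<in>A. iter_deriv [axis i 1] (\<lambda>x. c a * f a x) x)"
    unfolding pd_eq_iter_deriv
    by (rule iter_deriv_sum[OF open_UNIV _ UNIV_I]) (intro smooth_on_mult smooth_on_const assms open_UNIV)
  also have "\<dots> = (\<Sum>a\<in>A. c a * pd i (f a) x)"
    unfolding pd_eq_iter_deriv by (intro sum.cong refl iter_deriv_cmult[OF open_UNIV assms UNIV_I])
  finally show "pd i (\<lambda>x. \<Sum>a\<in>A. c a * f a x) x = (\<Sum>a\<in>A. c a * pd i (f a) x)" .
qed

lemma D_lincomb:
  assumes "\<And>a. a \<in> A \<Longrightarrow> smooth_on UNIV (f a)"
  shows "D1 (\<lambda>x. \<Sum>a\<in>A. c a * f a x) = (\<lambda>x. \<Sum>a\<in>A. c a * D1 (f a) x)"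
    "D2 (\<lambda>x. \<Sum>a\<in>A. c a * f a x) = (\<lambda>x. \<Sum>a\<in>A. c a * D2 (f a) x)"
    "D3 (\<lambda>x. \<Sum>a\<in>A. c a * f a x) = (\<lambda>x. \<Sum>a\<in>A. c a * D3 (f a) x)"
proof -
  have P: "pd i (\<lambda>x. \<Sum>a\<in>A. c a * f a x) = (\<lambda>x. \<Sum>a\<in>A. c a * pd i (f a) x)" for i
    by (rule pd_lincomb[OF assms])
  show "D1 (\<lambda>x. \<Sum>a\<in>A. c a * f a x) = (\<lambda>x. \<Sum>a\<in>A. c a * D1 (f a) x)"
    "D2 (\<lambda>x. \<Sum>a\<in>A. c a * f a x) = (\<lambda>x. \<Sum>a\<in>A. c a * D2 (f a) x)"
    "D3 (\<lambda>x. \<Sum>a\<in>A. c a * f a x) = (\<lambda>x. \<Sum>a\<in>A. c a * D3 (f a) x)"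
    unfolding D1_def D2_def D3_def P
    by (simp_all add: sum_distrib_left sum.distrib sum_subtractf right_diff_distrib distrib_left mult.left_commute)
qed

lemma D_lincomb2:
  assumes "smooth_on UNIV f" "smooth_on UNIV g"
  shows "D1 (\<lambda>x. f x + c * g x) = (\<lambda>x. D1 f x + c * D1 g x)"
    "D2 (\<lambda>x. f x + c * g x) = (\<lambda>x. D2 f x + c * D2 g x)"
    "D3 (\<lambda>x. f x + c * g x) = (\<lambda>x. D3 f x + c * D3 g x)"
proof -
  have s: "smooth_on UNIV (if b then f else g)" for b using assms by simp
  note l = D_lincomb[of "UNIV :: bool set" "\<lambda>b. if b then f else g" "\<lambda>b. if b then 1 else c", OF s]
  show "D1 (\<lambda>x. f x + c * g x) = (\<lambda>x. D1 f x + c * D1 g x)"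
    "D2 (\<lambda>x. f x + c * g x) = (\<lambda>x. D2 f x + c * D2 g x)"
    "D3 (\<lambda>x. f x + c * g x) = (\<lambda>x. D3 f x + c * D3 g x)"
    using l by (simp_all add: UNIV_bool add.commute)
qed

lemma pd_swap: "smooth_on UNIV f \<Longrightarrow> pd i (pd j f) = pd j (pd i f)"
  unfolding pd_def[abs_def] using deriv_swap[OF open_UNIV _ UNIV_I] by blast

lemma pd_coord:
  assumes f: "smooth_on UNIV f" and g: "smooth_on UNIV g"
  shows "pd i (\<lambda>x. g x + of_real (x $ j / 2) * f x) x
      = pd i g x + (of_real ((axis i 1 :: real^3) $ j / 2) * f x + of_real (x $ j / 2) * pd i f x)"
    "pd i (\<lambda>x. g x - of_real (x $ j / 2) * f x) x
      = pd i g x - (of_real ((axis i 1 :: real^3) $ j / 2) * f x + of_real (x $ j / 2) * pd i f x)"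
proof -
  have "((\<lambda>x :: real^3. x $ j / 2) has_derivative (\<lambda>v. v $ j / 2)) (at x)"
    by (intro bounded_linear_imp_has_derivative bounded_linear_divide[THEN bounded_linear_compose] bounded_linear_vec_nth)
  then have x: "((\<lambda>x. complex_of_real (x $ j / 2)) has_derivative (\<lambda>v. of_real (v $ j / 2))) (at x)"
    by (rule has_derivative_of_real)
  note d = has_derivative_mult[OF x smooth_on_has_derivative[OF open_UNIV f UNIV_I]]
  note gd = smooth_on_has_derivative[OF open_UNIV g UNIV_I]
  show "pd i (\<lambda>x. g x + of_real (x $ j / 2) * f x) x
      = pd i g x + (of_real ((axis i 1 :: real^3) $ j / 2) * f x + of_real (x $ j / 2) * pd i f x)"
    unfolding pd_def frechet_derivative_eq[OF has_derivative_add[OF gd d]] by (simp add: add.commute)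
  show "pd i (\<lambda>x. g x - of_real (x $ j / 2) * f x) x
      = pd i g x - (of_real ((axis i 1 :: real^3) $ j / 2) * f x + of_real (x $ j / 2) * pd i f x)"
    unfolding pd_def frechet_derivative_eq[OF has_derivative_diff[OF gd d]] by (simp add: add.commute)
qed

text \<open>The Heisenberg relations. The halves in \<open>D1\<close> and \<open>D2\<close> add up
  to one copy of \<open>D3\<close>, which is central.\<close>

lemma D_commutators:
  assumes "smooth_on UNIV f"
  shows "D2 (D1 f) = (\<lambda>x. D1 (D2 f) x + D3 f x)" "D3 (D1 f) = D1 (D3 f)" "D3 (D2 f) = D2 (D3 f)"
proof -
  note s = smooth_on_pd[OF assms] smooth_on_pd[OF smooth_on_pd[OF assms]]
  have swap: "pd 2 (pd 1 f) = pd 1 (pd 2 f)" "pd 3 (pd 1 f) = pd 1 (pd 3 f)" "pd 3 (pd 2 f) = pd 2 (pd 3 f)"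
    by (rule pd_swap[OF assms])+
  show "D2 (D1 f) = (\<lambda>x. D1 (D2 f) x + D3 f x)" "D3 (D1 f) = D1 (D3 f)" "D3 (D2 f) = D2 (D3 f)"
    unfolding D1_def D2_def D3_def pd_coord(1)[OF s(1) s(1)] pd_coord(2)[OF s(1) s(1)] swap
    by (auto simp: axis_def field_simps fun_eq_iff)
qed

section \<open>Normal ordering\<close>

definition D_ord :: "nat \<Rightarrow> nat \<Rightarrow> nat \<Rightarrow> operator3" where
  "D_ord a b c f = (D1 ^^ a) ((D2 ^^ b) ((D3 ^^ c) f))"

lemma smooth_on_D_ord: "smooth_on UNIV f \<Longrightarrow> smooth_on UNIV (D_ord a b c f)"
  unfolding D_ord_def by (intro smooth_on_D_funpow)

lemma D3_funpow_commute:
  assumes "smooth_on UNIV f"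
  shows "D3 ((D1 ^^ a) f) = (D1 ^^ a) (D3 f)" "D3 ((D2 ^^ a) f) = (D2 ^^ a) (D3 f)"
  by (induction a) (simp_all add: D_commutators smooth_on_D_funpow assms)

lemma D1_D_ord: "D1 (D_ord a b c f) = D_ord (Suc a) b c f"
  by (simp add: D_ord_def)

lemma D3_D_ord: "smooth_on UNIV f \<Longrightarrow> D3 (D_ord a b c f) = D_ord a b (Suc c) f"
  by (simp add: D_ord_def D3_funpow_commute smooth_on_D_funpow)

lemma D2_D1_funpow:
  assumes "smooth_on UNIV f"
  shows "D2 ((D1 ^^ a) f) = (\<lambda>x. (D1 ^^ a) (D2 f) x + of_nat a * (D1 ^^ (a - 1)) (D3 f) x)"
proof (induction a)
  case (Suc a)
  have "D2 ((D1 ^^ Suc a) f) = (\<lambda>x. D1 (D2 ((D1 ^^ a) f)) x + D3 ((D1 ^^ a) f) x)"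
    by (simp add: D_commutators smooth_on_D_funpow assms)
  also have "D1 (D2 ((D1 ^^ a) f)) = (\<lambda>x. D1 ((D1 ^^ a) (D2 f)) x + of_nat a * D1 ((D1 ^^ (a - 1)) (D3 f)) x)"
    unfolding Suc by (rule D_lincomb2) (intro smooth_on_D_funpow smooth_on_D assms)+
  also have "D3 ((D1 ^^ a) f) = (D1 ^^ a) (D3 f)" by (rule D3_funpow_commute[OF assms])
  finally show ?case by (cases a) (simp_all add: algebra_simps)
qed simp

lemma D2_D_ord:
  assumes "smooth_on UNIV f"
  shows "D2 (D_ord a b c f) = (\<lambda>x. D_ord a (Suc b) c f x + of_nat a * D_ord (a - 1) b (Suc c) f x)"
  using D2_D1_funpow[of "(D2 ^^ b) ((D3 ^^ c) f)" a] assms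
  by (simp add: D_ord_def smooth_on_D_funpow D3_funpow_commute)

lemma sym_coeff_eq_0: "min i j < k \<Longrightarrow> sym_coeff i j k = 0"
  by (auto simp: sym_coeff_def)

text \<open>Coefficient form of averaging over the first letter: i choices of \<open>D1\<close>, j
  choices of \<open>D2\<close>, and a correction from moving \<open>D2\<close> to the right past the
  powers of \<open>D1\<close>. By absorption the three terms are i - k, j - k and 2 k times the same
  coefficient.\<close>

lemma sym_coeff_rec:
  "of_nat i * sym_coeff (i - 1) j k + of_nat j * sym_coeff i (j - 1) k
    + (if k = 0 then 0 else of_nat j * sym_coeff i (j - 1) (k - 1) * of_nat (i - (k - 1))) = of_nat (i + j) * sym_coeff i j k"
proof -
  have 1: "of_nat i * sym_coeff (i - 1) j k = of_nat (i - k) * sym_coeff i j k"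
    using binomial_absorb_comp[of i k, THEN arg_cong[of _ _ "of_nat :: nat \<Rightarrow> complex"]]
    by (simp add: sym_coeff_def)
  have 2: "of_nat j * sym_coeff i (j - 1) k = of_nat (j - k) * sym_coeff i j k"
    using binomial_absorb_comp[of j k, THEN arg_cong[of _ _ "of_nat :: nat \<Rightarrow> complex"]]
    by (simp add: sym_coeff_def)
  have 3: "(if k = 0 then 0 else of_nat j * sym_coeff i (j - 1) (k - 1) * of_nat (i - (k - 1))) = of_nat (2 * k) * sym_coeff i j k"
  proof (cases k)
    case (Suc q)
    have a: "of_nat j * of_nat ((j - 1) choose q) = (of_nat (Suc q) * of_nat (j choose Suc q) :: complex)"
      by (metis binomial_absorption of_nat_mult)
    have b: "of_nat (i - q) * of_nat (i choose q) = (of_nat (Suc q) * of_nat (i choose Suc q) :: complex)"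
      by (metis binomial_absorption binomial_absorb_comp of_nat_mult)
    have "of_nat j * sym_coeff i (j - 1) q * of_nat (i - q)
      = (of_nat (i - q) * of_nat (i choose q)) * (of_nat j * of_nat ((j - 1) choose q)) * fact q / 2 ^ q"
      by (simp add: sym_coeff_def mult_ac)
    also have "\<dots> = of_nat (2 * k) * sym_coeff i j k"
      unfolding a b Suc sym_coeff_def by (simp add: field_simps)
    finally show ?thesis by (simp add: Suc)
  qed simp
  show ?thesis
  proof (cases "min i j < k")
    case True
    then show ?thesis unfolding 1 2 3 by (simp add: sym_coeff_eq_0)
  next
    case False
    then have "of_nat (i - k) + of_nat (j - k) + of_nat (2 * k) = (of_nat (i + j) :: complex)"
      by (simp add: of_nat_diff)
    then show ?thesis unfolding 1 2 3 by (metis distrib_right)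
  qed
qed

text \<open>The normal ordered form of the symmetrised monomial. Summands with \<open>k > min i j\<close> vanish, so the
  bound \<open>K\<close> only has to be large; keeping it fixed makes the recursion in \<open>i\<close> and \<open>j\<close> uniform.\<close>

definition D_sym :: "nat \<Rightarrow> nat \<Rightarrow> nat \<Rightarrow> nat \<Rightarrow> operator3" where
  "D_sym K i j n f = (\<lambda>x. \<Sum>k\<le>K. sym_coeff i j k * D_ord (i - k) (j - k) (n + k) f x)"

lemma smooth_on_D_sym: "smooth_on UNIV f \<Longrightarrow> smooth_on UNIV (D_sym K i j n f)"
  unfolding D_sym_def by (intro smooth_on_sum smooth_on_mult smooth_on_const smooth_on_D_ord open_UNIV)

lemma D3_D_sym: "smooth_on UNIV f \<Longrightarrow> D3 (D_sym K i j n f) = D_sym K i j (Suc n) f"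
  unfolding D_sym_def by (simp add: D_lincomb smooth_on_D_ord D3_D_ord)

lemma D_sym_rec:
  assumes f: "smooth_on UNIV f" and K: "i + j \<le> K"
  shows "of_nat i * D1 (D_sym K (i - 1) j n f) x + of_nat j * D2 (D_sym K i (j - 1) n f) x
    = of_nat (i + j) * D_sym K i j n f x"
proof -
  let ?E = "\<lambda>k. D_ord (i - k) (j - k) (n + k) f x"
  have 1: "of_nat i * D1 (D_sym K (i - 1) j n f) x = (\<Sum>k\<le>K. of_nat i * sym_coeff (i - 1) j k * ?E k)"
  proof -
    \<comment> \<open>Truncated subtraction is harmless: where Suc (i - 1 - k) differs from i - k,
      the factor i or the coefficient vanishes.\<close>
    have "of_nat i * (sym_coeff (i - 1) j k * D_ord (Suc (i - 1 - k)) (j - k) (n + k) f x) = of_nat i * sym_coeff (i - 1) j k * ?E k" for k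
      by (cases "i = 0 \<or> i - 1 < k") (auto simp: sym_coeff_eq_0 Suc_diff_Suc)
    moreover have "D1 (D_sym K (i - 1) j n f) x
        = (\<Sum>k\<le>K. sym_coeff (i - 1) j k * D_ord (Suc (i - 1 - k)) (j - k) (n + k) f x)"
      unfolding D_sym_def by (subst D_lincomb(1)) (auto simp: smooth_on_D_ord f D1_D_ord)
    ultimately show ?thesis by (simp only: sum_distrib_left)
  qed
  have 2: "of_nat j * D2 (D_sym K i (j - 1) n f) x
     = (\<Sum>k\<le>K. of_nat j * sym_coeff i (j - 1) k * ?E k) + (\<Sum>k\<le>K. of_nat j * sym_coeff i (j - 1) k * of_nat (i - k) * ?E (Suc k))"
  proof -
    have "of_nat j * (sym_coeff i (j - 1) k * (D_ord (i - k) (Suc (j - 1 - k)) (n + k) f x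
          + of_nat (i - k) * D_ord (i - k - 1) (j - 1 - k) (Suc (n + k)) f x))
       = of_nat j * sym_coeff i (j - 1) k * ?E k + of_nat j * sym_coeff i (j - 1) k * of_nat (i - k) * ?E (Suc k)" for k
      by (cases "j = 0 \<or> j - 1 < k") (auto simp: sym_coeff_eq_0 Suc_diff_Suc algebra_simps)
    moreover have "D2 (D_sym K i (j - 1) n f) x
        = (\<Sum>k\<le>K. sym_coeff i (j - 1) k * (D_ord (i - k) (Suc (j - 1 - k)) (n + k) f x
          + of_nat (i - k) * D_ord (i - k - 1) (j - 1 - k) (Suc (n + k)) f x))"
      unfolding D_sym_def by (subst D_lincomb(2)) (auto simp: smooth_on_D_ord f D2_D_ord)
    ultimately show ?thesis by (simp only: sum_distrib_left sum.distrib[symmetric])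
  qed
  have 3: "(\<Sum>k\<le>K. of_nat j * sym_coeff i (j - 1) k * of_nat (i - k) * ?E (Suc k))
     = (\<Sum>k\<le>K. (if k = 0 then 0 else of_nat j * sym_coeff i (j - 1) (k - 1) * of_nat (i - (k - 1))) * ?E k)"
  proof -
    \<comment> \<open>The bound i + j \<le> K makes the top term vanish, so the index shift by one
      loses nothing.\<close>
    have z: "of_nat j * sym_coeff i (j - 1) K = 0"
      using K by (cases "j = 0") (auto intro: sym_coeff_eq_0)
    show ?thesis
    proof (cases K)
      case 0
      then show ?thesis using z by simp
    next
      case (Suc Q)
      have "(\<Sum>k\<le>K. of_nat j * sym_coeff i (j - 1) k * of_nat (i - k) * ?E (Suc k))
        = (\<Sum>k\<le>Q. of_nat j * sym_coeff i (j - 1) k * of_nat (i - k) * ?E (Suc k))"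
        using z unfolding Suc by simp
      then show ?thesis
        unfolding Suc sum.atMost_Suc_shift[of "\<lambda>k. (if k = 0 then 0 else of_nat j * sym_coeff i (j - 1) (k - 1) * of_nat (i - (k - 1))) * ?E k"]
        by simp
    qed
  qed
  have "of_nat i * D1 (D_sym K (i - 1) j n f) x + of_nat j * D2 (D_sym K i (j - 1) n f) x
    = (\<Sum>k\<le>K. (of_nat i * sym_coeff (i - 1) j k + of_nat j * sym_coeff i (j - 1) k
       + (if k = 0 then 0 else of_nat j * sym_coeff i (j - 1) (k - 1) * of_nat (i - (k - 1)))) * ?E k)"
    unfolding 1 2 3 sum.distrib distrib_right by simp
  then show ?thesis unfolding sym_coeff_rec D_sym_def by (simp add: sum_distrib_left mult.assoc)
qed

text \<open>Letters are addressed by labels so that a word can be an arrangement of distinct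
  positions; repeated letters are then counted with the multiplicity that the symmetrised product
  requires.\<close>

definition D_op :: "nat \<Rightarrow> operator3" where
  "D_op l = (if l = 0 then D1 else if l = 1 then D2 else D3)"

lemma D_op_lincomb: "(\<And>a. a \<in> A \<Longrightarrow> smooth_on UNIV (f a)) \<Longrightarrow>
    D_op l (\<lambda>x. \<Sum>a\<in>A. c a * f a x) = (\<lambda>x. \<Sum>a\<in>A. c a * D_op l (f a) x)"
  by (simp add: D_op_def D_lincomb)

lemma smooth_on_D_word: "smooth_on UNIV f \<Longrightarrow> smooth_on UNIV (foldr (\<circ>) (map (\<lambda>i. D_op (lab i)) xs) id f)"
  by (induction xs) (auto simp: D_op_def smooth_on_D)

lemma sum_by_label:
  assumes "finite A" "\<And>i. i \<in> A \<Longrightarrow> lab i < (3::nat)"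
  shows "(\<Sum>i\<in>A. G (lab i) :: complex) = of_nat (card {i\<in>A. lab i = 0}) * G 0 + of_nat (card {i\<in>A. lab i = 1}) * G 1
    + of_nat (card {i\<in>A. lab i = 2}) * G 2"
proof -
  have "(\<Sum>i\<in>A. G (lab i)) = (\<Sum>i\<in>{i\<in>A. lab i = 0} \<union> {i\<in>A. lab i = 1} \<union> {i\<in>A. lab i = 2}. G (lab i))"
    using assms(2) by (intro sum.cong) force+
  also have "\<dots> = (\<Sum>i\<in>{i\<in>A. lab i = 0}. G (lab i)) + (\<Sum>i\<in>{i\<in>A. lab i = 1}. G (lab i)) + (\<Sum>i\<in>{i\<in>A. lab i = 2}. G (lab i))"
    using assms(1) by (subst sum.union_disjoint; auto)+
  finally show ?thesis by simp
qed

text \<open>Arrangements are grouped by their first position. Its contribution depends only on its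
  label, and the rest is the same sum over a smaller set. The labels 0 and 1 combine by
  \<open>D_sym_rec\<close>; label 2 is central and merely counts.\<close>

lemma sum_words_eq_D_sym:
  assumes f: "smooth_on UNIV f" and "finite A" "\<And>i. i \<in> A \<Longrightarrow> lab i < (3::nat)" "card A \<le> K"
  shows "(\<Sum>xs\<in>permutations_of_set A. foldr (\<circ>) (map (\<lambda>i. D_op (lab i)) xs) id f x)
    = fact (card A) * D_sym K (card {i\<in>A. lab i = 0}) (card {i\<in>A. lab i = 1}) (card {i\<in>A. lab i = 2}) f x"
  using assms(2-4)
proof (induction "card A" arbitrary: A x)
  case 0
  then have "A = {}" by simp
  moreover have "D_sym K 0 0 0 f x = f x"
  proof -
    have "D_sym K 0 0 0 f x = (\<Sum>k\<le>K. if k = 0 then f x else 0)"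
      unfolding D_sym_def by (intro sum.cong) (auto simp: sym_coeff_def D_ord_def)
    then show ?thesis by simp
  qed
  ultimately show ?case by simp
next
  case (Suc n)
  let ?W = "\<lambda>xs. foldr (\<circ>) (map (\<lambda>i. D_op (lab i)) xs) id f"
  let ?c = "\<lambda>A l. card {i\<in>A. lab i = l}"
  have ne: "A \<noteq> {}" using Suc.hyps(2) by auto
  have fin: "finite A" by fact
  have lab: "lab i < 3" if "i \<in> A" for i using Suc.prems that by blast
  have tot: "card A = ?c A 0 + ?c A 1 + ?c A 2"
  proof -
    have "(of_nat (card A) :: complex) = of_nat (?c A 0 + ?c A 1 + ?c A 2)"
      using sum_by_label[OF fin lab, where G = "\<lambda>_. 1"] by simp
    then show ?thesis by (simp only: of_nat_eq_iff)
  qed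
  have dec: "?c (A - {i}) l = (if lab i = l then ?c A l - 1 else ?c A l)" if "i \<in> A" for i l
  proof -
    have "{j \<in> A - {i}. lab j = l} = (if lab i = l then {j \<in> A. lab j = l} - {i} else {j \<in> A. lab j = l})" by auto
    then show ?thesis using that fin by (auto simp: card_Diff_singleton_if)
  qed
  \<comment> \<open>Contribution of the arrangements whose first letter has label l, up to the
    factor \<open>fact n\<close>.\<close>
  define G where "G l = D_op l (D_sym K (if l = 0 then ?c A 0 - 1 else ?c A 0) (if l = 1 then ?c A 1 - 1 else ?c A 1)
      (if l = 2 then ?c A 2 - 1 else ?c A 2) f) x" for l
  have "(\<Sum>xs\<in>permutations_of_set A. ?W xs x) = (\<Sum>i\<in>A. \<Sum>xs\<in>permutations_of_set (A - {i}). ?W (i # xs) x)"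
    unfolding permutations_of_set_nonempty[OF ne]
    by (subst sum.UNION_disjoint) (auto simp: fin sum.reindex)
  also have "\<dots> = (\<Sum>i\<in>A. fact n * G (lab i))"
  proof (intro sum.cong refl)
    fix i assume i: "i \<in> A"
    have n: "card (A - {i}) = n" using Suc.hyps(2) i fin by simp
    have IH: "(\<Sum>xs\<in>permutations_of_set (A - {i}). ?W xs y)
       = fact n * D_sym K (?c (A - {i}) 0) (?c (A - {i}) 1) (?c (A - {i}) 2) f y" for y
      using Suc.hyps(1)[of "A - {i}" y] n fin lab Suc.prems(3) Suc.hyps(2) by simp
    have "(\<Sum>xs\<in>permutations_of_set (A - {i}). ?W (i # xs) x) = (\<Sum>xs\<in>permutations_of_set (A - {i}). 1 * D_op (lab i) (?W xs) x)"
      by simp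
    also have "\<dots> = D_op (lab i) (\<lambda>y. \<Sum>xs\<in>permutations_of_set (A - {i}). 1 * ?W xs y) x"
      by (subst D_op_lincomb) (simp_all add: smooth_on_D_word f)
    also have "(\<lambda>y. \<Sum>xs\<in>permutations_of_set (A - {i}). 1 * ?W xs y)
        = (\<lambda>y. \<Sum>u\<in>{0::nat}. fact n * D_sym K (?c (A - {i}) 0) (?c (A - {i}) 1) (?c (A - {i}) 2) f y)"
      using IH by simp
    also have "D_op (lab i) \<dots> x = fact n * D_op (lab i) (D_sym K (?c (A - {i}) 0) (?c (A - {i}) 1) (?c (A - {i}) 2) f) x"
      by (subst D_op_lincomb) (simp_all add: smooth_on_D_sym f)
    also have "\<dots> = fact n * G (lab i)"
      unfolding dec[OF i] G_def ..
    finally show "(\<Sum>xs\<in>permutations_of_set (A - {i}). ?W (i # xs) x) = fact n * G (lab i)" .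
  qed
  also have "\<dots> = fact n * (of_nat (?c A 0) * G 0 + of_nat (?c A 1) * G 1 + of_nat (?c A 2) * G 2)"
    using sum_by_label[of A lab G, OF fin lab] by (simp only: sum_distrib_left[symmetric])
  also have "of_nat (?c A 0) * G 0 + of_nat (?c A 1) * G 1 = of_nat (?c A 0 + ?c A 1) * D_sym K (?c A 0) (?c A 1) (?c A 2) f x"
    using D_sym_rec[OF f, of "?c A 0" "?c A 1" K "?c A 2" x] tot Suc.prems(3) by (simp add: G_def D_op_def)
  also have "of_nat (?c A 2) * G 2 = of_nat (?c A 2) * D_sym K (?c A 0) (?c A 1) (?c A 2) f x"
    by (cases "?c A 2") (simp_all add: G_def D_op_def D3_D_sym f)
  also have "fact n * (of_nat (?c A 0 + ?c A 1) * D_sym K (?c A 0) (?c A 1) (?c A 2) f x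
      + of_nat (?c A 2) * D_sym K (?c A 0) (?c A 1) (?c A 2) f x)
      = fact n * of_nat (card A) * D_sym K (?c A 0) (?c A 1) (?c A 2) f x"
    unfolding tot by (simp add: algebra_simps)
  also have "fact n * of_nat (card A) = (fact (card A) :: complex)"
    using Suc.hyps(2) by (metis fact_Suc mult.commute)
  finally show ?case .
qed

text \<open>Trades permutations of the index set for arrangements of it, on which recursion over the
  first letter is available.\<close>

lemma bij_betw_permutations_list:
  "bij_betw (\<lambda>\<tau>. map \<tau> [0..<n]) {\<tau>. \<tau> permutes {..<n}} (permutations_of_set {..<n})"
  unfolding bij_betw_def
proof
  show "inj_on (\<lambda>\<tau>. map \<tau> [0..<n]) {\<tau>. \<tau> permutes {..<n}}"
  proof (intro inj_onI ext)
    fix \<tau> \<sigma> i assume *: "\<tau> \<in> {\<tau>. \<tau> permutes {..<n}}" "\<sigma> \<in> {\<tau>. \<tau> permutes {..<n}}" "map \<tau> [0..<n] = map \<sigma> [0..<n]"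
    show "\<tau> i = \<sigma> i"
    proof (cases "i < n")
      case True
      then show ?thesis using *(3) by simp
    next
      case False
      then show ?thesis using *(1,2) by (metis permutes_not_in lessThan_iff mem_Collect_eq)
    qed
  qed
  show "(\<lambda>\<tau>. map \<tau> [0..<n]) ` {\<tau>. \<tau> permutes {..<n}} = permutations_of_set {..<n}"
  proof (intro equalityI subsetI)
    fix xs assume "xs \<in> (\<lambda>\<tau>. map \<tau> [0..<n]) ` {\<tau>. \<tau> permutes {..<n}}"
    then obtain \<tau> where \<tau>: "\<tau> permutes {..<n}" "xs = map \<tau> [0..<n]" by blast
    have "distinct xs" using \<tau> permutes_inj_on[OF \<tau>(1)] by (simp add: distinct_map)
    moreover have "set xs = {..<n}" using \<tau> permutes_image[OF \<tau>(1)] by (simp add: atLeast0LessThan)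
    ultimately show "xs \<in> permutations_of_set {..<n}" by (simp add: permutations_of_setI)
  next
    fix xs assume "xs \<in> permutations_of_set {..<n}"
    then have xs: "set xs = {..<n}" "distinct xs" by (simp_all add: permutations_of_setD)
    then have len: "length xs = n" using distinct_card[of xs] by simp
    define \<tau> where "\<tau> i = (if i < n then xs ! i else i)" for i
    have "bij_betw \<tau> {..<n} {..<n}"
      unfolding bij_betw_def
    proof
      show "inj_on \<tau> {..<n}" using xs(2) len by (auto simp: inj_on_def \<tau>_def nth_eq_iff_index_eq)
      show "\<tau> ` {..<n} = {..<n}" using xs(1) len by (auto simp: \<tau>_def set_conv_nth image_def)
    qed
    then have "\<tau> permutes {..<n}" by (rule bij_imp_permutes) (simp add: \<tau>_def)
    moreover have "map \<tau> [0..<n] = xs" using len by (intro nth_equalityI) (auto simp: \<tau>_def)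
    ultimately show "xs \<in> (\<lambda>\<tau>. map \<tau> [0..<n]) ` {\<tau>. \<tau> permutes {..<n}}" by blast
  qed
qed

lemma sym_prod_eq_D_sym:
  assumes f: "smooth_on UNIV f" and K: "a + b + n \<le> K"
  shows "sym_prod (replicate a D1 @ replicate b D2 @ replicate n D3) f x = D_sym K a b n f x"
proof -
  let ?Ys = "replicate a D1 @ replicate b D2 @ replicate n D3" and ?N = "a + b + n"
  define lab :: "nat \<Rightarrow> nat" where "lab i = (if i < a then 0 else if i < a + b then 1 else 2)" for i
  have Y: "?Ys ! i = D_op (lab i)" if "i < ?N" for i
    using that by (auto simp: lab_def D_op_def nth_append)
  have c: "{i\<in>{..<?N}. lab i = 0} = {..<a}" "{i\<in>{..<?N}. lab i = 1} = {a..<a + b}" "{i\<in>{..<?N}. lab i = 2} = {a + b..<?N}"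
    by (auto simp: lab_def)
  have "(\<Sum>\<tau> | \<tau> permutes {..<?N}. foldr (\<circ>) (map (\<lambda>i. ?Ys ! \<tau> i) [0..<?N]) id f x)
      = (\<Sum>\<tau> | \<tau> permutes {..<?N}. foldr (\<circ>) (map (\<lambda>i. D_op (lab i)) (map \<tau> [0..<?N])) id f x)"
  proof (intro sum.cong refl)
    fix \<tau> assume "\<tau> \<in> {\<tau>. \<tau> permutes {..<?N}}"
    then have "\<tau> i < ?N" if "i < ?N" for i using permutes_in_image[of \<tau> "{..<?N}" i] that by simp
    then have "map (\<lambda>i. ?Ys ! \<tau> i) [0..<?N] = map (\<lambda>i. D_op (lab i)) (map \<tau> [0..<?N])"
      using Y by simp
    then show "foldr (\<circ>) (map (\<lambda>i. ?Ys ! \<tau> i) [0..<?N]) id f x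
        = foldr (\<circ>) (map (\<lambda>i. D_op (lab i)) (map \<tau> [0..<?N])) id f x"
      by (simp only:)
  qed
  also have "\<dots> = (\<Sum>xs\<in>permutations_of_set {..<?N}. foldr (\<circ>) (map (\<lambda>i. D_op (lab i)) xs) id f x)"
    by (rule sum.reindex_bij_betw[OF bij_betw_permutations_list])
  also have "\<dots> = fact ?N * D_sym K a b n f x"
    using sum_words_eq_D_sym[OF f, of "{..<?N}" lab K x] K unfolding c by (simp add: lab_def)
  finally show ?thesis by (simp add: sym_prod_def add.assoc)
qed

text \<open>The n-th symmetrised term contributes to every power N = n + k of \<open>D3\<close>;
  collecting by N gives the triangular relation of the hypothesis.\<close>

lemma T_sym_eq_T_ord:
  assumes f: "smooth_on UNIV f"
    and q: "\<And>N. N \<le> min (fst \<alpha>) (snd \<alpha>) \<Longrightarrow> coeff r N = (\<Sum>n\<le>N. coeff q n * sym_coeff (fst \<alpha> - n) (snd \<alpha> - n) (N - n))"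
  shows "T_sym \<alpha> q f = T_ord \<alpha> r f"
proof
  fix x
  obtain A B where \<alpha>: "\<alpha> = (A, B)" by (cases \<alpha>)
  let ?m = "min A B"
  have "T_sym \<alpha> q f x = (\<Sum>n\<le>?m. coeff q n * D_sym (A + B) (A - n) (B - n) n f x)"
    unfolding T_sym_def \<alpha> atLeast0AtMost fst_conv snd_conv
    by (intro sum.cong refl arg_cong2[of _ _ _ _ "(*)"] sym_prod_eq_D_sym f) auto
  also have "\<dots> = (\<Sum>n\<le>?m. \<Sum>k\<le>?m - n. coeff q n * sym_coeff (A - n) (B - n) k * D_ord (A - (n + k)) (B - (n + k)) (n + k) f x)"
  proof (intro sum.cong refl)
    fix n assume n: "n \<in> {..?m}"
    have "D_sym (A + B) (A - n) (B - n) n f x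
       = (\<Sum>k\<le>?m - n. sym_coeff (A - n) (B - n) k * D_ord (A - n - k) (B - n - k) (n + k) f x)"
      unfolding D_sym_def by (rule sum.mono_neutral_right) (use n in \<open>auto intro!: sym_coeff_eq_0\<close>)
    then show "coeff q n * D_sym (A + B) (A - n) (B - n) n f x
      = (\<Sum>k\<le>?m - n. coeff q n * sym_coeff (A - n) (B - n) k * D_ord (A - (n + k)) (B - (n + k)) (n + k) f x)"
      by (simp add: sum_distrib_left mult.assoc)
  qed
  also have "\<dots> = (\<Sum>N\<le>?m. \<Sum>n\<le>N. coeff q n * sym_coeff (A - n) (B - n) (N - n) * D_ord (A - N) (B - N) N f x)"
    unfolding sum.Sigma[OF finite_atMost ballI[OF finite_atMost]]
    by (rule sum.reindex_bij_witness[of _ "\<lambda>(N, n). (n, N - n)" "\<lambda>(n, k). (n + k, n)"]) auto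
  also have "\<dots> = (\<Sum>N\<le>?m. coeff r N * D_ord (A - N) (B - N) N f x)"
    using q by (intro sum.cong refl) (simp add: \<alpha> sum_distrib_right)
  also have "\<dots> = T_ord \<alpha> r f x"
    by (simp add: T_ord_def \<alpha> D_ord_def atLeast0AtMost)
  finally show "T_sym \<alpha> q f x = T_ord \<alpha> r f x" .
qed

section \<open>The lower unipotent cell and the principal series\<close>

text \<open>Matrix entries as coordinates. In contrast to \<open>cell3\<close> this chart is affine, so iterated derivatives
  in the chart are iterated derivatives of the function on the matrices in constant directions.\<close>

definition uch :: "real^3 \<Rightarrow> real^3^3" where
  "uch x = vector [vector [1, 0, 0], vector [x$1, 1, 0], vector [x$3, x$2, 1]]"

definition duch :: "real^3 \<Rightarrow> real^3^3" where
  "duch x = vector [vector [0, 0, 0], vector [x$1, 0, 0], vector [x$3, x$2, 0]]"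

definition upper3 :: "real^3 \<Rightarrow> real \<Rightarrow> real \<Rightarrow> real \<Rightarrow> real^3^3" where
  "upper3 t a b c = vector [vector [t$1, a, b], vector [0, t$2, c], vector [0, 0, t$3]]"

lemma matrix_mult_3: "(A ** B) $ i $ j = A$i$1 * B$1$j + A$i$2 * B$2$j + A$i$3 * (B$3$j :: real)"
  for A :: "real^3^'m" by (simp add: matrix_matrix_mult_def sum_3)

lemma matrix_mult_2: "(A ** B) $ i $ j = A$i$1 * B$1$j + A$i$2 * (B$2$j :: real)"
  for A :: "real^2^'m" by (simp add: matrix_matrix_mult_def sum_2)

lemma mat3_eq_iff: "A = B \<longleftrightarrow> (A$1$1 = B$1$1 \<and> A$1$2 = B$1$2 \<and> A$1$3 = B$1$3) \<and>
   (A$2$1 = B$2$1 \<and> A$2$2 = B$2$2 \<and> A$2$3 = B$2$3) \<and> (A$3$1 = B$3$1 \<and> A$3$2 = B$3$2 \<and> A$3$3 = B$3$3)"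
  for A B :: "real^3^3"
  by (simp add: vec_eq_iff forall_3)

lemma mat2_eq_iff: "A = B \<longleftrightarrow> A$1$1 = B$1$1 \<and> A$1$2 = B$1$2 \<and> A$2$1 = B$2$1 \<and> A$2$2 = B$2$2"
  for A B :: "real^2^2"
  by (auto simp add: vec_eq_iff forall_2)

lemma mat_entries [simp]:
  "(mat a :: real^3^3) $ i $ j = (if i = j then a else 0)" "(mat a :: real^2^2) $ k $ l = (if k = l then a else 0)"
  by (simp_all add: mat_def)

lemma numeral3_distinct [simp]: "(1::3) \<noteq> 2" "(1::3) \<noteq> 3" "(2::3) \<noteq> 3" "(2::3) \<noteq> 1" "(3::3) \<noteq> 1" "(3::3) \<noteq> 2"
  "(1::2) \<noteq> 2" "(2::2) \<noteq> 1"
  by simp_all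

lemma uch_entries [simp]:
  "uch x $ 1 $ 1 = 1" "uch x $ 1 $ 2 = 0" "uch x $ 1 $ 3 = 0"
  "uch x $ 2 $ 1 = x$1" "uch x $ 2 $ 2 = 1" "uch x $ 2 $ 3 = 0"
  "uch x $ 3 $ 1 = x$3" "uch x $ 3 $ 2 = x$2" "uch x $ 3 $ 3 = 1"
  by (simp_all add: uch_def)

lemma duch_entries [simp]:
  "duch x $ 1 $ i = 0" "duch x $ 2 $ 1 = x$1" "duch x $ 2 $ 2 = 0" "duch x $ 2 $ 3 = 0"
  "duch x $ 3 $ 1 = x$3" "duch x $ 3 $ 2 = x$2" "duch x $ 3 $ 3 = 0"
  using exhaust_3[of i] by (auto simp: duch_def)

lemma upper3_entries [simp]:
  "upper3 t a b c $ 1 $ 1 = t$1" "upper3 t a b c $ 1 $ 2 = a" "upper3 t a b c $ 1 $ 3 = b"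
  "upper3 t a b c $ 2 $ 1 = 0" "upper3 t a b c $ 2 $ 2 = t$2" "upper3 t a b c $ 2 $ 3 = c"
  "upper3 t a b c $ 3 $ 1 = 0" "upper3 t a b c $ 3 $ 2 = 0" "upper3 t a b c $ 3 $ 3 = t$3"
  by (simp_all add: upper3_def)

lemma iota3_entries [simp]:
  "iota3 h $ 1 $ 1 = h$1$1" "iota3 h $ 1 $ 2 = 0" "iota3 h $ 1 $ 3 = h$1$2"
  "iota3 h $ 2 $ 1 = 0" "iota3 h $ 2 $ 2 = 1" "iota3 h $ 2 $ 3 = 0"
  "iota3 h $ 3 $ 1 = h$2$1" "iota3 h $ 3 $ 2 = 0" "iota3 h $ 3 $ 3 = h$2$2"
  by (simp_all add: iota3_def)

lemma iota3_mult: "iota3 (g ** h) = iota3 g ** iota3 h"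
  by (simp add: mat3_eq_iff matrix_mult_3 matrix_mult_2)

lemma iota3_1 [simp]: "iota3 (mat 1) = mat 1"
  by (simp add: mat3_eq_iff)

lemma GL_iff_det: "g \<in> GL \<longleftrightarrow> det g \<noteq> 0" for g :: "real^'n^'n"
  by (simp add: GL_def invertible_det_nz)

lemma det_iota3: "det (iota3 h) = det h"
  by (simp add: det_3 det_2)

lemma iota3_GL [simp]: "iota3 h \<in> GL \<longleftrightarrow> h \<in> GL"
  by (simp add: GL_iff_det det_iota3)

lemma uch_GL [simp]: "uch x \<in> GL"
  by (simp add: GL_iff_det det_3)

lemma mult_GL: "g \<in> GL \<Longrightarrow> h \<in> GL \<Longrightarrow> g ** h \<in> (GL :: (real^'n^'n) set)"
  by (simp add: GL_iff_det det_mul)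

lemma mult_GL_iff: "g \<in> GL \<Longrightarrow> g ** h \<in> GL \<longleftrightarrow> h \<in> (GL :: (real^'n^'n) set)"
  by (simp add: GL_iff_det det_mul)

lemma mat_1_GL [simp]: "mat 1 \<in> (GL :: (real^'n^'n) set)"
  by (simp add: GL_iff_det)

lemma open_GL: "open (GL :: (real^'n^'n) set)"
proof -
  have "continuous_on UNIV (det :: real^'n^'n \<Rightarrow> real)"
    unfolding det_def by (intro continuous_intros)
  then have "open (det -` (- {0}) :: (real^'n^'n) set)"
    by (intro open_vimage open_Compl) auto
  moreover have "det -` (- {0}) = (GL :: (real^'n^'n) set)" by (auto simp: GL_iff_det)
  ultimately show ?thesis by simp
qed

lemma matrix_inv_GL:
  fixes h :: "real^'n^'n"
  assumes "h \<in> GL"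
  shows "matrix_inv h \<in> GL" "h ** matrix_inv h = mat 1" "matrix_inv h ** h = mat 1"
proof -
  have "\<exists>A'. h ** A' = mat 1 \<and> A' ** h = mat 1" using assms by (simp add: GL_def invertible_def)
  then have inv: "h ** matrix_inv h = mat 1 \<and> matrix_inv h ** h = mat 1"
    unfolding matrix_inv_def by (rule someI_ex)
  then show "h ** matrix_inv h = mat 1" "matrix_inv h ** h = mat 1" by simp_all
  show "matrix_inv h \<in> GL" using inv unfolding GL_def invertible_def by blast
qed

lemma funpow_matrix_nilpotent:
  assumes "X ** (X ** X) = (0 :: real^'n^'n)" "k \<ge> 3"
  shows "((\<lambda>Y. X ** Y) ^^ k) (mat 1) = 0"
proof -
  have "((\<lambda>Y. X ** Y) ^^ (m + 3)) (mat 1) = 0" for m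
    using assms(1) by (induction m) (simp_all add: numeral_3_eq_3)
  from this[of "k - 3"] show ?thesis using assms(2) by simp
qed

lemma mat_exp_nilpotent:
  assumes "X ** (X ** X) = (0 :: real^'n^'n)"
  shows "mat_exp X = mat 1 + X + (1 / 2) *\<^sub>R (X ** X)"
proof -
  have "mat_exp X = (\<Sum>k<3. (1 / fact k) *\<^sub>R (((\<lambda>Y. X ** Y) ^^ k) (mat 1)))"
    unfolding mat_exp_def by (rule suminf_finite) (auto simp: funpow_matrix_nilpotent[OF assms])
  then show ?thesis by (simp add: numeral_3_eq_3 eval_nat_numeral)
qed

text \<open>The square of the exponent has the single entry x1 x2 in the lower left corner, and half
  of it is the shear between the two charts.\<close>

lemma cell3_eq: "cell3 x = uch (kap_inv x)"
proof -
  let ?X = "x$1 *\<^sub>R unit_mat 2 1 + x$2 *\<^sub>R unit_mat 3 2 + x$3 *\<^sub>R unit_mat 3 1 :: real^3^3"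
  have "?X ** (?X ** ?X) = 0" by (simp add: mat3_eq_iff matrix_mult_3 unit_mat_def)
  then show ?thesis
    unfolding cell3_def by (simp add: mat_exp_nilpotent mat3_eq_iff matrix_mult_3 unit_mat_def)
qed

lemma cell2_eq: "cell2 t = vector [vector [1, 0], vector [t, 1]]"
proof -
  let ?X = "t *\<^sub>R unit_mat 2 1 :: real^2^2"
  have "?X ** (?X ** ?X) = 0" by (simp add: mat2_eq_iff matrix_mult_2 unit_mat_def)
  then show ?thesis
    unfolding cell2_def by (simp add: mat_exp_nilpotent mat2_eq_iff matrix_mult_2 unit_mat_def)
qed

lemma cell2_GL [simp]: "cell2 t \<in> GL"
  by (simp add: GL_iff_det cell2_eq det_2)

lemma cell2_0 [simp]: "cell2 0 = mat 1"
  by (simp add: cell2_eq mat2_eq_iff)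

text \<open>In affine coordinates the cell of the subgroup acts by translation along the axis, so
  statements at the origin transfer to every \<open>axis3 t\<close>.\<close>

lemma iota3_cell2_uch: "iota3 (cell2 t) ** uch x = uch (x + axis3 t)"
  by (simp add: mat3_eq_iff matrix_mult_3 cell2_eq axis3_def)

lemma uch_0 [simp]: "uch 0 = mat 1"
  by (simp add: mat3_eq_iff)

lemma uch_affine: "uch x = duch x + mat 1"
  by (simp add: mat3_eq_iff)

lemma bounded_linear_duch: "bounded_linear duch"
  unfolding linear_conv_bounded_linear[symmetric]
  by (rule linearI) (simp_all add: mat3_eq_iff)

lemma smooth_on_uch: "smooth_on UNIV uch"
  unfolding uch_affine[abs_def] by (rule smooth_on_affine[OF bounded_linear_duch open_UNIV])

lemma bounded_linear_matrix_left: "bounded_linear (\<lambda>g. A ** g :: real^'n^'n)"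
  unfolding linear_conv_bounded_linear[symmetric]
  by (rule linearI) (simp_all add: vec_eq_iff matrix_matrix_mult_def sum_distrib_left sum.distrib distrib_left mult_ac)

text \<open>The inducing character, as a function of the diagonal of an upper triangular matrix.\<close>

definition chr :: "bit^'n \<Rightarrow> complex^'n \<Rightarrow> real^'n \<Rightarrow> complex" where
  "chr \<xi> lam t = (\<Prod>j\<in>UNIV. complex_of_real (sgn (t $ j)) powi (- of_bool (\<xi> $ j = 1))) *
     (\<Prod>j\<in>UNIV. complex_of_real \<bar>t $ j\<bar> powr (- (lam $ j)))"

lemma princ_series_smooth: "f \<in> princ_series N \<xi> lam \<Longrightarrow> smooth_on GL f"
  by (simp add: princ_series_def)

lemma princ_series_zero: "f \<in> princ_series N \<xi> lam \<Longrightarrow> g \<notin> GL \<Longrightarrow> f g = 0"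
  by (simp add: princ_series_def)

lemma I_ser_smooth: "f \<in> I_ser \<xi> lam \<Longrightarrow> smooth_on GL f"
  by (simp add: I_ser_def princ_series_smooth)

lemma I_ser_equivariant:
  assumes f: "f \<in> I_ser \<xi> lam" and g: "g \<in> GL" and t: "t$1 \<noteq> 0" "t$2 \<noteq> 0" "t$3 \<noteq> 0"
  shows "f (g ** upper3 t a b c) = chr \<xi> lam t * f g"
proof -
  let ?m = "(\<chi> j. sgn (t $ j)) :: real^3" and ?a = "(\<chi> j. \<bar>t $ j\<bar>) :: real^3"
  let ?n = "vector [vector [1, a / t$1, b / t$1], vector [0, 1, c / t$2], vector [0, 0, 1]] :: real^3^3"
  have "upper3 t a b c = diag_mat ?m ** diag_mat ?a ** ?n"
    using t by (simp add: mat3_eq_iff matrix_mult_3 diag_mat_def sgn_mult_abs)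
  then have e: "g ** upper3 t a b c = g ** diag_mat ?m ** diag_mat ?a ** ?n"
    by (simp add: matrix_mul_assoc)
  have "?n \<in> unip3" unfolding unip3_def by blast
  moreover have "t $ j \<noteq> 0" for j using t exhaust_3[of j] by auto
  then have "\<forall>j. ?m $ j \<in> {1, - 1}" "\<forall>j. ?a $ j > 0" by (auto simp: sgn_if)
  ultimately have "f (g ** diag_mat ?m ** diag_mat ?a ** ?n) =
     (\<Prod>j\<in>UNIV. complex_of_real (?m $ j) powi (- of_bool (\<xi> $ j = 1))) *
     (\<Prod>j\<in>UNIV. complex_of_real (?a $ j) powr (- (lam $ j))) * f g"
    using f g unfolding I_ser_def princ_series_def by blast
  then show ?thesis unfolding e chr_def by simp
qed

lemma princ_series_translate:
  fixes A :: "real^'n^'n"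
  assumes f: "f \<in> princ_series N \<xi> lam" and A: "A \<in> GL"
  shows "(\<lambda>g. f (A ** g)) \<in> princ_series N \<xi> lam"
proof -
  have "smooth_on GL (\<lambda>g. f (A ** g))"
    by (rule smooth_on_compose[OF open_GL open_GL smooth_on_linear[OF open_GL bounded_linear_matrix_left] princ_series_smooth[OF f]])
      (simp add: mult_GL[OF A])
  moreover have "f (A ** g) = 0" if "g \<notin> GL" for g
    using princ_series_zero[OF f] that by (simp add: mult_GL_iff[OF A])
  moreover have "f (A ** (g ** diag_mat m ** diag_mat a ** n)) =
     (\<Prod>j\<in>UNIV. complex_of_real (m $ j) powi (- of_bool (\<xi> $ j = 1))) *
     (\<Prod>j\<in>UNIV. complex_of_real (a $ j) powr (- (lam $ j))) * f (A ** g)"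
    if "g \<in> GL" "\<forall>j. m $ j \<in> {1, - 1}" "\<forall>j. a $ j > 0" "n \<in> N" for g m a n
  proof -
    have "A ** (g ** diag_mat m ** diag_mat a ** n) = (A ** g) ** diag_mat m ** diag_mat a ** n"
      by (simp add: matrix_mul_assoc)
    then show ?thesis using f that mult_GL[OF A that(1)] unfolding princ_series_def by auto
  qed
  ultimately show ?thesis unfolding princ_series_def by blast
qed

lemma princ_series_lincomb:
  assumes "\<And>i. i \<in> I \<Longrightarrow> f i \<in> princ_series N \<xi> lam"
  shows "(\<lambda>g. \<Sum>i\<in>I. c i * f i g) \<in> princ_series N \<xi> lam"
proof -
  have "smooth_on GL (\<lambda>g. \<Sum>i\<in>I. c i * f i g)"
    by (intro smooth_on_sum smooth_on_mult smooth_on_const open_GL princ_series_smooth[OF assms])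
  moreover have "(\<Sum>i\<in>I. c i * f i g) = 0" if "g \<notin> GL" for g
    using princ_series_zero[OF assms that] by simp
  moreover have "(\<Sum>i\<in>I. c i * f i (g ** diag_mat m ** diag_mat a ** n)) =
     (\<Prod>j\<in>UNIV. complex_of_real (m $ j) powi (- of_bool (\<xi> $ j = 1))) *
     (\<Prod>j\<in>UNIV. complex_of_real (a $ j) powr (- (lam $ j))) * (\<Sum>i\<in>I. c i * f i g)"
    if "g \<in> GL \<and> (\<forall>j. m $ j \<in> {1, - 1}) \<and> (\<forall>j. a $ j > 0) \<and> n \<in> N" for g m a n
    unfolding sum_distrib_left
  proof (intro sum.cong refl)
    fix i assume "i \<in> I"
    then have "f i (g ** diag_mat m ** diag_mat a ** n) =
     (\<Prod>j\<in>UNIV. complex_of_real (m $ j) powi (- of_bool (\<xi> $ j = 1))) *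
     (\<Prod>j\<in>UNIV. complex_of_real (a $ j) powr (- (lam $ j))) * f i g"
      using assms that unfolding princ_series_def by blast
    then show "c i * f i (g ** diag_mat m ** diag_mat a ** n) =
     (\<Prod>j\<in>UNIV. complex_of_real (m $ j) powi (- of_bool (\<xi> $ j = 1))) *
     (\<Prod>j\<in>UNIV. complex_of_real (a $ j) powr (- (lam $ j))) * (c i * f i g)"
      by (simp only: mult.left_commute)
  qed
  ultimately show ?thesis
    unfolding princ_series_def by blast
qed

lemma I_ser_translate: "f \<in> I_ser \<xi> lam \<Longrightarrow> A \<in> GL \<Longrightarrow> (\<lambda>g. f (A ** g)) \<in> I_ser \<xi> lam"
  unfolding I_ser_def by (rule princ_series_translate)

lemma I_ser_lincomb: "(\<And>i. i \<in> I \<Longrightarrow> f i \<in> I_ser \<xi> lam) \<Longrightarrow> (\<lambda>g. \<Sum>i\<in>I. c i * f i g) \<in> I_ser \<xi> lam"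
  unfolding I_ser_def by (rule princ_series_lincomb)

lemma I_ser_add:
  assumes "f \<in> I_ser \<xi> lam" "g \<in> I_ser \<xi> lam"
  shows "(\<lambda>x. f x + g x) \<in> I_ser \<xi> lam"
proof -
  have "(if u then f else g) \<in> I_ser \<xi> lam" for u using assms by simp
  from I_ser_lincomb[of "UNIV :: bool set" "\<lambda>u. if u then f else g" \<xi> lam "\<lambda>_. 1", OF this]
  show ?thesis by (simp add: UNIV_bool add.commute)
qed

lemma smooth_on_I_ser_uch:
  assumes "f \<in> I_ser \<xi> lam" "A \<in> GL"
  shows "smooth_on UNIV (\<lambda>x. f (A ** uch x))"
  by (rule smooth_on_compose[OF open_UNIV open_GL smooth_on_uch I_ser_smooth[OF I_ser_translate[OF assms]]]) simp

lemma smooth_on_I_ser_uch1: "f \<in> I_ser \<xi> lam \<Longrightarrow> smooth_on UNIV (\<lambda>x. f (uch x))"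
  by (rule smooth_on_compose[OF open_UNIV open_GL smooth_on_uch I_ser_smooth]) simp_all

section \<open>Equivariant functions with prescribed jets\<close>

definition minor :: "3 \<Rightarrow> 3 \<Rightarrow> real^3^3 \<Rightarrow> real" where
  "minor i j g = g$i$1 * g$j$2 - g$i$2 * g$j$1"

text \<open>\<open>qcol\<close> and \<open>qminor\<close> are squared Euclidean norms, of the first
  column and of the wedge of the first two columns. They are positive on all of \<open>GL\<close>,
  so their complex powers are smooth there; powers of single entries would not be.\<close>

definition qcol :: "real^3^3 \<Rightarrow> real" where
  "qcol g = (g$1$1)\<^sup>2 + (g$2$1)\<^sup>2 + (g$3$1)\<^sup>2"

definition qminor :: "real^3^3 \<Rightarrow> real" where
  "qminor g = (minor 1 2 g)\<^sup>2 + (minor 1 3 g)\<^sup>2 + (minor 2 3 g)\<^sup>2"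

lemma det_minor: "det (g :: real^3^3) = g$1$3 * minor 2 3 g - g$2$3 * minor 1 3 g + g$3$3 * minor 1 2 g"
  by (simp add: det_3 minor_def algebra_simps)

lemma qcol_pos: "g \<in> GL \<Longrightarrow> qcol g > 0"
proof (rule ccontr)
  assume g: "g \<in> GL" and "\<not> qcol g > 0"
  then have "g$1$1 = 0 \<and> g$2$1 = 0 \<and> g$3$1 = 0"
    unfolding qcol_def by (smt (verit) zero_le_power2 zero_less_power2 power2_eq_iff)
  then show False using g by (simp add: GL_iff_det det_3)
qed

lemma qminor_pos: "g \<in> GL \<Longrightarrow> qminor g > 0"
proof (rule ccontr)
  assume g: "g \<in> GL" and "\<not> qminor g > 0"
  then have "minor 1 2 g = 0 \<and> minor 1 3 g = 0 \<and> minor 2 3 g = 0"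
    unfolding qminor_def by (smt (verit) zero_le_power2 zero_less_power2)
  then show False using g by (simp add: GL_iff_det det_minor)
qed

lemma smooth_on_entry: "open S \<Longrightarrow> smooth_on S (\<lambda>g :: real^3^3. g $ i $ j)"
  by (intro smooth_on_vec_nth smooth_on_ident)

lemma smooth_on_minor: "open S \<Longrightarrow> smooth_on S (minor i j)"
  unfolding minor_def[abs_def] by (intro smooth_intros)

lemma smooth_on_det3: "open S \<Longrightarrow> smooth_on S (det :: real^3^3 \<Rightarrow> real)"
  unfolding det_minor[abs_def] by (intro smooth_intros smooth_on_minor)

lemma smooth_on_q: "open S \<Longrightarrow> smooth_on S qcol" "open S \<Longrightarrow> smooth_on S qminor"
  unfolding qcol_def[abs_def] qminor_def[abs_def] by (intro smooth_intros smooth_on_minor; assumption)+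

lemma prod_UNIV_3: "(\<Prod>j\<in>UNIV. E j) = E 1 * E 2 * E 3" for E :: "3 \<Rightarrow> complex"
  unfolding UNIV_3 by (simp add: mult.assoc)

lemma powr_of_real_exp: "x > 0 \<Longrightarrow> complex_of_real x powr z = exp (z * of_real (ln x))"
  by (simp add: powr_def Ln_of_real)

lemma of_real_exp_ln: "x > 0 \<Longrightarrow> complex_of_real x = exp (of_real (ln x))"
  using powr_of_real_exp[of x 1] by simp

lemma powr_of_real_mult: "x > 0 \<Longrightarrow> y > 0 \<Longrightarrow> complex_of_real (x * y) powr z = complex_of_real x powr z * complex_of_real y powr z"
  using powr_of_real_exp[of "x * y" z]
  by (simp add: powr_of_real_exp ln_mult distrib_left exp_add[symmetric] del: of_real_mult)

text \<open>The even part 2 k of the exponents drops out. The parities solve a triangular system: e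
  for the third sign, e2 + e for the second, e1 + e2 + e for the first.\<close>

lemma sign_character:
  fixes \<xi> :: "bit^3" and m :: "real^3"
  assumes m: "\<forall>j. m $ j \<in> {1, - 1}"
    and e: "e1 = (if \<xi>$1 = \<xi>$2 then 0 else 1)" "e2 = (if \<xi>$2 = \<xi>$3 then 0 else 1)" "e = (if \<xi>$3 = 1 then 1 else 0)"
  shows "complex_of_real (m$1 ^ (2 * k + e1) * (m$1 * m$2) ^ (2 * k + e2) * (m$1 * m$2 * m$3) ^ e)
    = (\<Prod>j\<in>UNIV. complex_of_real (m $ j) powi (- of_bool (\<xi> $ j = 1)))"
proof -
  have sq: "(m$1)\<^sup>2 = 1" "(m$2)\<^sup>2 = 1" "(m$3)\<^sup>2 = 1"
    using m by (metis empty_iff insert_iff power2_minus power_one)+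
  have "m$1 ^ (2 * k + e1) = m$1 ^ e1" "(m$1 * m$2) ^ (2 * k + e2) = (m$1 * m$2) ^ e2"
    by (simp_all add: power_add power_mult power_mult_distrib sq)
  then have "complex_of_real (m$1 ^ (2 * k + e1) * (m$1 * m$2) ^ (2 * k + e2) * (m$1 * m$2 * m$3) ^ e)
     = complex_of_real (m$1 ^ e1 * (m$1 * m$2) ^ e2 * (m$1 * m$2 * m$3) ^ e)" by simp
  also have "\<dots> = (\<Prod>j\<in>UNIV. complex_of_real (m $ j) powi (- of_bool (\<xi> $ j = 1)))"
  proof -
    have mm: "m$1 = 1 \<or> m$1 = - 1" "m$2 = 1 \<or> m$2 = - 1" "m$3 = 1 \<or> m$3 = - 1" using m by auto
    show ?thesis
      unfolding e UNIV_3
      by (cases "\<xi>$1"; cases "\<xi>$2"; cases "\<xi>$3"; simp add: power_int_minus; use mm in auto)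
  qed
  finally show ?thesis .
qed

text \<open>The exponents satisfy N1 + 2 s1 = lam2 - lam1, N2 + 2 s2 = lam3 - lam2 and e + 2 s3 = -
  lam3, so the exponents of a1, a2, a3 telescope to - lam1, - lam2, - lam3.\<close>

lemma magnitude_character:
  fixes a :: "real^3" and lam :: "complex^3"
  assumes a: "\<forall>j. a $ j > 0"
    and s: "s1 = - (lam$1 - lam$2 + of_nat N1) / 2" "s2 = - (lam$2 - lam$3 + of_nat N2) / 2" "s3 = - (lam$3 + of_nat e) / 2"
  shows "complex_of_real (a$1 ^ N1 * (a$1 * a$2) ^ N2 * (a$1 * a$2 * a$3) ^ e)
     * complex_of_real ((a$1)\<^sup>2) powr s1 * complex_of_real ((a$1 * a$2)\<^sup>2) powr s2 * complex_of_real ((a$1 * a$2 * a$3)\<^sup>2) powr s3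
    = (\<Prod>j\<in>UNIV. complex_of_real (a $ j) powr (- (lam $ j)))"
proof -
  have p: "a$1 > 0" "a$2 > 0" "a$3 > 0" using a by auto
  define L where "L j = complex_of_real (ln (a$j))" for j
  have pw: "complex_of_real (x ^ N) = exp (of_nat N * of_real (ln x))" if "x > 0" for x N
    using of_real_exp_ln[OF that] by (simp add: exp_of_nat_mult)
  have l: "complex_of_real (ln (a$1)) = L 1" "complex_of_real (ln (a$1 * a$2)) = L 1 + L 2"
     "complex_of_real (ln (a$1 * a$2 * a$3)) = L 1 + L 2 + L 3"
    using p by (simp_all add: L_def ln_mult)
  have sq: "complex_of_real (x\<^sup>2) powr z = exp (z * (2 * of_real (ln x)))" if "x > 0" for x z
    using powr_of_real_exp[of "x\<^sup>2" z] that by (simp add: ln_realpow del: of_real_power)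
  have p2: "a$1 * a$2 > 0" "a$1 * a$2 * a$3 > 0" using p by simp_all
  have "complex_of_real (a$1 ^ N1 * (a$1 * a$2) ^ N2 * (a$1 * a$2 * a$3) ^ e)
     * complex_of_real ((a$1)\<^sup>2) powr s1 * complex_of_real ((a$1 * a$2)\<^sup>2) powr s2 * complex_of_real ((a$1 * a$2 * a$3)\<^sup>2) powr s3
    = exp (of_nat N1 * L 1) * exp (of_nat N2 * (L 1 + L 2)) * exp (of_nat e * (L 1 + L 2 + L 3))
      * exp (s1 * (2 * L 1)) * exp (s2 * (2 * (L 1 + L 2))) * exp (s3 * (2 * (L 1 + L 2 + L 3)))"
    unfolding sq[OF p(1)] sq[OF p2(1)] sq[OF p2(2)] of_real_mult[of "_ * _" "_ ^ e"] of_real_mult[of "_ ^ N1" "_ ^ N2"]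
      pw[OF p(1), of N1] pw[OF p2(1), of N2] pw[OF p2(2), of e] l ..
  also have "\<dots> = exp (- (lam$1) * L 1 + - (lam$2) * L 2 + - (lam$3) * L 3)"
    unfolding exp_add[symmetric] s by (rule arg_cong[of _ _ exp]) (simp add: field_simps)
  also have "\<dots> = (\<Prod>j\<in>{1, 2, 3}. exp (- (lam$j) * L j))"
  proof -
    have "(\<Prod>j\<in>{1, 2, 3}. E j) = E 1 * E 2 * E 3" for E :: "3 \<Rightarrow> complex"
      by (simp add: mult.assoc)
    then show ?thesis by (simp only: exp_add)
  qed
  also have "\<dots> = (\<Prod>j\<in>UNIV. complex_of_real (a $ j) powr (- (lam $ j)))"
    unfolding UNIV_3[symmetric] L_def by (intro prod.cong refl powr_of_real_exp[symmetric]) (use a in simp)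
  finally show ?thesis .
qed

text \<open>Homogenisation: the coordinates of \<open>uch\<close> are quotients of entries of the first column and of
  minors of the first two columns, so a polynomial in them becomes equivariant after multiplication
  with powers of the norms \<open>qcol\<close>, \<open>qminor\<close> and of the determinant.\<close>

lemma exists_I_ser_polynomial:
  fixes \<xi> :: "bit^3" and lam :: "complex^3"
  shows "\<exists>s1 s2. \<forall>c. \<exists>f\<in>I_ser \<xi> lam. \<forall>x. f (uch x) =
    complex_of_real (qcol (uch x)) powr s1 * complex_of_real (qminor (uch x)) powr s2 *
    (\<Sum>(i, j, l)\<in>{..k} \<times> {..k} \<times> {..k}. c i j l * monom3 i j l x)"
proof -
  define e1 :: nat where "e1 = (if \<xi>$1 = \<xi>$2 then 0 else 1)"
  define e2 :: nat where "e2 = (if \<xi>$2 = \<xi>$3 then 0 else 1)"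
  define e :: nat where "e = (if \<xi>$3 = 1 then 1 else 0)"
  \<comment> \<open>Degree 2 k leaves room for i + l column entries and for j minors with i, j, l
    \<le> k; being even, it does not disturb the signs fixed by e1 and e2.\<close>
  define N1 where "N1 = 2 * k + e1"
  define N2 where "N2 = 2 * k + e2"
  define s1 where "s1 = - (lam$1 - lam$2 + of_nat N1) / 2"
  define s2 where "s2 = - (lam$2 - lam$3 + of_nat N2) / 2"
  define s3 where "s3 = - (lam$3 + of_nat e) / 2"
  \<comment> \<open>Homogeneous of degree N1 in the first column, N2 in the minors and e in the
    determinant. On \<open>uch x\<close> the homogenising factors are 1 and the monomial
    remains.\<close>
  define mo where "mo i j l g = complex_of_real (g$2$1 ^ i * g$3$1 ^ l * g$1$1 ^ (N1 - i - l)
      * minor 1 3 g ^ j * minor 1 2 g ^ (N2 - j) * det g ^ e)" for i j l and g :: "real^3^3"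
  define P where "P c g = (\<Sum>t\<in>{..k} \<times> {..k} \<times> {..k}. c (fst t) (fst (snd t)) (snd (snd t)) * mo (fst t) (fst (snd t)) (snd (snd t)) g)"
    for c g
  define W where "W g = complex_of_real (qcol g) powr s1 * complex_of_real (qminor g) powr s2 * complex_of_real ((det g)\<^sup>2) powr s3" for g :: "real^3^3"
  define F where "F c g = (if g \<in> GL then P c g * W g else 0)" for c g
  have F_I: "F c \<in> I_ser \<xi> lam" for c
    unfolding I_ser_def princ_series_def
  proof (intro CollectI conjI allI impI)
    have "smooth_on GL (\<lambda>g. P c g * W g)"
      unfolding P_def mo_def W_def
      by (intro smooth_on_mult smooth_on_sum smooth_on_const smooth_on_of_real smooth_on_power smooth_on_entry
          smooth_on_minor smooth_on_det3 smooth_on_powr smooth_on_q open_GL)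
        (simp_all add: qcol_pos qminor_pos GL_iff_det)
    then show "smooth_on GL (F c)"
      by (rule smooth_on_cong[OF open_GL, rotated]) (simp add: F_def)
    show "F c g = 0" if "g \<notin> GL" for g using that by (simp add: F_def)
    fix g :: "real^3^3" and m a :: "real^3" and n
    assume H: "g \<in> GL \<and> (\<forall>j. m $ j \<in> {1, - 1}) \<and> (\<forall>j. a $ j > 0) \<and> n \<in> unip3"
    then obtain u v w where n: "n = vector [vector [1, u, v], vector [0, 1, w], vector [0, 0, 1]]"
      unfolding unip3_def by blast
    have g: "g \<in> GL" and m: "\<forall>j. m $ j \<in> {1, - 1}" and a: "\<forall>j. a $ j > 0" using H by auto
    have m2: "(m$j)\<^sup>2 = 1" for j using m by (metis empty_iff insert_iff power2_minus power_one)
    have ap: "a$1 > 0" "a$2 > 0" "a$3 > 0" using a by auto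
    let ?g = "g ** diag_mat m ** diag_mat a ** n"
    define t1 where "t1 = m$1 * a$1"
    define t2 where "t2 = m$1 * m$2 * (a$1 * a$2)"
    define t3 where "t3 = m$1 * m$2 * m$3 * (a$1 * a$2 * a$3)"
    have c1: "?g $ i $ 1 = t1 * g $ i $ 1" for i
      by (simp add: n matrix_mult_3 diag_mat_def t1_def)
    have mi: "minor i j ?g = t2 * minor i j g" for i j
      by (simp add: n minor_def matrix_mult_3 diag_mat_def t2_def algebra_simps)
    have d: "det ?g = t3 * det g"
      by (simp add: det_mul) (simp add: n det_3 diag_mat_def t3_def)
    have g': "?g \<in> GL" using d g m ap by (auto simp: GL_iff_det t3_def) (metis m2 power_zero_numeral zero_neq_one)+
    have q: "qcol ?g = (a$1)\<^sup>2 * qcol g" "qminor ?g = (a$1 * a$2)\<^sup>2 * qminor g" "(det ?g)\<^sup>2 = (a$1 * a$2 * a$3)\<^sup>2 * (det g)\<^sup>2"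
      unfolding qcol_def qminor_def c1 mi d t1_def t2_def t3_def power_mult_distrib m2 by (simp_all add: algebra_simps)
    have W: "W ?g = complex_of_real ((a$1)\<^sup>2) powr s1 * complex_of_real ((a$1 * a$2)\<^sup>2) powr s2
        * complex_of_real ((a$1 * a$2 * a$3)\<^sup>2) powr s3 * W g"
    proof -
      have "(a$1)\<^sup>2 > 0" "(a$1 * a$2)\<^sup>2 > 0" "(a$1 * a$2 * a$3)\<^sup>2 > 0" "(det g)\<^sup>2 > 0"
        using ap g by (auto simp: GL_iff_det)
      then show ?thesis
        unfolding W_def q by (simp only: powr_of_real_mult qcol_pos[OF g] qminor_pos[OF g] mult_ac)
    qed
    have mo: "mo i j l ?g = complex_of_real (t1 ^ N1 * t2 ^ N2 * t3 ^ e) * mo i j l g" if "i \<le> k" "j \<le> k" "l \<le> k" for i j l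
    proof -
      have "N1 = i + l + (N1 - i - l)" "N2 = j + (N2 - j)" using that by (auto simp: N1_def N2_def)
      then have "t1 ^ N1 = t1 ^ i * t1 ^ l * t1 ^ (N1 - i - l)" "t2 ^ N2 = t2 ^ j * t2 ^ (N2 - j)"
        by (metis power_add)+
      then show ?thesis unfolding mo_def c1 mi d power_mult_distrib by (simp add: mult_ac)
    qed
    have P: "P c ?g = complex_of_real (t1 ^ N1 * t2 ^ N2 * t3 ^ e) * P c g"
      unfolding P_def sum_distrib_left by (intro sum.cong refl) (auto simp: mo mult_ac)
    have K: "complex_of_real (t1 ^ N1 * t2 ^ N2 * t3 ^ e)
       = complex_of_real (m$1 ^ N1 * (m$1 * m$2) ^ N2 * (m$1 * m$2 * m$3) ^ e)
         * complex_of_real (a$1 ^ N1 * (a$1 * a$2) ^ N2 * (a$1 * a$2 * a$3) ^ e)"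
      unfolding t1_def t2_def t3_def power_mult_distrib by (simp add: mult_ac)
    have "F c ?g = complex_of_real (m$1 ^ N1 * (m$1 * m$2) ^ N2 * (m$1 * m$2 * m$3) ^ e) *
       (complex_of_real (a$1 ^ N1 * (a$1 * a$2) ^ N2 * (a$1 * a$2 * a$3) ^ e)
        * complex_of_real ((a$1)\<^sup>2) powr s1 * complex_of_real ((a$1 * a$2)\<^sup>2) powr s2 * complex_of_real ((a$1 * a$2 * a$3)\<^sup>2) powr s3)
       * F c g"
      using g g' unfolding F_def P W K by (simp add: mult_ac)
    also have "\<dots> = (\<Prod>j\<in>UNIV. complex_of_real (m $ j) powi (- of_bool (\<xi> $ j = 1))) *
              (\<Prod>j\<in>UNIV. complex_of_real (a $ j) powr (- (lam $ j))) * F c g"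
      unfolding magnitude_character[OF a s1_def s2_def s3_def]
        sign_character[OF m e1_def e2_def e_def, of k, folded N1_def N2_def] ..
    finally show "F c ?g = (\<Prod>j\<in>UNIV. complex_of_real (m $ j) powi (- of_bool (\<xi> $ j = 1))) *
              (\<Prod>j\<in>UNIV. complex_of_real (a $ j) powr (- (lam $ j))) * F c g" .
  qed
  have "F c (uch x) = complex_of_real (qcol (uch x)) powr s1 * complex_of_real (qminor (uch x)) powr s2 *
    (\<Sum>(i, j, l)\<in>{..k} \<times> {..k} \<times> {..k}. c i j l * monom3 i j l x)" for c x
  proof -
    have "det (uch x) = 1" by (simp add: det_3)
    moreover have "mo i j l (uch x) = monom3 i j l x" for i j l
      unfolding mo_def monom3_def by (simp add: det_3 minor_def mult_ac)
    ultimately show ?thesis by (simp add: F_def P_def W_def case_prod_beta mult_ac)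
  qed
  then show ?thesis using F_I by blast
qed

text \<open>Divide the target by the nowhere vanishing weight, take the Taylor polynomial and
  homogenise it. The error is the weight times a Taylor remainder, hence flat.\<close>

lemma exists_I_ser_jet:
  assumes "smooth_on UNIV \<psi>"
  shows "\<exists>f\<in>I_ser \<xi> lam. flat k 0 (\<lambda>x. f (uch x) - \<psi> x)"
proof -
  obtain s1 s2 where s: "\<forall>c. \<exists>f\<in>I_ser \<xi> lam. \<forall>x. f (uch x) =
    complex_of_real (qcol (uch x)) powr s1 * complex_of_real (qminor (uch x)) powr s2 *
    (\<Sum>(i, j, l)\<in>{..k} \<times> {..k} \<times> {..k}. c i j l * monom3 i j l x)"
    using exists_I_ser_polynomial by blast
  define w where "w s1 s2 x = complex_of_real (qcol (uch x)) powr s1 * complex_of_real (qminor (uch x)) powr s2" for s1 s2 x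
  have w: "smooth_on UNIV (w s1 s2)" for s1 s2
    unfolding w_def
    by (intro smooth_on_mult smooth_on_powr open_UNIV
        smooth_on_compose[OF open_UNIV open_UNIV smooth_on_uch smooth_on_q(1)[OF open_UNIV]]
        smooth_on_compose[OF open_UNIV open_UNIV smooth_on_uch smooth_on_q(2)[OF open_UNIV]])
      (simp_all add: qcol_pos qminor_pos)
  have inv: "w s1 s2 x * w (- s1) (- s2) x = 1" for x
  proof -
    have "qcol (uch x) \<noteq> 0" "qminor (uch x) \<noteq> 0" using qcol_pos[of "uch x"] qminor_pos[of "uch x"] by auto
    then show ?thesis by (simp add: w_def powr_minus field_simps)
  qed
  define \<psi>' where "\<psi>' x = w (- s1) (- s2) x * \<psi> x" for x
  have \<psi>': "smooth_on UNIV \<psi>'"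
    unfolding \<psi>'_def by (intro smooth_on_mult w assms open_UNIV)
  obtain f where f: "f \<in> I_ser \<xi> lam" "\<And>x. f (uch x) = w s1 s2 x * taylor3 k \<psi>' x"
    using s[rule_format, of "\<lambda>i j l. pdm i j l \<psi>' 0 / (fact i * fact j * fact l)"] unfolding w_def taylor3_def by blast
  have "f (uch x) - \<psi> x = (- 1 * w s1 s2 x) * (\<psi>' x - taylor3 k \<psi>' x)" for x
  proof -
    have "\<psi> x = w s1 s2 x * \<psi>' x" using inv[of x] by (simp add: \<psi>'_def mult.assoc[symmetric])
    then show ?thesis by (simp add: f(2) algebra_simps)
  qed
  moreover have "flat k 0 (\<lambda>x. (- 1 * w s1 s2 x) * (\<psi>' x - taylor3 k \<psi>' x))"
    by (intro flat_mult[OF open_UNIV UNIV_I] smooth_on_mult smooth_on_const smooth_on_diff w \<psi>' smooth_on_taylor3 flat_taylor3 open_UNIV)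
  ultimately have "flat k 0 (\<lambda>x. f (uch x) - \<psi> x)" by (simp only:)
  then show ?thesis using f(1) by blast
qed

text \<open>Asking for positive instead of nonzero pivots gives an open neighbourhood of the
  identity on which the sign part of the character is trivial.\<close>

definition big_cell :: "(real^3^3) set" where
  "big_cell = {g. g$1$1 > 0 \<and> minor 1 2 g > 0 \<and> det g > 0}"

definition cell_coord :: "real^3^3 \<Rightarrow> real^3" where
  "cell_coord g = vector [g$2$1 / g$1$1, minor 1 3 g / minor 1 2 g, g$3$1 / g$1$1]"

lemma open_big_cell: "open big_cell"
proof -
  have "continuous_on UNIV (\<lambda>g :: real^3^3. g$1$1)" "continuous_on UNIV (minor 1 2)" "continuous_on UNIV (det :: real^3^3 \<Rightarrow> real)"
    by (intro smooth_on_continuous smooth_on_entry smooth_on_minor smooth_on_det3 open_UNIV)+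
  then have "open ({g. 0 < g$1$1} \<inter> {g. 0 < minor 1 2 g} \<inter> {g :: real^3^3. 0 < det g})"
    by (intro open_Int open_Collect_less continuous_on_const)
  moreover have "{g. 0 < g$1$1} \<inter> {g. 0 < minor 1 2 g} \<inter> {g :: real^3^3. 0 < det g} = big_cell"
    by (auto simp: big_cell_def)
  ultimately show ?thesis by simp
qed

lemma big_cell_decomposition:
  assumes "g \<in> big_cell"
  shows "g = uch (cell_coord g) ** upper3 (vector [g$1$1, minor 1 2 g / g$1$1, det g / minor 1 2 g])
     (g$1$2) (g$1$3) (g$2$3 - g$2$1 * g$1$3 / g$1$1)"
proof -
  have nz: "g$1$1 \<noteq> 0" "minor 1 2 g \<noteq> 0" using assms by (auto simp: big_cell_def)
  have m12: "g$1$1 * g$2$2 = minor 1 2 g + g$1$2 * g$2$1" and m13: "g$1$1 * g$3$2 = minor 1 3 g + g$1$2 * g$3$1"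
    by (simp_all add: minor_def)
  \<comment> \<open>A Pluecker relation among the minors of the first two columns; it eliminates the
    third minor from the determinant.\<close>
  have m23: "g$1$1 * minor 2 3 g = g$2$1 * minor 1 3 g - g$3$1 * minor 1 2 g"
    by (simp add: minor_def algebra_simps)
  have "g$1$1 * det g = g$1$3 * (g$2$1 * minor 1 3 g - g$3$1 * minor 1 2 g) - g$1$1 * g$2$3 * minor 1 3 g + g$1$1 * g$3$3 * minor 1 2 g"
    unfolding det_minor m23[symmetric] by (simp add: algebra_simps)
  then have "g$3$3 = g$3$1 * g$1$3 / g$1$1 + minor 1 3 g / minor 1 2 g * (g$2$3 - g$2$1 * g$1$3 / g$1$1) + det g / minor 1 2 g"
    using nz by (simp add: field_simps)
  moreover have "g$2$2 = g$2$1 * g$1$2 / g$1$1 + minor 1 2 g / g$1$1" "g$3$2 = g$3$1 * g$1$2 / g$1$1 + minor 1 3 g / g$1$1"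
    using nz m12 m13 by (simp_all add: field_simps)
  ultimately show ?thesis
    using nz by (simp add: mat3_eq_iff matrix_mult_3 cell_coord_def)
qed

text \<open>On the big cell f is a smooth character factor times its restriction to the lower
  unipotent group, composed with the coordinate map. Flatness along that group therefore spreads to
  all matrix directions.\<close>

lemma flat_I_ser:
  assumes f: "f \<in> I_ser \<xi> lam" and flat: "flat k 0 (\<lambda>x. f (uch x))"
  shows "flat k (mat 1) f"
proof -
  let ?t = "\<lambda>g. vector [g$1$1, minor 1 2 g / g$1$1, det g / minor 1 2 g] :: real^3"
  define X where "X g = complex_of_real (g$1$1) powr (- (lam$1)) * complex_of_real (minor 1 2 g / g$1$1) powr (- (lam$2))
    * complex_of_real (det g / minor 1 2 g) powr (- (lam$3))" for g
  have eq: "X g * f (uch (cell_coord g)) = f g" if g: "g \<in> big_cell" for g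
  proof -
    have p: "g$1$1 > 0" "minor 1 2 g > 0" "det g > 0" using g by (auto simp: big_cell_def)
    have "f g = f (uch (cell_coord g) ** upper3 (?t g) (g$1$2) (g$1$3) (g$2$3 - g$2$1 * g$1$3 / g$1$1))"
      by (rule arg_cong[OF big_cell_decomposition[OF g]])
    also have "\<dots> = chr \<xi> lam (?t g) * f (uch (cell_coord g))"
      by (rule I_ser_equivariant[OF f uch_GL]) (use p in simp_all)
    finally have "f g = chr \<xi> lam (?t g) * f (uch (cell_coord g))" .
    moreover have "chr \<xi> lam (?t g) = X g"
      unfolding chr_def prod_UNIV_3 X_def using p by simp
    ultimately show ?thesis by simp
  qed
  have one: "mat 1 \<in> big_cell" by (simp add: big_cell_def minor_def)
  have X: "smooth_on big_cell X"
    unfolding X_def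
    by (intro smooth_on_mult smooth_on_powr smooth_on_divide smooth_on_entry smooth_on_minor smooth_on_det3 open_big_cell)
      (auto simp: big_cell_def)
  have cc: "smooth_on big_cell cell_coord"
    unfolding cell_coord_def[abs_def]
    by (intro smooth_on_vector_3 smooth_on_divide smooth_on_entry smooth_on_minor open_big_cell) (auto simp: big_cell_def)
  have c0: "cell_coord (mat 1) = 0" by (simp add: cell_coord_def minor_def vec_eq_iff forall_3)
  have "flat k (mat 1) (\<lambda>g. f (uch (cell_coord g)))"
    by (rule flat_compose[OF open_big_cell open_UNIV one cc UNIV_I smooth_on_I_ser_uch1[OF f]]) (simp add: c0 flat)
  then have "flat k (mat 1) (\<lambda>g. X g * f (uch (cell_coord g)))"
    by (intro flat_mult[OF open_big_cell one] X smooth_on_compose[OF open_big_cell open_UNIV cc smooth_on_I_ser_uch1[OF f] UNIV_I])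
  then show ?thesis by (rule flat_cong[OF open_big_cell one, rotated]) (rule eq)
qed

section \<open>Infinitesimal equivariance and the recursion\<close>

lemma powr_line_derivative:
  "((\<lambda>s. complex_of_real (1 + s * y) powr z) has_vector_derivative z * of_real y) (at 0)"
proof -
  have 1: "((\<lambda>s. complex_of_real (1 + s * y)) has_vector_derivative of_real y) (at 0)"
    by (auto intro!: derivative_eq_intros simp: has_vector_derivative_def scaleR_conv_of_real)
  have 2: "((\<lambda>w. w powr z) has_field_derivative z) (at (complex_of_real (1 + 0 * y)))"
    using has_field_derivative_powr[of 1 z] by simp
  show ?thesis
    using field_vector_diff_chain_at[OF 1 2] by (simp add: o_def mult.commute)
qed

text \<open>The straight line g + s g Y is g (1 + s Y), with 1 + s Y upper triangular and of
  positive diagonal for small s, so equivariance can be differentiated without the exponential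
  map.\<close>

lemma I_ser_infinitesimal:
  assumes f: "f \<in> I_ser \<xi> lam" and g: "g \<in> GL"
  shows "frechet_derivative f (at g) (g ** upper3 y a b c) = - (lam$1 * of_real (y$1) + lam$2 * of_real (y$2) + lam$3 * of_real (y$3)) * f g"
proof -
  let ?Y = "g ** upper3 y a b c"
  have 1: "((\<lambda>s. f (g + s *\<^sub>R ?Y)) has_vector_derivative frechet_derivative f (at g) ?Y) (at 0)"
    using line_derivative[OF open_GL smooth_on_differentiable[OF I_ser_smooth[OF f]], of g 0 ?Y] g by simp
  let ?P = "\<lambda>s. complex_of_real (1 + s * y$1) powr (- (lam$1)) * complex_of_real (1 + s * y$2) powr (- (lam$2))
      * complex_of_real (1 + s * y$3) powr (- (lam$3))"
  let ?S = "{s. 0 < 1 + s * y$1} \<inter> {s. 0 < 1 + s * y$2} \<inter> {s. 0 < 1 + s * y$3}"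
  have S: "open ?S" "0 \<in> ?S" by (intro open_Int open_Collect_less continuous_intros) simp
  have eq: "f (g + s *\<^sub>R ?Y) = ?P s * f g" if s: "s \<in> ?S" for s
  proof -
    let ?t = "vector [1 + s * y$1, 1 + s * y$2, 1 + s * y$3] :: real^3"
    have "g + s *\<^sub>R ?Y = g ** upper3 ?t (s * a) (s * b) (s * c)"
      by (simp add: vec_eq_iff forall_3 matrix_mult_3 algebra_simps)
    then have "f (g + s *\<^sub>R ?Y) = f (g ** upper3 ?t (s * a) (s * b) (s * c))" by simp
    also have "\<dots> = chr \<xi> lam ?t * f g"
      by (rule I_ser_equivariant[OF f g]) (use s in simp_all)
    also have "chr \<xi> lam ?t = ?P s"
      unfolding chr_def prod_UNIV_3 using s by simp
    finally show ?thesis .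
  qed
  have "((\<lambda>s. ?P s * f g) has_vector_derivative frechet_derivative f (at g) ?Y) (at 0)"
    by (rule has_vector_derivative_transform_within_open[OF 1 S eq])
  moreover have "((\<lambda>s. ?P s * f g) has_vector_derivative
      - (lam$1 * of_real (y$1) + lam$2 * of_real (y$2) + lam$3 * of_real (y$3)) * f g) (at 0)"
    by (rule has_vector_derivative_eq_rhs[OF has_vector_derivative_mult_left[OF has_vector_derivative_mult[OF
         has_vector_derivative_mult[OF powr_line_derivative powr_line_derivative] powr_line_derivative]]])
      (simp add: algebra_simps)
  ultimately show ?thesis by (rule vector_derivative_unique_at)
qed

text \<open>The infinitesimal action of \<open>E\<^sub>1\<^sub>3\<close> on equivariant functions, written in the chart \<open>uch\<close>.\<close>

definition Xop :: "complex^3 \<Rightarrow> operator3" where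
  "Xop lam \<psi> = (\<lambda>x. of_real (- (x$3 * x$1)) * pd 1 \<psi> x + of_real (- (x$2 * (x$3 - x$1 * x$2))) * pd 2 \<psi> x
     + of_real (- (x$3 * x$3)) * pd 3 \<psi> x
     + ((lam$3 - lam$1) * of_real (x$3) + (lam$2 - lam$3) * of_real (x$1 * x$2)) * \<psi> x)"

lemma frechet_real3:
  "smooth_on UNIV \<psi> \<Longrightarrow> frechet_derivative \<psi> (at x) v = of_real (v$1) * pd 1 \<psi> x + of_real (v$2) * pd 2 \<psi> x + of_real (v$3) * pd 3 \<psi> x"
  using frechet_compose_real3[OF has_derivative_ident, of \<psi> x v] by simp

lemma I_ser_Xop:
  assumes f: "f \<in> I_ser \<xi> lam"
  shows "frechet_derivative f (at (uch x)) (unit_mat 1 3 ** uch x) = Xop lam (\<lambda>x. f (uch x)) x"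
proof -
  \<comment> \<open>Splits the tangent vector of left multiplication by E_13 at \<open>uch x\<close>
    into a part along the lower unipotent group, with coordinates \<open>?v\<close>, and a right
    translate by an upper triangular matrix with diagonal \<open>?y\<close>.\<close>
  let ?v = "vector [- (x$3 * x$1), - (x$2 * (x$3 - x$1 * x$2)), - (x$3 * x$3)] :: real^3"
  let ?y = "vector [x$3, - (x$1 * x$2), x$1 * x$2 - x$3] :: real^3"
  have e: "unit_mat 1 3 ** uch x = duch ?v + uch x ** upper3 ?y (x$2) 1 (- (x$1))"
    by (simp add: mat3_eq_iff matrix_mult_3 unit_mat_def algebra_simps)
  have Df: "(f has_derivative frechet_derivative f (at (uch x))) (at (uch x))"
    by (rule smooth_on_has_derivative[OF open_GL I_ser_smooth[OF f] uch_GL])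
  have Du: "(uch has_derivative duch) (at x)"
    unfolding uch_affine[abs_def]
    by (rule has_derivative_add_const[OF bounded_linear_imp_has_derivative[OF bounded_linear_duch]])
  have "((\<lambda>x. f (uch x)) has_derivative (\<lambda>v. frechet_derivative f (at (uch x)) (duch v))) (at x)"
    by (rule has_derivative_compose[where f = uch, OF Du]) (rule Df)
  then have "frechet_derivative f (at (uch x)) (duch ?v) = frechet_derivative (\<lambda>x. f (uch x)) (at x) ?v"
    by (simp add: frechet_derivative_eq)
  moreover have "frechet_derivative f (at (uch x)) (uch x ** upper3 ?y (x$2) 1 (- (x$1)))
     = ((lam$3 - lam$1) * of_real (x$3) + (lam$2 - lam$3) * of_real (x$1 * x$2)) * f (uch x)"
    unfolding I_ser_infinitesimal[OF f uch_GL] by (simp add: algebra_simps)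
  ultimately show ?thesis
    unfolding e linear_add[OF has_derivative_linear[OF Df]]
      frechet_real3[OF smooth_on_I_ser_uch1[OF f]] Xop_def by simp
qed

text \<open>The upper unipotent subgroup of \<open>G'\<close> as a one-parameter group.\<close>

definition nil2 :: "real \<Rightarrow> real^2^2" where
  "nil2 s = vector [vector [1, s], vector [0, 1]]"

lemma nil2_add: "nil2 (s + r) = nil2 s ** nil2 r"
  by (simp add: nil2_def mat2_eq_iff matrix_mult_2)

lemma nil2_0 [simp]: "nil2 0 = mat 1"
  by (simp add: nil2_def mat2_eq_iff)

lemma nil2_GL [simp]: "nil2 s \<in> GL"
  by (simp add: GL_iff_det det_2 nil2_def)

lemma iota3_nil2_mult: "iota3 (nil2 s) ** g = g + s *\<^sub>R (unit_mat 1 3 ** g)" for g :: "real^3^3"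
  by (simp add: mat3_eq_iff matrix_mult_3 unit_mat_def nil2_def)

text \<open>Derivatives in x are taken before the one in the flow time s. Viewing the translate as
  one smooth function of the pair (s, x) makes this an instance of commuting mixed derivatives;
  differentiating first in s gives \<open>Xop\<close>.\<close>

lemma nil2_flow_derivative_0:
  assumes f: "f \<in> I_ser \<xi> lam"
  shows "((\<lambda>s. pdm i j l (\<lambda>x. f (iota3 (nil2 s) ** uch x)) 0) has_vector_derivative
     pdm i j l (Xop lam (\<lambda>x. f (uch x))) 0) (at 0)"
proof -
  define h where "h = (\<lambda>p :: real \<times> (real^3). f (iota3 (nil2 (fst p)) ** uch (snd p)))"
  let ?vs = "replicate i (axis 1 1) @ replicate j (axis 2 1) @ replicate l (axis 3 1) :: (real^3) list"
  let ?A = "\<lambda>v :: real^3. (0 :: real, v)"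
  have A: "bounded_linear ?A" by (intro bounded_linear_Pair bounded_linear_zero bounded_linear_ident)
  have u: "smooth_on UNIV (\<lambda>p :: real \<times> (real^3). uch (snd p))"
    by (rule smooth_on_compose[OF open_UNIV open_UNIV smooth_on_linear[OF open_UNIV bounded_linear_snd] smooth_on_uch UNIV_I])
  have "smooth_on UNIV (\<lambda>p :: real \<times> (real^3). uch (snd p) + fst p *\<^sub>R (unit_mat 1 3 ** uch (snd p)))"
    by (intro smooth_on_add smooth_on_scaleR u smooth_on_linear[OF open_UNIV bounded_linear_fst] open_UNIV
        smooth_on_compose_linear[OF open_UNIV bounded_linear_matrix_left])
  then have h: "smooth_on UNIV h"
    unfolding h_def iota3_nil2_mult[symmetric]
    by (rule smooth_on_compose[OF open_UNIV open_GL _ I_ser_smooth[OF f]]) (simp add: mult_GL)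
  have slice: "pdm i j l (\<lambda>x. F (s, x)) 0 = iter_deriv (map ?A ?vs) F (s, 0)" if "smooth_on UNIV F" for F :: "real \<times> (real^3) \<Rightarrow> complex" and s
    using iter_deriv_affine[OF A open_UNIV that, of 0 "(s, 0)" ?vs] by (simp add: pdm_def)
  let ?G = "iter_deriv (map ?A ?vs) h"
  have "((\<lambda>s. ?G (0 + s *\<^sub>R (1, 0))) has_vector_derivative frechet_derivative ?G (at (0 + 0 *\<^sub>R (1, 0))) (1, 0)) (at 0)"
    by (rule line_derivative[OF open_UNIV smooth_on_differentiable[OF smooth_on_iter_deriv[OF h]] UNIV_I])
  then have "((\<lambda>s. ?G (s, 0)) has_vector_derivative iter_deriv ((1, 0) # map ?A ?vs) h (0, 0)) (at 0)"
    by (simp add: zero_prod_def)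
  moreover have "iter_deriv ((1, 0) # map ?A ?vs) h (0, 0) = iter_deriv (map ?A ?vs @ [(1, 0)]) h (0, 0)"
    by (rule iter_deriv_perm[OF open_UNIV h UNIV_I]) simp
  moreover have "iter_deriv (map ?A ?vs @ [(1, 0)]) h (0, 0) = iter_deriv (map ?A ?vs) (\<lambda>p. frechet_derivative h (at p) (1, 0)) (0, 0)"
    by (simp add: iter_deriv_append)
  moreover have "iter_deriv (map ?A ?vs) (\<lambda>p. frechet_derivative h (at p) (1, 0)) (0, 0)
     = pdm i j l (\<lambda>x. frechet_derivative h (at (0, x)) (1, 0)) 0"
    by (rule slice[symmetric, OF smooth_on_deriv[OF h]])
  moreover have "frechet_derivative h (at (0, x)) (1, 0) = Xop lam (\<lambda>x. f (uch x)) x" for x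
  proof -
    have "((\<lambda>s. h ((0, x) + s *\<^sub>R (1, 0))) has_vector_derivative frechet_derivative h (at ((0, x) + 0 *\<^sub>R (1, 0))) (1, 0)) (at 0)"
      by (rule line_derivative[OF open_UNIV smooth_on_differentiable[OF h] UNIV_I])
    then have "((\<lambda>s. f (uch x + s *\<^sub>R (unit_mat 1 3 ** uch x))) has_vector_derivative frechet_derivative h (at (0, x)) (1, 0)) (at 0)"
      by (simp add: h_def iota3_nil2_mult)
    moreover have "((\<lambda>s. f (uch x + s *\<^sub>R (unit_mat 1 3 ** uch x))) has_vector_derivative
        frechet_derivative f (at (uch x + 0 *\<^sub>R (unit_mat 1 3 ** uch x))) (unit_mat 1 3 ** uch x)) (at 0)"
      by (rule line_derivative[OF open_GL smooth_on_differentiable[OF I_ser_smooth[OF f]]]) simp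
    ultimately show ?thesis
      using vector_derivative_unique_at I_ser_Xop[OF f] by fastforce
  qed
  moreover have "pdm i j l (\<lambda>x. f (iota3 (nil2 s) ** uch x)) 0 = ?G (s, 0)" for s
    using slice[OF h, of s] by (simp add: h_def)
  ultimately show ?thesis by simp
qed

text \<open>The group law moves time r to time 0, at the cost of replacing f by a translate.\<close>

lemma nil2_flow_derivative:
  assumes f: "f \<in> I_ser \<xi> lam"
  shows "((\<lambda>s. pdm i j l (\<lambda>x. f (iota3 (nil2 s) ** uch x)) 0) has_vector_derivative
     pdm i j l (Xop lam (\<lambda>x. f (iota3 (nil2 r) ** uch x))) 0) (at r)"
proof -
  have fr: "(\<lambda>g. f (iota3 (nil2 r) ** g)) \<in> I_ser \<xi> lam" by (rule I_ser_translate[OF f]) simp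
  have 0: "((\<lambda>s. pdm i j l (\<lambda>x. f (iota3 (nil2 r) ** (iota3 (nil2 s) ** uch x))) 0) has_vector_derivative
     pdm i j l (Xop lam (\<lambda>x. f (iota3 (nil2 r) ** uch x))) 0) (at (r - r))"
    using nil2_flow_derivative_0[OF fr] by simp
  have "((\<lambda>s. s - r) has_vector_derivative 1) (at r)"
    by (auto intro!: derivative_eq_intros simp: has_vector_derivative_def)
  from vector_diff_chain_at[OF this 0] show ?thesis
    by (simp add: o_def matrix_mul_assoc iota3_mult[symmetric] nil2_add[symmetric])
qed

lemma smooth_on_Xop: "smooth_on UNIV \<psi> \<Longrightarrow> smooth_on UNIV (Xop lam \<psi>)"
  unfolding Xop_def minus_mult_left
  by (intro smooth_on_add smooth_on_mult smooth_on_of_real smooth_on_const smooth_on_pd open_UNIV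
      smooth_on_vec_nth smooth_on_ident smooth_on_diff smooth_on_compose_linear[OF open_UNIV bounded_linear_minus[OF bounded_linear_ident]])

lemma Xop_lincomb:
  assumes "\<And>a. a \<in> A \<Longrightarrow> smooth_on UNIV (f a)"
  shows "Xop lam (\<lambda>x. \<Sum>a\<in>A. c a * f a x) = (\<lambda>x. \<Sum>a\<in>A. c a * Xop lam (f a) x)"
proof -
  have P: "pd i (\<lambda>x. \<Sum>a\<in>A. c a * f a x) = (\<lambda>x. \<Sum>a\<in>A. c a * pd i (f a) x)" for i
    by (rule pd_lincomb[OF assms])
  have "k1 * (\<Sum>a\<in>A. c a * p1 a) + k2 * (\<Sum>a\<in>A. c a * p2 a) + k3 * (\<Sum>a\<in>A. c a * p3 a) + k4 * (\<Sum>a\<in>A. c a * p4 a)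
      = (\<Sum>a\<in>A. c a * (k1 * p1 a + k2 * p2 a + k3 * p3 a + k4 * p4 a))" for k1 k2 k3 k4 :: complex and p1 p2 p3 p4
    by (simp add: sum_distrib_left sum.distrib distrib_left mult.left_commute)
  then show ?thesis unfolding Xop_def P by (intro ext)
qed

lemma Xop_add:
  assumes "smooth_on UNIV f" "smooth_on UNIV g"
  shows "Xop lam (\<lambda>x. f x + g x) = (\<lambda>x. Xop lam f x + Xop lam g x)"
proof -
  have "smooth_on UNIV (if b then f else g)" for b using assms by simp
  from Xop_lincomb[of "UNIV :: bool set" "\<lambda>b. if b then f else g" lam "\<lambda>_. 1", OF this]
  show ?thesis by (simp add: UNIV_bool add.commute)
qed

lemma flat_Xop:
  assumes "smooth_on UNIV \<psi>" "flat (Suc k) 0 \<psi>"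
  shows "flat k 0 (Xop lam \<psi>)"
proof -
  have p: "flat k 0 (pd i \<psi>)" for i
    using assms(2) unfolding flat_Suc pd_def[abs_def] by blast
  have f: "flat k 0 \<psi>" using flat_mono[OF assms(2)] by simp
  have m: "smooth_on UNIV (\<lambda>x. complex_of_real (- q x))" if "smooth_on UNIV q" for q :: "real^3 \<Rightarrow> real"
    by (intro smooth_on_of_real open_UNIV smooth_on_compose_linear[OF open_UNIV bounded_linear_minus[OF bounded_linear_ident]] that)
  show ?thesis
    unfolding Xop_def
    by (intro flat_add[OF open_UNIV UNIV_I] flat_mult[OF open_UNIV UNIV_I] smooth_on_add smooth_on_mult m p f assms(1) smooth_on_pd
      smooth_on_of_real smooth_on_const open_UNIV smooth_on_vec_nth smooth_on_ident smooth_on_diff)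
qed

text \<open>Both monomials on the right have the torus weight (i + l, j + l) raised by (1, 1); two
  such monomials per step are the source of the two-term recursion.\<close>

lemma Xop_monom3:
  "Xop lam (monom3 i j l) x = (lam$3 - lam$1 - of_nat (i + j + l)) * monom3 i j (Suc l) x
     + (lam$2 - lam$3 + of_nat j) * monom3 (Suc i) (Suc j) l x"
proof -
  have 1: "of_real (x$1) * (of_nat i * monom3 (i - 1) j l x) = of_nat i * monom3 i j l x"
    and 2: "of_real (x$2) * (of_nat j * monom3 i (j - 1) l x) = of_nat j * monom3 i j l x"
    and 3: "of_real (x$3) * (of_nat l * monom3 i j (l - 1) x) = of_nat l * monom3 i j l x"
    by (cases i; cases j; cases l; simp add: monom3_def)+
  have S: "monom3 i j (Suc l) x = of_real (x$3) * monom3 i j l x" "monom3 (Suc i) (Suc j) l x = of_real (x$1) * of_real (x$2) * monom3 i j l x"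
    by (simp_all add: monom3_def)
  have "Xop lam (monom3 i j l) x = - of_real (x$3) * (of_real (x$1) * (of_nat i * monom3 (i - 1) j l x))
     - of_real (x$3 - x$1 * x$2) * (of_real (x$2) * (of_nat j * monom3 i (j - 1) l x))
     - of_real (x$3) * (of_real (x$3) * (of_nat l * monom3 i j (l - 1) x))
     + ((lam$3 - lam$1) * of_real (x$3) + (lam$2 - lam$3) * of_real (x$1 * x$2)) * monom3 i j l x"
    by (simp add: Xop_def pd_def frechet_derivative_monom3 algebra_simps)
  then show ?thesis unfolding 1 2 3 S by (simp add: algebra_simps)
qed

text \<open>The derivatives of torus weight \<alpha>: order i in x1, j in x2 and l in x3 with i + l
  and j + l fixed, so that l = n is the only free index.\<close>

definition Lop :: "nat \<times> nat \<Rightarrow> (nat \<Rightarrow> complex) \<Rightarrow> operator3" where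
  "Lop \<alpha> b \<psi> = (\<lambda>x. \<Sum>n\<le>min (fst \<alpha>) (snd \<alpha>). b n * pdm (fst \<alpha> - n) (snd \<alpha> - n) n \<psi> x)"

lemma Lop_lincomb:
  assumes "\<And>a. a \<in> A \<Longrightarrow> smooth_on UNIV (f a)"
  shows "Lop \<alpha> b (\<lambda>x. \<Sum>a\<in>A. c a * f a x) y = (\<Sum>a\<in>A. c a * Lop \<alpha> b (f a) y)"
proof -
  have "pdm i j l (\<lambda>x. \<Sum>a\<in>A. c a * f a x) y = (\<Sum>a\<in>A. c a * pdm i j l (f a) y)" for i j l
    using pdm_sum[of A "\<lambda>a x. c a * f a x"] assms by (simp add: pdm_cmult smooth_on_mult)
  then have "Lop \<alpha> b (\<lambda>x. \<Sum>a\<in>A. c a * f a x) y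
      = (\<Sum>n\<le>min (fst \<alpha>) (snd \<alpha>). \<Sum>a\<in>A. c a * (b n * pdm (fst \<alpha> - n) (snd \<alpha> - n) n (f a) y))"
    by (simp add: Lop_def sum_distrib_left mult.left_commute)
  then show ?thesis by (simp add: Lop_def sum_distrib_left sum.swap[of _ A])
qed

lemma Lop_add:
  "smooth_on UNIV f \<Longrightarrow> smooth_on UNIV g \<Longrightarrow> Lop \<alpha> b (\<lambda>x. f x + g x) y = Lop \<alpha> b f y + Lop \<alpha> b g y"
  by (simp add: Lop_def pdm_add distrib_left sum.distrib)

lemma Lop_flat: "flat k x \<psi> \<Longrightarrow> fst \<alpha> + snd \<alpha> \<le> k \<Longrightarrow> Lop \<alpha> b \<psi> x = 0"
  unfolding Lop_def by (rule sum.neutral) (auto intro!: flat_imp_pdm)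

lemma Lop_monom3:
  "Lop \<alpha> b (monom3 i j l) 0 = (if l \<le> min (fst \<alpha>) (snd \<alpha>) \<and> i = fst \<alpha> - l \<and> j = snd \<alpha> - l
     then b l * (fact i * fact j * fact l) else 0)"
proof -
  have "Lop \<alpha> b (monom3 i j l) 0 = (\<Sum>n\<le>min (fst \<alpha>) (snd \<alpha>). if n = l then
      (if i = fst \<alpha> - l \<and> j = snd \<alpha> - l then b l * (fact i * fact j * fact l) else 0) else 0)"
    unfolding Lop_def by (intro sum.cong refl) (auto simp: pdm_monom3)
  then show ?thesis by (simp add: sum.delta)
qed

text \<open>Only monomials of weight \<alpha> - (1, 1) survive. Expressing lam1 and lam3 through
  \<nu> and \<alpha> turns the two coefficients of \<open>Xop_monom3\<close> into d + l and - (c +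
  l).\<close>

lemma Lop_Xop_monom3:
  assumes "\<nu>1 - lam$1 = of_nat (fst \<alpha>)" "lam$3 - \<nu>2 = of_nat (snd \<alpha>)"
  shows "Lop \<alpha> b (Xop lam (monom3 i j l)) 0 = (if l < min (fst \<alpha>) (snd \<alpha>) \<and> i = fst \<alpha> - Suc l \<and> j = snd \<alpha> - Suc l
     then fact i * fact j * fact l * (b (Suc l) * of_nat (Suc l) * (\<nu>2 - \<nu>1 + 2 + of_nat l)
        - b l * of_nat (fst \<alpha> - l) * of_nat (snd \<alpha> - l) * (\<nu>2 - lam$2 + 1 + of_nat l)) else 0)"
proof -
  let ?c1 = "lam$3 - lam$1 - of_nat (i + j + l)" and ?c2 = "lam$2 - lam$3 + of_nat j"
  have sm: "smooth_on UNIV (\<lambda>x. c * monom3 i j l x)" for c i j l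
    by (intro smooth_on_mult smooth_on_const smooth_on_monom3 open_UNIV)
  have cm: "Lop \<alpha> b (\<lambda>x. c * monom3 i j l x) 0 = c * Lop \<alpha> b (monom3 i j l) 0" for c i j l
    using Lop_lincomb[of "{()}" "\<lambda>_. monom3 i j l" \<alpha> b "\<lambda>_. c"] smooth_on_monom3[OF open_UNIV] by simp
  have "Xop lam (monom3 i j l) = (\<lambda>x. ?c1 * monom3 i j (Suc l) x + ?c2 * monom3 (Suc i) (Suc j) l x)"
    by (rule ext) (rule Xop_monom3)
  then have e: "Lop \<alpha> b (Xop lam (monom3 i j l)) 0 = ?c1 * Lop \<alpha> b (monom3 i j (Suc l)) 0 + ?c2 * Lop \<alpha> b (monom3 (Suc i) (Suc j) l) 0"
    by (simp add: Lop_add sm cm)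
  show ?thesis
  proof (cases "l < min (fst \<alpha>) (snd \<alpha>) \<and> i = fst \<alpha> - Suc l \<and> j = snd \<alpha> - Suc l")
    case True
    then have i: "fst \<alpha> = i + Suc l" "snd \<alpha> = j + Suc l" by auto
    have l1: "lam$1 = \<nu>1 - of_nat (i + Suc l)" and l3: "lam$3 = \<nu>2 + of_nat (j + Suc l)"
      using assms unfolding i by (simp_all add: algebra_simps del: of_nat_Suc of_nat_add)
    have c: "?c1 = \<nu>2 - \<nu>1 + 2 + of_nat l" "?c2 = - (\<nu>2 - lam$2 + 1 + of_nat l)"
      unfolding l1 l3 by (simp_all add: algebra_simps)
    have L: "Lop \<alpha> b (monom3 i j (Suc l)) 0 = b (Suc l) * (fact i * fact j * fact (Suc l))"
      "Lop \<alpha> b (monom3 (Suc i) (Suc j) l) 0 = b l * (fact (Suc i) * fact (Suc j) * fact l)"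
      unfolding Lop_monom3 using i by auto
    have d: "fst \<alpha> - l = Suc i" "snd \<alpha> - l = Suc j" using i by auto
    have ring: "X * (B * (I * J * (S * L))) + - Y * (b' * ((SI * I) * (SJ * J) * L)) = I * J * L * (B * S * X - b' * SI * SJ * Y)"
      for X B I J S L Y b' SI SJ :: complex by (simp add: algebra_simps)
    show ?thesis
      unfolding e c L if_P[OF True] d fact_Suc by (rule ring)
  next
    case False
    then have "Lop \<alpha> b (monom3 i j (Suc l)) 0 = 0" "Lop \<alpha> b (monom3 (Suc i) (Suc j) l) 0 = 0"
      by (auto simp: Lop_monom3)
    then show ?thesis using False e by auto
  qed
qed

text \<open>\<open>E\<^sub>1\<^sub>3\<close>-invariance of a functional with ordered coefficients \<open>b\<close> is a two-term recursion, the one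
  satisfied by the coefficients of \<open>\<^sub>3F\<^sub>1\<close>.\<close>

definition Frob :: "nat \<times> nat \<Rightarrow> complex \<Rightarrow> complex \<Rightarrow> (nat \<Rightarrow> complex) \<Rightarrow> bool" where
  "Frob \<alpha> c d b \<longleftrightarrow> (\<forall>k < min (fst \<alpha>) (snd \<alpha>).
     b (Suc k) * of_nat (Suc k) * (d + of_nat k) = b k * of_nat (fst \<alpha> - k) * of_nat (snd \<alpha> - k) * (c + of_nat k))"

text \<open>The Taylor polynomial is handled monomial by monomial through the recursion, the
  remainder by flatness.\<close>

lemma Frob_imp_Lop_Xop:
  assumes "\<nu>1 - lam$1 = of_nat (fst \<alpha>)" "lam$3 - \<nu>2 = of_nat (snd \<alpha>)"
    and "Frob \<alpha> (\<nu>2 - lam$2 + 1) (\<nu>2 - \<nu>1 + 2) b" "smooth_on UNIV \<psi>"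
  shows "Lop \<alpha> b (Xop lam \<psi>) 0 = 0"
proof -
  \<comment> \<open>One order above the order of the functional, since \<open>Xop\<close>
    differentiates once.\<close>
  let ?k = "Suc (fst \<alpha> + snd \<alpha>)"
  let ?r = "\<lambda>x. \<psi> x - taylor3 ?k \<psi> x"
  have r: "smooth_on UNIV ?r" by (intro smooth_on_diff assms smooth_on_taylor3 open_UNIV)
  have "flat (fst \<alpha> + snd \<alpha>) 0 (Xop lam ?r)"
    by (rule flat_Xop[OF r flat_taylor3[OF assms(4)]])
  then have 1: "Lop \<alpha> b (Xop lam ?r) 0 = 0" by (rule Lop_flat) simp
  have m: "Lop \<alpha> b (Xop lam (monom3 i j l)) 0 = 0" for i j l
    unfolding Lop_Xop_monom3[OF assms(1,2)] using assms(3) by (auto simp: Frob_def)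
  have 2: "Lop \<alpha> b (Xop lam (taylor3 ?k \<psi>)) 0 = 0"
    unfolding taylor3_def[abs_def] case_prod_beta
      Xop_lincomb[OF smooth_on_monom3[OF open_UNIV]] Lop_lincomb[OF smooth_on_Xop[OF smooth_on_monom3[OF open_UNIV]]] m
    by simp
  have "Xop lam \<psi> = Xop lam (\<lambda>x. ?r x + taylor3 ?k \<psi> x)" by simp
  also have "\<dots> = (\<lambda>x. Xop lam ?r x + Xop lam (taylor3 ?k \<psi>) x)"
    by (rule Xop_add[OF r smooth_on_taylor3])
  finally have "Lop \<alpha> b (Xop lam \<psi>) 0 = Lop \<alpha> b (\<lambda>x. Xop lam ?r x + Xop lam (taylor3 ?k \<psi>) x) 0" by simp
  also have "\<dots> = 0" using 1 2 by (simp add: Lop_add smooth_on_Xop r smooth_on_taylor3)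
  finally show ?thesis .
qed

text \<open>An equivariant function with the jet of a single monomial isolates one equation of the
  recursion.\<close>

lemma Lop_Xop_imp_Frob:
  assumes "\<nu>1 - lam$1 = of_nat (fst \<alpha>)" "lam$3 - \<nu>2 = of_nat (snd \<alpha>)"
    and "\<And>f. f \<in> I_ser \<xi> lam \<Longrightarrow> Lop \<alpha> b (Xop lam (\<lambda>x. f (uch x))) 0 = 0"
  shows "Frob \<alpha> (\<nu>2 - lam$2 + 1) (\<nu>2 - \<nu>1 + 2) b"
  unfolding Frob_def
proof (intro allI impI)
  fix k assume k: "k < min (fst \<alpha>) (snd \<alpha>)"
  \<comment> \<open>The monomial of weight \<alpha> - (1, 1) with third exponent k, which isolates
    equation k.\<close>
  let ?m = "monom3 (fst \<alpha> - Suc k) (snd \<alpha> - Suc k) k"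
  have m: "smooth_on UNIV ?m" by (rule smooth_on_monom3[OF open_UNIV])
  obtain f where f: "f \<in> I_ser \<xi> lam" "flat (Suc (fst \<alpha> + snd \<alpha>)) 0 (\<lambda>x. f (uch x) - ?m x)"
    using exists_I_ser_jet[OF m] by blast
  let ?r = "\<lambda>x. f (uch x) - ?m x"
  have r: "smooth_on UNIV ?r" by (intro smooth_on_diff smooth_on_I_ser_uch1[OF f(1)] m open_UNIV)
  have "Lop \<alpha> b (Xop lam ?r) 0 = 0"
    by (rule Lop_flat[OF flat_Xop[OF r f(2)]]) simp
  moreover have "Xop lam (\<lambda>x. f (uch x)) = (\<lambda>x. Xop lam ?r x + Xop lam ?m x)"
    using Xop_add[OF r m] by simp
  ultimately have "Lop \<alpha> b (Xop lam ?m) 0 = 0"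
    using assms(3)[OF f(1)] by (simp add: Lop_add smooth_on_Xop r m)
  then show "b (Suc k) * of_nat (Suc k) * (\<nu>2 - \<nu>1 + 2 + of_nat k) = b k * of_nat (fst \<alpha> - k) * of_nat (snd \<alpha> - k) * (\<nu>2 - lam$2 + 1 + of_nat k)"
    unfolding Lop_Xop_monom3[OF assms(1,2)] using k by (simp del: of_nat_Suc)
qed

section \<open>Classification of the intertwining operators\<close>

definition qchar :: "bit \<Rightarrow> complex \<Rightarrow> real \<Rightarrow> complex" where
  "qchar \<epsilon> z t = complex_of_real (sgn t) powi (- of_bool (\<epsilon> = 1)) * complex_of_real \<bar>t\<bar> powr (- z)"

lemma bit_of_nat: "(of_nat p :: bit) = of_bool (odd p)"
  by (induction p) auto

text \<open>A single r determines z only up to periods of the exponential; the derivative at r = 0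
  determines z itself.\<close>

lemma exp_line_eq_1_imp:
  assumes "\<And>r::real. exp (of_real r * z) = (1 :: complex)"
  shows "z = 0"
proof -
  have 1: "((\<lambda>r. complex_of_real r * z) has_vector_derivative z) (at 0)"
    by (auto intro!: derivative_eq_intros simp: has_vector_derivative_def scaleR_conv_of_real)
  have 2: "(exp has_field_derivative 1) (at (complex_of_real 0 * z))"
    using DERIV_exp[of "0 :: complex"] by simp
  have "((\<lambda>r. exp (complex_of_real r * z)) has_vector_derivative z) (at 0)"
    using field_vector_diff_chain_at[OF 1 2] by (simp add: o_def)
  moreover have "((\<lambda>r. exp (complex_of_real r * z)) has_vector_derivative 0) (at 0)"
    unfolding assms by (rule has_vector_derivative_const)
  ultimately show ?thesis by (rule vector_derivative_unique_at)
qed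

text \<open>Positive t = exp r fix the exponent exactly, and t = - 1 fixes the parity.\<close>

lemma qchar_power_iff:
  "(\<forall>t. t \<noteq> 0 \<longrightarrow> qchar \<epsilon> z t * of_real (1 / t) ^ p = qchar \<epsilon>' z' t) \<longleftrightarrow> z' - z = of_nat p \<and> \<epsilon> + \<epsilon>' = of_nat p"
proof
  assume L: "\<forall>t. t \<noteq> 0 \<longrightarrow> qchar \<epsilon> z t * of_real (1 / t) ^ p = qchar \<epsilon>' z' t"
  have "exp (of_real r * (z' - z - of_nat p)) = 1" for r :: real
  proof -
    have p1: "of_real (1 / exp r) ^ p = exp (- (of_nat p * complex_of_real r))"
      by (simp add: exp_of_real exp_minus exp_of_nat_mult power_inverse divide_inverse)
    have "exp (- z * of_real r) * exp (- (of_nat p * of_real r)) = exp (- z' * of_real r)"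
      using L[rule_format, of "exp r"] powr_of_real_exp[of "exp r"] p1 by (simp add: qchar_def del: of_real_exp)
    then have E: "exp (- z * of_real r + - (of_nat p * of_real r)) = exp (- z' * of_real r)"
      by (simp only: exp_add)
    have "exp (of_real r * (z' - z - of_nat p)) = exp (- z * of_real r + - (of_nat p * of_real r)) * exp (z' * of_real r)"
      by (simp only: exp_add[symmetric]) (simp add: algebra_simps)
    also have "\<dots> = 1" unfolding E by (simp only: exp_add[symmetric]) simp
    finally show ?thesis .
  qed
  then have "z' - z - of_nat p = 0" by (rule exp_line_eq_1_imp)
  moreover have "\<epsilon> + \<epsilon>' = of_nat p"
    using L[rule_format, of "- 1"]
    by (cases \<epsilon>; cases \<epsilon>'; cases "even p") (simp_all add: qchar_def bit_of_nat power_int_minus)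
  ultimately show "z' - z = of_nat p \<and> \<epsilon> + \<epsilon>' = of_nat p" by simp
next
  assume R: "z' - z = of_nat p \<and> \<epsilon> + \<epsilon>' = of_nat p"
  show "\<forall>t. t \<noteq> 0 \<longrightarrow> qchar \<epsilon> z t * of_real (1 / t) ^ p = qchar \<epsilon>' z' t"
  proof (intro allI impI)
    fix t :: real assume t: "t \<noteq> 0"
    have z': "- z' = - z + - of_nat p" using R by (simp add: algebra_simps)
    have "complex_of_real \<bar>t\<bar> powr (- z') = complex_of_real \<bar>t\<bar> powr (- z) * complex_of_real \<bar>t\<bar> powr (- of_nat p)"
      unfolding z' by (rule powr_add)
    also have "complex_of_real \<bar>t\<bar> powr (- of_nat p) = of_real (1 / \<bar>t\<bar>) ^ p"
      using t by (simp add: powr_minus powr_nat power_divide divide_inverse power_inverse)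
    finally have 1: "complex_of_real \<bar>t\<bar> powr (- z') = complex_of_real \<bar>t\<bar> powr (- z) * of_real (1 / \<bar>t\<bar>) ^ p" .
    have s: "sgn t = 1 \<or> sgn t = - 1" using t by (auto simp: sgn_if)
    have "of_real (1 / t) ^ p = complex_of_real (sgn t) ^ p * of_real (1 / \<bar>t\<bar>) ^ p"
      using t by (auto simp: power_mult_distrib[symmetric] sgn_if)
    moreover have "complex_of_real (sgn t) powi (- of_bool (\<epsilon> = 1)) * complex_of_real (sgn t) ^ p = complex_of_real (sgn t) powi (- of_bool (\<epsilon>' = 1))"
      using R s by (cases \<epsilon>; cases \<epsilon>'; cases "even p") (auto simp: bit_of_nat power_int_minus)
    ultimately show "qchar \<epsilon> z t * of_real (1 / t) ^ p = qchar \<epsilon>' z' t"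
      unfolding qchar_def 1 by (simp add: mult_ac)
  qed
qed

lemma qchar_1 [simp]: "qchar \<epsilon> z 1 = 1"
  by (simp add: qchar_def)

text \<open>Setting one variable to 1 separates the two factors. The variable s enters with a
  positive power, so its condition is \<open>qchar_power_iff\<close> with the two characters
  exchanged.\<close>

lemma torus_weight_iff:
  "(\<forall>t s. t \<noteq> 0 \<longrightarrow> s \<noteq> 0 \<longrightarrow> qchar \<epsilon>1 z1 t * qchar \<epsilon>3 z3 s * (of_real (1 / t) ^ p * of_real s ^ q) = qchar \<delta>1 w1 t * qchar \<delta>2 w2 s)
   \<longleftrightarrow> w1 - z1 = of_nat p \<and> \<epsilon>1 + \<delta>1 = of_nat p \<and> z3 - w2 = of_nat q \<and> \<epsilon>3 + \<delta>2 = of_nat q"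
proof -
  have "(\<forall>t s. t \<noteq> 0 \<longrightarrow> s \<noteq> 0 \<longrightarrow> qchar \<epsilon>1 z1 t * qchar \<epsilon>3 z3 s * (of_real (1 / t) ^ p * of_real s ^ q) = qchar \<delta>1 w1 t * qchar \<delta>2 w2 s)
    \<longleftrightarrow> (\<forall>t. t \<noteq> 0 \<longrightarrow> qchar \<epsilon>1 z1 t * of_real (1 / t) ^ p = qchar \<delta>1 w1 t) \<and>
        (\<forall>s. s \<noteq> 0 \<longrightarrow> qchar \<delta>2 w2 s * of_real (1 / s) ^ q = qchar \<epsilon>3 z3 s)" (is "?L \<longleftrightarrow> ?R1 \<and> ?R2")
  proof
    assume L: ?L
    have ?R1 using L[rule_format, of _ 1] by simp
    moreover have ?R2
    proof (intro allI impI)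
      fix s :: real assume "s \<noteq> 0"
      then show "qchar \<delta>2 w2 s * of_real (1 / s) ^ q = qchar \<epsilon>3 z3 s"
        using L[rule_format, of 1 s] by (simp add: field_simps)
    qed
    ultimately show "?R1 \<and> ?R2" ..
  next
    assume R: "?R1 \<and> ?R2"
    show ?L
    proof (intro allI impI)
      fix t s :: real assume t: "t \<noteq> 0" and s: "s \<noteq> 0"
      have 1: "qchar \<epsilon>1 z1 t * of_real (1 / t) ^ p = qchar \<delta>1 w1 t" using R t by blast
      have "qchar \<delta>2 w2 s * of_real (1 / s) ^ q = qchar \<epsilon>3 z3 s" using R s by blast
      then have 2: "qchar \<epsilon>3 z3 s * of_real s ^ q = qchar \<delta>2 w2 s" using s by (auto simp: field_simps)
      show "qchar \<epsilon>1 z1 t * qchar \<epsilon>3 z3 s * (of_real (1 / t) ^ p * of_real s ^ q) = qchar \<delta>1 w1 t * qchar \<delta>2 w2 s"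
        unfolding 1[symmetric] 2[symmetric] by (simp add: mult_ac)
    qed
  qed
  then show ?thesis unfolding qchar_power_iff by (auto simp: add.commute)
qed

definition diag2 :: "real \<Rightarrow> real \<Rightarrow> real^2^2" where
  "diag2 t s = vector [vector [t, 0], vector [0, s]]"

text \<open>Conjugation of the lower unipotent group by \<open>iota3 (diag2 t s)\<close>, in the
  chart \<open>uch\<close>.\<close>

definition scal :: "real \<Rightarrow> real \<Rightarrow> real^3 \<Rightarrow> real^3" where
  "scal t s x = vector [x$1 / t, s * x$2, s / t * x$3]"

lemma bounded_linear_scal: "bounded_linear (scal t s)"
  unfolding linear_conv_bounded_linear[symmetric]
  by (rule linearI) (simp_all add: scal_def vec_eq_iff forall_3 algebra_simps add_divide_distrib)

lemma diag2_GL [simp]: "t \<noteq> 0 \<Longrightarrow> s \<noteq> 0 \<Longrightarrow> diag2 t s \<in> GL"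
  by (simp add: GL_iff_det det_2 diag2_def)

lemma chr_vector_3:
  fixes \<xi> :: "bit^3"
  shows "chr \<xi> lam (vector [t, 1, s]) = qchar (\<xi>$1) (lam$1) t * qchar (\<xi>$3) (lam$3) s"
  unfolding chr_def prod_UNIV_3 qchar_def by (simp add: mult_ac)

lemma I_ser_torus:
  assumes f: "f \<in> I_ser \<xi> lam" and t: "t \<noteq> 0" "s \<noteq> 0"
  shows "f (iota3 (diag2 t s) ** uch x) = qchar (\<xi>$1) (lam$1) t * qchar (\<xi>$3) (lam$3) s * f (uch (scal t s x))"
proof -
  have "iota3 (diag2 t s) ** uch x = uch (scal t s x) ** upper3 (vector [t, 1, s]) 0 0 0"
    using t by (simp add: mat3_eq_iff matrix_mult_3 diag2_def scal_def)
  then show ?thesis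
    using I_ser_equivariant[OF f uch_GL, of "vector [t, 1, s]"] t by (simp add: chr_vector_3)
qed

lemma pdm_scal:
  assumes "smooth_on UNIV F"
  shows "pdm i j l (\<lambda>x. F (scal t s x)) 0 = of_real (1 / t) ^ (i + l) * of_real s ^ (j + l) * pdm i j l F 0"
proof -
  define c where "c v = (if v = axis 1 1 then 1 / t else if v = axis 2 1 then s else s / t)" for v :: "real^3"
  let ?vs = "replicate i (axis 1 1) @ replicate j (axis 2 1) @ replicate l (axis 3 1) :: (real^3) list"
  have "scal t s (axis 1 1) = (1 / t) *\<^sub>R axis 1 1" "scal t s (axis 2 1) = s *\<^sub>R axis 2 1" "scal t s (axis 3 1) = (s / t) *\<^sub>R axis 3 1"
    by (simp_all add: scal_def vec_eq_iff forall_3 axis_def)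
  then have m: "map (scal t s) ?vs = map (\<lambda>v. c v *\<^sub>R v) ?vs"
    using axis3_distinct axis3_distinct[symmetric] by (simp add: c_def)
  have "pdm i j l (\<lambda>x. F (scal t s x)) 0 = iter_deriv (map (scal t s) ?vs) F (scal t s 0 + 0)"
    unfolding pdm_def using iter_deriv_affine[OF bounded_linear_scal[of t s] open_UNIV assms, of 0 0 ?vs] by simp
  also have "scal t s 0 + 0 = 0" by (simp add: scal_def vec_eq_iff forall_3)
  also have "iter_deriv (map (scal t s) ?vs) F 0 = of_real (prod_list (map c ?vs)) * iter_deriv ?vs F 0"
    unfolding m by (rule iter_deriv_scale[OF open_UNIV assms UNIV_I])
  also have "prod_list (map c ?vs) = (1 / t) ^ i * s ^ j * (s / t) ^ l"
    using axis3_distinct axis3_distinct[symmetric] by (simp add: c_def prod_list_replicate mult.assoc)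
  finally show ?thesis by (simp add: pdm_def power_add power_divide)
qed

lemma matrix_inv_eqI:
  fixes A B :: "real^'n^'n"
  assumes "A ** B = mat 1" "B ** A = mat 1"
  shows "matrix_inv A = B"
proof -
  have A: "A \<in> GL" using assms unfolding GL_def invertible_def by blast
  have "matrix_inv A = matrix_inv A ** (A ** B)" using assms by simp
  also have "\<dots> = B" by (simp add: matrix_mul_assoc matrix_inv_GL[OF A])
  finally show ?thesis .
qed

lemma matrix_inv_iota3:
  assumes "h \<in> GL"
  shows "matrix_inv (iota3 h) = iota3 (matrix_inv h)"
  by (rule matrix_inv_eqI) (simp_all add: iota3_mult[symmetric] matrix_inv_GL[OF assms])

lemma matrix_inv_inv:
  fixes h :: "real^'n^'n"
  assumes "h \<in> GL"
  shows "matrix_inv (matrix_inv h) = h"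
  by (rule matrix_inv_eqI) (simp_all add: matrix_inv_GL[OF assms])

section \<open>From an operator to a functional at the identity\<close>

lemma Diff_G3_translate:
  assumes T: "T \<in> Diff_G3 \<xi> lam \<eta> \<nu>" and f: "f \<in> I_ser \<xi> lam" and h: "h \<in> GL"
  shows "T (\<lambda>g. f (iota3 h ** g)) k = T f (h ** k)"
proof -
  let ?h = "matrix_inv h"
  have h': "?h \<in> GL" using matrix_inv_GL[OF h] by blast
  have "T (ltrans (iota3 ?h) f) = ltrans ?h (T f)"
    using T f h' unfolding Diff_G3_def by blast
  then show ?thesis
    unfolding ltrans_def matrix_inv_iota3[OF h'] matrix_inv_inv[OF h] by metis
qed

lemma Diff_G3_J_ser: "T \<in> Diff_G3 \<xi> lam \<eta> \<nu> \<Longrightarrow> f \<in> I_ser \<xi> lam \<Longrightarrow> T f \<in> J_ser \<eta> \<nu>"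
  unfolding Diff_G3_def by blast

lemma prod_UNIV_2: "(\<Prod>j\<in>UNIV. E j) = E 1 * E 2" for E :: "2 \<Rightarrow> complex"
  unfolding UNIV_2 by simp

lemma J_ser_diag2:
  assumes F: "F \<in> J_ser \<eta> \<nu>" and t: "t \<noteq> 0" "s \<noteq> 0"
  shows "F (diag2 t s) = qchar (\<eta>$1) (\<nu>$1) t * qchar (\<eta>$2) (\<nu>$2) s * F (mat 1)"
proof -
  let ?m = "vector [sgn t, sgn s] :: real^2" and ?a = "vector [\<bar>t\<bar>, \<bar>s\<bar>] :: real^2"
  have "mat 1 \<in> unip2" unfolding unip2_def by (rule CollectI, rule exI[of _ 0]) (simp add: mat2_eq_iff)
  moreover have "\<forall>j. ?m $ j \<in> {1, - 1}" "\<forall>j. ?a $ j > 0" using t by (auto simp: forall_2 sgn_if)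
  ultimately have "F (mat 1 ** diag_mat ?m ** diag_mat ?a ** mat 1) =
     (\<Prod>j\<in>UNIV. complex_of_real (?m $ j) powi (- of_bool (\<eta> $ j = 1))) *
     (\<Prod>j\<in>UNIV. complex_of_real (?a $ j) powr (- (\<nu> $ j))) * F (mat 1)"
    using F mat_1_GL unfolding J_ser_def princ_series_def by blast
  moreover have "mat 1 ** diag_mat ?m ** diag_mat ?a ** mat 1 = diag2 t s"
    using t by (simp add: mat2_eq_iff matrix_mult_2 diag_mat_def diag2_def sgn_mult_abs)
  ultimately show ?thesis unfolding prod_UNIV_2 qchar_def by simp
qed

lemma J_ser_nil2:
  assumes F: "F \<in> J_ser \<eta> \<nu>"
  shows "F (nil2 s) = F (mat 1)"
proof -
  have "nil2 s \<in> unip2" unfolding unip2_def nil2_def by blast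
  moreover have "\<forall>j. (1 :: real^2) $ j \<in> {1, - 1}" "\<forall>j. (1 :: real^2) $ j > 0" by auto
  ultimately have "F (mat 1 ** diag_mat 1 ** diag_mat 1 ** nil2 s) =
     (\<Prod>j\<in>UNIV. complex_of_real ((1 :: real^2) $ j) powi (- of_bool (\<eta> $ j = 1))) *
     (\<Prod>j\<in>UNIV. complex_of_real ((1 :: real^2) $ j) powr (- (\<nu> $ j))) * F (mat 1)"
    using F mat_1_GL unfolding J_ser_def princ_series_def by blast
  moreover have "(diag_mat 1 :: real^2^2) = mat 1" by (simp add: mat2_eq_iff diag_mat_def)
  ultimately show ?thesis by simp
qed

text \<open>Fix equivariant functions with the jets of all monomials. Subtracting from f the
  combination that matches its Taylor coefficients leaves a function flat at the identity, which T
  annihilates there. Every k beyond the local order of T works, so the cube of exponents can later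
  be enlarged at will.\<close>

lemma Diff_G3_jet_functional:
  assumes T: "T \<in> Diff_G3 \<xi> lam \<eta> \<nu>"
  shows "\<exists>k0. \<forall>k\<ge>k0. \<exists>b. \<forall>f\<in>I_ser \<xi> lam. T f (mat 1) =
    (\<Sum>t\<in>{..k} \<times> {..k} \<times> {..k}. b t * pdm (fst t) (fst (snd t)) (snd (snd t)) (\<lambda>x. f (uch x)) 0)"
proof -
  have "diff_op_along iota3 GL (I_ser \<xi> lam) T" using T unfolding Diff_G3_def by blast
  then obtain U k0 c where U: "mat 1 \<in> U" and
    Tf: "\<And>f z. f \<in> I_ser \<xi> lam \<Longrightarrow> z \<in> U \<Longrightarrow> T f z = (\<Sum>vs\<in>{vs. set vs \<subseteq> Basis \<and> length vs \<le> k0}. c vs z * iter_deriv vs f (iota3 z))"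
    unfolding diff_op_along_def using mat_1_GL by meson
  let ?V = "{vs :: (real^3^3) list. set vs \<subseteq> Basis \<and> length vs \<le> k0}"
  show ?thesis
  proof (intro exI[of _ k0] allI impI)
    fix k assume k: "k \<ge> k0"
    let ?K = "{..k} \<times> {..k} \<times> {..k}"
    let ?p = "\<lambda>t :: nat \<times> nat \<times> nat. pdm (fst t) (fst (snd t)) (snd (snd t))"
    let ?m = "\<lambda>t :: nat \<times> nat \<times> nat. monom3 (fst t) (fst (snd t)) (snd (snd t))"
    define ff where "ff t = (fact (fst t) * fact (fst (snd t)) * fact (snd (snd t)) :: complex)" for t :: "nat \<times> nat \<times> nat"
    have "\<forall>t. \<exists>f\<in>I_ser \<xi> lam. flat k 0 (\<lambda>x. f (uch x) - ?m t x)"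
      using exists_I_ser_jet[OF smooth_on_monom3[OF open_UNIV]] by blast
    then obtain F where F: "\<And>t. F t \<in> I_ser \<xi> lam" "\<And>t. flat k 0 (\<lambda>x. F t (uch x) - ?m t x)" by metis
    \<comment> \<open>Value of T at the identity on the function with the jet of the t-th monomial,
      divided by the factorials of that monomial.\<close>
    define b where "b t = (\<Sum>vs\<in>?V. c vs (mat 1) * iter_deriv vs (F t) (mat 1)) / ff t" for t
    have "T f (mat 1) = (\<Sum>t\<in>?K. b t * ?p t (\<lambda>x. f (uch x)) 0)" if f: "f \<in> I_ser \<xi> lam" for f
    proof -
      define a where "a t = ?p t (\<lambda>x. f (uch x)) 0 / ff t" for t
      \<comment> \<open>f minus its Taylor expansion, with monomials replaced by their equivariant
        substitutes.\<close>
      define f' where "f' g = f g + (\<Sum>t\<in>?K. - a t * F t g)" for g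
      have sumI: "(\<lambda>g. \<Sum>t\<in>?K. - a t * F t g) \<in> I_ser \<xi> lam" by (intro I_ser_lincomb F)
      have f': "f' \<in> I_ser \<xi> lam" unfolding f'_def[abs_def] by (rule I_ser_add[OF f sumI])
      have sf: "smooth_on UNIV (\<lambda>x. f (uch x))" by (rule smooth_on_I_ser_uch1[OF f])
      have sF: "smooth_on UNIV (\<lambda>x. F t (uch x) - ?m t x)" for t
        by (intro smooth_on_diff smooth_on_I_ser_uch1[OF F(1)] smooth_on_monom3 open_UNIV)
      have "f' (uch x) = (f (uch x) - taylor3 k (\<lambda>x. f (uch x)) x) + (\<Sum>t\<in>?K. - a t * (F t (uch x) - ?m t x))" for x
      proof -
        have "taylor3 k (\<lambda>x. f (uch x)) x = (\<Sum>t\<in>?K. a t * ?m t x)"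
          by (simp add: taylor3_def case_prod_beta a_def ff_def)
        then show ?thesis by (simp add: f'_def right_diff_distrib sum_subtractf sum_negf)
      qed
      moreover have "flat k 0 (\<lambda>x. (f (uch x) - taylor3 k (\<lambda>x. f (uch x)) x) + (\<Sum>t\<in>?K. - a t * (F t (uch x) - ?m t x)))"
        by (intro flat_add[OF open_UNIV UNIV_I] flat_sum[OF open_UNIV UNIV_I] flat_mult[OF open_UNIV UNIV_I]
            smooth_on_sum smooth_on_mult smooth_on_const smooth_on_diff smooth_on_taylor3 flat_taylor3 sf sF F open_UNIV
            smooth_on_I_ser_uch1[OF F(1)] smooth_on_monom3)
      ultimately have "flat k 0 (\<lambda>x. f' (uch x))" by (simp only:)
      then have fl: "flat k (mat 1) f'" by (rule flat_I_ser[OF f'])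
      have it: "iter_deriv vs f (mat 1) = (\<Sum>t\<in>?K. a t * iter_deriv vs (F t) (mat 1))" if "length vs \<le> k" for vs
      proof -
        have sm: "smooth_on GL (\<lambda>g. - a t * F t g)" for t
          by (intro smooth_on_mult smooth_on_const I_ser_smooth[OF F(1)] open_GL)
        have "iter_deriv vs f' (mat 1) = iter_deriv vs f (mat 1) + iter_deriv vs (\<lambda>g. \<Sum>t\<in>?K. - a t * F t g) (mat 1)"
          unfolding f'_def[abs_def]
          by (rule iter_deriv_add[OF open_GL I_ser_smooth[OF f] I_ser_smooth[OF sumI] mat_1_GL])
        also have "iter_deriv vs (\<lambda>g. \<Sum>t\<in>?K. - a t * F t g) (mat 1) = (\<Sum>t\<in>?K. iter_deriv vs (\<lambda>g. - a t * F t g) (mat 1))"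
          by (rule iter_deriv_sum[OF open_GL sm mat_1_GL])
        also have "\<dots> = (\<Sum>t\<in>?K. - a t * iter_deriv vs (F t) (mat 1))"
          by (intro sum.cong refl iter_deriv_cmult[OF open_GL I_ser_smooth[OF F(1)] mat_1_GL])
        finally show ?thesis using fl that by (simp add: flat_def sum_negf)
      qed
      have "T f (mat 1) = (\<Sum>vs\<in>?V. c vs (mat 1) * (\<Sum>t\<in>?K. a t * iter_deriv vs (F t) (mat 1)))"
        unfolding Tf[OF f U] by (intro sum.cong refl) (use it k in auto)
      also have "\<dots> = (\<Sum>t\<in>?K. \<Sum>vs\<in>?V. a t * (c vs (mat 1) * iter_deriv vs (F t) (mat 1)))"
        by (subst sum.swap) (simp add: sum_distrib_left mult_ac)
      also have "\<dots> = (\<Sum>t\<in>?K. b t * ?p t (\<lambda>x. f (uch x)) 0)"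
        unfolding sum_distrib_left[symmetric] by (intro sum.cong refl) (simp add: a_def b_def mult_ac)
      finally show ?thesis .
    qed
    then show "\<exists>b. \<forall>f\<in>I_ser \<xi> lam. T f (mat 1) = (\<Sum>t\<in>?K. b t * ?p t (\<lambda>x. f (uch x)) 0)" by blast
  qed
qed

text \<open>Tested on an equivariant function with the jet of one monomial, the torus multiplies the
  functional by an explicit character, which must be the inducing character of J.\<close>

lemma Diff_G3_weights:
  assumes T: "T \<in> Diff_G3 \<xi> lam \<eta> \<nu>"
    and b: "\<And>f. f \<in> I_ser \<xi> lam \<Longrightarrow> T f (mat 1) =
    (\<Sum>t\<in>{..k} \<times> {..k} \<times> {..k}. b t * pdm (fst t) (fst (snd t)) (snd (snd t)) (\<lambda>x. f (uch x)) 0)"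
    and t: "i \<le> k" "j \<le> k" "l \<le> k" "b (i, j, l) \<noteq> 0"
  shows "\<nu>$1 - lam$1 = of_nat (i + l) \<and> \<xi>$1 + \<eta>$1 = of_nat (i + l) \<and> lam$3 - \<nu>$2 = of_nat (j + l) \<and> \<xi>$3 + \<eta>$2 = of_nat (j + l)"
proof -
  let ?K = "{..k} \<times> {..k} \<times> {..k}"
  let ?p = "\<lambda>t :: nat \<times> nat \<times> nat. pdm (fst t) (fst (snd t)) (snd (snd t))"
  \<comment> \<open>Exponents in the cube have total degree up to 3 k.\<close>
  obtain f where f: "f \<in> I_ser \<xi> lam" and fl: "flat (3 * k) 0 (\<lambda>x. f (uch x) - monom3 i j l x)"
    using exists_I_ser_jet[OF smooth_on_monom3[OF open_UNIV]] by blast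
  have sf: "smooth_on UNIV (\<lambda>x. f (uch x))" by (rule smooth_on_I_ser_uch1[OF f])
  have p: "?p u (\<lambda>x. f (uch x)) 0 = (if u = (i, j, l) then fact i * fact j * fact l else 0)" if "u \<in> ?K" for u
  proof -
    have "?p u (\<lambda>x. f (uch x) - monom3 i j l x) 0 = 0"
      by (rule flat_imp_pdm[OF fl]) (use that in auto)
    then have "?p u (\<lambda>x. f (uch x)) 0 = ?p u (monom3 i j l) 0"
      by (simp add: pdm_diff sf smooth_on_monom3)
    then show ?thesis by (cases u) (auto simp: pdm_monom3)
  qed
  have "qchar (\<xi>$1) (lam$1) t * qchar (\<xi>$3) (lam$3) s * (of_real (1 / t) ^ (i + l) * of_real s ^ (j + l))
      = qchar (\<eta>$1) (\<nu>$1) t * qchar (\<eta>$2) (\<nu>$2) s" if ts: "t \<noteq> 0" "s \<noteq> 0" for t s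
  proof -
    let ?\<chi> = "qchar (\<xi>$1) (lam$1) t * qchar (\<xi>$3) (lam$3) s"
    have fh: "(\<lambda>g. f (iota3 (diag2 t s) ** g)) \<in> I_ser \<xi> lam"
      by (rule I_ser_translate[OF f]) (simp add: ts)
    have ss: "smooth_on UNIV (\<lambda>x. f (uch (scal t s x)))"
      by (rule smooth_on_compose[OF open_UNIV open_UNIV smooth_on_linear[OF open_UNIV bounded_linear_scal] sf UNIV_I])
    have "T (\<lambda>g. f (iota3 (diag2 t s) ** g)) (mat 1)
      = (\<Sum>u\<in>?K. b u * ?p u (\<lambda>x. ?\<chi> * f (uch (scal t s x))) 0)"
      unfolding b[OF fh] I_ser_torus[OF f ts] ..
    also have "\<dots> = (\<Sum>u\<in>?K. if u = (i, j, l) then b u * (?\<chi> * (of_real (1 / t) ^ (i + l) * of_real s ^ (j + l) * (fact i * fact j * fact l))) else 0)"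
    proof (intro sum.cong refl)
      fix u assume "u \<in> ?K"
      then show "b u * ?p u (\<lambda>x. ?\<chi> * f (uch (scal t s x))) 0
        = (if u = (i, j, l) then b u * (?\<chi> * (of_real (1 / t) ^ (i + l) * of_real s ^ (j + l) * (fact i * fact j * fact l))) else 0)"
        unfolding pdm_cmult[OF ss] pdm_scal[OF sf] p[OF \<open>u \<in> ?K\<close>] by simp
    qed
    also have "\<dots> = b (i, j, l) * (?\<chi> * (of_real (1 / t) ^ (i + l) * of_real s ^ (j + l) * (fact i * fact j * fact l)))"
      using t by (simp add: sum.delta)
    finally have 1: "T f (diag2 t s) = b (i, j, l) * (?\<chi> * (of_real (1 / t) ^ (i + l) * of_real s ^ (j + l) * (fact i * fact j * fact l)))"
      using Diff_G3_translate[OF T f diag2_GL[OF ts], of "mat 1"] by simp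
    have "T f (mat 1) = (\<Sum>u\<in>?K. if u = (i, j, l) then b u * (fact i * fact j * fact l) else 0)"
      unfolding b[OF f] by (intro sum.cong refl) (simp add: p)
    also have "\<dots> = b (i, j, l) * (fact i * fact j * fact l)" using t by (simp add: sum.delta)
    finally have 2: "T f (mat 1) = b (i, j, l) * (fact i * fact j * fact l)" .
    have "b (i, j, l) * (fact i * fact j * fact l) \<noteq> 0" using t(4) by simp
    then show ?thesis
      using J_ser_diag2[OF Diff_G3_J_ser[OF T f] ts] unfolding 1 2 by (simp add: mult_ac)
  qed
  then show ?thesis using torus_weight_iff[of "\<xi>$1" "lam$1" "\<xi>$3" "lam$3" "i + l" "j + l"] by blast
qed

text \<open>Spreads the functional \<open>Lop\<close> from the identity to all of \<open>GL\<close>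
  by left translation of the argument.\<close>

definition lift_op :: "nat \<times> nat \<Rightarrow> (nat \<Rightarrow> complex) \<Rightarrow> bit^3 \<Rightarrow> complex^3 \<Rightarrow> (real^3^3 \<Rightarrow> complex) \<Rightarrow> (real^2^2 \<Rightarrow> complex)" where
  "lift_op \<alpha> b \<xi> lam f = (\<lambda>h. if f \<in> I_ser \<xi> lam \<and> h \<in> GL then Lop \<alpha> b (\<lambda>x. f (iota3 h ** uch x)) 0 else 0)"

text \<open>\<open>iota3\<close> is only affine, because of its constant middle entry; subtracting
  its value at 0 leaves the linear part.\<close>

lemma bounded_linear_iota3_mult: "bounded_linear (\<lambda>h. iota3 h ** C - iota3 0 ** C)" for C :: "real^3^3"
  unfolding linear_conv_bounded_linear[symmetric]
  by (rule linearI) (simp_all add: mat3_eq_iff matrix_mult_3 algebra_simps)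

lemma smooth_on_iota3_mult: "open S \<Longrightarrow> smooth_on S (\<lambda>h. iota3 h ** C)" for C :: "real^3^3"
  using smooth_on_affine[OF bounded_linear_iota3_mult, of S C "iota3 0 ** C"] by simp

lemma smooth_on_iota3: "open S \<Longrightarrow> smooth_on S iota3"
  using smooth_on_iota3_mult[of S "mat 1"] by simp

text \<open>As \<open>uch\<close> is affine, derivatives in the chart at h are matrix derivatives at
  \<open>iota3 h\<close> along directions that depend smoothly on h.\<close>

lemma pdm_translate_form:
  "diff_op_form iota3 GL {f. smooth_on GL f} (\<lambda>f h. pdm i j l (\<lambda>x. f (iota3 h ** uch x)) 0)"
proof -
  let ?vs = "replicate i (axis 1 1) @ replicate j (axis 2 1) @ replicate l (axis 3 1) :: (real^3) list"
  have "diff_op_form iota3 GL {f. smooth_on GL f}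
     (\<lambda>f h. iter_deriv (map (\<lambda>V. V h) (map (\<lambda>v h. iota3 h ** duch v) ?vs)) f (iota3 h))"
    by (rule diff_op_form_iter_smooth[OF open_GL open_GL]) (auto intro!: smooth_on_iota3_mult open_GL)
  then show ?thesis
  proof (rule diff_op_form_cong[rotated])
    fix f :: "real^3^3 \<Rightarrow> complex" and h :: "real^2^2"
    assume f: "f \<in> {f. smooth_on GL f}" and h: "h \<in> GL"
    have A: "bounded_linear (\<lambda>x. iota3 h ** duch x)"
      by (rule bounded_linear_compose[OF bounded_linear_matrix_left bounded_linear_duch])
    have d0: "duch 0 = 0" by (simp add: mat3_eq_iff)
    have u: "iota3 h ** uch x = iota3 h ** duch x + iota3 h" for x
      unfolding uch_affine by (simp add: matrix_add_ldistrib)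
    have "iota3 h ** duch 0 + iota3 h \<in> GL" using h by (simp add: d0)
    then have "iter_deriv ?vs (\<lambda>x. f (iota3 h ** duch x + iota3 h)) 0
      = iter_deriv (map (\<lambda>x. iota3 h ** duch x) ?vs) f (iota3 h ** duch 0 + iota3 h)"
      using f by (intro iter_deriv_affine[OF A open_GL]) simp_all
    then show "iter_deriv (map (\<lambda>V. V h) (map (\<lambda>v h. iota3 h ** duch v) ?vs)) f (iota3 h)
       = pdm i j l (\<lambda>x. f (iota3 h ** uch x)) 0"
      unfolding pdm_def u by (simp add: d0 o_def)
  qed
qed

lemma Lop_translate_form:
  "diff_op_form iota3 GL {f. smooth_on GL f} (\<lambda>f h. Lop \<alpha> b (\<lambda>x. f (iota3 h ** uch x)) 0)"
  unfolding Lop_def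
  by (intro diff_op_form_sum diff_op_form_mult[OF open_GL smooth_on_const] open_GL pdm_translate_form)

text \<open>The flow derivative at every time is the functional applied to an image of
  \<open>Xop\<close>, which the recursion annihilates; hence the value is constant in s.\<close>

lemma Lop_nil2_invariant:
  assumes w: "\<nu>1 - lam$1 = of_nat (fst \<alpha>)" "lam$3 - \<nu>2 = of_nat (snd \<alpha>)"
    and F: "Frob \<alpha> (\<nu>2 - lam$2 + 1) (\<nu>2 - \<nu>1 + 2) b"
    and f: "f \<in> I_ser \<xi> lam"
  shows "Lop \<alpha> b (\<lambda>x. f (iota3 (nil2 s) ** uch x)) 0 = Lop \<alpha> b (\<lambda>x. f (uch x)) 0"
proof -
  let ?F = "\<lambda>s. Lop \<alpha> b (\<lambda>x. f (iota3 (nil2 s) ** uch x)) 0"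
  have "(?F has_vector_derivative Lop \<alpha> b (Xop lam (\<lambda>x. f (iota3 (nil2 r) ** uch x))) 0) (at r)" for r
    unfolding Lop_def
    by (intro has_vector_derivative_sum has_vector_derivative_mult_right nil2_flow_derivative[OF f])
  moreover have "Lop \<alpha> b (Xop lam (\<lambda>x. f (iota3 (nil2 r) ** uch x))) 0 = 0" for r
    by (rule Frob_imp_Lop_Xop[OF w F smooth_on_I_ser_uch[OF f]]) simp
  ultimately have "(?F has_derivative (\<lambda>h. 0)) (at r within UNIV)" for r
    by (simp add: has_vector_derivative_def)
  then obtain c where "\<And>r. ?F r = c"
    using has_derivative_zero_constant[of UNIV ?F] by auto
  then have "?F s = ?F 0" by metis
  then show ?thesis by simp
qed

lemma Lop_torus:
  assumes w: "\<nu>$1 - lam$1 = of_nat (fst \<alpha>)" "\<xi>$1 + \<eta>$1 = of_nat (fst \<alpha>)" "lam$3 - \<nu>$2 = of_nat (snd \<alpha>)" "\<xi>$3 + \<eta>$2 = of_nat (snd \<alpha>)"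
    and f: "f \<in> I_ser \<xi> lam" and ts: "t \<noteq> 0" "s \<noteq> 0"
  shows "Lop \<alpha> b (\<lambda>x. f (iota3 (diag2 t s) ** uch x)) 0 = qchar (\<eta>$1) (\<nu>$1) t * qchar (\<eta>$2) (\<nu>$2) s * Lop \<alpha> b (\<lambda>x. f (uch x)) 0"
proof -
  let ?\<chi> = "qchar (\<xi>$1) (lam$1) t * qchar (\<xi>$3) (lam$3) s"
  have q: "?\<chi> * (of_real (1 / t) ^ fst \<alpha> * of_real s ^ snd \<alpha>) = qchar (\<eta>$1) (\<nu>$1) t * qchar (\<eta>$2) (\<nu>$2) s"
    using torus_weight_iff[of "\<xi>$1" "lam$1" "\<xi>$3" "lam$3" "fst \<alpha>" "snd \<alpha>" "\<eta>$1" "\<nu>$1" "\<eta>$2" "\<nu>$2"] w ts by blast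
  have sf: "smooth_on UNIV (\<lambda>x. f (uch x))" by (rule smooth_on_I_ser_uch1[OF f])
  have ss: "smooth_on UNIV (\<lambda>x. f (uch (scal t s x)))"
    by (rule smooth_on_compose[OF open_UNIV open_UNIV smooth_on_linear[OF open_UNIV bounded_linear_scal] sf UNIV_I])
  have "pdm (fst \<alpha> - n) (snd \<alpha> - n) n (\<lambda>x. f (iota3 (diag2 t s) ** uch x)) 0
     = qchar (\<eta>$1) (\<nu>$1) t * qchar (\<eta>$2) (\<nu>$2) s * pdm (fst \<alpha> - n) (snd \<alpha> - n) n (\<lambda>x. f (uch x)) 0"
    if "n \<le> min (fst \<alpha>) (snd \<alpha>)" for n
    unfolding I_ser_torus[OF f ts] pdm_cmult[OF ss] pdm_scal[OF sf] q[symmetric] using that by simp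
  then show ?thesis by (simp add: Lop_def sum_distrib_left mult.left_commute)
qed

text \<open>Left equivariance is built into the construction. Right equivariance is required only
  for the triangular group, which is generated by the torus and the group
  \<open>nil2\<close>.\<close>

lemma lift_op_in_Diff_G3:
  assumes w: "\<nu>$1 - lam$1 = of_nat (fst \<alpha>)" "\<xi>$1 + \<eta>$1 = of_nat (fst \<alpha>)" "lam$3 - \<nu>$2 = of_nat (snd \<alpha>)" "\<xi>$3 + \<eta>$2 = of_nat (snd \<alpha>)"
    and F: "Frob \<alpha> (\<nu>$2 - lam$2 + 1) (\<nu>$2 - \<nu>$1 + 2) b"
  shows "lift_op \<alpha> b \<xi> lam \<in> Diff_G3 \<xi> lam \<eta> \<nu>"
proof -
  let ?T = "lift_op \<alpha> b \<xi> lam"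
  have form: "diff_op_form iota3 GL (I_ser \<xi> lam) ?T"
  proof (rule diff_op_form_cong)
    show "diff_op_form iota3 GL (I_ser \<xi> lam) (\<lambda>f h. Lop \<alpha> b (\<lambda>x. f (iota3 h ** uch x)) 0)"
      by (rule diff_op_form_subset[OF Lop_translate_form]) (use I_ser_smooth in blast)
  qed (simp add: lift_op_def)
  have J: "?T f \<in> J_ser \<eta> \<nu>" if f: "f \<in> I_ser \<xi> lam" for f
    unfolding J_ser_def princ_series_def
  proof (intro CollectI conjI allI impI)
    have "smooth_on GL (\<lambda>h. Lop \<alpha> b (\<lambda>x. f (iota3 h ** uch x)) 0)"
      by (rule smooth_on_diff_op_form[OF open_GL open_GL smooth_on_iota3[OF open_GL] _ I_ser_smooth[OF f] Lop_translate_form]) simp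
    then show "smooth_on GL (?T f)"
      by (rule smooth_on_cong[OF open_GL, rotated]) (simp add: lift_op_def f)
    show "?T f g = 0" if "g \<notin> GL" for g using that by (simp add: lift_op_def)
    fix g :: "real^2^2" and m a :: "real^2" and n
    assume H: "g \<in> GL \<and> (\<forall>j. m $ j \<in> {1, - 1}) \<and> (\<forall>j. a $ j > 0) \<and> n \<in> unip2"
    then obtain s where n: "n = nil2 s" unfolding unip2_def nil2_def by blast
    have g: "g \<in> GL" using H by blast
    have m: "m$1 = 1 \<or> m$1 = - 1" "m$2 = 1 \<or> m$2 = - 1" and a: "a$1 > 0" "a$2 > 0" using H by auto
    let ?t = "m$1 * a$1" and ?s = "m$2 * a$2"
    have ts: "?t \<noteq> 0" "?s \<noteq> 0" using m a by auto
    have dd: "diag_mat m ** diag_mat a = diag2 ?t ?s"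
      by (simp add: mat2_eq_iff matrix_mult_2 diag_mat_def diag2_def)
    have e: "g ** diag_mat m ** diag_mat a ** n = g ** diag2 ?t ?s ** nil2 s"
      unfolding n dd[symmetric] by (simp add: matrix_mul_assoc)
    have G: "g ** diag2 ?t ?s ** nil2 s \<in> GL" by (intro mult_GL g diag2_GL[OF ts] nil2_GL)
    \<comment> \<open>Absorbing g and the torus element into f reduces the claim to the identity,
      where invariance under \<open>nil2\<close> and the torus weight apply one after the
      other.\<close>
    let ?f1 = "\<lambda>k. f (iota3 g ** k)"
    let ?f2 = "\<lambda>k. ?f1 (iota3 (diag2 ?t ?s) ** k)"
    have f1: "?f1 \<in> I_ser \<xi> lam" by (rule I_ser_translate[OF f]) (simp add: g)
    have f2: "?f2 \<in> I_ser \<xi> lam" by (rule I_ser_translate[OF f1]) (simp only: iota3_GL diag2_GL[OF ts])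
    have "?T f (g ** diag_mat m ** diag_mat a ** n) = Lop \<alpha> b (\<lambda>x. ?f2 (iota3 (nil2 s) ** uch x)) 0"
      unfolding e lift_op_def using f G by (simp add: iota3_mult matrix_mul_assoc)
    also have "\<dots> = Lop \<alpha> b (\<lambda>x. ?f2 (uch x)) 0"
      by (rule Lop_nil2_invariant[OF w(1,3) F f2])
    also have "\<dots> = qchar (\<eta>$1) (\<nu>$1) ?t * qchar (\<eta>$2) (\<nu>$2) ?s * Lop \<alpha> b (\<lambda>x. ?f1 (uch x)) 0"
      by (rule Lop_torus[OF w f1 ts])
    also have "Lop \<alpha> b (\<lambda>x. ?f1 (uch x)) 0 = ?T f g" by (simp add: lift_op_def f g)
    also have "qchar (\<eta>$1) (\<nu>$1) ?t * qchar (\<eta>$2) (\<nu>$2) ?s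
       = (\<Prod>j\<in>UNIV. complex_of_real (m $ j) powi (- of_bool (\<eta> $ j = 1))) *
         (\<Prod>j\<in>UNIV. complex_of_real (a $ j) powr (- (\<nu> $ j)))"
    proof -
      have "sgn ?t = m$1" "sgn ?s = m$2" "\<bar>?t\<bar> = a$1" "\<bar>?s\<bar> = a$2" using m a by (auto simp: sgn_if)
      then show ?thesis unfolding qchar_def prod_UNIV_2 by (simp only: mult_ac)
    qed
    finally show "?T f (g ** diag_mat m ** diag_mat a ** n) =
       (\<Prod>j\<in>UNIV. complex_of_real (m $ j) powi (- of_bool (\<eta> $ j = 1))) *
       (\<Prod>j\<in>UNIV. complex_of_real (a $ j) powr (- (\<nu> $ j))) * ?T f g" .
  qed
  have lin: "linear_op_on (I_ser \<xi> lam) ?T"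
    unfolding linear_op_on_def
  proof (intro conjI ballI allI)
    fix f g assume f: "f \<in> I_ser \<xi> lam" and g: "g \<in> I_ser \<xi> lam"
    have fg: "(\<lambda>x. f x + g x) \<in> I_ser \<xi> lam" by (rule I_ser_add[OF f g])
    show "?T (\<lambda>x. f x + g x) = (\<lambda>y. ?T f y + ?T g y)"
    proof
      fix h show "?T (\<lambda>x. f x + g x) h = ?T f h + ?T g h"
      proof (cases "h \<in> GL")
        case True
        then have "iota3 h \<in> GL" by simp
        then show ?thesis using True f g fg by (simp add: lift_op_def Lop_add smooth_on_I_ser_uch[of _ \<xi> lam])
      qed (simp add: lift_op_def)
    qed
  next
    fix f c assume f: "f \<in> I_ser \<xi> lam"
    have cf: "(\<lambda>x. c * f x) \<in> I_ser \<xi> lam"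
      using I_ser_lincomb[of "{()}" "\<lambda>_. f" \<xi> lam "\<lambda>_. c"] f by simp
    show "?T (\<lambda>x. c * f x) = (\<lambda>y. c * ?T f y)"
    proof
      fix h show "?T (\<lambda>x. c * f x) h = c * ?T f h"
      proof (cases "h \<in> GL")
        case True
        then have "smooth_on UNIV (\<lambda>x. f (iota3 h ** uch x))" by (intro smooth_on_I_ser_uch[OF f]) simp
        then have "Lop \<alpha> b (\<lambda>x. c * f (iota3 h ** uch x)) 0 = c * Lop \<alpha> b (\<lambda>x. f (iota3 h ** uch x)) 0"
          using Lop_lincomb[of "{()}" "\<lambda>_ x. f (iota3 h ** uch x)" \<alpha> b "\<lambda>_. c"] by simp
        then show ?thesis using True f cf by (simp add: lift_op_def)
      qed (simp add: lift_op_def)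
    qed
  qed
  have tw: "?T (ltrans (iota3 h) f) = ltrans h (?T f)" if h: "h \<in> GL" and f: "f \<in> I_ser \<xi> lam" for h f
  proof
    fix k
    let ?h = "matrix_inv h"
    have h': "?h \<in> GL" using matrix_inv_GL[OF h] by blast
    have "(\<lambda>g. f (iota3 ?h ** g)) \<in> I_ser \<xi> lam" by (rule I_ser_translate[OF f]) (simp add: h')
    then show "?T (ltrans (iota3 h) f) k = ltrans h (?T f) k"
      unfolding ltrans_def matrix_inv_iota3[OF h] lift_op_def
      using f by (simp add: mult_GL_iff[OF h'] iota3_mult matrix_mul_assoc)
  qed
  have "\<forall>f. f \<notin> I_ser \<xi> lam \<longrightarrow> ?T f = (\<lambda>_. 0)" by (auto simp: lift_op_def)
  then show ?thesis
    unfolding Diff_G3_def using J lin tw diff_op_form_along[OF open_GL form] by blast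
qed

lemma Diff_G3_eqI:
  assumes T: "T \<in> Diff_G3 \<xi> lam \<eta> \<nu>" and S: "S \<in> Diff_G3 \<xi> lam \<eta> \<nu>"
    and eq: "\<And>f. f \<in> I_ser \<xi> lam \<Longrightarrow> T f (mat 1) = S f (mat 1)"
  shows "T = S"
proof (intro ext)
  fix f h
  show "T f h = S f h"
  proof (cases "f \<in> I_ser \<xi> lam")
    case f: True
    show ?thesis
    proof (cases "h \<in> GL")
      case h: True
      then have "(\<lambda>g. f (iota3 h ** g)) \<in> I_ser \<xi> lam" by (intro I_ser_translate[OF f]) simp
      from eq[OF this] show ?thesis
        using Diff_G3_translate[OF T f h, of "mat 1"] Diff_G3_translate[OF S f h, of "mat 1"] by simp
    next
      case False
      then show ?thesis
        using Diff_G3_J_ser[OF T f] Diff_G3_J_ser[OF S f] by (simp add: J_ser_def princ_series_def)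
    qed
  next
    case False
    then show ?thesis using T S by (simp add: Diff_G3_def)
  qed
qed

lemma zero_in_Diff_G3: "(\<lambda>f h. 0) \<in> Diff_G3 \<xi> lam \<eta> \<nu>"
proof -
  have "(\<lambda>h. 0) \<in> J_ser \<eta> \<nu>" by (simp add: J_ser_def princ_series_def)
  then show ?thesis
    unfolding Diff_G3_def linear_op_on_def ltrans_def
    using diff_op_form_along[OF open_GL diff_op_form_zero] by auto
qed

lemma Diff_G3_trivial:
  assumes "\<not> (\<exists>p q. \<nu>$1 - lam$1 = of_nat p \<and> \<xi>$1 + \<eta>$1 = of_nat p \<and> lam$3 - \<nu>$2 = of_nat q \<and> \<xi>$3 + \<eta>$2 = of_nat q)"
  shows "Diff_G3 \<xi> lam \<eta> \<nu> = {\<lambda>f h. 0}"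
proof -
  have "T = (\<lambda>f h. 0)" if T: "T \<in> Diff_G3 \<xi> lam \<eta> \<nu>" for T
  proof (rule Diff_G3_eqI[OF T zero_in_Diff_G3])
    fix f assume f: "f \<in> I_ser \<xi> lam"
    obtain k b where b: "\<And>f. f \<in> I_ser \<xi> lam \<Longrightarrow> T f (mat 1) =
      (\<Sum>t\<in>{..k} \<times> {..k} \<times> {..k}. b t * pdm (fst t) (fst (snd t)) (snd (snd t)) (\<lambda>x. f (uch x)) 0)"
      using Diff_G3_jet_functional[OF T] by blast
    have "b (i, j, l) = 0" if "i \<le> k" "j \<le> k" "l \<le> k" for i j l
      using Diff_G3_weights[OF T b that] assms by blast
    then show "T f (mat 1) = 0" unfolding b[OF f] by (intro sum.neutral) auto
  qed
  then show ?thesis using zero_in_Diff_G3 by blast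
qed

lemma Diff_G3_eq_lift_ops:
  assumes w: "\<nu>$1 - lam$1 = of_nat (fst \<alpha>)" "\<xi>$1 + \<eta>$1 = of_nat (fst \<alpha>)" "lam$3 - \<nu>$2 = of_nat (snd \<alpha>)" "\<xi>$3 + \<eta>$2 = of_nat (snd \<alpha>)"
  shows "Diff_G3 \<xi> lam \<eta> \<nu> = {lift_op \<alpha> b \<xi> lam | b. Frob \<alpha> (\<nu>$2 - lam$2 + 1) (\<nu>$2 - \<nu>$1 + 2) b}"
proof (intro equalityI subsetI)
  fix T assume T: "T \<in> Diff_G3 \<xi> lam \<eta> \<nu>"
  obtain k0 where k0: "\<And>k. k \<ge> k0 \<Longrightarrow> \<exists>b. \<forall>f\<in>I_ser \<xi> lam. T f (mat 1) =
      (\<Sum>t\<in>{..k} \<times> {..k} \<times> {..k}. b t * pdm (fst t) (fst (snd t)) (snd (snd t)) (\<lambda>x. f (uch x)) 0)"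
    using Diff_G3_jet_functional[OF T] by blast
  \<comment> \<open>Large enough for the functional and for the cube to contain every exponent of
    weight \<alpha>.\<close>
  define k where "k = max k0 (fst \<alpha> + snd \<alpha>)"
  obtain B where B: "\<And>f. f \<in> I_ser \<xi> lam \<Longrightarrow> T f (mat 1) =
      (\<Sum>t\<in>{..k} \<times> {..k} \<times> {..k}. B t * pdm (fst t) (fst (snd t)) (snd (snd t)) (\<lambda>x. f (uch x)) 0)"
    using k0[of k] by (auto simp: k_def)
  define b where "b n = B (fst \<alpha> - n, snd \<alpha> - n, n)" for n
  have T1: "T f (mat 1) = Lop \<alpha> b (\<lambda>x. f (uch x)) 0" if f: "f \<in> I_ser \<xi> lam" for f
  proof -
    let ?g = "\<lambda>t. B t * pdm (fst t) (fst (snd t)) (snd (snd t)) (\<lambda>x. f (uch x)) 0"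
    let ?i = "\<lambda>n. (fst \<alpha> - n, snd \<alpha> - n, n)"
    let ?M = "{..min (fst \<alpha>) (snd \<alpha>)}"
    have "sum ?g ({..k} \<times> {..k} \<times> {..k}) = sum ?g (?i ` ?M)"
    proof (rule sum.mono_neutral_right)
      show "?i ` ?M \<subseteq> {..k} \<times> {..k} \<times> {..k}" by (auto simp: k_def)
      show "\<forall>t\<in>{..k} \<times> {..k} \<times> {..k} - ?i ` ?M. ?g t = 0"
      proof
        fix t assume t: "t \<in> {..k} \<times> {..k} \<times> {..k} - ?i ` ?M"
        obtain i j l where ijl: "t = (i, j, l)" by (cases t)
        show "?g t = 0"
        proof (rule ccontr)
          assume "?g t \<noteq> 0"
          then have "B (i, j, l) \<noteq> 0" by (auto simp: ijl)
          then have "\<nu>$1 - lam$1 = of_nat (i + l)" "lam$3 - \<nu>$2 = of_nat (j + l)"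
            using Diff_G3_weights[OF T B, of i j l] t ijl by auto
          then have "of_nat (i + l) = (of_nat (fst \<alpha>) :: complex)" "of_nat (j + l) = (of_nat (snd \<alpha>) :: complex)"
            using w by simp_all
          then have "i + l = fst \<alpha>" "j + l = snd \<alpha>" by (simp_all only: of_nat_eq_iff)
          then have "t = ?i l" "l \<in> ?M" by (auto simp: ijl)
          then show False using t by blast
        qed
      qed
    qed simp
    also have "\<dots> = sum (?g \<circ> ?i) ?M" by (rule sum.reindex) (auto simp: inj_on_def)
    finally show ?thesis unfolding B[OF f] by (simp add: Lop_def b_def)
  qed
  have "Frob \<alpha> (\<nu>$2 - lam$2 + 1) (\<nu>$2 - \<nu>$1 + 2) b"
  proof (rule Lop_Xop_imp_Frob[OF w(1,3)])
    fix f assume f: "f \<in> I_ser \<xi> lam"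
    have "Lop \<alpha> b (\<lambda>x. f (iota3 (nil2 s) ** uch x)) 0 = T f (mat 1)" for s
    proof -
      have "(\<lambda>g. f (iota3 (nil2 s) ** g)) \<in> I_ser \<xi> lam" by (rule I_ser_translate[OF f]) simp
      from T1[OF this] have "Lop \<alpha> b (\<lambda>x. f (iota3 (nil2 s) ** uch x)) 0 = T f (nil2 s)"
        using Diff_G3_translate[OF T f nil2_GL, of s "mat 1"] by simp
      also have "\<dots> = T f (mat 1)" by (rule J_ser_nil2[OF Diff_G3_J_ser[OF T f]])
      finally show ?thesis .
    qed
    moreover have "((\<lambda>s. Lop \<alpha> b (\<lambda>x. f (iota3 (nil2 s) ** uch x)) 0) has_vector_derivative
       Lop \<alpha> b (Xop lam (\<lambda>x. f (uch x))) 0) (at 0)"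
      unfolding Lop_def
      by (intro has_vector_derivative_sum has_vector_derivative_mult_right nil2_flow_derivative_0[OF f])
    \<comment> \<open>The functional is constant along the unipotent flow, so its derivative, given
      by \<open>Xop\<close>, is that of a constant.\<close>
    ultimately have "((\<lambda>s :: real. T f (mat 1)) has_vector_derivative Lop \<alpha> b (Xop lam (\<lambda>x. f (uch x))) 0) (at 0)"
      by simp
    then show "Lop \<alpha> b (Xop lam (\<lambda>x. f (uch x))) 0 = 0"
      using vector_derivative_unique_at has_vector_derivative_const by metis
  qed
  note Fr = this
  have "T = lift_op \<alpha> b \<xi> lam"
    by (rule Diff_G3_eqI[OF T lift_op_in_Diff_G3[OF w Fr]]) (simp add: T1 lift_op_def)
  then show "T \<in> {lift_op \<alpha> b \<xi> lam | b. Frob \<alpha> (\<nu>$2 - lam$2 + 1) (\<nu>$2 - \<nu>$1 + 2) b}" using Fr by blast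
qed (use lift_op_in_Diff_G3[OF w] in blast)

section \<open>The operators on the cells\<close>

text \<open>Indexing cell operators by their normally ordered coefficients makes the solution space
  of the recursion a space of operators.\<close>

definition ord_op :: "nat \<times> nat \<Rightarrow> (nat \<Rightarrow> complex) \<Rightarrow> cell_operator" where
  "ord_op \<alpha> b = Rest3 (\<lambda>\<phi> x. \<Sum>n\<le>min (fst \<alpha>) (snd \<alpha>). b n * D_ord (fst \<alpha> - n) (snd \<alpha> - n) n \<phi> x)"

lemma ord_op_eq:
  assumes "\<phi> \<in> Cinf"
  shows "ord_op \<alpha> b \<phi> t = Lop \<alpha> b (\<lambda>x. \<phi> (kap x)) (axis3 t)"
  using assms by (simp add: ord_op_def Rest3_def Lop_def D_ord_def D_ord_axis3 Cinf_def)

lemma ord_op_notin: "\<phi> \<notin> Cinf \<Longrightarrow> ord_op \<alpha> b \<phi> = (\<lambda>_. 0)"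
  by (simp add: ord_op_def Rest3_def)

lemma smooth_on_axis3: "open S \<Longrightarrow> smooth_on S axis3"
  unfolding axis3_def[abs_def] by (intro smooth_on_vector_3 smooth_on_const smooth_on_ident)

lemma smooth_on_comp_kap: "\<phi> \<in> Cinf \<Longrightarrow> smooth_on UNIV (\<lambda>x. \<phi> (kap x))"
  unfolding Cinf_def by (intro smooth_on_compose[OF open_UNIV open_UNIV smooth_on_kap(1)[OF open_UNIV]]) simp_all

lemma diff_op_form_D:
  assumes "diff_op_form (\<lambda>x. x) UNIV Cinf T"
  shows "diff_op_form (\<lambda>x. x) UNIV Cinf (\<lambda>\<phi>. D1 (T \<phi>))"
    "diff_op_form (\<lambda>x. x) UNIV Cinf (\<lambda>\<phi>. D2 (T \<phi>))"
    "diff_op_form (\<lambda>x. x) UNIV Cinf (\<lambda>\<phi>. D3 (T \<phi>))"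
proof -
  have h: "smooth_on UNIV (\<lambda>x :: real^3. complex_of_real (c * x $ i))" for c i
    by (intro smooth_intros open_UNIV)
  have d: "diff_op_form (\<lambda>x. x) UNIV Cinf (\<lambda>\<phi> x. pd i (T \<phi>) x)" for i
    unfolding pd_def by (rule diff_op_form_deriv[OF _ assms]) (auto simp: Cinf_def)
  note m = diff_op_form_add[OF open_UNIV d diff_op_form_mult[OF open_UNIV h d]]
  show "diff_op_form (\<lambda>x. x) UNIV Cinf (\<lambda>\<phi>. D1 (T \<phi>))"
    by (rule diff_op_form_cong[OF _ m[of 1 "1 / 2" 2 3]]) (simp add: D1_def)
  show "diff_op_form (\<lambda>x. x) UNIV Cinf (\<lambda>\<phi>. D2 (T \<phi>))"
    by (rule diff_op_form_cong[OF _ m[of 2 "- 1 / 2" 1 3]]) (simp add: D2_def)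
  show "diff_op_form (\<lambda>x. x) UNIV Cinf (\<lambda>\<phi>. D3 (T \<phi>))"
    unfolding D3_def by (rule d)
qed

lemma diff_op_form_D_ord: "diff_op_form (\<lambda>x. x) UNIV Cinf (D_ord a b c)"
proof -
  have 0: "diff_op_form (\<lambda>x. x) UNIV Cinf (\<lambda>\<phi>. \<phi>)"
    using diff_op_form_iter[of "[]" "\<lambda>x. x" UNIV Cinf] by simp
  have 3: "diff_op_form (\<lambda>x. x) UNIV Cinf (\<lambda>\<phi>. (D3 ^^ c) \<phi>)"
    by (induction c) (simp_all add: 0 diff_op_form_D)
  have 2: "diff_op_form (\<lambda>x. x) UNIV Cinf (\<lambda>\<phi>. (D2 ^^ b) ((D3 ^^ c) \<phi>))"
    by (induction b) (simp_all add: 3 diff_op_form_D)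
  have "diff_op_form (\<lambda>x. x) UNIV Cinf (\<lambda>\<phi>. (D1 ^^ a) ((D2 ^^ b) ((D3 ^^ c) \<phi>)))"
    by (induction a) (simp_all add: 2 diff_op_form_D)
  then show ?thesis unfolding D_ord_def[abs_def] .
qed

lemma ord_op_in_cell_diff_ops: "ord_op \<alpha> b \<in> cell_diff_ops"
proof -
  let ?P = "\<lambda>\<phi> x. \<Sum>n\<le>min (fst \<alpha>) (snd \<alpha>). b n * D_ord (fst \<alpha> - n) (snd \<alpha> - n) n \<phi> x"
  have "diff_op_form (\<lambda>x. x) UNIV Cinf ?P"
    by (intro diff_op_form_sum diff_op_form_mult[OF open_UNIV smooth_on_const] open_UNIV diff_op_form_D_ord)
  then have "diff_op_form axis3 UNIV Cinf (\<lambda>\<phi> t. ?P \<phi> (axis3 t))"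
    by (rule diff_op_form_restrict[OF _ open_UNIV smooth_on_axis3[OF open_UNIV]])
  then have "diff_op_form axis3 UNIV Cinf (ord_op \<alpha> b)"
    by (rule diff_op_form_cong[rotated]) (simp add: ord_op_def Rest3_def)
  then have d: "diff_op_along axis3 UNIV Cinf (ord_op \<alpha> b)" by (rule diff_op_form_along[OF open_UNIV])
  have s: "ord_op \<alpha> b \<phi> \<in> Cinf" if \<phi>: "\<phi> \<in> Cinf" for \<phi>
  proof -
    have "smooth_on UNIV (?P \<phi>)"
      using \<phi> by (intro smooth_on_sum smooth_on_mult smooth_on_const smooth_on_D_ord open_UNIV) (simp add: Cinf_def)
    then have "smooth_on UNIV (\<lambda>t. ?P \<phi> (axis3 t))"
      by (rule smooth_on_compose[OF open_UNIV open_UNIV smooth_on_axis3[OF open_UNIV]]) simp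
    then show ?thesis using \<phi> by (simp add: ord_op_def Rest3_def Cinf_def)
  qed
  have add: "(\<lambda>x. \<phi> x + \<psi> x) \<in> Cinf" if "\<phi> \<in> Cinf" "\<psi> \<in> Cinf" for \<phi> \<psi> :: "real^3 \<Rightarrow> complex"
    using that by (simp add: Cinf_def smooth_on_add)
  have cm: "(\<lambda>x. c * \<phi> x) \<in> Cinf" if "\<phi> \<in> Cinf" for \<phi> :: "real^3 \<Rightarrow> complex" and c
    using that by (simp add: Cinf_def smooth_on_mult)
  have "linear_op_on Cinf (ord_op \<alpha> b)"
    unfolding linear_op_on_def
  proof (intro conjI ballI allI ext)
    fix \<phi> \<psi> :: "real^3 \<Rightarrow> complex" and t assume "\<phi> \<in> Cinf" "\<psi> \<in> Cinf"
    then show "ord_op \<alpha> b (\<lambda>x. \<phi> x + \<psi> x) t = ord_op \<alpha> b \<phi> t + ord_op \<alpha> b \<psi> t"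
      by (simp add: ord_op_eq add Lop_add smooth_on_comp_kap)
  next
    fix \<phi> :: "real^3 \<Rightarrow> complex" and c t assume "\<phi> \<in> Cinf"
    then show "ord_op \<alpha> b (\<lambda>x. c * \<phi> x) t = c * ord_op \<alpha> b \<phi> t"
      using Lop_lincomb[of "{()}" "\<lambda>_ x. \<phi> (kap x)" \<alpha> b "\<lambda>_. c"] by (simp add: ord_op_eq cm smooth_on_comp_kap)
  qed
  then show ?thesis using d s ord_op_notin unfolding cell_diff_ops_def by blast
qed

lemma I_ser_cell3_Cinf: "f \<in> I_ser \<xi> lam \<Longrightarrow> (\<lambda>x. f (cell3 x)) \<in> Cinf"
  unfolding Cinf_def cell3_eq
  by (intro CollectI smooth_on_compose[OF open_UNIV open_UNIV smooth_on_kap(2)[OF open_UNIV] smooth_on_I_ser_uch1]) simp_all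

text \<open>Translation by \<open>cell2 t\<close> is translation along the axis, and the shear
  \<open>kap\<close> in \<open>ord_op_eq\<close> cancels the one in \<open>cell3_eq\<close>.\<close>

lemma lift_op_cell2:
  assumes f: "f \<in> I_ser \<xi> lam"
  shows "lift_op \<alpha> b \<xi> lam f (cell2 t) = ord_op \<alpha> b (\<lambda>x. f (cell3 x)) t"
proof -
  have sf: "smooth_on UNIV (\<lambda>x. f (uch x))" by (rule smooth_on_I_ser_uch1[OF f])
  have "pdm i j l (\<lambda>x. f (uch (x + axis3 t))) 0 = pdm i j l (\<lambda>x. f (uch x)) (axis3 t)" for i j l
    unfolding pdm_def using iter_deriv_affine[OF bounded_linear_ident open_UNIV sf, of 0 "axis3 t"] by simp
  then have "Lop \<alpha> b (\<lambda>x. f (uch (x + axis3 t))) 0 = Lop \<alpha> b (\<lambda>x. f (uch x)) (axis3 t)"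
    by (simp add: Lop_def)
  then show ?thesis
    using f by (simp add: lift_op_def iota3_cell2_uch ord_op_eq I_ser_cell3_Cinf) (simp add: cell3_eq)
qed

text \<open>Jets are prescribed at the origin and carried along the axis by left translation with
  \<open>cell2 (- t)\<close>.\<close>

lemma exists_I_ser_jet_axis3:
  assumes \<phi>: "\<phi> \<in> Cinf"
  shows "\<exists>f\<in>I_ser \<xi> lam. flat k (axis3 t) (\<lambda>x. f (cell3 x) - \<phi> x)"
proof -
  have "smooth_on UNIV (\<lambda>x. x + axis3 t)" by (intro smooth_on_add smooth_on_ident smooth_on_const open_UNIV)
  then have \<psi>: "smooth_on UNIV (\<lambda>x. \<phi> (kap (x + axis3 t)))"
    using smooth_on_compose[OF open_UNIV open_UNIV _ smooth_on_comp_kap[OF \<phi>] UNIV_I] by blast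
  obtain f where f: "f \<in> I_ser \<xi> lam" "flat k 0 (\<lambda>x. f (uch x) - \<phi> (kap (x + axis3 t)))"
    using exists_I_ser_jet[OF \<psi>] by blast
  let ?f = "\<lambda>g. f (iota3 (cell2 (- t)) ** g)"
  have z: "axis3 t + axis3 (- t) = 0" "y + axis3 (- t) + axis3 t = y" for y
    by (simp_all add: axis3_def vec_eq_iff forall_3)
  have fI: "?f \<in> I_ser \<xi> lam" by (rule I_ser_translate[OF f(1)]) simp
  have G: "smooth_on UNIV (\<lambda>y. kap_inv y + axis3 (- t))"
    by (intro smooth_on_add smooth_on_kap smooth_on_const open_UNIV)
  have "flat k (axis3 t) (\<lambda>y. (\<lambda>x. f (uch x) - \<phi> (kap (x + axis3 t))) (kap_inv y + axis3 (- t)))"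
    by (rule flat_compose[OF open_UNIV open_UNIV UNIV_I G UNIV_I])
      (use f(2) in \<open>auto simp: z intro!: smooth_on_diff smooth_on_I_ser_uch1[OF f(1)] \<psi>\<close>)
  moreover have "(\<lambda>x. f (uch x) - \<phi> (kap (x + axis3 t))) (kap_inv y + axis3 (- t)) = ?f (cell3 y) - \<phi> y" for y
    by (simp add: z cell3_eq iota3_cell2_uch)
  ultimately show ?thesis using fI by auto
qed

text \<open>At each t both operators depend on a finite jet at \<open>axis3 t\<close>, and
  restrictions of equivariant functions realise all such jets. This makes the definite description
  in \<open>cell_op\<close> meaningful.\<close>

lemma cell_diff_op_unique:
  assumes D: "D \<in> cell_diff_ops" "D' \<in> cell_diff_ops"
    and eq: "\<And>f t. f \<in> I_ser \<xi> lam \<Longrightarrow> D (\<lambda>x. f (cell3 x)) t = D' (\<lambda>x. f (cell3 x)) t"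
  shows "D = D'"
proof (intro ext)
  fix \<phi> t
  show "D \<phi> t = D' \<phi> t"
  proof (cases "\<phi> \<in> Cinf")
    case \<phi>: True
    have jet: "\<exists>k. \<forall>\<psi>\<in>Cinf. (\<forall>vs. length vs \<le> k \<longrightarrow> iter_deriv vs \<psi> (axis3 t) = iter_deriv vs \<phi> (axis3 t)) \<longrightarrow> E \<psi> t = E \<phi> t"
      if "E \<in> cell_diff_ops" for E
    proof -
      have "diff_op_along axis3 UNIV Cinf E" using that by (simp add: cell_diff_ops_def)
      from this[unfolded diff_op_along_def, THEN bspec, OF UNIV_I, of t]
      obtain U k c where "t \<in> U" "\<forall>f\<in>Cinf. \<forall>z\<in>U. E f z =
           (\<Sum>vs\<in>{vs. set vs \<subseteq> Basis \<and> length vs \<le> k}. c vs z * iter_deriv vs f (axis3 z))"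
        by (elim exE conjE) (rule that; assumption)
      then have "\<forall>\<psi>\<in>Cinf. (\<forall>vs. length vs \<le> k \<longrightarrow> iter_deriv vs \<psi> (axis3 t) = iter_deriv vs \<phi> (axis3 t)) \<longrightarrow> E \<psi> t = E \<phi> t"
        using \<phi> by (auto intro!: sum.cong)
      then show ?thesis by blast
    qed
    obtain k1 where k1: "\<And>\<psi>. \<psi> \<in> Cinf \<Longrightarrow> (\<And>vs. length vs \<le> k1 \<Longrightarrow> iter_deriv vs \<psi> (axis3 t) = iter_deriv vs \<phi> (axis3 t)) \<Longrightarrow> D \<psi> t = D \<phi> t"
      using jet[OF D(1)] by blast
    obtain k2 where k2: "\<And>\<psi>. \<psi> \<in> Cinf \<Longrightarrow> (\<And>vs. length vs \<le> k2 \<Longrightarrow> iter_deriv vs \<psi> (axis3 t) = iter_deriv vs \<phi> (axis3 t)) \<Longrightarrow> D' \<psi> t = D' \<phi> t"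
      using jet[OF D(2)] by blast
    obtain f where f: "f \<in> I_ser \<xi> lam" "flat (max k1 k2) (axis3 t) (\<lambda>x. f (cell3 x) - \<phi> x)"
      using exists_I_ser_jet_axis3[OF \<phi>] by blast
    have fC: "(\<lambda>x. f (cell3 x)) \<in> Cinf" by (rule I_ser_cell3_Cinf[OF f(1)])
    have "iter_deriv vs (\<lambda>x. f (cell3 x)) (axis3 t) = iter_deriv vs \<phi> (axis3 t)" if "length vs \<le> max k1 k2" for vs
    proof -
      have s: "smooth_on UNIV (\<lambda>x. f (cell3 x))" "smooth_on UNIV \<phi>" using fC \<phi> by (simp_all add: Cinf_def)
      have "iter_deriv vs (\<lambda>x. (f (cell3 x) - \<phi> x) + \<phi> x) (axis3 t)
        = iter_deriv vs (\<lambda>x. f (cell3 x) - \<phi> x) (axis3 t) + iter_deriv vs \<phi> (axis3 t)"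
        by (rule iter_deriv_add[OF open_UNIV smooth_on_diff[OF open_UNIV s] s(2) UNIV_I])
      then show ?thesis using f(2) that by (simp add: flat_def)
    qed
    then have "D (\<lambda>x. f (cell3 x)) t = D \<phi> t" "D' (\<lambda>x. f (cell3 x)) t = D' \<phi> t"
      using k1[OF fC] k2[OF fC] by simp_all
    then show ?thesis using eq[OF f(1)] by simp
  next
    case False
    then show ?thesis using D by (simp add: cell_diff_ops_def)
  qed
qed

lemma cell_op_eqI:
  assumes D: "D \<in> cell_diff_ops" and eq: "\<And>f t. f \<in> I_ser \<xi> lam \<Longrightarrow> T f (cell2 t) = D (\<lambda>x. f (cell3 x)) t"
  shows "cell_op \<xi> lam T = D"
  unfolding cell_op_def
proof (rule the_equality)
  show "D \<in> cell_diff_ops \<and> (\<forall>f\<in>I_ser \<xi> lam. \<forall>t. T f (cell2 t) = D (\<lambda>x. f (cell3 x)) t)" using D eq by blast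
  fix D' assume D': "D' \<in> cell_diff_ops \<and> (\<forall>f\<in>I_ser \<xi> lam. \<forall>t. T f (cell2 t) = D' (\<lambda>x. f (cell3 x)) t)"
  show "D' = D"
  proof (rule cell_diff_op_unique[OF conjunct1[OF D'] D])
    fix f t assume "f \<in> I_ser \<xi> lam"
    then show "D' (\<lambda>x. f (cell3 x)) t = D (\<lambda>x. f (cell3 x)) t" using D' eq[of f t] by simp
  qed
qed

lemma cell_op_lift_op: "cell_op \<xi> lam (lift_op \<alpha> b \<xi> lam) = ord_op \<alpha> b"
  by (rule cell_op_eqI[OF ord_op_in_cell_diff_ops lift_op_cell2])

lemma ord_op_zero: "ord_op \<alpha> (\<lambda>n. 0) = zero_op"
  by (auto simp: ord_op_def Rest3_def zero_op_def fun_eq_iff)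

lemma cell_op_zero: "cell_op \<xi> lam (\<lambda>f h. 0) = zero_op"
proof (rule cell_op_eqI)
  show "zero_op \<in> cell_diff_ops" using ord_op_in_cell_diff_ops[of undefined "\<lambda>n. 0"] by (simp add: ord_op_zero)
qed (simp add: zero_op_def)

lemma bij_betw_cell_op:
  assumes w: "\<nu>$1 - lam$1 = of_nat (fst \<alpha>)" "\<xi>$1 + \<eta>$1 = of_nat (fst \<alpha>)" "lam$3 - \<nu>$2 = of_nat (snd \<alpha>)" "\<xi>$3 + \<eta>$2 = of_nat (snd \<alpha>)"
  shows "bij_betw (cell_op \<xi> lam) (Diff_G3 \<xi> lam \<eta> \<nu>) {ord_op \<alpha> b | b. Frob \<alpha> (\<nu>$2 - lam$2 + 1) (\<nu>$2 - \<nu>$1 + 2) b}"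
proof -
  note eq = Diff_G3_eq_lift_ops[OF w]
  have "inj_on (cell_op \<xi> lam) (Diff_G3 \<xi> lam \<eta> \<nu>)"
  proof (rule inj_onI)
    fix T S assume T: "T \<in> Diff_G3 \<xi> lam \<eta> \<nu>" and S: "S \<in> Diff_G3 \<xi> lam \<eta> \<nu>" and cs: "cell_op \<xi> lam T = cell_op \<xi> lam S"
    obtain b b' where bb: "T = lift_op \<alpha> b \<xi> lam" "S = lift_op \<alpha> b' \<xi> lam" using T S eq by blast
    then have o: "ord_op \<alpha> b = ord_op \<alpha> b'" using cs by (simp add: cell_op_lift_op)
    show "T = S"
    proof (rule Diff_G3_eqI[OF T S])
      fix f assume f: "f \<in> I_ser \<xi> lam"
      \<comment> \<open>\<open>cell2 0\<close> is the identity, so the cell operators at t = 0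
        recover both functionals.\<close>
      show "T f (mat 1) = S f (mat 1)"
        using lift_op_cell2[OF f, of \<alpha> b 0] lift_op_cell2[OF f, of \<alpha> b' 0] by (simp add: bb o)
    qed
  qed
  moreover have "cell_op \<xi> lam ` Diff_G3 \<xi> lam \<eta> \<nu> = {ord_op \<alpha> b | b. Frob \<alpha> (\<nu>$2 - lam$2 + 1) (\<nu>$2 - \<nu>$1 + 2) b}"
    unfolding eq
  proof (intro equalityI subsetI)
    fix D assume "D \<in> {ord_op \<alpha> b | b. Frob \<alpha> (\<nu>$2 - lam$2 + 1) (\<nu>$2 - \<nu>$1 + 2) b}"
    then obtain b where b: "D = cell_op \<xi> lam (lift_op \<alpha> b \<xi> lam)" "Frob \<alpha> (\<nu>$2 - lam$2 + 1) (\<nu>$2 - \<nu>$1 + 2) b"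
      by (auto simp: cell_op_lift_op)
    then show "D \<in> cell_op \<xi> lam ` {lift_op \<alpha> b \<xi> lam | b. Frob \<alpha> (\<nu>$2 - lam$2 + 1) (\<nu>$2 - \<nu>$1 + 2) b}" by blast
  qed (auto simp: cell_op_lift_op)
  ultimately show ?thesis by (simp add: bij_betw_def)
qed

section \<open>Solutions of the recursion\<close>

lemma coeff_F31_Suc:
  assumes k: "k < min n m" and d: "d + of_nat k \<noteq> 0"
  shows "coeff (F31 n m c d) (Suc k) * of_nat (Suc k) * (d + of_nat k)
    = coeff (F31 n m c d) k * of_nat (n - k) * of_nat (m - k) * (c + of_nat k)"
proof -
  have nm: "- of_nat n + of_nat k = (- of_nat (n - k) :: complex)" "- of_nat m + of_nat k = (- of_nat (m - k) :: complex)"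
    using k by (simp_all add: of_nat_diff)
  have ring: "P * - a * (Q * - b) * (C * y) / (D * x * (s * F)) * s * x = P * Q * C / (D * F) * a * b * y"
    if "x \<noteq> 0" "s \<noteq> 0" for P Q C D F a b s x y :: complex
    using that by (simp add: mult_ac)
  have k': "Suc k \<le> min n m" "k \<le> min n m" using k by auto
  show ?thesis
    unfolding coeff_F31 if_P[OF k'(1)] if_P[OF k'(2)] pochhammer_Suc nm fact_Suc
    by (rule ring[OF d of_nat_neq_0])
qed

lemma coeff_F31_0: "coeff (F31 n m c d) 0 = 1"
  by (simp add: coeff_F31)

text \<open>Where d + k = 0 the equation only demands that its right side vanish; the hypothesis on
  c ensures this, as coefficient k contains the factor \<open>pochhammer c k\<close>.\<close>

lemma Frob_F31:
  assumes "\<And>k. k < min (fst \<alpha>) (snd \<alpha>) \<Longrightarrow> d + of_nat k = 0 \<Longrightarrow> pochhammer c (Suc k) = 0"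
  shows "Frob \<alpha> c d (coeff (F31 (fst \<alpha>) (snd \<alpha>) c d))"
  unfolding Frob_def
proof (intro allI impI)
  fix k assume k: "k < min (fst \<alpha>) (snd \<alpha>)"
  show "coeff (F31 (fst \<alpha>) (snd \<alpha>) c d) (Suc k) * of_nat (Suc k) * (d + of_nat k)
    = coeff (F31 (fst \<alpha>) (snd \<alpha>) c d) k * of_nat (fst \<alpha> - k) * of_nat (snd \<alpha> - k) * (c + of_nat k)"
  proof (cases "d + of_nat k = 0")
    case True
    then have "pochhammer c k * (c + of_nat k) = 0" using assms[OF k] by (simp add: pochhammer_Suc)
    then have "coeff (F31 (fst \<alpha>) (snd \<alpha>) c d) k * (c + of_nat k) = 0"
      by (auto simp: coeff_F31)
    then show ?thesis using True by auto
  qed (rule coeff_F31_Suc[OF k])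
qed

lemma Frob_unique_low:
  assumes F: "Frob \<alpha> c d b" and N: "N \<le> min (fst \<alpha>) (snd \<alpha>)"
    and d: "\<And>k. k < N \<Longrightarrow> d + of_nat k \<noteq> 0" and n: "n \<le> N"
  shows "b n = b 0 * coeff (F31 (fst \<alpha>) (snd \<alpha>) c d) n"
  using n
proof (induction n)
  case 0
  then show ?case by (simp add: coeff_F31_0)
next
  case (Suc n)
  then have n: "n < min (fst \<alpha>) (snd \<alpha>)" and dn: "d + of_nat n \<noteq> 0" using N d by auto
  let ?F = "coeff (F31 (fst \<alpha>) (snd \<alpha>) c d)"
  have "b (Suc n) * of_nat (Suc n) * (d + of_nat n) = b 0 * (?F n * of_nat (fst \<alpha> - n) * of_nat (snd \<alpha> - n) * (c + of_nat n))"
    using F n Suc by (simp add: Frob_def mult.assoc)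
  also have "\<dots> = b 0 * ?F (Suc n) * (of_nat (Suc n) * (d + of_nat n))"
    unfolding coeff_F31_Suc[OF n dn, symmetric] by (simp only: mult_ac)
  finally have "b (Suc n) * (of_nat (Suc n) * (d + of_nat n)) = b 0 * ?F (Suc n) * (of_nat (Suc n) * (d + of_nat n))"
    by (simp only: mult_ac)
  moreover have "of_nat (Suc n) * (d + of_nat n) \<noteq> 0" using dn of_nat_neq_0 by (simp del: of_nat_Suc)
  ultimately show ?case using mult_right_cancel by blast
qed

text \<open>The solution that starts at the resonance p. It also lists the coefficients of
  \<open>DD2_ord\<close>, in which the power of \<open>D3\<close> shifts the index by p.\<close>

definition shifted :: "nat \<times> nat \<Rightarrow> nat \<Rightarrow> complex \<Rightarrow> nat \<Rightarrow> complex" where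
  "shifted \<alpha> p c n = (if n < p then 0 else coeff (F31 (fst \<alpha> - p) (snd \<alpha> - p) (c + of_nat p) (of_nat p + 1)) (n - p))"

lemma of_nat_add_1_nonzero: "(of_nat p + 1 + of_nat q :: complex) \<noteq> 0"
proof -
  have "(of_nat p + 1 + of_nat q :: complex) = of_nat (Suc (p + q))" by simp
  then show ?thesis by (simp only: of_nat_neq_0 not_False_eq_True)
qed

text \<open>At a resonance \<open>d = 1 - p\<close> the recursion decouples at \<open>p\<close>, and above \<open>p\<close> it is the recursion with
  parameters \<open>c + p\<close> and \<open>p + 1\<close>.\<close>

lemma Frob_shift:
  assumes d: "d = 1 - of_nat p" and p: "p \<le> min (fst \<alpha>) (snd \<alpha>)" and F: "Frob \<alpha> c d b"
  shows "Frob (fst \<alpha> - p, snd \<alpha> - p) (c + of_nat p) (of_nat p + 1) (\<lambda>n. b (n + p))"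
  unfolding Frob_def
proof (intro allI impI)
  fix k assume "k < min (fst (fst \<alpha> - p, snd \<alpha> - p)) (snd (fst \<alpha> - p, snd \<alpha> - p))"
  then have k: "k + p < min (fst \<alpha>) (snd \<alpha>)" by auto
  have 1: "b (Suc (k + p)) * of_nat (Suc (k + p)) * (d + of_nat (k + p))
     = b (k + p) * of_nat (fst \<alpha> - (k + p)) * of_nat (snd \<alpha> - (k + p)) * (c + of_nat (k + p))"
    using F k unfolding Frob_def by blast
  have 2: "d + of_nat (k + p) = of_nat (Suc k)" "of_nat (Suc (k + p)) = (of_nat p + 1 + of_nat k :: complex)"
    unfolding d by simp_all
  show "b (Suc k + p) * of_nat (Suc k) * (of_nat p + 1 + of_nat k) =
      b (k + p) * of_nat (fst (fst \<alpha> - p, snd \<alpha> - p) - k) * of_nat (snd (fst \<alpha> - p, snd \<alpha> - p) - k) * (c + of_nat p + of_nat k)"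
    using 1[unfolded 2] by (simp only: add_Suc add_Suc_right fst_conv snd_conv diff_diff_left of_nat_add add_ac mult_ac)
qed

lemma Frob_shifted:
  assumes d: "d = 1 - of_nat p" and p: "1 \<le> p"
  shows "Frob \<alpha> c d (shifted \<alpha> p c)"
  unfolding Frob_def
proof (intro allI impI)
  fix k assume k: "k < min (fst \<alpha>) (snd \<alpha>)"
  consider "Suc k < p" | "Suc k = p" | "p \<le> k" by linarith
  then show "shifted \<alpha> p c (Suc k) * of_nat (Suc k) * (d + of_nat k)
     = shifted \<alpha> p c k * of_nat (fst \<alpha> - k) * of_nat (snd \<alpha> - k) * (c + of_nat k)"
  proof cases
    case 1
    then show ?thesis by (simp add: shifted_def)
  next
    \<comment> \<open>At k = p - 1 the left factor d + k vanishes, which permits the jump from 0 to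
      the leading coefficient 1.\<close>
    case 2
    then have "d + of_nat k = 0" unfolding d by (simp flip: 2)
    moreover have "shifted \<alpha> p c k = 0" using 2 by (simp add: shifted_def)
    ultimately show ?thesis by simp
  next
    case 3
    define q where "q = k - p"
    have kq: "k = p + q" using 3 by (simp add: q_def)
    let ?F = "coeff (F31 (fst \<alpha> - p) (snd \<alpha> - p) (c + of_nat p) (of_nat p + 1))"
    have r: "?F (Suc q) * of_nat (Suc q) * (of_nat p + 1 + of_nat q)
       = ?F q * of_nat (fst \<alpha> - p - q) * of_nat (snd \<alpha> - p - q) * (c + of_nat p + of_nat q)"
      by (rule coeff_F31_Suc[OF _ of_nat_add_1_nonzero]) (use k kq in auto)
    have "shifted \<alpha> p c (Suc k) = ?F (Suc q)" "shifted \<alpha> p c k = ?F q" by (simp_all add: shifted_def kq Suc_diff_le)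
    moreover have "d + of_nat k = of_nat (Suc q)" "of_nat (Suc k) = (of_nat p + 1 + of_nat q :: complex)"
      "fst \<alpha> - k = fst \<alpha> - p - q" "snd \<alpha> - k = snd \<alpha> - p - q" "c + of_nat k = c + of_nat p + of_nat q"
      unfolding d kq by simp_all
    ultimately show ?thesis using r by (simp only: mult_ac)
  qed
qed

lemma Frob_unique_high:
  assumes d: "d = 1 - of_nat p" and p: "1 \<le> p" "p \<le> min (fst \<alpha>) (snd \<alpha>)" and F: "Frob \<alpha> c d b"
    and n: "p \<le> n" "n \<le> min (fst \<alpha>) (snd \<alpha>)"
  shows "b n = b p * shifted \<alpha> p c n"
proof -
  have "n - p \<le> fst \<alpha> - p \<and> n - p \<le> snd \<alpha> - p" using n by (auto intro: diff_le_mono)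
  then show ?thesis
    using Frob_unique_low[OF Frob_shift[OF d p(2) F] order_refl of_nat_add_1_nonzero, of "n - p"] n p
    by (simp add: shifted_def)
qed

text \<open>Descending induction: at p - 1 the left side vanishes through d + k, below it because
  the next coefficient is already 0, and nonvanishing c + k then forces each coefficient to be
  0.\<close>

lemma Frob_low_zero:
  assumes d: "d = 1 - of_nat p" and p: "1 \<le> p" "p \<le> min (fst \<alpha>) (snd \<alpha>)" and F: "Frob \<alpha> c d b"
    and c: "\<And>k. k < p \<Longrightarrow> c + of_nat k \<noteq> 0" and n: "n < p"
  shows "b n = 0"
proof -
  have step: "b k = 0" if "k < p" "b (Suc k) * (d + of_nat k) = 0" for k
  proof -
    have "b (Suc k) * of_nat (Suc k) * (d + of_nat k) = b k * of_nat (fst \<alpha> - k) * of_nat (snd \<alpha> - k) * (c + of_nat k)"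
      using F that p unfolding Frob_def by auto
    then have "b k * of_nat (fst \<alpha> - k) * of_nat (snd \<alpha> - k) * (c + of_nat k) = 0"
      using that(2) by (metis mult.commute mult.left_commute mult_zero_right)
    moreover have "of_nat (fst \<alpha> - k) \<noteq> (0::complex)" "of_nat (snd \<alpha> - k) \<noteq> (0::complex)" using that p by auto
    ultimately show ?thesis using c[OF that(1)] by simp
  qed
  have "n \<le> p - 1" using n by simp
  then show ?thesis
  proof (induction rule: inc_induct)
    case base
    have "d + of_nat (p - 1) = 0" unfolding d using p by (simp add: of_nat_diff)
    then show ?case using step[of "p - 1"] p by simp
  next
    case (step k)
    then show ?case using \<open>\<And>k. k < p \<Longrightarrow> b (Suc k) * (d + of_nat k) = 0 \<Longrightarrow> b k = 0\<close>[of k] by simp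
  qed
qed

section \<open>Coefficient sequences and the operators of the theorem\<close>

lemma ord_op_lincomb: "ord_op \<alpha> (\<lambda>n. c * b n + c' * b' n) = (\<lambda>\<phi> t. c * ord_op \<alpha> b \<phi> t + c' * ord_op \<alpha> b' \<phi> t)"
  by (auto simp: ord_op_def Rest3_def fun_eq_iff sum_distrib_left sum.distrib[symmetric] algebra_simps)

lemma ord_op_cmult: "ord_op \<alpha> (\<lambda>n. c * b n) = (\<lambda>\<phi> t. c * ord_op \<alpha> b \<phi> t)"
  using ord_op_lincomb[of \<alpha> c b 0 b] by simp

lemma ord_op_cong: "(\<And>n. n \<le> min (fst \<alpha>) (snd \<alpha>) \<Longrightarrow> b n = b' n) \<Longrightarrow> ord_op \<alpha> b = ord_op \<alpha> b'"
  by (simp add: ord_op_def)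

lemma Rest3_cong: "(\<And>\<phi>. smooth_on UNIV \<phi> \<Longrightarrow> D \<phi> = D' \<phi>) \<Longrightarrow> Rest3 D = Rest3 D'"
  by (auto simp: Rest3_def Cinf_def fun_eq_iff)

lemma T_ord_eq: "T_ord \<alpha> q \<phi> = (\<lambda>x. \<Sum>n\<le>min (fst \<alpha>) (snd \<alpha>). coeff q n * D_ord (fst \<alpha> - n) (snd \<alpha> - n) n \<phi> x)"
  by (simp add: T_ord_def D_ord_def atLeast0AtMost)

lemma Rest3_T_ord: "Rest3 (T_ord \<alpha> q) = ord_op \<alpha> (coeff q)"
  unfolding ord_op_def by (rule Rest3_cong) (simp add: T_ord_eq)

lemma D3_funpow_T_ord:
  assumes \<phi>: "smooth_on UNIV \<phi>"
  shows "(D3 ^^ p) (T_ord \<alpha> q \<phi>) = (\<lambda>x. \<Sum>n\<le>min (fst \<alpha>) (snd \<alpha>). coeff q n * D_ord (fst \<alpha> - n) (snd \<alpha> - n) (n + p) \<phi> x)"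
  by (induction p) (simp_all add: T_ord_eq D_lincomb smooth_on_D_ord \<phi> D3_D_ord)

text \<open>\<open>D3\<close> is central, so its power only raises the last exponent; with N = n + p
  the other exponents are again those of weight \<alpha>.\<close>

lemma Rest3_D3_T_ord:
  assumes p: "p \<le> min (fst \<alpha>) (snd \<alpha>)"
  shows "Rest3 ((D3 ^^ p) \<circ> T_ord (fst \<alpha> - p, snd \<alpha> - p) (F31 (fst \<alpha> - p) (snd \<alpha> - p) (c + of_nat p) (of_nat p + 1)))
    = ord_op \<alpha> (shifted \<alpha> p c)"
  unfolding ord_op_def
proof (rule Rest3_cong)
  fix \<phi> :: "real^3 \<Rightarrow> complex" assume \<phi>: "smooth_on UNIV \<phi>"
  let ?q = "F31 (fst \<alpha> - p) (snd \<alpha> - p) (c + of_nat p) (of_nat p + 1)"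
  have "(\<Sum>n\<le>min (fst \<alpha> - p) (snd \<alpha> - p). coeff ?q n * D_ord (fst \<alpha> - p - n) (snd \<alpha> - p - n) (n + p) \<phi> x)
     = (\<Sum>n\<in>{p..min (fst \<alpha>) (snd \<alpha>)}. shifted \<alpha> p c n * D_ord (fst \<alpha> - n) (snd \<alpha> - n) n \<phi> x)" for x
    by (rule sum.reindex_bij_witness[of _ "\<lambda>n. n - p" "\<lambda>n. n + p"])
      (use p in \<open>auto simp: shifted_def add.commute\<close>)
  also have "\<dots> x = (\<Sum>n\<le>min (fst \<alpha>) (snd \<alpha>). shifted \<alpha> p c n * D_ord (fst \<alpha> - n) (snd \<alpha> - n) n \<phi> x)" for x
    by (rule sum.mono_neutral_left) (auto simp: shifted_def)
  finally show "((D3 ^^ p) \<circ> T_ord (fst \<alpha> - p, snd \<alpha> - p) ?q) \<phi>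
     = (\<lambda>x. \<Sum>n\<le>min (fst \<alpha>) (snd \<alpha>). shifted \<alpha> p c n * D_ord (fst \<alpha> - n) (snd \<alpha> - n) n \<phi> x)"
    by (simp add: D3_funpow_T_ord[OF \<phi>])
qed

lemma zero_op_in_cline: "zero_op \<in> cline D"
  unfolding cline_def zero_op_def by (rule CollectI, rule exI[of _ 0]) simp

lemma cnat_of_nat [simp]: "cnat (of_nat n) = n"
  by (simp add: cnat_def)

lemma Phi3E:
  assumes "(lam, \<nu>) \<in> Phi3"
  obtains \<alpha> where "\<nu>$1 - lam$1 = of_nat (fst \<alpha>)" "lam$3 - \<nu>$2 = of_nat (snd \<alpha>)"
    "(cnat (\<nu>$1 - lam$1), cnat (lam$3 - \<nu>$2)) = \<alpha>"
proof -
  from assms obtain p q where "\<nu>$1 - lam$1 = of_nat p" "lam$3 - \<nu>$2 = of_nat q"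
    unfolding Phi3_def Nats_def by auto
  then show thesis using that[of "(p, q)"] by simp
qed

lemma resonantE:
  assumes "resonant lam \<nu>" and w: "\<nu>$1 - lam$1 = of_nat (fst \<alpha>)" "lam$3 - \<nu>$2 = of_nat (snd \<alpha>)"
  obtains p where "\<nu>$1 - \<nu>$2 - 1 = of_nat p" "1 \<le> p" "p \<le> min (fst \<alpha>) (snd \<alpha>)"
  using assms(1) that unfolding resonant_def w cnat_of_nat by auto

lemma not_resonant:
  assumes "\<not> resonant lam \<nu>" and w: "\<nu>$1 - lam$1 = of_nat (fst \<alpha>)" "lam$3 - \<nu>$2 = of_nat (snd \<alpha>)"
    and k: "k < min (fst \<alpha>) (snd \<alpha>)"
  shows "\<nu>$2 - \<nu>$1 + 2 + of_nat k \<noteq> 0"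
proof
  assume "\<nu>$2 - \<nu>$1 + 2 + of_nat k = 0"
  then have "\<nu>$1 - \<nu>$2 - 1 = of_nat (Suc k)" by (simp add: algebra_simps)
  then have "resonant lam \<nu>"
    unfolding resonant_def w cnat_of_nat using k by (intro image_eqI[of _ _ "Suc k"]) auto
  then show False using assms(1) by blast
qed

lemma DD1_ord_eq:
  assumes "(cnat (\<nu>$1 - lam$1), cnat (lam$3 - \<nu>$2)) = \<alpha>"
  shows "DD1_ord lam \<nu> = ord_op \<alpha> (coeff (F31 (fst \<alpha>) (snd \<alpha>) (\<nu>$2 - lam$2 + 1) (\<nu>$2 - \<nu>$1 + 2)))"
  unfolding DD1_ord_def Let_def assms by (rule Rest3_T_ord)

lemma DD2_params:
  assumes w: "\<nu>$1 - lam$1 = of_nat (fst \<alpha>)" "lam$3 - \<nu>$2 = of_nat (snd \<alpha>)"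
    and p: "\<nu>$1 - \<nu>$2 - 1 = of_nat p" "p \<le> min (fst \<alpha>) (snd \<alpha>)"
  shows "cnat (\<nu>$2 - lam$1 + 1) = fst \<alpha> - p" "cnat (lam$3 - \<nu>$1 + 1) = snd \<alpha> - p"
    "\<nu>$1 - lam$2 = \<nu>$2 - lam$2 + 1 + of_nat p" "\<nu>$1 - \<nu>$2 = of_nat p + 1" "\<nu>$2 - \<nu>$1 + 2 = 1 - of_nat p"
proof -
  have n1: "\<nu>$1 = \<nu>$2 + of_nat p + 1" using p(1) by (simp add: algebra_simps)
  have "\<nu>$2 - lam$1 + 1 = of_nat (fst \<alpha>) - of_nat p" "lam$3 - \<nu>$1 + 1 = of_nat (snd \<alpha>) - of_nat p"
    unfolding w[symmetric] n1 by (simp_all add: algebra_simps)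
  then have "\<nu>$2 - lam$1 + 1 = of_nat (fst \<alpha> - p)" "lam$3 - \<nu>$1 + 1 = of_nat (snd \<alpha> - p)"
    using p(2) by (simp_all add: of_nat_diff)
  then show "cnat (\<nu>$2 - lam$1 + 1) = fst \<alpha> - p" "cnat (lam$3 - \<nu>$1 + 1) = snd \<alpha> - p" by simp_all
  show "\<nu>$1 - lam$2 = \<nu>$2 - lam$2 + 1 + of_nat p" "\<nu>$1 - \<nu>$2 = of_nat p + 1" "\<nu>$2 - \<nu>$1 + 2 = 1 - of_nat p"
    unfolding n1 by simp_all
qed

lemma DD2_ord_eq:
  assumes w: "\<nu>$1 - lam$1 = of_nat (fst \<alpha>)" "lam$3 - \<nu>$2 = of_nat (snd \<alpha>)"
    and p: "\<nu>$1 - \<nu>$2 - 1 = of_nat p" "p \<le> min (fst \<alpha>) (snd \<alpha>)"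
  shows "DD2_ord lam \<nu> = ord_op \<alpha> (shifted \<alpha> p (\<nu>$2 - lam$2 + 1))"
proof -
  have "cnat (\<nu>$1 - \<nu>$2 - 1) = p" by (simp add: p(1))
  note e = this DD2_params(1,2,3,4)[OF w p]
  show ?thesis
    unfolding DD2_ord_def Let_def e(1) fst_conv snd_conv unfolding e(2-5)
    by (rule Rest3_D3_T_ord[OF p(2)])
qed

lemma T_sym_p_poly_eq:
  assumes "smooth_on UNIV \<phi>" "c = (a - b) / 2" "d = - b"
    and "\<And>n. n \<le> min (fst \<alpha>) (snd \<alpha>) \<Longrightarrow> pochhammer d n \<noteq> 0 \<or> b \<in> \<nat> \<and> cnat b < n \<and> (b - a) / 2 \<in> of_nat ` {0..cnat b}"
  shows "T_sym \<alpha> (p_poly \<alpha> a b) \<phi> = T_ord \<alpha> (F31 (fst \<alpha>) (snd \<alpha>) c d) \<phi>"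
  unfolding assms(2,3)
proof (rule T_sym_eq_T_ord[OF assms(1)], rule ord_coeff_eq)
  fix N n assume "N \<le> min (fst \<alpha>) (snd \<alpha>)" "n \<le> N"
  then have "n \<le> min (fst \<alpha>) (snd \<alpha>)" by simp
  then show "pochhammer (- b) n \<noteq> 0 \<or> b \<in> \<nat> \<and> cnat b < n \<and> (b - a) / 2 \<in> of_nat ` {0..cnat b}"
    using assms(4)[of n, unfolded assms(3)] by blast
qed

text \<open>Here d = - b. Off resonance no relevant Pochhammer symbol vanishes. In case c one has b
  = p - 1 and (b - a) / 2 = lam2 - \<nu>2 - 1, an integer between 0 and p - 1: exactly the range in
  which the quotient 0 / 0 has its special reading.\<close>

lemma DD1_sym_eq_ord:
  assumes "(lam, \<nu>) \<in> Phi3a \<union> Phi3c"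
  shows "DD1_sym lam \<nu> = DD1_ord lam \<nu>"
proof -
  let ?a = "\<nu>$1 + \<nu>$2 - 2 * lam$2" and ?b = "\<nu>$1 - \<nu>$2 - 2"
  have "(lam, \<nu>) \<in> Phi3" using assms by (auto simp: Phi3a_def Phi3c_def)
  then obtain \<alpha> where w: "\<nu>$1 - lam$1 = of_nat (fst \<alpha>)" "lam$3 - \<nu>$2 = of_nat (snd \<alpha>)"
    and \<alpha>: "(cnat (\<nu>$1 - lam$1), cnat (lam$3 - \<nu>$2)) = \<alpha>" by (rule Phi3E)
  have ok: "pochhammer (\<nu>$2 - \<nu>$1 + 2) n \<noteq> 0 \<or> ?b \<in> \<nat> \<and> cnat ?b < n \<and> (?b - ?a) / 2 \<in> of_nat ` {0..cnat ?b}"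
    if n: "n \<le> min (fst \<alpha>) (snd \<alpha>)" for n
  proof (cases "resonant lam \<nu>")
    case False
    have "pochhammer (\<nu>$2 - \<nu>$1 + 2) n \<noteq> 0"
    proof
      assume "pochhammer (\<nu>$2 - \<nu>$1 + 2) n = 0"
      then obtain k where "k < n" "\<nu>$2 - \<nu>$1 + 2 = - of_nat k" by (auto simp: pochhammer_eq_0_iff)
      then show False using not_resonant[OF False w, of k] n by simp
    qed
    then show ?thesis by blast
  next
    case True
    then have "(lam, \<nu>) \<in> Phi3c" using assms by (auto simp: Phi3a_def)
    then have c: "lam$2 - \<nu>$2 \<in> of_nat ` {1..cnat (\<nu>$1 - \<nu>$2 - 1)}" by (auto simp: Phi3c_def)
    from True obtain p where p: "\<nu>$1 - \<nu>$2 - 1 = of_nat p" "1 \<le> p" "p \<le> min (fst \<alpha>) (snd \<alpha>)" using w by (rule resonantE)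
    from c obtain r where r: "lam$2 - \<nu>$2 = of_nat r" "1 \<le> r" "r \<le> p" unfolding p(1) cnat_of_nat by auto
    have b: "?b = of_nat (p - 1)" using p by (simp add: of_nat_diff algebra_simps)
    have d: "\<nu>$2 - \<nu>$1 + 2 = - of_nat (p - 1)" using b by (simp add: algebra_simps)
    have "(?b - ?a) / 2 = lam$2 - \<nu>$2 - 1" by (simp add: field_simps)
    then have m: "(?b - ?a) / 2 = of_nat (r - 1)" unfolding r(1) using r(2) by (simp add: of_nat_diff)
    show ?thesis
    proof (cases "n \<le> p - 1")
      case True
      then show ?thesis unfolding d by (simp add: pochhammer_of_nat_eq_0_iff)
    next
      case False
      then show ?thesis
        unfolding m unfolding b cnat_of_nat using r by (intro disjI2 conjI of_nat_in_Nats imageI) auto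
    qed
  qed
  show ?thesis
    unfolding DD1_sym_def DD1_ord_def Let_def \<alpha>
    by (rule Rest3_cong, rule T_sym_p_poly_eq[OF _ _ _ ok]) (simp_all add: field_simps)
qed

text \<open>The lower parameter is p + 1, a positive integer, so every Pochhammer symbol in a
  denominator is nonzero.\<close>

lemma DD2_sym_eq_ord:
  assumes "(lam, \<nu>) \<in> Phi3b \<union> Phi3c"
  shows "DD2_sym lam \<nu> = DD2_ord lam \<nu>"
proof -
  let ?\<alpha> = "(cnat (\<nu>$2 - lam$1 + 1), cnat (lam$3 - \<nu>$1 + 1))"
  have "(lam, \<nu>) \<in> Phi3" and res: "resonant lam \<nu>" using assms by (auto simp: Phi3b_def Phi3c_def)
  then obtain \<alpha> where w: "\<nu>$1 - lam$1 = of_nat (fst \<alpha>)" "lam$3 - \<nu>$2 = of_nat (snd \<alpha>)"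
    by (blast elim: Phi3E)
  obtain p where p: "\<nu>$1 - \<nu>$2 - 1 = of_nat p" using resonantE[OF res w] by metis
  have d: "\<nu>$1 - \<nu>$2 = of_nat (Suc p)" using p by (simp add: algebra_simps)
  have "\<And>n. pochhammer (\<nu>$1 - \<nu>$2) n \<noteq> 0"
    unfolding d by (simp add: pochhammer_eq_0_iff del: of_nat_Suc)
      (metis add_eq_0_iff of_nat_add of_nat_eq_0_iff add_is_0 nat.distinct(1) add.commute)
  then have "T_sym ?\<alpha> (p_poly ?\<alpha> (\<nu>$1 + \<nu>$2 - 2 * lam$2) (\<nu>$2 - \<nu>$1)) \<phi>
      = T_ord ?\<alpha> (F31 (fst ?\<alpha>) (snd ?\<alpha>) (\<nu>$1 - lam$2) (\<nu>$1 - \<nu>$2)) \<phi>" if "smooth_on UNIV \<phi>" for \<phi>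
    by (intro T_sym_p_poly_eq[OF that]) (simp_all add: field_simps)
  then show ?thesis
    unfolding DD2_sym_def DD2_ord_def Let_def by (intro Rest3_cong) simp
qed

lemma cline_intersection:
  assumes b: "b 0 \<noteq> 0" and b': "b' 0 = 0"
  shows "cline (ord_op \<alpha> b) \<inter> cline (ord_op \<alpha> b') = {zero_op}"
proof (intro equalityI subsetI)
  fix D assume "D \<in> cline (ord_op \<alpha> b) \<inter> cline (ord_op \<alpha> b')"
  then obtain c c' where c: "D = (\<lambda>\<phi> t. c * ord_op \<alpha> b \<phi> t)" and c': "D = (\<lambda>\<phi> t. c' * ord_op \<alpha> b' \<phi> t)"
    unfolding cline_def by blast
  \<comment> \<open>In affine coordinates this is x1^\<alpha>1 x2^\<alpha>2; only the term n = 0 of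
    an ordered operator sees it at the origin.\<close>
  let ?\<phi> = "\<lambda>x. monom3 (fst \<alpha>) (snd \<alpha>) 0 (kap_inv x)"
  have \<phi>: "?\<phi> \<in> Cinf"
    unfolding Cinf_def
    by (intro CollectI smooth_on_compose[OF open_UNIV open_UNIV smooth_on_kap(2)[OF open_UNIV] smooth_on_monom3[OF open_UNIV] UNIV_I])
  have a0: "axis3 0 = 0" by (simp add: axis3_def vec_eq_iff forall_3)
  have e: "ord_op \<alpha> \<beta> ?\<phi> 0 = \<beta> 0 * (fact (fst \<alpha>) * fact (snd \<alpha>))" for \<beta>
    using Lop_monom3[of \<alpha> \<beta> "fst \<alpha>" "snd \<alpha>" 0] by (simp add: ord_op_eq[OF \<phi>] a0 eta_contract_eq)
  have "c * ord_op \<alpha> b ?\<phi> 0 = c' * ord_op \<alpha> b' ?\<phi> 0"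
    using fun_cong[OF fun_cong[OF c, of ?\<phi>], of 0] fun_cong[OF fun_cong[OF c', of ?\<phi>], of 0] by simp
  then have "c = 0" unfolding e using b b' by simp
  then show "D \<in> {zero_op}" using c by (simp add: zero_op_def)
qed (use zero_op_in_cline in auto)

lemma Frob_lincomb: "Frob \<alpha> c d b \<Longrightarrow> Frob \<alpha> c d b' \<Longrightarrow> Frob \<alpha> c d (\<lambda>n. x * b n + y * b' n)"
  unfolding Frob_def by (auto simp: distrib_right mult.assoc)

lemma ord_ops_case_a:
  assumes "\<And>k. k < min (fst \<alpha>) (snd \<alpha>) \<Longrightarrow> d + of_nat k \<noteq> 0"
  shows "{ord_op \<alpha> b | b. Frob \<alpha> c d b} = cline (ord_op \<alpha> (coeff (F31 (fst \<alpha>) (snd \<alpha>) c d)))"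
proof -
  let ?F = "coeff (F31 (fst \<alpha>) (snd \<alpha>) c d)"
  have F: "Frob \<alpha> c d ?F" by (rule Frob_F31) (use assms in blast)
  have 1: "ord_op \<alpha> b = (\<lambda>\<phi> t. b 0 * ord_op \<alpha> ?F \<phi> t)" if "Frob \<alpha> c d b" for b
    unfolding ord_op_cmult[symmetric]
    by (rule ord_op_cong) (rule Frob_unique_low[OF that order_refl assms])
  have 2: "Frob \<alpha> c d (\<lambda>n. x * ?F n)" for x
    using Frob_lincomb[OF F F, of x 0] by simp
  show ?thesis
  proof (intro equalityI subsetI)
    fix D assume "D \<in> {ord_op \<alpha> b | b. Frob \<alpha> c d b}"
    then show "D \<in> cline (ord_op \<alpha> (?F))" unfolding cline_def using 1 by blast
  next
    fix D assume "D \<in> cline (ord_op \<alpha> (?F))"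
    then obtain x where "D = ord_op \<alpha> (\<lambda>n. x * ?F n)" unfolding cline_def ord_op_cmult by blast
    then show "D \<in> {ord_op \<alpha> b | b. Frob \<alpha> c d b}" using 2 by blast
  qed
qed

text \<open>The coefficients below p are forced to vanish, so the coefficient at p is the free
  parameter.\<close>

lemma ord_ops_case_b:
  assumes d: "d = 1 - of_nat p" and p: "1 \<le> p" "p \<le> min (fst \<alpha>) (snd \<alpha>)"
    and c: "\<And>k. k < p \<Longrightarrow> c + of_nat k \<noteq> 0"
  shows "{ord_op \<alpha> b | b. Frob \<alpha> c d b} = cline (ord_op \<alpha> (shifted \<alpha> p c))"
proof -
  note F = Frob_shifted[OF d p(1), of \<alpha> c]
  have 1: "ord_op \<alpha> b = (\<lambda>\<phi> t. b p * ord_op \<alpha> (shifted \<alpha> p c) \<phi> t)" if b: "Frob \<alpha> c d b" for b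
    unfolding ord_op_cmult[symmetric]
  proof (rule ord_op_cong)
    fix n assume n: "n \<le> min (fst \<alpha>) (snd \<alpha>)"
    show "b n = b p * shifted \<alpha> p c n"
    proof (cases "n < p")
      case True
      then show ?thesis using Frob_low_zero[OF d p b c True] by (simp add: shifted_def)
    next
      case False
      then show ?thesis using Frob_unique_high[OF d p b _ n] by simp
    qed
  qed
  have 2: "Frob \<alpha> c d (\<lambda>n. x * shifted \<alpha> p c n)" for x
    using Frob_lincomb[OF F F, of x 0] by simp
  show ?thesis
  proof (intro equalityI subsetI)
    fix D assume "D \<in> {ord_op \<alpha> b | b. Frob \<alpha> c d b}"
    then show "D \<in> cline (ord_op \<alpha> (shifted \<alpha> p c))" unfolding cline_def using 1 by blast
  next
    fix D assume "D \<in> cline (ord_op \<alpha> (shifted \<alpha> p c))"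
    then obtain x where "D = ord_op \<alpha> (\<lambda>n. x * shifted \<alpha> p c n)" unfolding cline_def ord_op_cmult by blast
    then show "D \<in> {ord_op \<alpha> b | b. Frob \<alpha> c d b}" using 2 by blast
  qed
qed

text \<open>The recursion decouples at p: the 3F1 breaks off at degree m < p and the second solution
  starts at p, so the coefficients at 0 and at p are independent parameters.\<close>

lemma ord_ops_case_c:
  assumes d: "d = 1 - of_nat p" and p: "1 \<le> p" "p \<le> min (fst \<alpha>) (snd \<alpha>)"
    and c: "c = - of_nat m" "m < p"
  shows "{ord_op \<alpha> b | b. Frob \<alpha> c d b}
    = op_set_plus (cline (ord_op \<alpha> (coeff (F31 (fst \<alpha>) (snd \<alpha>) c d)))) (cline (ord_op \<alpha> (shifted \<alpha> p c)))"
proof -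
  let ?F = "coeff (F31 (fst \<alpha>) (snd \<alpha>) c d)" and ?S = "shifted \<alpha> p c"
  have poch: "pochhammer c k = 0" if "m < k" for k
    using that unfolding c by (simp add: pochhammer_of_nat_eq_0_iff)
  have dk: "k = p - 1" if "d + of_nat k = 0" for k
  proof -
    have "of_nat (Suc k) = (of_nat p :: complex)" using that unfolding d by (simp add: algebra_simps)
    then have "Suc k = p" by (simp only: of_nat_eq_iff)
    then show ?thesis by simp
  qed
  have F: "Frob \<alpha> c d ?F"
  proof (rule Frob_F31)
    fix k assume "d + of_nat k = 0"
    then show "pochhammer c (Suc k) = 0" using dk[of k] c(2) p by (intro poch) simp
  qed
  note S = Frob_shifted[OF d p(1), of \<alpha> c]
  have 1: "ord_op \<alpha> b = (\<lambda>\<phi> t. b 0 * ord_op \<alpha> ?F \<phi> t + b p * ord_op \<alpha> ?S \<phi> t)" if b: "Frob \<alpha> c d b" for b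
    unfolding ord_op_lincomb[symmetric]
  proof (rule ord_op_cong)
    fix n assume n: "n \<le> min (fst \<alpha>) (snd \<alpha>)"
    show "b n = b 0 * ?F n + b p * ?S n"
    proof (cases "n < p")
      case True
      \<comment> \<open>The factor d + k first vanishes at k = p - 1, so the coefficient at 0
        determines all those up to p - 1.\<close>
      have "b n = b 0 * ?F n"
        by (rule Frob_unique_low[OF b, of "p - 1"]) (use p True dk in auto)
      then show ?thesis using True by (simp add: shifted_def)
    next
      case False
      \<comment> \<open>From p on the numerator contains \<open>pochhammer c n\<close> = 0, so the
        term is 0 although the denominator vanishes as well.\<close>
      then have "?F n = 0" using poch[of n] c(2) by (simp add: coeff_F31)
      then show ?thesis using Frob_unique_high[OF d p b _ n] False by simp
    qed
  qed
  show ?thesis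
  proof (intro equalityI subsetI)
    fix D assume "D \<in> {ord_op \<alpha> b | b. Frob \<alpha> c d b}"
    then obtain b where b: "D = ord_op \<alpha> b" "Frob \<alpha> c d b" by blast
    have "(\<lambda>\<phi> t. x * E \<phi> t) \<in> cline E" for x E unfolding cline_def by blast
    then show "D \<in> op_set_plus (cline (ord_op \<alpha> ?F)) (cline (ord_op \<alpha> ?S))"
      unfolding op_set_plus_def
      by (intro CollectI exI[of _ "\<lambda>\<phi> t. b 0 * ord_op \<alpha> ?F \<phi> t"] exI[of _ "\<lambda>\<phi> t. b p * ord_op \<alpha> ?S \<phi> t"])
        (simp add: 1[OF b(2)] b(1))
  next
    fix D assume "D \<in> op_set_plus (cline (ord_op \<alpha> ?F)) (cline (ord_op \<alpha> ?S))"
    then obtain x y where "D = (\<lambda>\<phi> t. x * ord_op \<alpha> ?F \<phi> t + y * ord_op \<alpha> ?S \<phi> t)"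
      unfolding op_set_plus_def cline_def by blast
    then have "D = ord_op \<alpha> (\<lambda>n. x * ?F n + y * ?S n)" by (simp add: ord_op_lincomb)
    then show "D \<in> {ord_op \<alpha> b | b. Frob \<alpha> c d b}" using Frob_lincomb[OF F S] by blast
  qed
qed

text \<open>Operators on the groups and on the cells have different types, so the equality of spaces
  is a bijection through \<open>cell_op\<close>. Directness of the sum is the trivial intersection
  of the two lines.\<close>

theorem theoremD:
  fixes \<xi> :: "bit^3" and \<eta> :: "bit^2" and lam :: "complex^3" and \<nu> :: "complex^2"
  shows
    "bij_betw (cell_op \<xi> lam) (Diff_G3 \<xi> lam \<eta> \<nu>)
       (if (\<xi>, \<eta>, lam, \<nu>) \<in> Supp3 Phi3a then cline (DD1_sym lam \<nu>)
        else if (\<xi>, \<eta>, lam, \<nu>) \<in> Supp3 Phi3b then cline (DD2_sym lam \<nu>)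
        else if (\<xi>, \<eta>, lam, \<nu>) \<in> Supp3 Phi3c
          then op_set_plus (cline (DD1_sym lam \<nu>)) (cline (DD2_sym lam \<nu>))
        else {zero_op})
     \<and> ((\<xi>, \<eta>, lam, \<nu>) \<in> Supp3 Phi3c \<longrightarrow>
          cline (DD1_sym lam \<nu>) \<inter> cline (DD2_sym lam \<nu>) = {zero_op})
     \<and> ((lam, \<nu>) \<in> Phi3a \<union> Phi3c \<longrightarrow> DD1_sym lam \<nu> = DD1_ord lam \<nu>)
     \<and> ((lam, \<nu>) \<in> Phi3b \<union> Phi3c \<longrightarrow> DD2_sym lam \<nu> = DD2_ord lam \<nu>)"
proof -
  let ?c = "\<nu>$2 - lam$2 + 1" and ?d = "\<nu>$2 - \<nu>$1 + 2"
  let ?par = "\<lambda>\<alpha>. \<xi>$1 + \<eta>$1 = of_nat (fst \<alpha>) \<and> \<xi>$3 + \<eta>$2 = of_nat (snd \<alpha>)"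
  have supp: "(\<xi>, \<eta>, lam, \<nu>) \<in> Supp3 \<Phi> \<longleftrightarrow> (lam, \<nu>) \<in> \<Phi> \<and> ?par (cnat (\<nu>$1 - lam$1), cnat (lam$3 - \<nu>$2))" for \<Phi>
    by (simp add: Supp3_def)
  \<comment> \<open>The index shift comes from c = \<nu>2 - lam2 + 1: lam2 - \<nu>2 = m + 1 means c
    = - m, so the range 1 to p becomes m < p.\<close>
  have resonant_c: "lam$2 - \<nu>$2 \<in> of_nat ` {1..cnat (\<nu>$1 - \<nu>$2 - 1)} \<longleftrightarrow> (\<exists>m<p. ?c = - of_nat m)"
    if p: "\<nu>$1 - \<nu>$2 - 1 = of_nat p" for p
  proof
    assume "lam$2 - \<nu>$2 \<in> of_nat ` {1..cnat (\<nu>$1 - \<nu>$2 - 1)}"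
    then obtain r where r: "lam$2 - \<nu>$2 = of_nat r" "1 \<le> r" "r \<le> p" unfolding p cnat_of_nat by auto
    then have "?c = - of_nat (r - 1)" by (simp add: of_nat_diff algebra_simps)
    then show "\<exists>m<p. ?c = - of_nat m" using r by (intro exI[of _ "r - 1"]) auto
  next
    assume "\<exists>m<p. ?c = - of_nat m"
    then obtain m where m: "m < p" "?c = - of_nat m" by blast
    then have "lam$2 - \<nu>$2 = of_nat (Suc m)" by (simp add: algebra_simps)
    then show "lam$2 - \<nu>$2 \<in> of_nat ` {1..cnat (\<nu>$1 - \<nu>$2 - 1)}"
      unfolding p cnat_of_nat using m(1) by (intro image_eqI[of _ _ "Suc m"]) auto
  qed
  have inter: "cline (DD1_sym lam \<nu>) \<inter> cline (DD2_sym lam \<nu>) = {zero_op}"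
    if C: "(\<xi>, \<eta>, lam, \<nu>) \<in> Supp3 Phi3c"
  proof -
    from C have c: "(lam, \<nu>) \<in> Phi3c" by (simp add: supp)
    then have "(lam, \<nu>) \<in> Phi3" "resonant lam \<nu>" by (auto simp: Phi3c_def)
    from this(1) obtain \<alpha> where w: "\<nu>$1 - lam$1 = of_nat (fst \<alpha>)" "lam$3 - \<nu>$2 = of_nat (snd \<alpha>)"
      and \<alpha>: "(cnat (\<nu>$1 - lam$1), cnat (lam$3 - \<nu>$2)) = \<alpha>" by (rule Phi3E)
    obtain p where p: "\<nu>$1 - \<nu>$2 - 1 = of_nat p" "1 \<le> p" "p \<le> min (fst \<alpha>) (snd \<alpha>)"
      using \<open>resonant lam \<nu>\<close> w by (rule resonantE)
    have "DD1_sym lam \<nu> = ord_op \<alpha> (coeff (F31 (fst \<alpha>) (snd \<alpha>) ?c ?d))"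
      using DD1_sym_eq_ord[of lam \<nu>] c DD1_ord_eq[OF \<alpha>] by simp
    moreover have "DD2_sym lam \<nu> = ord_op \<alpha> (shifted \<alpha> p ?c)"
      using DD2_sym_eq_ord[of lam \<nu>] c DD2_ord_eq[OF w p(1,3)] by simp
    ultimately show ?thesis using p(2) by (simp add: cline_intersection coeff_F31_0 shifted_def)
  qed
  have "bij_betw (cell_op \<xi> lam) (Diff_G3 \<xi> lam \<eta> \<nu>)
       (if (\<xi>, \<eta>, lam, \<nu>) \<in> Supp3 Phi3a then cline (DD1_sym lam \<nu>)
        else if (\<xi>, \<eta>, lam, \<nu>) \<in> Supp3 Phi3b then cline (DD2_sym lam \<nu>)
        else if (\<xi>, \<eta>, lam, \<nu>) \<in> Supp3 Phi3c
          then op_set_plus (cline (DD1_sym lam \<nu>)) (cline (DD2_sym lam \<nu>))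
        else {zero_op})" (is "bij_betw _ _ ?R")
  proof (cases "(\<xi>, \<eta>, lam, \<nu>) \<in> Supp3 Phi3")
    case False
    have "\<not> (\<exists>p q. \<nu>$1 - lam$1 = of_nat p \<and> \<xi>$1 + \<eta>$1 = of_nat p \<and> lam$3 - \<nu>$2 = of_nat q \<and> \<xi>$3 + \<eta>$2 = of_nat q)"
      using False unfolding supp by (auto simp: Phi3_def)
    then have "Diff_G3 \<xi> lam \<eta> \<nu> = {\<lambda>f h. 0}" by (rule Diff_G3_trivial)
    moreover have "?R = {zero_op}"
      using False by (auto simp: supp Phi3a_def Phi3b_def Phi3c_def)
    ultimately show ?thesis by (simp add: bij_betw_def cell_op_zero)
  next
    case True
    then have "(lam, \<nu>) \<in> Phi3" by (simp add: supp)
    then obtain \<alpha> where w: "\<nu>$1 - lam$1 = of_nat (fst \<alpha>)" "lam$3 - \<nu>$2 = of_nat (snd \<alpha>)"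
      and \<alpha>: "(cnat (\<nu>$1 - lam$1), cnat (lam$3 - \<nu>$2)) = \<alpha>" by (rule Phi3E)
    have par: "\<xi>$1 + \<eta>$1 = of_nat (fst \<alpha>)" "\<xi>$3 + \<eta>$2 = of_nat (snd \<alpha>)"
      using True unfolding supp \<alpha> by auto
    have su: "(\<xi>, \<eta>, lam, \<nu>) \<in> Supp3 \<Phi> \<longleftrightarrow> (lam, \<nu>) \<in> \<Phi>" for \<Phi>
      unfolding supp \<alpha> using par by simp
    note bij = bij_betw_cell_op[OF w(1) par(1) w(2) par(2)]
    show ?thesis
    proof (cases "resonant lam \<nu>")
      case False
      then have a: "(lam, \<nu>) \<in> Phi3a" using \<open>(lam, \<nu>) \<in> Phi3\<close> by (simp add: Phi3a_def)
      then have "?R = cline (ord_op \<alpha> (coeff (F31 (fst \<alpha>) (snd \<alpha>) ?c ?d)))"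
        using DD1_sym_eq_ord[of lam \<nu>] DD1_ord_eq[OF \<alpha>] by (simp add: su)
      also have "\<dots> = {ord_op \<alpha> b | b. Frob \<alpha> ?c ?d b}"
        by (rule ord_ops_case_a[symmetric]) (rule not_resonant[OF False w])
      finally show ?thesis using bij by (simp only:)
    next
      case res: True
      obtain p where p: "\<nu>$1 - \<nu>$2 - 1 = of_nat p" "1 \<le> p" "p \<le> min (fst \<alpha>) (snd \<alpha>)"
        using res w by (rule resonantE)
      note d = DD2_params(5)[OF w p(1,3)]
      have na: "(lam, \<nu>) \<notin> Phi3a" using res by (simp add: Phi3a_def)
      \<comment> \<open>Separates case c from case b: whether or not c + k vanishes at some k below
        the resonance.\<close>
      show ?thesis
      proof (cases "\<exists>m<p. ?c = - of_nat m")
        case False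
        then have b: "(lam, \<nu>) \<in> Phi3b"
          using \<open>(lam, \<nu>) \<in> Phi3\<close> res resonant_c[OF p(1)] by (simp add: Phi3b_def)
        have "?R = cline (ord_op \<alpha> (shifted \<alpha> p ?c))"
          using b na DD2_sym_eq_ord[of lam \<nu>] DD2_ord_eq[OF w p(1,3)] by (simp add: su)
        also have "\<dots> = {ord_op \<alpha> b | b. Frob \<alpha> ?c ?d b}"
        proof (rule ord_ops_case_b[OF d p(2,3), symmetric])
          show "?c + of_nat k \<noteq> 0" if "k < p" for k
            using False that by (metis add_eq_0_iff2)
        qed
        finally show ?thesis using bij by (simp only:)
      next
        case True
        then obtain m where m: "?c = - of_nat m" "m < p" by blast
        have c: "(lam, \<nu>) \<in> Phi3c" and nb: "(lam, \<nu>) \<notin> Phi3b"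
          using \<open>(lam, \<nu>) \<in> Phi3\<close> res resonant_c[OF p(1)] True by (simp_all add: Phi3b_def Phi3c_def)
        have "?R = op_set_plus (cline (ord_op \<alpha> (coeff (F31 (fst \<alpha>) (snd \<alpha>) ?c ?d)))) (cline (ord_op \<alpha> (shifted \<alpha> p ?c)))"
          using c na nb DD1_sym_eq_ord[of lam \<nu>] DD1_ord_eq[OF \<alpha>] DD2_sym_eq_ord[of lam \<nu>] DD2_ord_eq[OF w p(1,3)] by (simp add: su)
        also have "\<dots> = {ord_op \<alpha> b | b. Frob \<alpha> ?c ?d b}"
          by (rule ord_ops_case_c[OF d p(2,3) m, symmetric])
        finally show ?thesis using bij by (simp only:)
      qed
    qed
  qed
  then show ?thesis using inter DD1_sym_eq_ord DD2_sym_eq_ord by blast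
qed

end
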